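(* Let $n\ge 1$ be an integer, $0<\gamma<n$, $1<p\le\alpha<s\le\infty$, $\mu\in\Delta_2$ and $b\in BMO(\mathbb R^n)$. Let $(w,\nu)$ be a pair of weights such that for some $r>1$ and some constant $C_0<\infty$, for all cubes $Q$ in $\mathbb R^n$, $$|Q|^{\gamma/n}\cdot\left(\frac{1}{|Q|}\int_Q w(x)^r\,dx\right)^{1/(rp)}\big\|\nu^{-1/p}\big\|_{\mathcal A,Q}\le C_0,\qquad \mathcal A(t)=t^{p'}(1+\log^+t)^{p'}.$$ If $w\in A_\infty$, then the linear commutator $[b,I_\gamma]$ is bounded from $(L^p,L^s)^{\alpha}(\nu,w;\mu)$ into $(WL^p,L^s)^{\alpha}(w;\mu)$; that is, there is a constant $C>0$ independent of $f$ such that $\|[b,I_\gamma]f\|_{(WL^p,L^s)^{\alpha}(w;\mu)}\le C\|f\|_{(L^p,L^s)^{\alpha}(\nu,w;\mu)}$ for all $f\in(L^p,L^s)^{\alpha}(\nu,w;\mu)$.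
   Context: A weight is a non-negative locally integrable function on $\mathbb R^n$; for a weight $w$ and measurable $E$, $w(E)=\int_E w(x)\,dx$. $B(y,r)$ is the open Euclidean ball with center $y$ and radius $r$; $p'=p/(p-1)$; $\log^+t=\max\{\log t,0\}$. All cubes have sides parallel to the coordinate axes. Linear commutator of the fractional integral operator: $[b,I_\gamma]f(x)=\frac{1}{\zeta(\gamma)}\int_{\mathbb R^n}\frac{[b(x)-b(y)]f(y)}{|x-y|^{n-\gamma}}\,dy$, with $\zeta(\gamma)=\frac{\pi^{n/2}2^\gamma\Gamma(\gamma/2)}{\Gamma((n-\gamma)/2)}$. $BMO(\mathbb R^n)$: locally integrable $b$ with $\|b\|_*=\sup_B\frac1{|B|}\int_B|b-b_B|\,dx<\infty$, the supremum over all balls, $b_B$ the mean of $b$ over $B$. Luxemburg average over a cube: $\|g\|_{\mathcal A,Q}=\inf\{\lambda>0:\frac1{|Q|}\int_Q\mathcal A(|g(x)|/\lambda)\,dx\le1\}$. $A_\infty=\bigcup_{1\le p<\infty}A_p$ is the union of the Muckenhoupt classes. A weight $\mu$ is in $\Delta_2$ if there is $C>0$ with $\mu(2B)\le C\mu(B)$ for every ball $B$ ($2B$ is the concentric ball with twice the radius). Weighted amalgam spaces: for $1\le p\le\alpha\le s\le\infty$ and weights $\nu,w,\mu$, the space $(L^p,L^s)^{\alpha}(\nu,w;\mu)$ consists of all locally integrable $f$ with $$\|f\|_{(L^p,L^s)^{\alpha}(\nu,w;\mu)}:=\sup_{r>0}\Big\|w(B(y,r))^{1/\alpha-1/p-1/s}\,\|f\chi_{B(y,r)}\|_{L^p(\nu)}\Big\|_{L^s(\mu)}<\infty,$$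 where the $L^s(\mu)$-norm (norm with respect to $\mu(y)\,dy$, usual modification when $s=\infty$) is taken in $y$, and $\|g\|_{L^p(\nu)}=(\int|g|^p\nu\,dx)^{1/p}$. The weak space $(WL^p,L^s)^{\alpha}(w;\mu)$ consists of all measurable $f$ with $$\|f\|_{(WL^p,L^s)^{\alpha}(w;\mu)}:=\sup_{r>0}\Big\|w(B(y,r))^{1/\alpha-1/p-1/s}\,\|f\chi_{B(y,r)}\|_{WL^p(w)}\Big\|_{L^s(\mu)}<\infty,$$ where $\|g\|_{WL^p(w)}=\sup_{\lambda>0}\lambda\,[w(\{x:|g(x)|>\lambda\})]^{1/p}$. By convention these notions may equivalently be defined with cubes $Q(y,\ell)$ (center $y$, side length $\ell$) in place of balls $B(y,r)$. *)

theory Defs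
  imports "HOL-Analysis.Analysis" "HOL-Probability.Essential_Supremum"
begin

text \<open>Euclidean space of dimension \<open>n \<ge> 1\<close> is \<^typ>\<open>real ^ 'n\<close> with \<open>n = CARD('n)\<close>. Norms and averages of
  non-negative quantities take values in \<^typ>\<open>ennreal\<close>, so that divergent ones equal \<open>\<infinity>\<close>;
  note that \<open>0 * \<infinity> = 0\<close> there.\<close>

text \<open>Real powers on \<open>[0, \<infinity>]\<close>. Unlike \<open>powr\<close>, a negative power of \<open>0\<close> is \<open>\<infinity>\<close>, as is needed for
  \<open>\<nu> powr (-1/p)\<close> and \<open>w(B) powr (1/\<alpha> - 1/p - 1/s)\<close>.\<close>

definition epow :: "ennreal \<Rightarrow> real \<Rightarrow> ennreal" where
  "epow x a =
     (if a = 0 then 1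
      else if x = 0 then (if a > 0 then 0 else \<infinity>)
      else if x = \<infinity> then (if a > 0 then \<infinity> else 0)
      else ennreal (enn2real x powr a))"

definition locally_integrable :: "(real ^ 'n \<Rightarrow> real) \<Rightarrow> bool" where
  "locally_integrable f \<longleftrightarrow> (\<forall>K. compact K \<longrightarrow> f absolutely_integrable_on K)"

definition weight :: "(real ^ 'n \<Rightarrow> real) \<Rightarrow> bool" where
  "weight w \<longleftrightarrow> (\<forall>x. 0 \<le> w x) \<and> locally_integrable w"

definition wmeasure :: "(real ^ 'n \<Rightarrow> real) \<Rightarrow> (real ^ 'n) measure" where
  "wmeasure w = density lebesgue (\<lambda>x. ennreal (w x))"

definition cube :: "real ^ 'n \<Rightarrow> real \<Rightarrow> (real ^ 'n) set" where
  "cube y l = cbox (\<chi> i. y $ i - l / 2) (\<chi> i. y $ i + l / 2)"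

definition eaverage :: "(real ^ 'n) set \<Rightarrow> (real ^ 'n \<Rightarrow> ennreal) \<Rightarrow> ennreal" where
  "eaverage E g = (\<integral>\<^sup>+x\<in>E. g x \<partial>lebesgue) / emeasure lebesgue E"

definition average :: "(real ^ 'n) set \<Rightarrow> (real ^ 'n \<Rightarrow> real) \<Rightarrow> real" where
  "average E g = (LINT x:E|lebesgue. g x) / measure lebesgue E"

definition BMO_norm :: "(real ^ 'n \<Rightarrow> real) \<Rightarrow> ennreal" where
  "BMO_norm b =
     (SUP (y, r) \<in> UNIV \<times> {0<..}.
        eaverage (ball y r) (\<lambda>x. ennreal \<bar>b x - average (ball y r) b\<bar>))"

definition BMO :: "(real ^ 'n \<Rightarrow> real) set" where
  "BMO = {b. locally_integrable b \<and> BMO_norm b < \<infinity>}"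

text \<open>For \<open>q = 1\<close> the condition is \<open>|B|\<^sup>-\<^sup>1 w(B) \<le> C ess inf\<^bsub>B\<^esub> w\<close>.\<close>

definition Muckenhoupt :: "real \<Rightarrow> (real ^ 'n \<Rightarrow> real) set" where
  "Muckenhoupt q = {w. weight w \<and> (\<exists>C::real. \<forall>y. \<forall>r>0.
     if q = 1 then
       AE x in lebesgue. x \<in> ball y r \<longrightarrow>
         eaverage (ball y r) (\<lambda>z. ennreal (w z)) \<le> ennreal C * ennreal (w x)
     else
       eaverage (ball y r) (\<lambda>x. ennreal (w x)) *
         epow (eaverage (ball y r) (\<lambda>x. epow (ennreal (w x)) (- 1 / (q - 1)))) (q - 1)
       \<le> ennreal C)}"

definition A_infinity :: "(real ^ 'n \<Rightarrow> real) set" where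
  "A_infinity = (\<Union>q\<in>{1..}. Muckenhoupt q)"

definition Delta2 :: "(real ^ 'n \<Rightarrow> real) set" where
  "Delta2 = {\<mu>. weight \<mu> \<and> (\<exists>C>0. \<forall>y. \<forall>r>0.
     emeasure (wmeasure \<mu>) (ball y (2 * r)) \<le> ennreal C * emeasure (wmeasure \<mu>) (ball y r))}"

definition Luxemburg_average ::
  "(ennreal \<Rightarrow> ennreal) \<Rightarrow> (real ^ 'n) set \<Rightarrow> (real ^ 'n \<Rightarrow> ennreal) \<Rightarrow> ennreal" where
  "Luxemburg_average A Q g =
     (INF l \<in> {l::real. l > 0 \<and> eaverage Q (\<lambda>x. A (g x / ennreal l)) \<le> 1}. ennreal l)"

definition conjugate_exponent :: "real \<Rightarrow> real" where
  "conjugate_exponent p = p / (p - 1)"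

definition log_plus :: "real \<Rightarrow> real" where
  "log_plus t = max (ln t) 0"

text \<open>\<open>\<A>(t) = t\<^sup>p\<^sup>' (1 + log\<^sup>+ t)\<^sup>p\<^sup>'\<close>, extended by \<open>\<A>(\<infinity>) = \<infinity>\<close>. At \<open>t = 0\<close> the first factor vanishes.\<close>

definition Young_A :: "real \<Rightarrow> ennreal \<Rightarrow> ennreal" where
  "Young_A p t =
     (if t = \<infinity> then \<infinity>
      else ennreal (enn2real t powr conjugate_exponent p *
             (1 + log_plus (enn2real t)) powr conjugate_exponent p))"

definition Lp_norm :: "real \<Rightarrow> (real ^ 'n \<Rightarrow> real) \<Rightarrow> (real ^ 'n \<Rightarrow> real) \<Rightarrow> ennreal" where
  "Lp_norm p \<nu> g = epow (\<integral>\<^sup>+x. ennreal (\<bar>g x\<bar> powr p) \<partial>wmeasure \<nu>) (1 / p)"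

definition weak_Lp_norm :: "real \<Rightarrow> (real ^ 'n \<Rightarrow> real) \<Rightarrow> (real ^ 'n \<Rightarrow> real) \<Rightarrow> ennreal" where
  "weak_Lp_norm p w g =
     (SUP l \<in> {0<..}. ennreal l * epow (emeasure (wmeasure w) {x. \<bar>g x\<bar> > l}) (1 / p))"

definition outer_Ls_norm ::
  "ennreal \<Rightarrow> (real ^ 'n \<Rightarrow> real) \<Rightarrow> (real ^ 'n \<Rightarrow> ennreal) \<Rightarrow> ennreal" where
  "outer_Ls_norm s \<mu> G =
     (if s = \<infinity> then esssup (wmeasure \<mu>) G
      else epow (\<integral>\<^sup>+y. epow (G y) (enn2real s) \<partial>wmeasure \<mu>) (1 / enn2real s))"

text \<open>\<open>enn2real (1 / s)\<close> is \<open>1/s\<close> with the convention \<open>1/\<infinity> = 0\<close>.\<close>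

definition amalgam_norm ::
  "real \<Rightarrow> ennreal \<Rightarrow> real \<Rightarrow> (real ^ 'n \<Rightarrow> real) \<Rightarrow> (real ^ 'n \<Rightarrow> real) \<Rightarrow> (real ^ 'n \<Rightarrow> real)
    \<Rightarrow> (real ^ 'n \<Rightarrow> real) \<Rightarrow> ennreal" where
  "amalgam_norm p s \<alpha> \<nu> w \<mu> f =
     (SUP r \<in> {0<..}. outer_Ls_norm s \<mu>
        (\<lambda>y. epow (emeasure (wmeasure w) (ball y r)) (1 / \<alpha> - 1 / p - enn2real (1 / s)) *
             Lp_norm p \<nu> (\<lambda>x. f x * indicator (ball y r) x)))"

definition amalgam_space ::
  "real \<Rightarrow> ennreal \<Rightarrow> real \<Rightarrow> (real ^ 'n \<Rightarrow> real) \<Rightarrow> (real ^ 'n \<Rightarrow> real) \<Rightarrow> (real ^ 'n \<Rightarrow> real)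
    \<Rightarrow> (real ^ 'n \<Rightarrow> real) set" where
  "amalgam_space p s \<alpha> \<nu> w \<mu> = {f. locally_integrable f \<and> amalgam_norm p s \<alpha> \<nu> w \<mu> f < \<infinity>}"

definition weak_amalgam_norm ::
  "real \<Rightarrow> ennreal \<Rightarrow> real \<Rightarrow> (real ^ 'n \<Rightarrow> real) \<Rightarrow> (real ^ 'n \<Rightarrow> real)
    \<Rightarrow> (real ^ 'n \<Rightarrow> real) \<Rightarrow> ennreal" where
  "weak_amalgam_norm p s \<alpha> w \<mu> f =
     (SUP r \<in> {0<..}. outer_Ls_norm s \<mu>
        (\<lambda>y. epow (emeasure (wmeasure w) (ball y r)) (1 / \<alpha> - 1 / p - enn2real (1 / s)) *
             weak_Lp_norm p w (\<lambda>x. f x * indicator (ball y r) x)))"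

definition weak_amalgam_space ::
  "real \<Rightarrow> ennreal \<Rightarrow> real \<Rightarrow> (real ^ 'n \<Rightarrow> real) \<Rightarrow> (real ^ 'n \<Rightarrow> real)
    \<Rightarrow> (real ^ 'n \<Rightarrow> real) set" where
  "weak_amalgam_space p s \<alpha> w \<mu> =
     {f \<in> borel_measurable lebesgue. weak_amalgam_norm p s \<alpha> w \<mu> f < \<infinity>}"

definition riesz_constant :: "'n::finite itself \<Rightarrow> real \<Rightarrow> real" where
  "riesz_constant _ \<gamma> =
     pi powr (real CARD('n) / 2) * 2 powr \<gamma> * Gamma (\<gamma> / 2) / Gamma ((real CARD('n) - \<gamma>) / 2)"

definition commutator_integrand ::
  "(real ^ 'n \<Rightarrow> real) \<Rightarrow> real \<Rightarrow> (real ^ 'n \<Rightarrow> real) \<Rightarrow> real ^ 'n \<Rightarrow> real ^ 'n \<Rightarrow> real" where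
  "commutator_integrand b \<gamma> f x y = (b x - b y) * f y / norm (x - y) powr (real CARD('n) - \<gamma>)"

text \<open>The Bochner integral is \<open>0\<close> at points \<open>x\<close> where the integrand is not integrable; that this
  happens only on a null set has to be asserted separately.\<close>

definition commutator ::
  "(real ^ 'n \<Rightarrow> real) \<Rightarrow> real \<Rightarrow> (real ^ 'n \<Rightarrow> real) \<Rightarrow> real ^ 'n \<Rightarrow> real" where
  "commutator b \<gamma> f x =
     1 / riesz_constant TYPE('n) \<gamma> * (LINT y|lebesgue. commutator_integrand b \<gamma> f x y)"

end

theory Submission
  imports Defs
begin

text \<open>The commutator is dominated pointwise by the positive operator with kernel
  \<open>\<bar>b x - b y\<bar> / norm (x - y) powr (n - \<gamma>)\<close>, and by the one-third trick a truncation of this operator is dominated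
  by finitely many operators that sum over the cells of a dyadic grid. For such an operator the weak-type
  inequality is dualised against the level set \<open>E\<close>: after Fubini's theorem only the cells \<open>P\<close> selected by a
  stopping rule for \<open>w(P)\<^bsup>1-1/u\<^esup> w(E \<inter> P)\<^bsup>1/u\<^esup> / |P|\<close> matter. The points of \<open>P\<close> that leave the selected cell
  later on fill at most half of \<open>P\<close>, so by \<open>w \<in> A_infinity\<close> the remaining ones carry a fixed fraction of \<open>w(P)\<close>.
  The bump condition, the John--Nirenberg inequality and Young's inequality bound the integral of
  \<open>(|b - b\<^sub>P| + 1) f\<close> over \<open>P\<close> by the \<open>L\<^sup>p(\<nu>)\<close> norm of \<open>f\<close> on \<open>P\<close>, and the weak (1,1) inequality for dyadic
  maximal functions with respect to \<open>w\<close> sums the contributions of the selected cells.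

  On a ball \<open>B\<close> of the amalgam norm this handles the part of \<open>f\<close> supported in \<open>2B\<close>. The annuli
  \<open>2\<^bsup>j+1\<^esup>B - 2\<^sup>jB\<close> contribute a series in which the reverse doubling of \<open>w\<close> beats the linear growth of the means
  of \<open>b\<close>, because the exponent \<open>1/\<alpha> - 1/s\<close> is positive; it is summed in \<open>L\<^sup>s(\<mu>)\<close> term by term.\<close>

section \<open>Powers and integrals on the extended half-line\<close>

text \<open>Two obstacles shape the argument. The kernel couples the variables through
  \<open>b x - b y\<close>; with m the mean of \<open>b\<close> over a cell, the bound by (|b x - m|
  + 1) (|b y - m| + 1) separates them. The oscillation in y meets \<nu>^(-1/p) and uses up the
  logarithmic factor of the Young function; the oscillation in x is integrated against
  \<open>w\<close> over E and, having exponential moments under \<open>w\<close>, costs no more than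
  the passage from w(E \<inter> P) to w(P)^(1-1/u) w(E \<inter> P)^(1/u). Secondly, after the
  selection of cells the integral of \<open>Z1 powr (1/u) * Z2 powr (1/p)\<close> remains, where
  \<open>Z1\<close>, at most 1, and \<open>Z2\<close> are known only to lie in weak L^1. The choice
  1 < u < v < p' leaves the slack 1/u + 1/p > 1: Young's inequality with exponent v produces powers
  above 1 of quantities cut off at 1, and the part of \<open>Z2\<close> above the cut keeps the
  power 1/p < 1, so each piece is integrable from a weak bound alone. A free scaling parameter then
  absorbs half of the left side, which is why w(E) has to be finite and the operator is first
  truncated; all constants are independent of grid, truncation and E.\<close>

lemma ennreal_pos_cases [case_names zero top pos]:
  fixes x :: ennreal
  obtains "x = 0" | "x = \<infinity>" | r where "x = ennreal r" "0 < r"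
proof (cases x)
  case (real r)
  then show ?thesis using that(1,3) by (cases "r = 0") auto
qed (use that in auto)

lemma epow_ennreal_pos: "0 < x \<Longrightarrow> epow (ennreal x) a = ennreal (x powr a)"
  by (auto simp: epow_def)

lemma epow_ennreal: "0 \<le> x \<Longrightarrow> 0 < a \<Longrightarrow> epow (ennreal x) a = ennreal (x powr a)"
  by (cases "x = 0") (auto simp: epow_def)

lemma epow_zero [simp]: "0 < a \<Longrightarrow> epow 0 a = 0"
  by (simp add: epow_def)

lemma epow_top [simp]: "0 < a \<Longrightarrow> epow top a = top"
  by (simp add: epow_def)

lemma epow_one [simp]: "epow x 1 = x"
  by (cases x rule: ennreal_pos_cases) (auto simp: epow_def)

lemma epow_of_one [simp]: "epow 1 a = 1"
  by (auto simp: epow_def)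

lemma epow_exponent_zero [simp]: "epow x 0 = 1"
  by (simp add: epow_def)

lemma epow_mono: "x \<le> y \<Longrightarrow> 0 \<le> a \<Longrightarrow> epow x a \<le> epow y a"
  by (cases x rule: ennreal_pos_cases; cases y rule: ennreal_pos_cases)
     (auto simp: epow_def top_unique intro!: ennreal_leI powr_mono2)

lemma epow_mult: "0 \<le> a \<Longrightarrow> epow (x * y) a = epow x a * epow y a"
  by (cases x rule: ennreal_pos_cases; cases y rule: ennreal_pos_cases)
     (auto simp: epow_def ennreal_mult_top ennreal_top_mult powr_mult simp flip: ennreal_mult)

lemma epow_epow: "a \<noteq> 0 \<Longrightarrow> 0 < b \<Longrightarrow> epow (epow x a) b = epow x (a * b)"
  by (cases x rule: ennreal_pos_cases)
     (auto simp: epow_def powr_powr zero_less_mult_iff)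

lemma epow_add: "x \<noteq> 0 \<Longrightarrow> x \<noteq> \<infinity> \<Longrightarrow> epow x (a + b) = epow x a * epow x b"
  by (cases x rule: ennreal_pos_cases) (auto simp: epow_ennreal_pos powr_add simp flip: ennreal_mult)

lemma epow_finite_iff: "0 < a \<Longrightarrow> epow x a = \<infinity> \<longleftrightarrow> x = \<infinity>"
  by (cases x rule: ennreal_pos_cases) (auto simp: epow_def)

lemma epow_eq_0_iff: "0 < a \<Longrightarrow> epow x a = 0 \<longleftrightarrow> x = 0"
  by (cases x rule: ennreal_pos_cases) (auto simp: epow_def)

lemma measurable_epow [measurable (raw)]:
  assumes [measurable]: "f \<in> borel_measurable M"
  shows "(\<lambda>x. epow (f x) a) \<in> borel_measurable M"
  unfolding epow_def by (intro measurable_If) auto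

lemma term_le_suminf_ennreal: "f m \<le> (\<Sum>m. f m :: ennreal)"
  using sum_le_suminf[of f "{m}"] by simp

text \<open>Young's inequality for \<open>f\<close> and \<open>g\<close> divided by their norms,
  multiplied out again. The cases in which a norm is 0 or \<infinity> are split off first, because
  there it is impossible to normalise.\<close>

lemma Holder_nn_integral:
  fixes f g :: "'a \<Rightarrow> ennreal"
  assumes [measurable]: "f \<in> borel_measurable M" "g \<in> borel_measurable M"
    and pq: "0 < p" "0 < q" "1/p + 1/q = 1"
  shows "(\<integral>\<^sup>+x. f x * g x \<partial>M) \<le> epow (\<integral>\<^sup>+x. epow (f x) p \<partial>M) (1/p) * epow (\<integral>\<^sup>+x. epow (g x) q \<partial>M) (1/q)"
proof -
  define A where "A = (\<integral>\<^sup>+x. epow (f x) p \<partial>M)"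
  define B where "B = (\<integral>\<^sup>+x. epow (g x) q \<partial>M)"
  show ?thesis
  proof (cases "A = 0 \<or> B = 0")
    case True
    then have "AE x in M. f x * g x = 0"
    proof
      assume "A = 0"
      then have "AE x in M. epow (f x) p = 0"
        unfolding A_def by (subst (asm) nn_integral_0_iff_AE) auto
      then show ?thesis by (auto simp: epow_eq_0_iff pq)
    next
      assume "B = 0"
      then have "AE x in M. epow (g x) q = 0"
        unfolding B_def by (subst (asm) nn_integral_0_iff_AE) auto
      then show ?thesis by (auto simp: epow_eq_0_iff pq)
    qed
    then have "(\<integral>\<^sup>+x. f x * g x \<partial>M) = 0" by (subst nn_integral_0_iff_AE) auto
    then show ?thesis by simp
  next
    case nz: False
    show ?thesis
    proof (cases "A = \<infinity> \<or> B = \<infinity>")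
      case True
      then have "epow A (1/p) * epow B (1/q) = \<infinity>"
        using nz pq by (auto simp: ennreal_mult_eq_top_iff epow_eq_0_iff epow_finite_iff)
      then show ?thesis unfolding A_def B_def by (metis infinity_ennreal_def top_greatest)
    next
      case False
      with nz obtain A' B' where A': "A = ennreal A'" "0 < A'" and B': "B = ennreal B'" "0 < B'"
        by (metis ennreal_pos_cases)
      let ?a = "A' powr (1/p)" and ?b = "B' powr (1/q)"
      have q1: "p > 1" using pq by (smt (verit) divide_less_eq_1_pos divide_pos_pos)
      have q2: "q > 1" using pq by (smt (verit) divide_less_eq_1_pos divide_pos_pos)
      have Young: "f x * g x \<le> ennreal (?a * ?b / (p * A')) * epow (f x) p + ennreal (?a * ?b / (q * B')) * epow (g x) q" for x
      proof (cases "f x" rule: ennreal_pos_cases)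
        case top
        then show ?thesis using pq A' B' by (auto simp: ennreal_mult_eq_top_iff)
      next
        case (pos u) note fu = pos
        show ?thesis
        proof (cases "g x" rule: ennreal_pos_cases)
          case top then show ?thesis using pq A' B' by (auto simp: ennreal_mult_eq_top_iff)
        next
          case (pos v)
          have "(u / ?a) * (v / ?b) \<le> (u / ?a) powr p / p + (v / ?b) powr q / q"
            by (rule Youngs_inequality) (use q1 q2 pq fu pos A' B' in auto)
          also have "\<dots> = u powr p / (A' * p) + v powr q / (B' * q)"
            using pq A' B' fu pos by (simp add: powr_divide powr_powr)
          finally have "u * v / (?a * ?b) \<le> u powr p / (A' * p) + v powr q / (B' * q)" by simp
          then have "u * v \<le> (u powr p / (A' * p) + v powr q / (B' * q)) * (?a * ?b)"
            using A' B' by (subst (asm) pos_divide_le_eq) auto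
          also have "\<dots> = ?a * ?b / (p * A') * u powr p + ?a * ?b / (q * B') * v powr q"
            by (simp add: field_simps)
          finally show ?thesis
            using fu pos pq A' B'
            by (simp add: epow_ennreal_pos flip: ennreal_mult ennreal_plus)
        qed auto
      qed auto
      have "(\<integral>\<^sup>+x. f x * g x \<partial>M) \<le> (\<integral>\<^sup>+x. ennreal (?a * ?b / (p * A')) * epow (f x) p + ennreal (?a * ?b / (q * B')) * epow (g x) q \<partial>M)"
        by (intro nn_integral_mono Young)
      also have "\<dots> = ennreal (?a * ?b / (p * A')) * A + ennreal (?a * ?b / (q * B')) * B"
        unfolding A_def B_def by (simp add: nn_integral_add nn_integral_cmult)
      also have "\<dots> = ennreal (?a * ?b / (p * A') * A' + ?a * ?b / (q * B') * B')"
        using A' B' pq by (simp flip: ennreal_mult ennreal_plus)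
      also have "?a * ?b / (p * A') * A' + ?a * ?b / (q * B') * B' = ?a * ?b * (1/p + 1/q)"
        using A' B' pq by (simp add: field_simps)
      also have "ennreal \<dots> = epow A (1/p) * epow B (1/q)"
        using A' B' pq by (simp add: epow_ennreal_pos ennreal_mult)
      finally show ?thesis unfolding A_def B_def .
    qed
  qed
qed

text \<open>Dyadic layers below 1: where \<open>min (Z x) 1\<close> is about 2^(-m) the power
  contributes 2^(-m a), while the weak bound gives that set measure at most 2^(m+1) K. The series
  converges because a > 1; the truncation at 1 removes the large values, for which such a power is
  out of control.\<close>

lemma truncated_power_integral_le:
  fixes Z :: "'a \<Rightarrow> real"
  assumes [measurable]: "Z \<in> borel_measurable M"
    and weak: "\<And>t. 0 < t \<Longrightarrow> emeasure M {x \<in> space M. Z x > t} \<le> K / ennreal t"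
    and a: "1 < a" and Z: "\<And>x. 0 \<le> Z x"
  shows "(\<integral>\<^sup>+x. ennreal (min (Z x) 1 powr a) \<partial>M) \<le> ennreal (2 / (1 - 2 powr (1 - a))) * K"
proof -
  let ?q = "2 powr (1 - a)"
  have q: "0 < ?q" "?q < 1" using a by (auto simp: powr_less_one)
  have pw: "?q ^ m = 2 powr ((1 - a) * real m)" for m
    by (simp add: powr_powr flip: powr_realpow)
  have "(\<integral>\<^sup>+x. ennreal (min (Z x) 1 powr a) \<partial>M)
     \<le> (\<integral>\<^sup>+x. (\<Sum>m. ennreal (2 powr (- real m * a)) * indicator {x \<in> space M. Z x > 2 powr (- real m - 1)} x) \<partial>M)"
  proof (rule nn_integral_mono)
    fix x assume x: "x \<in> space M"
    show "ennreal (min (Z x) 1 powr a) \<le> (\<Sum>m. ennreal (2 powr (- real m * a)) * indicator {x \<in> space M. Z x > 2 powr (- real m - 1)} x)"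
    proof (cases "Z x = 0")
      case False
      have "\<exists>m::nat. min (Z x) 1 \<le> 2 powr (- real m) \<and> Z x > 2 powr (- real m - 1)"
      proof -
        define m where "m = nat \<lfloor>- log 2 (min (Z x) 1)\<rfloor>"
        have Zp: "0 < min (Z x) 1" using False Z[of x] by auto
        have "log 2 (min (Z x) 1) \<le> 0" using Zp by auto
        then have "real m \<le> - log 2 (min (Z x) 1)" "- log 2 (min (Z x) 1) < real m + 1"
          unfolding m_def by linarith+
        then have "log 2 (min (Z x) 1) \<le> - real m" "- real m - 1 < log 2 (min (Z x) 1)" by auto
        then have "min (Z x) 1 \<le> 2 powr (- real m)" "2 powr (- real m - 1) < min (Z x) 1"
          using Zp by (simp_all add: le_log_iff log_le_iff less_log_iff)
        then show ?thesis by (intro exI[of _ m]) auto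
      qed
      then obtain m :: nat where m: "min (Z x) 1 \<le> 2 powr (- real m)" "Z x > 2 powr (- real m - 1)" by blast
      have "min (Z x) 1 powr a \<le> (2 powr (- real m)) powr a"
        using m Z[of x] a by (intro powr_mono2) auto
      then have "ennreal (min (Z x) 1 powr a) \<le> ennreal (2 powr (- real m * a)) * indicator {x \<in> space M. Z x > 2 powr (- real m - 1)} x"
        using m x by (simp add: powr_powr ennreal_leI)
      also have "\<dots> \<le> (\<Sum>m. ennreal (2 powr (- real m * a)) * indicator {x \<in> space M. Z x > 2 powr (- real m - 1)} x)"
        by (rule term_le_suminf_ennreal)
      finally show ?thesis .
    qed auto
  qed
  also have "\<dots> = (\<Sum>m. ennreal (2 powr (- real m * a)) * emeasure M {x \<in> space M. Z x > 2 powr (- real m - 1)})"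
    by (subst nn_integral_suminf) (auto simp: nn_integral_cmult_indicator)
  also have "\<dots> \<le> (\<Sum>m. ennreal (2 * ?q ^ m) * K)"
  proof (intro suminf_le allI)
    fix m :: nat
    have "ennreal (2 powr (- real m * a)) * emeasure M {x \<in> space M. Z x > 2 powr (- real m - 1)}
       \<le> ennreal (2 powr (- real m * a)) * (K / ennreal (2 powr (- real m - 1)))"
      by (intro mult_left_mono weak) auto
    also have "\<dots> = ennreal (2 powr (- real m * a)) * (K * ennreal (2 powr (real m + 1)))"
      by (simp add: divide_ennreal_def inverse_ennreal powr_diff powr_add powr_minus field_simps)
    also have "\<dots> = ennreal (2 powr (- real m * a) * 2 powr (real m + 1)) * K"
      by (simp add: ennreal_mult ac_simps)
    also have "2 powr (- real m * a) * 2 powr (real m + 1) = 2 powr ((1 - a) * real m + 1)"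
      by (simp only: powr_add[symmetric]) (simp add: algebra_simps)
    also have "\<dots> = 2 * ?q ^ m"
      by (simp add: powr_add pw)
    finally show "ennreal (2 powr (- real m * a)) * emeasure M {x \<in> space M. Z x > 2 powr (- real m - 1)} \<le> ennreal (2 * ?q ^ m) * K" .
  qed auto
  also have "\<dots> = (\<Sum>m. ennreal (2 * ?q ^ m)) * K" by simp
  also have "(\<Sum>m. ennreal (2 * ?q ^ m)) = ennreal (\<Sum>m. 2 * ?q ^ m)"
    using q by (intro suminf_ennreal2 summable_mult summable_geometric) auto
  also have "(\<Sum>m. 2 * ?q ^ m) = 2 / (1 - ?q)"
    using q by (simp add: suminf_mult suminf_geometric)
  finally show ?thesis .
qed

text \<open>The counterpart above 1: the layer at 2^m contributes at most 2^((m+1) a) times K / 2^m,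
  so now the series converges because a < 1.\<close>

lemma large_part_power_integral_le:
  fixes Z :: "'a \<Rightarrow> real"
  assumes [measurable]: "Z \<in> borel_measurable M"
    and weak: "\<And>t. 0 < t \<Longrightarrow> emeasure M {x \<in> space M. Z x > t} \<le> K / ennreal t"
    and a: "0 < a" "a < 1"
  shows "(\<integral>\<^sup>+x. ennreal (Z x powr a) * indicator {x. Z x > 1} x \<partial>M) \<le> ennreal (2 powr a / (1 - 2 powr (a - 1))) * K"
proof -
  let ?q = "2 powr (a - 1)"
  have q: "0 < ?q" "?q < 1" using a by (auto simp: powr_less_one)
  have pw: "?q ^ m = 2 powr ((a - 1) * real m)" for m
    by (simp add: powr_powr flip: powr_realpow)
  have "(\<integral>\<^sup>+x. ennreal (Z x powr a) * indicator {x. Z x > 1} x \<partial>M)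
     \<le> (\<integral>\<^sup>+x. (\<Sum>m. ennreal (2 powr ((real m + 1) * a)) * indicator {x \<in> space M. Z x > 2 powr (real m)} x) \<partial>M)"
  proof (rule nn_integral_mono)
    fix x assume x: "x \<in> space M"
    show "ennreal (Z x powr a) * indicator {x. Z x > 1} x \<le> (\<Sum>m. ennreal (2 powr ((real m + 1) * a)) * indicator {x \<in> space M. Z x > 2 powr (real m)} x)"
    proof (cases "Z x > 1")
      case True
      \<comment> \<open>The ceiling minus one, not the floor: it makes 2^m < Z x strict, as in the
        sets of the weak hypothesis, even when Z x is a power of 2.\<close>
      define m where "m = nat (\<lceil>log 2 (Z x)\<rceil> - 1)"
      have "log 2 (Z x) > 0" using True by auto
      then have "log 2 (Z x) \<le> real m + 1" "real m < log 2 (Z x)"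
        unfolding m_def by linarith+
      then have m: "Z x \<le> 2 powr (real m + 1)" "2 powr real m < Z x"
        using True by (simp_all add: log_le_iff less_log_iff)
      have "Z x powr a \<le> (2 powr (real m + 1)) powr a"
        using m True a by (intro powr_mono2) auto
      then have "ennreal (Z x powr a) * indicator {x. Z x > 1} x \<le> ennreal (2 powr ((real m + 1) * a)) * indicator {x \<in> space M. Z x > 2 powr (real m)} x"
        using m x True by (simp add: powr_powr ennreal_leI)
      also have "\<dots> \<le> (\<Sum>m. ennreal (2 powr ((real m + 1) * a)) * indicator {x \<in> space M. Z x > 2 powr (real m)} x)"
        by (rule term_le_suminf_ennreal)
      finally show ?thesis .
    qed auto
  qed
  also have "\<dots> = (\<Sum>m. ennreal (2 powr ((real m + 1) * a)) * emeasure M {x \<in> space M. Z x > 2 powr (real m)})"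
    by (subst nn_integral_suminf) (auto simp: nn_integral_cmult_indicator)
  also have "\<dots> \<le> (\<Sum>m. ennreal (2 powr a * ?q ^ m) * K)"
  proof (intro suminf_le allI)
    fix m :: nat
    have "ennreal (2 powr ((real m + 1) * a)) * emeasure M {x \<in> space M. Z x > 2 powr (real m)}
       \<le> ennreal (2 powr ((real m + 1) * a)) * (K / ennreal (2 powr (real m)))"
      by (intro mult_left_mono weak) auto
    also have "\<dots> = ennreal (2 powr ((real m + 1) * a)) * (K * ennreal (2 powr (- real m)))"
      by (simp add: divide_ennreal_def inverse_ennreal powr_minus)
    also have "\<dots> = ennreal (2 powr ((real m + 1) * a) * 2 powr (- real m)) * K"
      by (simp add: ennreal_mult ac_simps)
    also have "2 powr ((real m + 1) * a) * 2 powr (- real m) = 2 powr (a + (a - 1) * real m)"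
      by (simp only: powr_add[symmetric]) (simp add: algebra_simps)
    also have "\<dots> = 2 powr a * ?q ^ m"
      by (simp add: powr_add pw)
    finally show "ennreal (2 powr ((real m + 1) * a)) * emeasure M {x \<in> space M. Z x > 2 powr (real m)} \<le> ennreal (2 powr a * ?q ^ m) * K" .
  qed auto
  also have "\<dots> = (\<Sum>m. ennreal (2 powr a * ?q ^ m)) * K" by simp
  also have "(\<Sum>m. ennreal (2 powr a * ?q ^ m)) = ennreal (\<Sum>m. 2 powr a * ?q ^ m)"
    using q by (intro suminf_ennreal2 summable_mult summable_geometric) auto
  also have "(\<Sum>m. 2 powr a * ?q ^ m) = 2 powr a / (1 - ?q)"
    using q by (simp add: suminf_mult suminf_geometric)
  finally show ?thesis .
qed

lemma sets_wmeasure [simp, measurable_cong]: "sets (wmeasure w) = sets lebesgue"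
  by (simp add: wmeasure_def)

lemma space_wmeasure [simp]: "space (wmeasure w) = UNIV"
  by (simp add: wmeasure_def)

lemma lebesgue_id_borel: "(\<lambda>x::'a::euclidean_space. x) \<in> borel_measurable lebesgue"
  by (rule measurable_completion) auto

lemma borel_in_lebesgue: "A \<in> sets borel \<Longrightarrow> A \<in> sets lebesgue"
  by (metis sets_completionI_sets sets_lborel)

lemma ennreal_divide_leD:
  fixes x c q :: ennreal
  assumes "x / c \<le> q" "c \<noteq> 0" "c \<noteq> top"
  shows "x \<le> q * c"
proof -
  have "c / c = 1" using assms by (intro ennreal_divide_self) (auto simp: less_top)
  then have "x = x / c * c" using assms by (simp add: ennreal_divide_times)
  then show ?thesis using mult_right_mono[OF assms(1), of c] by simp
qed

section \<open>Dyadic grids and the John--Nirenberg inequality\<close>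

text \<open>Cells are given as functions of a point, that is, as classes of one equivalence relation
  per level; level 0 is the coarsest and nothing lies above it. The enclosing ball is where the
  A-infinity and BMO hypotheses apply, the enclosing closed cube is where the bump hypothesis
  applies.\<close>

locale dyadic_grid =
  fixes cell :: "nat \<Rightarrow> real ^ 'n \<Rightarrow> (real ^ 'n) set" and len :: "nat \<Rightarrow> real"
  assumes len_pos: "0 < len i"
    and len_Suc: "len (Suc i) = len i / 2"
    and cell_self: "x \<in> cell i x"
    and cell_eq: "y \<in> cell i x \<Longrightarrow> cell i y = cell i x"
    and cell_nested: "cell (Suc i) x \<subseteq> cell i x"
    and countable_cells: "countable (range (cell i))"
    and cell_borel: "cell i x \<in> sets borel"
    and emeasure_cell: "emeasure lebesgue (cell i x) = ennreal (len i ^ CARD('n))"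
    and cell_subset_ball: "cell i x \<subseteq> ball x (2 * real CARD('n) * len i)"
    and cell_subset_cube: "\<exists>z. cell i x \<subseteq> cube z (len i)"
begin

text \<open>The sets of the \<sigma>-algebra generated by the cells of level \<open>i\<close>.
  Stopping sets are of this kind, so that their measurability and the estimates on them reduce to
  single cells.\<close>

definition saturated :: "nat \<Rightarrow> (real ^ 'n) set \<Rightarrow> bool" where
  "saturated i U \<longleftrightarrow> (\<forall>x\<in>U. cell i x \<subseteq> U)"

lemma cell_sets [measurable, simp]: "cell i x \<in> sets lebesgue"
  by (rule borel_in_lebesgue[OF cell_borel])

lemma measure_cell: "measure lebesgue (cell i x) = len i ^ CARD('n)"
  using len_pos[of i] by (simp add: measure_def emeasure_cell)

lemma cell_mono: "i \<le> j \<Longrightarrow> cell j x \<subseteq> cell i x"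
  by (induction j rule: dec_induct) (use cell_nested in blast)+

lemma cell_sym: "y \<in> cell i x \<longleftrightarrow> x \<in> cell i y"
  using cell_eq cell_self by metis

lemma len_eq: "len (i + m) = len i / 2 ^ m"
  by (induction m) (auto simp: len_Suc)

lemma saturated_Union: "saturated i U \<Longrightarrow> U = (\<Union>(cell i ` U))"
  unfolding saturated_def using cell_self by blast

lemma saturated_sets: "saturated i U \<Longrightarrow> U \<in> sets lebesgue"
  by (subst saturated_Union, assumption)
     (intro sets.countable_Union countable_subset[OF _ countable_cells], auto)

text \<open>A saturated set is a countable disjoint union of cells, so an inequality on cells adds
  up. The two measures may differ because Lebesgue measure is later compared with weighted
  ones.\<close>

lemma saturated_emeasure_le:
  assumes [simp]: "sets M = sets lebesgue" "sets M' = sets lebesgue" and U: "saturated i U"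
    and le: "\<And>x. x \<in> U \<Longrightarrow> emeasure M (cell i x) \<le> emeasure M' (cell i x)"
  shows "emeasure M U \<le> emeasure M' U"
proof -
  let ?C = "cell i ` U"
  have cnt: "countable ?C" by (rule countable_subset[OF _ countable_cells]) auto
  have disj: "disjoint_family_on (\<lambda>Q. Q) ?C"
    unfolding disjoint_family_on_def
  proof (intro ballI impI equals0I)
    fix A B z assume "A \<in> ?C" "B \<in> ?C" and ne: "A \<noteq> B" and z: "z \<in> A \<inter> B"
    then obtain x y where "A = cell i x" "B = cell i y" by auto
    then show False using ne z cell_eq[of z i x] cell_eq[of z i y] by simp
  qed
  have eq: "emeasure L U = (\<integral>\<^sup>+Q. emeasure L Q \<partial>count_space ?C)" if L: "sets L = sets lebesgue" for L
  proof -
    have "?C \<subseteq> sets L" unfolding L using cell_sets by (rule image_subsetI)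
    then have "Q \<in> sets L" if "Q \<in> ?C" for Q using that by (rule subsetD)
    then have "emeasure L (\<Union>Q\<in>?C. Q) = (\<integral>\<^sup>+Q. emeasure L Q \<partial>count_space ?C)"
      by (rule emeasure_UN_countable[OF _ cnt disj])
    moreover have "(\<Union>Q\<in>?C. Q) = U" by (rule trans[OF _ saturated_Union[OF U, symmetric]]) simp
    ultimately show ?thesis by (simp only:)
  qed
  show ?thesis
    unfolding eq[OF assms(1)] eq[OF assms(2)]
    by (rule nn_integral_mono) (use le in auto)
qed

lemma saturated_nn_integral_le:
  fixes g g' :: "real ^ 'n \<Rightarrow> ennreal"
  assumes M: "sets M = sets lebesgue" "sets M' = sets lebesgue" and U: "saturated i U"
    and g: "g \<in> borel_measurable lebesgue" "g' \<in> borel_measurable lebesgue"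
    and le: "\<And>x. x \<in> U \<Longrightarrow> (\<integral>\<^sup>+y\<in>cell i x. g y \<partial>M) \<le> (\<integral>\<^sup>+y\<in>cell i x. g' y \<partial>M')"
  shows "(\<integral>\<^sup>+y\<in>U. g y \<partial>M) \<le> (\<integral>\<^sup>+y\<in>U. g' y \<partial>M')"
proof -
  note [measurable_cong] = M
  have [measurable]: "g \<in> borel_measurable M" "g' \<in> borel_measurable M'"
    using g M by (auto cong: measurable_cong_sets)
  have [simp]: "U \<in> sets M" "U \<in> sets M'" using saturated_sets[OF U] M by auto
  have "emeasure (density M g) U \<le> emeasure (density M' g') U"
    by (rule saturated_emeasure_le[OF _ _ U]) (use M le in \<open>auto simp: emeasure_density\<close>)
  then show ?thesis by (simp add: emeasure_density)
qed

lemma cell_const_measurable: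
  fixes g :: "real ^ 'n \<Rightarrow> 'c::topological_space"
  assumes "\<And>x y. y \<in> cell i x \<Longrightarrow> g y = g x"
  shows "g \<in> borel_measurable lebesgue"
proof (rule measurableI)
  fix A :: "'c set"
  have "saturated i (g -` A)" using assms by (auto simp: saturated_def)
  then show "g -` A \<inter> space lebesgue \<in> sets lebesgue" by (simp add: saturated_sets)
qed auto

lemma cell_const_sets:
  assumes "\<And>x y. y \<in> cell i x \<Longrightarrow> P y = P x"
  shows "{x. P x} \<in> sets lebesgue"
  by (rule saturated_sets[of i]) (use assms in \<open>auto simp: saturated_def\<close>)

lemma len_tendsto_0: "(\<lambda>i. C * len i) \<longlonglongrightarrow> 0"
proof -
  have eq: "C * len i = C * (len 0 * (1/2) ^ i)" for i
    using len_eq[of 0 i] by (simp add: power_one_over field_simps)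
  have "(\<lambda>i. C * (len 0 * (1/2) ^ i)) \<longlonglongrightarrow> C * (len 0 * 0)"
    by (intro tendsto_intros LIMSEQ_power_zero) auto
  then show ?thesis unfolding eq by simp
qed

lemma cell_subset_open:
  assumes "open U" "x \<in> U"
  shows "\<exists>k\<ge>i. cell k x \<subseteq> U"
proof -
  obtain e where e: "e > 0" "ball x e \<subseteq> U" using assms openE by blast
  have "\<forall>\<^sub>F k in sequentially. 2 * real CARD('n) * len k < e"
    using order_tendstoD(2)[OF len_tendsto_0 e(1)] .
  then obtain K where K: "\<And>k. k \<ge> K \<Longrightarrow> 2 * real CARD('n) * len k < e"
    unfolding eventually_sequentially by blast
  let ?k = "max i K"
  have "cell ?k x \<subseteq> ball x (2 * real CARD('n) * len ?k)" by (rule cell_subset_ball)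
  also have "\<dots> \<subseteq> ball x e" using K[of ?k] by (intro subset_ball) auto
  finally show ?thesis using e(2) by (intro exI[of _ ?k]) auto
qed

lemma eaverage_cell_const: "y \<in> cell i x \<Longrightarrow> eaverage (cell i y) g = eaverage (cell i x) g"
  using cell_eq by metis

text \<open>Only this half of Lebesgue's differentiation theorem is needed, and it follows by comparing \<open>S\<close> with the
  disjoint union of the maximal cells that meet \<open>S\<close> and lie in an open superset of almost the same measure.\<close>

lemma AE_le_SUP_cell_averages_aux:
  fixes g :: "real ^ 'n \<Rightarrow> ennreal"
  assumes [measurable]: "g \<in> borel_measurable lebesgue" and q: "0 \<le> q'" "q' < q"
    and S: "S \<in> sets lebesgue" "emeasure lebesgue S < \<infinity>"
    and gS: "\<And>y. y \<in> S \<Longrightarrow> ennreal q \<le> g y"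
    and avS: "\<And>y k. y \<in> S \<Longrightarrow> i \<le> k \<Longrightarrow> eaverage (cell k y) g \<le> ennreal q'"
  shows "emeasure lebesgue S = 0"
proof -
  define s where "s = measure lebesgue S"
  have s: "emeasure lebesgue S = ennreal s" "0 \<le> s"
    using S by (auto simp: s_def emeasure_eq_ennreal_measure)
  \<comment> \<open>Letting \<open>e\<close> tend to 0 gives q s \<le> q' s, which forces s =
    0.\<close>
  have main: "q * s \<le> q' * (s + e)" if "0 < e" for e
  proof -
    obtain U where U: "open U" "S \<subseteq> U" "U - S \<in> lmeasurable" "emeasure lebesgue (U - S) < ennreal e"
      using sets_lebesgue_outer_open[OF S(1) \<open>0 < e\<close>] by blast
    \<comment> \<open>Points whose largest cell inside \<open>U\<close>, among the levels from
      \<open>i\<close> on, has level \<open>k\<close>. Only cells that meet \<open>S\<close> are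
      kept, since the bound on averages is known only at points of \<open>S\<close>.\<close>
    define V where "V k = {y. i \<le> k \<and> cell k y \<subseteq> U \<and> (\<forall>j. i \<le> j \<longrightarrow> j < k \<longrightarrow> \<not> cell j y \<subseteq> U) \<and> cell k y \<inter> S \<noteq> {}}" for k
    have sat: "saturated k (V k)" for k
      unfolding saturated_def
    proof (intro ballI subsetI)
      fix y z assume y: "y \<in> V k" and z: "z \<in> cell k y"
      have "cell j z = cell j y" if "j \<le> k" for j using z cell_mono[OF that] cell_eq by blast
      then show "z \<in> V k" using y by (simp add: V_def)
    qed
    have [measurable]: "V k \<in> sets lebesgue" for k by (rule saturated_sets[OF sat])
    have disj: "disjoint_family V"
      unfolding disjoint_family_on_def
    proof (safe, goal_cases)
      case (1 m k x) then show ?case unfolding V_def by (metis (no_types, lifting) linorder_neqE_nat mem_Collect_eq)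
    qed
    have sub: "S \<subseteq> (\<Union>k. V k)"
    proof
      fix y assume y: "y \<in> S"
      have ex: "\<exists>k. i \<le> k \<and> cell k y \<subseteq> U" using cell_subset_open[OF U(1), of y i] y U(2) by auto
      define k where "k = (LEAST k. i \<le> k \<and> cell k y \<subseteq> U)"
      have "i \<le> k \<and> cell k y \<subseteq> U" unfolding k_def by (rule LeastI_ex[OF ex])
      moreover have "\<not> cell j y \<subseteq> U" if "i \<le> j" "j < k" for j
        using not_less_Least[of j "\<lambda>k. i \<le> k \<and> cell k y \<subseteq> U"] that by (auto simp: k_def)
      moreover have "cell k y \<inter> S \<noteq> {}" using cell_self y by blast
      ultimately show "y \<in> (\<Union>k. V k)" by (auto simp: V_def)
    qed
    have VU: "(\<Union>k. V k) \<subseteq> U" using cell_self by (auto simp: V_def)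
    have Vk: "(\<integral>\<^sup>+y\<in>V k. g y \<partial>lebesgue) \<le> (\<integral>\<^sup>+y\<in>V k. ennreal q' \<partial>lebesgue)" for k
    proof (rule saturated_nn_integral_le[OF _ _ sat])
      fix x assume x: "x \<in> V k"
      then obtain z where z: "z \<in> cell k x" "z \<in> S" by (auto simp: V_def)
      have "eaverage (cell k x) g \<le> ennreal q'" using avS[OF z(2), of k] x z(1) cell_eq by (auto simp: V_def)
      then have "(\<integral>\<^sup>+y\<in>cell k x. g y \<partial>lebesgue) / emeasure lebesgue (cell k x) \<le> ennreal q'"
        by (simp add: eaverage_def)
      then have "(\<integral>\<^sup>+y\<in>cell k x. g y \<partial>lebesgue) \<le> ennreal q' * emeasure lebesgue (cell k x)"
        by (rule ennreal_divide_leD) (use len_pos[of k] in \<open>auto simp: emeasure_cell\<close>)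
      then show "(\<integral>\<^sup>+y\<in>cell k x. g y \<partial>lebesgue) \<le> (\<integral>\<^sup>+y\<in>cell k x. ennreal q' \<partial>lebesgue)"
        by (simp add: nn_integral_cmult_indicator)
    qed auto
    have "ennreal q * emeasure lebesgue S = (\<integral>\<^sup>+y\<in>S. ennreal q \<partial>lebesgue)"
      using S by (simp add: nn_integral_cmult_indicator)
    also have "\<dots> \<le> (\<integral>\<^sup>+y\<in>(\<Union>k. V k). g y \<partial>lebesgue)"
      by (rule nn_integral_mono) (use gS sub in \<open>auto simp: indicator_def\<close>)
    also have "\<dots> = (\<Sum>k. \<integral>\<^sup>+y\<in>V k. g y \<partial>lebesgue)"
      using disj by (subst nn_integral_disjoint_family) auto
    also have "\<dots> \<le> (\<Sum>k. \<integral>\<^sup>+y\<in>V k. ennreal q' \<partial>lebesgue)"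
      by (intro suminf_le Vk) auto
    also have "\<dots> = (\<integral>\<^sup>+y\<in>(\<Union>k. V k). ennreal q' \<partial>lebesgue)"
      using disj by (subst nn_integral_disjoint_family) auto
    also have "\<dots> = ennreal q' * emeasure lebesgue (\<Union>k. V k)"
      by (subst nn_integral_cmult_indicator) auto
    also have "emeasure lebesgue (\<Union>k. V k) \<le> emeasure lebesgue (S \<union> (U - S))"
      using VU S U by (intro emeasure_mono) auto
    also have "\<dots> \<le> emeasure lebesgue S + emeasure lebesgue (U - S)"
      using S U by (intro emeasure_subadditive) auto
    also have "\<dots> \<le> ennreal (s + e)"
      using s U(4) \<open>0 < e\<close> by (auto simp: ennreal_plus intro!: add_mono)
    finally have "ennreal (q * s) \<le> ennreal (q' * (s + e))"
      using s q \<open>0 < e\<close> by (simp add: ennreal_mult mult_left_mono)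
    then show ?thesis using q s \<open>0 < e\<close> by (subst (asm) ennreal_le_iff) auto
  qed
  have "s \<le> 0"
  proof (rule ccontr)
    assume "\<not> s \<le> 0"
    then have sp: "0 < s" by simp
    \<comment> \<open>Small enough for q' e < (q - q') s; the summand 1 keeps the quotient
      meaningful when q' = 0.\<close>
    define e where "e = (q - q') * s / (2 * (q' + 1))"
    have "0 < e" unfolding e_def using q sp by (intro divide_pos_pos mult_pos_pos) auto
    have "(q - q') * s \<le> q' * e" using main[OF \<open>0 < e\<close>] by (simp add: algebra_simps)
    also have "\<dots> \<le> (q' + 1) * e" using \<open>0 < e\<close> by (intro mult_right_mono) auto
    also have "\<dots> = (q - q') * s / 2" unfolding e_def using q by (simp add: field_simps)
    also have "\<dots> < (q - q') * s" using q sp by simp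
    finally show False by simp
  qed
  then show ?thesis using s by simp
qed

text \<open>Where \<open>g\<close> exceeds the supremum, two rationals fit strictly between. The
  exceptional set is therefore covered by countably many sets to which
  \<open>AE_le_SUP_cell_averages_aux\<close> applies, the bound \<open>R\<close> on the norm making
  each of them of finite measure.\<close>

lemma AE_le_SUP_cell_averages:
  fixes g :: "real ^ 'n \<Rightarrow> ennreal"
  assumes [measurable]: "g \<in> borel_measurable lebesgue"
  shows "AE y in lebesgue. g y \<le> (SUP k\<in>{i..}. eaverage (cell k y) g)"
proof -
  let ?A = "\<lambda>y. SUP k\<in>{i..}. eaverage (cell k y) g"
  have [measurable]: "(\<lambda>y. eaverage (cell k y) g) \<in> borel_measurable lebesgue" for k
    by (rule cell_const_measurable[of k]) (rule eaverage_cell_const)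
  have [measurable]: "?A \<in> borel_measurable lebesgue" by measurable
  let ?S = "\<lambda>q' q R. {y. ennreal (real_of_rat q) \<le> g y \<and> ?A y \<le> ennreal (real_of_rat q') \<and> norm y < real R}"
  note lebesgue_id_borel[measurable]
  have null: "AE y in lebesgue. y \<notin> ?S q' q R" if "0 \<le> q'" "q' < q" for q' q :: rat and R :: nat
  proof -
    have "Measurable.pred lebesgue (\<lambda>y. ennreal (real_of_rat q) \<le> g y \<and> ?A y \<le> ennreal (real_of_rat q') \<and> norm y < real R)"
      by measurable
    then have m: "?S q' q R \<in> sets lebesgue" by (simp add: pred_def)
    have "emeasure lebesgue (?S q' q R) \<le> emeasure lebesgue (ball (0::real^'n) (real R))"
      by (rule emeasure_mono) auto
    also have "\<dots> < \<infinity>" using lmeasurable_ball[of "0::real^'n" "real R"] by (simp add: fmeasurable_def)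
    finally have fin: "emeasure lebesgue (?S q' q R) < \<infinity>" .
    have 0: "0 \<le> real_of_rat q'" "real_of_rat q' < real_of_rat q"
      using that by (simp_all add: of_rat_less)
    have "emeasure lebesgue (?S q' q R) = 0"
    proof (rule AE_le_SUP_cell_averages_aux[where i=i and g=g, OF _ 0 m fin])
      fix y k assume y: "y \<in> ?S q' q R" and "i \<le> k"
      then have "eaverage (cell k y) g \<le> ?A y" by (intro SUP_upper) auto
      then show "eaverage (cell k y) g \<le> ennreal (real_of_rat q')" using y by auto
    qed auto
    then have "?S q' q R \<in> null_sets lebesgue" using m by blast
    then show ?thesis by (rule AE_not_in)
  qed
  have "AE y in lebesgue. \<forall>q' q R. 0 \<le> q' \<longrightarrow> q' < q \<longrightarrow> y \<notin> ?S q' q R"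
    unfolding AE_all_countable using null by auto
  then show ?thesis
  proof (eventually_elim)
    case (elim y)
    show ?case
    proof (rule ccontr)
      assume "\<not> g y \<le> ?A y"
      then have lt: "?A y < g y" by simp
      then obtain z where z: "?A y < z" "z < g y" using dense by blast
      then obtain z' where z': "?A y < z'" "z' < z" using dense by blast
      have tops: "?A y < top" "z' < top" "z < top"
        using z(1) z'(2) z(2) by (meson less_le_trans top_greatest)+
      obtain a where a: "?A y = ennreal a" "0 \<le> a" using tops(1) by (cases "?A y" rule: ennreal_cases) auto
      obtain c' where c': "z' = ennreal c'" "0 \<le> c'" using tops(2) by (cases z' rule: ennreal_cases) auto
      obtain c where c: "z = ennreal c" "0 \<le> c" using tops(3) by (cases z rule: ennreal_cases) auto
      have "a < c'" "c' < c" using z z' a c' c by (auto simp: ennreal_less_iff)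
      obtain q' where q': "a < real_of_rat q'" "real_of_rat q' < c'" using of_rat_dense[OF \<open>a < c'\<close>] by blast
      obtain q where q: "c' < real_of_rat q" "real_of_rat q < c" using of_rat_dense[OF \<open>c' < c\<close>] by blast
      obtain R :: nat where R: "norm y < real R" using reals_Archimedean2 by blast
      have "0 \<le> q'" using q' a by (smt (verit) zero_le_of_rat_iff)
      moreover have "q' < q" using q q' by (metis of_rat_less order.strict_trans)
      moreover have "y \<in> ?S q' q R"
      proof -
        have "ennreal (real_of_rat q) \<le> ennreal c" using q by (intro ennreal_leI) auto
        then have "ennreal (real_of_rat q) \<le> g y"
          using less_imp_le[OF z(2)] unfolding c(1) by (rule order_trans)
        moreover have "?A y \<le> ennreal (real_of_rat q')" unfolding a using q' by (intro ennreal_leI) auto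
        ultimately show ?thesis using R by (auto simp: dist_norm)
      qed
      ultimately show False using elim by blast
    qed
  qed
qed

end

section \<open>Functions of bounded mean oscillation on a grid\<close>

lemma sum_nn_integral_disjoint:
  fixes f :: "'a \<Rightarrow> ennreal"
  assumes I: "finite I" "disjoint_family_on B I" and B: "\<And>i. i \<in> I \<Longrightarrow> B i \<in> sets M"
    and [measurable]: "f \<in> borel_measurable M"
  shows "(\<Sum>i\<in>I. \<integral>\<^sup>+x\<in>B i. f x \<partial>M) = (\<integral>\<^sup>+x\<in>(\<Union>i\<in>I. B i). f x \<partial>M)"
proof -
  have "(\<Sum>i\<in>I. \<integral>\<^sup>+x\<in>B i. f x \<partial>M) = (\<Sum>i\<in>I. emeasure (density M f) (B i))"
    by (intro sum.cong refl) (simp add: emeasure_density B)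
  also have "\<dots> = emeasure (density M f) (\<Union>i\<in>I. B i)"
    by (rule sum_emeasure) (use I B in auto)
  also have "\<dots> = (\<integral>\<^sup>+x\<in>(\<Union>i\<in>I. B i). f x \<partial>M)"
    using I B by (intro emeasure_density) auto
  finally show ?thesis .
qed

text \<open>Multiplying by the measure keeps the estimate valid for null sets, on which
  \<open>average\<close> is 0 by the convention for division.\<close>

lemma average_deviation_le:
  fixes b :: "real ^ 'n \<Rightarrow> real"
  assumes S: "S \<in> lmeasurable" and b: "set_integrable lebesgue S b"
  shows "ennreal (\<bar>average S b - c\<bar> * measure lebesgue S) \<le> (\<integral>\<^sup>+x\<in>S. ennreal \<bar>b x - c\<bar> \<partial>lebesgue)"
proof (cases "measure lebesgue S = 0")
  case False
  let ?m = "measure lebesgue S"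
  have m: "0 < ?m" using False by (simp add: zero_less_measure_iff)
  have S': "S \<in> sets lebesgue" "emeasure lebesgue S < \<infinity>" using S by (auto simp: fmeasurable_def)
  have c: "set_integrable lebesgue S (\<lambda>_. c)"
    unfolding set_integrable_def using S
    by (intro integrable_scaleR_left) (auto simp: lmeasurable_iff_integrable)
  have d: "set_integrable lebesgue S (\<lambda>x. b x - c)" by (rule set_integral_diff(1)[OF b c])
  have "(average S b - c) * ?m = (LINT x:S|lebesgue. b x) - c * ?m"
    using False by (simp add: average_def algebra_simps)
  also have "\<dots> = (LINT x:S|lebesgue. b x - c)"
    using set_integral_diff(2)[OF b c] S' by (simp add: set_lebesgue_integral_def)
  finally have "\<bar>average S b - c\<bar> * ?m = \<bar>LINT x:S|lebesgue. b x - c\<bar>"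
    using m by (metis abs_mult abs_of_pos)
  also have "ennreal \<dots> \<le> (\<integral>\<^sup>+x. ennreal (norm (indicator S x *\<^sub>R (b x - c))) \<partial>lebesgue)"
    using integral_norm_bound_ennreal[OF d[unfolded set_integrable_def]] by (simp add: set_lebesgue_integral_def)
  also have "\<dots> = (\<integral>\<^sup>+x\<in>S. ennreal \<bar>b x - c\<bar> \<partial>lebesgue)"
    by (intro nn_integral_cong) (auto simp: indicator_def)
  finally show ?thesis .
qed simp

context dyadic_grid
begin

lemma cell_lmeasurable: "cell i x \<in> lmeasurable"
  by (simp add: fmeasurable_def emeasure_cell)

definition cell_mean :: "(real ^ 'n \<Rightarrow> real) \<Rightarrow> nat \<Rightarrow> real ^ 'n \<Rightarrow> real" where
  "cell_mean b i x = average (cell i x) b"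

lemma cell_mean_const: "y \<in> cell i x \<Longrightarrow> cell_mean b i y = cell_mean b i x"
  using cell_eq by (simp add: cell_mean_def)

lemma cell_mean_const_le: "i \<le> k \<Longrightarrow> y \<in> cell k x \<Longrightarrow> cell_mean b i y = cell_mean b i x"
  using cell_mean_const cell_mono by blast

lemma cell_mean_measurable [measurable]: "cell_mean b i \<in> borel_measurable lebesgue"
  by (rule cell_const_measurable[of i]) (rule cell_mean_const)

end

locale dyadic_bmo = dyadic_grid cell len
  for cell :: "nat \<Rightarrow> real ^ 'n \<Rightarrow> (real ^ 'n) set" and len +
  fixes b :: "real ^ 'n \<Rightarrow> real" and \<kappa> :: real
  assumes b_measurable [measurable]: "b \<in> borel_measurable lebesgue"
    and b_integrable: "set_integrable lebesgue (cell i x) b"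
    and \<kappa>_pos: "0 < \<kappa>"
    and oscillation_le: "(\<integral>\<^sup>+y\<in>cell i x. ennreal \<bar>b y - cell_mean b i x\<bar> \<partial>lebesgue) \<le> ennreal (\<kappa> * len i ^ CARD('n))"
begin

text \<open>A child has the fraction 2^(-n) of the measure of its parent, so the oscillation over
  the parent costs the factor 2^n when it is averaged over the child only.\<close>

lemma cell_mean_Suc_diff: "\<bar>cell_mean b (Suc i) x - cell_mean b i x\<bar> \<le> 2 ^ CARD('n) * \<kappa>"
proof -
  have "ennreal (\<bar>cell_mean b (Suc i) x - cell_mean b i x\<bar> * len (Suc i) ^ CARD('n))
     \<le> (\<integral>\<^sup>+y\<in>cell (Suc i) x. ennreal \<bar>b y - cell_mean b i x\<bar> \<partial>lebesgue)"
    using average_deviation_le[OF cell_lmeasurable b_integrable, of "Suc i" x "cell_mean b i x"]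
    by (simp add: measure_cell cell_mean_def)
  also have "\<dots> \<le> (\<integral>\<^sup>+y\<in>cell i x. ennreal \<bar>b y - cell_mean b i x\<bar> \<partial>lebesgue)"
    by (intro nn_integral_mono) (use cell_nested[of i x] in \<open>auto simp: indicator_def\<close>)
  also have "\<dots> \<le> ennreal (\<kappa> * len i ^ CARD('n))" by (rule oscillation_le)
  finally have "\<bar>cell_mean b (Suc i) x - cell_mean b i x\<bar> * len (Suc i) ^ CARD('n) \<le> \<kappa> * len i ^ CARD('n)"
    using \<kappa>_pos len_pos[of i] by (subst (asm) ennreal_le_iff) (auto intro: less_imp_le)
  also have "\<dots> = 2 ^ CARD('n) * \<kappa> * len (Suc i) ^ CARD('n)"
    by (simp add: len_Suc power_divide)
  finally show ?thesis using len_pos[of "Suc i"] by (subst (asm) mult_le_cancel_right_pos) auto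
qed

lemma cell_mean_diff: "\<bar>cell_mean b (i + m) x - cell_mean b i x\<bar> \<le> 2 ^ CARD('n) * \<kappa> * real m"
proof (induction m)
  case (Suc m)
  then show ?case using cell_mean_Suc_diff[of "i + m" x] by (simp add: algebra_simps)
qed simp

text \<open>The horizon \<open>N\<close> makes the maximum finite and permits induction on
  \<open>N - i\<close>; it is removed by monotone convergence in
  \<open>John_Nirenberg\<close>.\<close>

definition max_dev :: "nat \<Rightarrow> nat \<Rightarrow> real ^ 'n \<Rightarrow> real" where
  "max_dev i N y = Max ((\<lambda>k. \<bar>cell_mean b k y - cell_mean b i y\<bar>) ` {i..N})"

lemma max_dev_measurable [measurable]: "max_dev i N \<in> borel_measurable lebesgue"
proof (cases "i \<le> N")
  case True
  have "max_dev i N = (\<lambda>y. Max ((\<lambda>k. \<bar>cell_mean b k y - cell_mean b i y\<bar>) ` {i..N}))"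
    by (auto simp: max_dev_def)
  then show ?thesis using True by (simp add: borel_measurable_Max)
next
  case False
  then have "max_dev i N = (\<lambda>y. Max {})" by (auto simp: max_dev_def)
  then show ?thesis by simp
qed

definition stop_set :: "nat \<Rightarrow> real ^ 'n \<Rightarrow> nat \<Rightarrow> (real ^ 'n) set" where
  "stop_set i x k = {y \<in> cell i x. i \<le> k \<and> 2 * \<kappa> < \<bar>cell_mean b k y - cell_mean b i y\<bar> \<and>
      (\<forall>j. i \<le> j \<longrightarrow> j < k \<longrightarrow> \<bar>cell_mean b j y - cell_mean b i y\<bar> \<le> 2 * \<kappa>)}"

lemma saturated_stop_set: "saturated k (stop_set i x k)"
  unfolding saturated_def
proof (intro ballI subsetI)
  fix y z assume y: "y \<in> stop_set i x k" and z: "z \<in> cell k y"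
  have "i \<le> k" using y by (simp add: stop_set_def)
  have eq: "cell_mean b j z = cell_mean b j y" if "j \<le> k" for j by (rule cell_mean_const_le[OF that z])
  have "z \<in> cell i x" using y z cell_mono[OF \<open>i \<le> k\<close>] cell_eq[of y i x] by (auto simp: stop_set_def)
  then show "z \<in> stop_set i x k" using y eq \<open>i \<le> k\<close> by (simp add: stop_set_def)
qed

lemma stop_set_sets [measurable]: "stop_set i x k \<in> sets lebesgue"
  by (rule saturated_sets[OF saturated_stop_set])

lemma stop_set_disjoint: "j \<noteq> k \<Longrightarrow> stop_set i x j \<inter> stop_set i x k = {}"
proof (induction j k rule: linorder_wlog)
  case (le j k)
  show ?case
  proof (rule equals0I)
    fix y assume "y \<in> stop_set i x j \<inter> stop_set i x k"
    then have j: "y \<in> stop_set i x j" and k: "y \<in> stop_set i x k" by auto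
    have "i \<le> j" "2 * \<kappa> < \<bar>cell_mean b j y - cell_mean b i y\<bar>" using j by (simp_all add: stop_set_def)
    moreover have "\<bar>cell_mean b j y - cell_mean b i y\<bar> \<le> 2 * \<kappa>"
      using k le \<open>i \<le> j\<close> by (simp add: stop_set_def)
    ultimately show False by simp
  qed
qed (simp add: Int_commute)

text \<open>The threshold \<open>2 * \<kappa>\<close> is made for this. On each selected cell the
  average of |b y - cell_mean b i x| exceeds \<open>2 * \<kappa>\<close>, while over the whole of
  \<open>cell i x\<close> it is at most \<open>\<kappa>\<close>.\<close>

lemma emeasure_stop_sets_le: "2 * emeasure lebesgue (\<Union>k\<in>{i..N}. stop_set i x k) \<le> emeasure lebesgue (cell i x)"
proof -
  have dj: "disjoint_family_on (stop_set i x) {i..N}"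
    unfolding disjoint_family_on_def using stop_set_disjoint by blast
  have "ennreal (2 * \<kappa>) * emeasure lebesgue (\<Union>k\<in>{i..N}. stop_set i x k)
      = (\<Sum>k\<in>{i..N}. \<integral>\<^sup>+y\<in>stop_set i x k. ennreal (2 * \<kappa>) \<partial>lebesgue)"
    using dj by (subst sum_nn_integral_disjoint) (auto simp: nn_integral_cmult_indicator)
  also have "\<dots> \<le> (\<Sum>k\<in>{i..N}. \<integral>\<^sup>+y\<in>stop_set i x k. ennreal \<bar>b y - cell_mean b i x\<bar> \<partial>lebesgue)"
  proof (intro sum_mono saturated_nn_integral_le[OF _ _ saturated_stop_set])
    fix k z assume z: "z \<in> stop_set i x k"
    have "cell_mean b i z = cell_mean b i x" using z by (auto simp: stop_set_def cell_mean_const)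
    then have "2 * \<kappa> \<le> \<bar>cell_mean b k z - cell_mean b i x\<bar>" using z by (simp add: stop_set_def)
    then have "ennreal (2 * \<kappa> * len k ^ CARD('n)) \<le> ennreal (\<bar>cell_mean b k z - cell_mean b i x\<bar> * len k ^ CARD('n))"
      using len_pos[of k] by (intro ennreal_leI mult_right_mono) auto
    also have "\<dots> \<le> (\<integral>\<^sup>+y\<in>cell k z. ennreal \<bar>b y - cell_mean b i x\<bar> \<partial>lebesgue)"
      using average_deviation_le[OF cell_lmeasurable b_integrable, of k z "cell_mean b i x"]
      by (simp add: measure_cell cell_mean_def)
    finally show "(\<integral>\<^sup>+y\<in>cell k z. ennreal (2 * \<kappa>) \<partial>lebesgue) \<le> (\<integral>\<^sup>+y\<in>cell k z. ennreal \<bar>b y - cell_mean b i x\<bar> \<partial>lebesgue)"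
      using len_pos[of k] \<kappa>_pos by (simp add: nn_integral_cmult_indicator emeasure_cell ennreal_mult)
  qed auto
  also have "\<dots> = (\<integral>\<^sup>+y\<in>(\<Union>k\<in>{i..N}. stop_set i x k). ennreal \<bar>b y - cell_mean b i x\<bar> \<partial>lebesgue)"
    using dj by (intro sum_nn_integral_disjoint) auto
  also have "\<dots> \<le> (\<integral>\<^sup>+y\<in>cell i x. ennreal \<bar>b y - cell_mean b i x\<bar> \<partial>lebesgue)"
    by (intro nn_integral_mono) (auto simp: indicator_def stop_set_def)
  also have "\<dots> \<le> ennreal (\<kappa> * len i ^ CARD('n))" by (rule oscillation_le)
  also have "\<dots> = ennreal \<kappa> * emeasure lebesgue (cell i x)"
    using len_pos[of i] \<kappa>_pos by (simp add: ennreal_mult emeasure_cell)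
  finally have "ennreal \<kappa> * (2 * emeasure lebesgue (\<Union>k\<in>{i..N}. stop_set i x k)) \<le> ennreal \<kappa> * emeasure lebesgue (cell i x)"
    using \<kappa>_pos by (simp add: ennreal_mult ac_simps)
  then show ?thesis using \<kappa>_pos by (subst (asm) ennreal_mult_le_mult_iff) auto
qed

lemma max_dev_ge: "i \<le> k \<Longrightarrow> k \<le> N \<Longrightarrow> \<bar>cell_mean b k y - cell_mean b i y\<bar> \<le> max_dev i N y"
  unfolding max_dev_def by (intro Max_ge) auto

lemma max_dev_le:
  assumes "i \<le> N" "\<And>k. i \<le> k \<Longrightarrow> k \<le> N \<Longrightarrow> \<bar>cell_mean b k y - cell_mean b i y\<bar> \<le> B"
  shows "max_dev i N y \<le> B"
  unfolding max_dev_def using assms by (subst Max_le_iff) auto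

text \<open>Up to the level before \<open>k\<close> the deviation is at most
  \<open>2 * \<kappa>\<close>, the single step to \<open>k\<close> adds at most
  \<open>2 ^ CARD('n) * \<kappa>\<close>, and from \<open>k\<close> on \<open>max_dev k N\<close>
  takes over.\<close>

lemma max_dev_stop_set_le:
  assumes y: "y \<in> stop_set i x k" and k: "k \<le> N"
  shows "max_dev i N y \<le> 2 * \<kappa> + 2 ^ CARD('n) * \<kappa> + max_dev k N y"
proof (rule max_dev_le)
  have ik: "i \<le> k" using y by (simp add: stop_set_def)
  \<comment> \<open>At level \<open>i\<close> the deviation is 0, so stopping happens strictly later
    and a preceding level \<open>m\<close> exists.\<close>
  have "k \<noteq> i" using y \<kappa>_pos by (auto simp: stop_set_def)
  then obtain m where m: "k = Suc m" "i \<le> m" using ik by (metis le_neq_implies_less less_imp_Suc_add le_add1)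
  show "i \<le> N" using ik k by simp
  fix j assume j: "i \<le> j" "j \<le> N"
  have pos: "0 \<le> max_dev k N y" using max_dev_ge[of k k N y] k by simp
  show "\<bar>cell_mean b j y - cell_mean b i y\<bar> \<le> 2 * \<kappa> + 2 ^ CARD('n) * \<kappa> + max_dev k N y"
  proof (cases "j < k")
    case True
    then have "\<bar>cell_mean b j y - cell_mean b i y\<bar> \<le> 2 * \<kappa>" using y j by (simp add: stop_set_def)
    then show ?thesis using pos \<kappa>_pos by (smt (verit) mult_pos_pos zero_less_power)
  next
    case False
    then have 1: "\<bar>cell_mean b j y - cell_mean b k y\<bar> \<le> max_dev k N y" using j by (intro max_dev_ge) auto
    have 2: "\<bar>cell_mean b k y - cell_mean b m y\<bar> \<le> 2 ^ CARD('n) * \<kappa>" unfolding m by (rule cell_mean_Suc_diff)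
    have 3: "\<bar>cell_mean b m y - cell_mean b i y\<bar> \<le> 2 * \<kappa>" using y m by (auto simp: stop_set_def)
    show ?thesis using 1 2 3 by linarith
  qed
qed

lemma max_dev_not_stop_set_le:
  assumes y: "y \<in> cell i x" "y \<notin> (\<Union>k\<in>{i..N}. stop_set i x k)" and N: "i \<le> N"
  shows "max_dev i N y \<le> 2 * \<kappa>"
proof (rule max_dev_le[OF N])
  fix k assume "i \<le> k" "k \<le> N"
  then show "\<bar>cell_mean b k y - cell_mean b i y\<bar> \<le> 2 * \<kappa>"
  proof (induction k rule: less_induct)
    case (less k)
    have "y \<notin> stop_set i x k" using y less.prems by auto
    moreover have "\<forall>j. i \<le> j \<longrightarrow> j < k \<longrightarrow> \<bar>cell_mean b j y - cell_mean b i y\<bar> \<le> 2 * \<kappa>"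
      using less by auto
    ultimately show ?case using less.prems y(1) by (auto simp: stop_set_def)
  qed
qed

text \<open>Chosen so that \<open>exp (c * L) * \<beta>\<close> equals
  \<open>(1 + \<beta>) / 2\<close>, midway between \<open>\<beta>\<close> and 1, where
  \<open>L = 2 * \<kappa> + 2 ^ CARD('n) * \<kappa>\<close> bounds the deviation gained at one
  stopping.\<close>

definition jn_exponent :: "real \<Rightarrow> real" where
  "jn_exponent \<beta> = ln ((1 + \<beta>) / (2 * \<beta>)) / (2 * \<kappa> + 2 ^ CARD('n) * \<kappa>)"

text \<open>The solution of \<open>C = (1 + \<beta>) / 2 * C + exp (c * (2 * \<kappa>))\<close>,
  with which the induction in \<open>exp_max_dev_integral_le\<close> closes.\<close>

definition jn_const :: "real \<Rightarrow> real" where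
  "jn_const \<beta> = exp (jn_exponent \<beta> * (2 * \<kappa>)) * 2 / (1 - \<beta>)"

lemma jn_exponent_pos: "0 < \<beta> \<Longrightarrow> \<beta> < 1 \<Longrightarrow> 0 < jn_exponent \<beta>"
  unfolding jn_exponent_def using \<kappa>_pos by (intro divide_pos_pos ln_gt_zero add_pos_pos) (auto simp: field_simps)

text \<open>Induction on \<open>N - i\<close>. The stopped part carries at most the fraction
  \<open>\<beta>\<close> of the weight by \<open>small\<close>, and on it the hypothesis for the
  deeper level costs a factor \<open>exp (c * L)\<close>; elsewhere the deviation never exceeds
  \<open>2 * \<kappa>\<close>. As \<open>small\<close> is the only quantitative information about
  \<open>w\<close>, the weight of the theorem and Lebesgue measure are covered alike.\<close>

lemma exp_max_dev_integral_le:
  assumes [measurable]: "w \<in> borel_measurable lebesgue"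
    and \<beta>: "0 < \<beta>" "\<beta> < 1"
    and small: "\<And>j x S. S \<in> sets lebesgue \<Longrightarrow> S \<subseteq> cell j x \<Longrightarrow> 2 * emeasure lebesgue S \<le> emeasure lebesgue (cell j x)
      \<Longrightarrow> emeasure (wmeasure w) S \<le> ennreal \<beta> * emeasure (wmeasure w) (cell j x)"
    and "i \<le> N"
  shows "(\<integral>\<^sup>+y\<in>cell i x. ennreal (exp (jn_exponent \<beta> * max_dev i N y)) \<partial>wmeasure w)
      \<le> ennreal (jn_const \<beta>) * emeasure (wmeasure w) (cell i x)"
  using \<open>i \<le> N\<close>
proof (induction "N - i" arbitrary: i x rule: less_induct)
  case (less i x)
  let ?W = "wmeasure w" and ?c = "jn_exponent \<beta>" and ?C = "jn_const \<beta>"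
  let ?L = "2 * \<kappa> + 2 ^ CARD('n) * \<kappa>"
  have c: "0 < ?c" by (rule jn_exponent_pos[OF \<beta>])
  have L: "0 < ?L" using \<kappa>_pos by (intro add_pos_pos) auto
  have expL: "exp (?c * ?L) * \<beta> = (1 + \<beta>) / 2"
  proof -
    have "?c * ?L = ln ((1 + \<beta>) / (2 * \<beta>))" unfolding jn_exponent_def using L by simp
    moreover have "0 < (1 + \<beta>) / (2 * \<beta>)" using \<beta> by auto
    ultimately have "exp (?c * ?L) = (1 + \<beta>) / (2 * \<beta>)" by simp
    then show ?thesis using \<beta> by (simp add: field_simps)
  qed
  have C: "0 < ?C" unfolding jn_const_def using \<beta> by (intro divide_pos_pos) auto
  let ?U = "\<Union>k\<in>{i..N}. stop_set i x k"
  have U: "?U \<in> sets lebesgue" "?U \<subseteq> cell i x" by (auto simp: stop_set_def)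
  have [measurable]: "(\<lambda>y. ennreal (exp (?c * max_dev k N y))) \<in> borel_measurable lebesgue" for k by measurable
  have dj: "disjoint_family_on (stop_set i x) {i..N}"
    unfolding disjoint_family_on_def using stop_set_disjoint by blast
  have stop: "(\<integral>\<^sup>+y\<in>stop_set i x k. ennreal (exp (?c * max_dev i N y)) \<partial>?W)
      \<le> (\<integral>\<^sup>+y\<in>stop_set i x k. ennreal (exp (?c * ?L) * ?C) \<partial>?W)" if k: "i \<le> k" "k \<le> N" for k
  proof (cases "stop_set i x k = {}")
    case False
    then have ki: "i < k" using \<kappa>_pos k(1) by (auto simp: stop_set_def order_le_less)
    have "(\<integral>\<^sup>+y\<in>stop_set i x k. ennreal (exp (?c * max_dev i N y)) \<partial>?W)
       \<le> (\<integral>\<^sup>+y\<in>stop_set i x k. ennreal (exp (?c * ?L)) * ennreal (exp (?c * max_dev k N y)) \<partial>?W)"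
    proof (rule nn_integral_mono)
      fix y
      have "?c * max_dev i N y \<le> ?c * ?L + ?c * max_dev k N y" if "y \<in> stop_set i x k"
        using mult_left_mono[OF max_dev_stop_set_le[OF that k(2)], of ?c] c by (simp add: distrib_left)
      then show "ennreal (exp (?c * max_dev i N y)) * indicator (stop_set i x k) y
          \<le> ennreal (exp (?c * ?L)) * ennreal (exp (?c * max_dev k N y)) * indicator (stop_set i x k) y"
        by (auto simp: indicator_def ennreal_mult[symmetric] exp_add[symmetric])
    qed
    also have "\<dots> \<le> (\<integral>\<^sup>+y\<in>stop_set i x k. ennreal (exp (?c * ?L) * ?C) \<partial>?W)"
    proof (rule saturated_nn_integral_le[OF _ _ saturated_stop_set])
      fix z
      have IH: "(\<integral>\<^sup>+y\<in>cell k z. ennreal (exp (?c * max_dev k N y)) \<partial>?W) \<le> ennreal ?C * emeasure ?W (cell k z)"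
        by (rule less.hyps) (use ki k in auto)
      have "(\<integral>\<^sup>+y\<in>cell k z. ennreal (exp (?c * ?L)) * ennreal (exp (?c * max_dev k N y)) \<partial>?W)
          = ennreal (exp (?c * ?L)) * (\<integral>\<^sup>+y\<in>cell k z. ennreal (exp (?c * max_dev k N y)) \<partial>?W)"
        by (simp add: mult.assoc nn_integral_cmult)
      also have "\<dots> \<le> ennreal (exp (?c * ?L)) * (ennreal ?C * emeasure ?W (cell k z))"
        by (rule mult_left_mono[OF IH]) auto
      finally show "(\<integral>\<^sup>+y\<in>cell k z. ennreal (exp (?c * ?L)) * ennreal (exp (?c * max_dev k N y)) \<partial>?W)
          \<le> (\<integral>\<^sup>+y\<in>cell k z. ennreal (exp (?c * ?L) * ?C) \<partial>?W)"
        using C by (subst nn_integral_cmult_indicator) (auto simp: ennreal_mult mult.assoc)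
    qed auto
    finally show ?thesis .
  qed simp
  have sU: "emeasure ?W ?U \<le> ennreal \<beta> * emeasure ?W (cell i x)"
    by (rule small[OF U emeasure_stop_sets_le])
  have "(\<integral>\<^sup>+y\<in>cell i x. ennreal (exp (?c * max_dev i N y)) \<partial>?W)
      = (\<integral>\<^sup>+y\<in>?U \<union> (cell i x - ?U). ennreal (exp (?c * max_dev i N y)) \<partial>?W)"
    using U by (simp add: Un_absorb1 Un_Diff_cancel)
  also have "\<dots> = (\<integral>\<^sup>+y\<in>?U. ennreal (exp (?c * max_dev i N y)) \<partial>?W) + (\<integral>\<^sup>+y\<in>cell i x - ?U. ennreal (exp (?c * max_dev i N y)) \<partial>?W)"
    by (rule nn_integral_disjoint_pair) auto
  also have "(\<integral>\<^sup>+y\<in>?U. ennreal (exp (?c * max_dev i N y)) \<partial>?W) = (\<Sum>k\<in>{i..N}. \<integral>\<^sup>+y\<in>stop_set i x k. ennreal (exp (?c * max_dev i N y)) \<partial>?W)"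
    by (rule sum_nn_integral_disjoint[symmetric]) (use dj in auto)
  also have "\<dots> \<le> (\<Sum>k\<in>{i..N}. \<integral>\<^sup>+y\<in>stop_set i x k. ennreal (exp (?c * ?L) * ?C) \<partial>?W)"
    by (intro sum_mono stop) auto
  also have "\<dots> = (\<integral>\<^sup>+y\<in>?U. ennreal (exp (?c * ?L) * ?C) \<partial>?W)"
    by (rule sum_nn_integral_disjoint) (use dj in auto)
  also have "\<dots> = ennreal (exp (?c * ?L) * ?C) * emeasure ?W ?U"
    by (subst nn_integral_cmult_indicator) auto
  also have "\<dots> \<le> ennreal (exp (?c * ?L) * ?C) * (ennreal \<beta> * emeasure ?W (cell i x))"
    by (rule mult_left_mono[OF sU]) auto
  also have "\<dots> = ennreal ((1 + \<beta>) / 2 * ?C) * emeasure ?W (cell i x)"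
    using \<beta> C by (simp add: expL[symmetric] ennreal_mult ac_simps)
  also have "(\<integral>\<^sup>+y\<in>cell i x - ?U. ennreal (exp (?c * max_dev i N y)) \<partial>?W) \<le> (\<integral>\<^sup>+y\<in>cell i x. ennreal (exp (?c * (2 * \<kappa>))) \<partial>?W)"
  proof (rule nn_integral_mono)
    fix y
    have "?c * max_dev i N y \<le> ?c * (2 * \<kappa>)" if "y \<in> cell i x - ?U"
      using max_dev_not_stop_set_le[of y i x N] that less.prems c by (intro mult_left_mono) auto
    then show "ennreal (exp (?c * max_dev i N y)) * indicator (cell i x - ?U) y \<le> ennreal (exp (?c * (2 * \<kappa>))) * indicator (cell i x) y"
      by (auto simp: indicator_def intro!: ennreal_leI)
  qed
  also have "\<dots> = ennreal (exp (?c * (2 * \<kappa>))) * emeasure ?W (cell i x)"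
    by (subst nn_integral_cmult_indicator) auto
  finally have "(\<integral>\<^sup>+y\<in>cell i x. ennreal (exp (?c * max_dev i N y)) \<partial>?W)
      \<le> (ennreal ((1 + \<beta>) / 2 * ?C) + ennreal (exp (?c * (2 * \<kappa>)))) * emeasure ?W (cell i x)"
    by (simp add: distrib_right add_mono)
  also have "ennreal ((1 + \<beta>) / 2 * ?C) + ennreal (exp (?c * (2 * \<kappa>))) = ennreal ((1 + \<beta>) / 2 * ?C + exp (?c * (2 * \<kappa>)))"
    using \<beta> C by (intro ennreal_plus[symmetric]) auto
  also have "(1 + \<beta>) / 2 * ?C + exp (?c * (2 * \<kappa>)) = ?C"
    unfolding jn_const_def using \<beta> by (simp add: field_simps)
  finally show ?case .
qed

text \<open>Almost everywhere the deviation is at most the supremum of its averages over small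
  cells, and each of these averages is at most \<open>\<kappa>\<close> plus the distance between two
  cell means.\<close>

lemma AE_deviation_le_SUP:
  "AE y in lebesgue. y \<in> cell i x \<longrightarrow> ennreal \<bar>b y - cell_mean b i x\<bar> \<le> (SUP N\<in>{i..}. ennreal (\<kappa> + max_dev i N y))"
proof -
  have "(\<lambda>y. ennreal \<bar>b y - cell_mean b i x\<bar>) \<in> borel_measurable lebesgue" by measurable
  from AE_le_SUP_cell_averages[OF this, of i] show ?thesis
proof (eventually_elim, safe)
  fix y assume y: "y \<in> cell i x" and le: "ennreal \<bar>b y - cell_mean b i x\<bar> \<le> (SUP k\<in>{i..}. eaverage (cell k y) (\<lambda>y. ennreal \<bar>b y - cell_mean b i x\<bar>))"
  have mi: "cell_mean b i x = cell_mean b i y" by (rule cell_mean_const[OF y, symmetric])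
  have "eaverage (cell k y) (\<lambda>y. ennreal \<bar>b y - cell_mean b i x\<bar>) \<le> ennreal (\<kappa> + max_dev i k y)" if k: "i \<le> k" for k
  proof -
    let ?d = "\<bar>cell_mean b k y - cell_mean b i x\<bar>"
    have lp: "0 < len k ^ CARD('n)" using len_pos by simp
    have "(\<integral>\<^sup>+z\<in>cell k y. ennreal \<bar>b z - cell_mean b i x\<bar> \<partial>lebesgue)
       \<le> (\<integral>\<^sup>+z. ennreal \<bar>b z - cell_mean b k y\<bar> * indicator (cell k y) z + ennreal ?d * indicator (cell k y) z \<partial>lebesgue)"
      by (intro nn_integral_mono) (auto simp: indicator_def simp flip: ennreal_plus intro!: ennreal_leI)
    also have "\<dots> = (\<integral>\<^sup>+z\<in>cell k y. ennreal \<bar>b z - cell_mean b k y\<bar> \<partial>lebesgue) + ennreal ?d * emeasure lebesgue (cell k y)"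
      by (subst nn_integral_add) (auto simp: nn_integral_cmult_indicator)
    also have "\<dots> \<le> ennreal (\<kappa> * len k ^ CARD('n)) + ennreal ?d * ennreal (len k ^ CARD('n))"
      by (intro add_mono oscillation_le) (auto simp: emeasure_cell)
    also have "\<dots> = ennreal ((\<kappa> + ?d) * len k ^ CARD('n))"
      using \<kappa>_pos lp by (simp add: distrib_right flip: ennreal_mult ennreal_plus)
    finally have "eaverage (cell k y) (\<lambda>y. ennreal \<bar>b y - cell_mean b i x\<bar>) \<le> ennreal ((\<kappa> + ?d) * len k ^ CARD('n)) / ennreal (len k ^ CARD('n))"
      unfolding eaverage_def emeasure_cell by (rule divide_right_mono_ennreal)
    also have "\<dots> = ennreal (\<kappa> + ?d)" using lp \<kappa>_pos len_pos[of k] by (subst divide_ennreal) auto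
    also have "\<dots> \<le> ennreal (\<kappa> + max_dev i k y)"
      using max_dev_ge[OF k order_refl, of y] mi by (intro ennreal_leI) auto
    finally show ?thesis .
  qed
  then have "(SUP k\<in>{i..}. eaverage (cell k y) (\<lambda>y. ennreal \<bar>b y - cell_mean b i x\<bar>)) \<le> (SUP N\<in>{i..}. ennreal (\<kappa> + max_dev i N y))"
    by (intro SUP_mono) auto
  then show "ennreal \<bar>b y - cell_mean b i x\<bar> \<le> (SUP N\<in>{i..}. ennreal (\<kappa> + max_dev i N y))"
    using le by (rule order_trans[rotated])
qed
qed

lemma max_dev_mono: "i \<le> N \<Longrightarrow> N \<le> N' \<Longrightarrow> max_dev i N y \<le> max_dev i N' y"
  by (intro max_dev_le max_dev_ge) auto

theorem John_Nirenberg: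
  assumes [measurable]: "w \<in> borel_measurable lebesgue"
    and \<beta>: "0 < \<beta>" "\<beta> < 1"
    and small: "\<And>j x S. S \<in> sets lebesgue \<Longrightarrow> S \<subseteq> cell j x \<Longrightarrow> 2 * emeasure lebesgue S \<le> emeasure lebesgue (cell j x)
      \<Longrightarrow> emeasure (wmeasure w) S \<le> ennreal \<beta> * emeasure (wmeasure w) (cell j x)"
  shows "(\<integral>\<^sup>+y\<in>cell i x. ennreal (exp (jn_exponent \<beta> * \<bar>b y - cell_mean b i x\<bar>)) \<partial>wmeasure w)
      \<le> ennreal (exp (jn_exponent \<beta> * \<kappa>) * jn_const \<beta>) * emeasure (wmeasure w) (cell i x)"
proof -
  let ?W = "wmeasure w" and ?c = "jn_exponent \<beta>" and ?C = "jn_const \<beta>"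
  have c: "0 < ?c" by (rule jn_exponent_pos[OF \<beta>])
  let ?g = "\<lambda>N y. ennreal (exp (?c * \<kappa>)) * (ennreal (exp (?c * max_dev i (i + N) y)) * indicator (cell i x) y)"
  have "AE y in lebesgue. ennreal (exp (?c * \<bar>b y - cell_mean b i x\<bar>)) * indicator (cell i x) y \<le> (SUP N. ?g N y)"
    using AE_deviation_le_SUP[of i x]
  proof eventually_elim
    case (elim y)
    show ?case
    proof (cases "y \<in> cell i x")
      case True
      let ?a = "\<bar>b y - cell_mean b i x\<bar>"
      have le: "ennreal ?a \<le> (SUP N\<in>{i..}. ennreal (\<kappa> + max_dev i N y))" using elim True by simp
      have "ennreal (exp (?c * ?a)) \<le> (SUP N. ?g N y)"
      \<comment> \<open>A number \<open>t\<close> below the exponential corresponds to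
        \<open>ln t / c\<close> below the deviation, and the supremum passes the latter at a finite
        \<open>N\<close>. For \<open>t \<le> 1\<close> the logarithm is not positive, and there
        level \<open>i\<close> suffices.\<close>
      proof (rule dense_le)
        fix z assume z: "z < ennreal (exp (?c * ?a))"
        obtain t where t: "z = ennreal t" "0 \<le> t" using z by (cases z rule: ennreal_cases) (auto simp: top_unique)
        have texp: "t < exp (?c * ?a)" using z t by (simp add: ennreal_less_iff)
        have "\<exists>N\<ge>i. t \<le> exp (?c * (\<kappa> + max_dev i N y))"
        proof (cases "t \<le> 1")
          case True
          have "0 \<le> max_dev i i y" using max_dev_ge[of i i i y] by simp
          then have "1 \<le> exp (?c * (\<kappa> + max_dev i i y))" using c \<kappa>_pos by auto
          then show ?thesis using True by (intro exI[of _ i]) (metis order_refl order_trans)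
        next
          case False
          then have t1: "1 < t" by simp
          then have "ln t < ?c * ?a" using texp by (metis exp_less_cancel_iff exp_ln less_trans zero_less_one)
          then have "ln t / ?c < ?a" using c by (simp add: field_simps)
          moreover have "0 \<le> ln t / ?c" using t1 c by auto
          ultimately have "ennreal (ln t / ?c) < ennreal ?a" by (simp add: ennreal_less_iff)
          then have "ennreal (ln t / ?c) < (SUP N\<in>{i..}. ennreal (\<kappa> + max_dev i N y))" using le by (rule less_le_trans)
          then obtain N where N: "i \<le> N" "ennreal (ln t / ?c) < ennreal (\<kappa> + max_dev i N y)"
            unfolding less_SUP_iff by auto
          then have "ln t / ?c < \<kappa> + max_dev i N y" using \<open>0 \<le> ln t / ?c\<close> by (simp add: ennreal_less_iff)
          then have "ln t < ?c * (\<kappa> + max_dev i N y)" using c by (simp add: field_simps)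
          then have "t < exp (?c * (\<kappa> + max_dev i N y))" using t1 by (metis exp_less_cancel_iff exp_ln less_trans zero_less_one)
          then show ?thesis using N by (intro exI[of _ N]) auto
        qed
        then obtain N where N: "i \<le> N" "t \<le> exp (?c * (\<kappa> + max_dev i N y))" by blast
        have "z \<le> ?g (N - i) y"
          using N True t by (auto simp: ennreal_mult[symmetric] exp_add[symmetric] distrib_left intro!: ennreal_leI)
        also have "\<dots> \<le> (SUP N. ?g N y)" by (rule SUP_upper) auto
        finally show "z \<le> (SUP N. ?g N y)" .
      qed
      then show ?thesis using True by simp
    qed simp
  qed
  then have "AE y in ?W. ennreal (exp (?c * \<bar>b y - cell_mean b i x\<bar>)) * indicator (cell i x) y \<le> (SUP N. ?g N y)"
    unfolding wmeasure_def by (subst AE_density) auto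
  then have "(\<integral>\<^sup>+y\<in>cell i x. ennreal (exp (?c * \<bar>b y - cell_mean b i x\<bar>)) \<partial>?W) \<le> (\<integral>\<^sup>+y. (SUP N. ?g N y) \<partial>?W)"
    by (rule nn_integral_mono_AE)
  also have "\<dots> = (SUP N. \<integral>\<^sup>+y. ?g N y \<partial>?W)"
  proof (rule nn_integral_monotone_convergence_SUP)
    show "incseq ?g"
      unfolding incseq_def le_fun_def
      using c by (auto intro!: mult_left_mono mult_right_mono ennreal_leI max_dev_mono)
  qed measurable
  also have "\<dots> \<le> ennreal (exp (?c * \<kappa>) * ?C) * emeasure ?W (cell i x)"
  proof (rule SUP_least)
    fix N
    have "(\<integral>\<^sup>+y. ?g N y \<partial>?W) = ennreal (exp (?c * \<kappa>)) * (\<integral>\<^sup>+y\<in>cell i x. ennreal (exp (?c * max_dev i (i + N) y)) \<partial>?W)"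
      by (rule nn_integral_cmult) measurable
    also have "\<dots> \<le> ennreal (exp (?c * \<kappa>)) * (ennreal ?C * emeasure ?W (cell i x))"
      by (intro mult_left_mono exp_max_dev_integral_le[OF assms]) auto
    also have "\<dots> = ennreal (exp (?c * \<kappa>) * ?C) * emeasure ?W (cell i x)"
      by (simp add: ennreal_mult' mult.assoc)
    finally show "(\<integral>\<^sup>+y. ?g N y \<partial>?W) \<le> ennreal (exp (?c * \<kappa>) * ?C) * emeasure ?W (cell i x)" .
  qed
  finally show ?thesis .
qed

end

section \<open>Stopping times\<close>

lemma sigma_finite_lebesgue: "sigma_finite_measure (lebesgue :: 'a::euclidean_space measure)"
proof
  have "\<exists>n::nat. x \<in> ball 0 (real n)" for x :: 'a
    using reals_Archimedean2[of "norm x"] by auto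
  then have "(\<Union>n::nat. ball (0::'a) (real n)) = UNIV" by blast
  then show "\<exists>A. countable A \<and> A \<subseteq> sets lebesgue \<and> \<Union>A = space (lebesgue :: 'a measure) \<and> (\<forall>a\<in>A. emeasure lebesgue a \<noteq> \<infinity>)"
    using lmeasurable_ball[of "0::'a"]
    by (intro exI[of _ "range (\<lambda>n::nat. ball (0::'a) (real n))"]) (auto simp: fmeasurable_def less_top)
qed

interpretation lebesgue: sigma_finite_measure "lebesgue :: 'a::euclidean_space measure"
  by (rule sigma_finite_lebesgue)

text \<open>A level is selected when \<open>A\<close> more than doubles its value at the previously selected level. In
  \<open>sum_stop_level_le\<close> every index is charged to the last selected level before it: since then \<open>A\<close> has at most
  doubled, \<open>L\<close> has decayed geometrically and \<open>\<beta>\<close> has moved at most linearly.\<close>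

primrec stop_level :: "(nat \<Rightarrow> real) \<Rightarrow> nat \<Rightarrow> nat" where
  "stop_level A 0 = 0"
| "stop_level A (Suc i) = (if 2 * A (stop_level A i) < A (Suc i) then Suc i else stop_level A i)"

lemma stop_level_le: "stop_level A i \<le> i"
  by (induction i) auto

lemma stop_level_idem: "stop_level A (stop_level A i) = stop_level A i"
  by (induction i) auto

lemma stop_level_bound: "(\<And>i. 0 \<le> A i) \<Longrightarrow> A i \<le> 2 * A (stop_level A i)"
  by (induction i) (auto simp: not_less)

lemma stop_level_cong: "(\<And>i. i \<le> k \<Longrightarrow> A i = A' i) \<Longrightarrow> stop_level A k = stop_level A' k"
proof (induction k)
  case (Suc k)
  then have "stop_level A k = stop_level A' k" by simp
  moreover have "A (stop_level A' k) = A' (stop_level A' k)"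
    using Suc.prems stop_level_le[of A' k] by simp
  ultimately show ?case using Suc.prems[of "Suc k"] by simp
qed simp

text \<open>Take the first level at which \<open>j\<close> ceases to be the selected one: nothing is
  selected strictly between \<open>j\<close> and \<open>k\<close>, so the comparison that selects
  \<open>k\<close> is a comparison with \<open>A j\<close>.\<close>

lemma stop_level_first_change:
  assumes "j \<le> N" "stop_level A j = j" "stop_level A N \<noteq> j"
  shows "\<exists>k. j < k \<and> k \<le> N \<and> (\<forall>i. j \<le> i \<longrightarrow> i < k \<longrightarrow> stop_level A i = j) \<and> 2 * A j < A k"
  using assms
proof (induction N)
  case (Suc N)
  show ?case
  proof (cases "j = Suc N")
    case False
    then have jN: "j \<le> N" using Suc.prems by simp
    show ?thesis
    proof (cases "stop_level A N = j")
      case True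
      have "\<forall>i. j \<le> i \<longrightarrow> i < Suc N \<longrightarrow> stop_level A i = j"
      proof (rule ccontr)
        assume "\<not> ?thesis"
        then obtain i where i: "j \<le> i" "i \<le> N" "stop_level A i \<noteq> j" by auto
        have mono: "stop_level A a \<le> stop_level A c" if "a \<le> c" for a c
          using that
        proof (induction c rule: dec_induct)
          case (step n) then show ?case using stop_level_le[of A n] by auto
        qed simp
        show False using mono[OF i(1)] mono[OF i(2)] True Suc.prems(2) i(3) by simp
      qed
      moreover have "2 * A j < A (Suc N)" using Suc.prems True by (auto split: if_splits)
      ultimately show ?thesis using jN by (intro exI[of _ "Suc N"]) auto
    next
      case False
      then obtain k where "j < k \<and> k \<le> N \<and> (\<forall>i. j \<le> i \<longrightarrow> i < k \<longrightarrow> stop_level A i = j) \<and> 2 * A j < A k"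
        using Suc.IH[OF jN Suc.prems(2)] by blast
      then show ?thesis by (intro exI[of _ k]) auto
    qed
  qed (use Suc.prems in simp)
qed simp

lemma summable_power_linear:
  fixes q k :: real
  assumes "0 \<le> q" "q < 1"
  shows "summable (\<lambda>m. q ^ m * (1 + k * real m))"
proof -
  have "summable (\<lambda>n. real n * q ^ n)"
  proof (cases "q = 0")
    case True
    have "(\<lambda>n. real n * q ^ n) = (\<lambda>n. 0)" using True by (auto simp: fun_eq_iff power_0_left)
    then show ?thesis by simp
  next
    case False
    have "summable (\<lambda>n. diffs (\<lambda>_. 1) n * q ^ n)"
      by (rule termdiff_converges[of q 1]) (use assms in \<open>auto intro: summable_geometric\<close>)
    then have "summable (\<lambda>n. real (Suc n) * q ^ n)" by (simp add: diffs_def)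
    from summable_diff[OF this summable_geometric[of q]] show ?thesis
      using assms by (simp add: algebra_simps)
  qed
  from summable_add[OF summable_geometric[of q] summable_mult[OF this, of k]] show ?thesis
    using assms by (simp add: algebra_simps)
qed

lemma sum_stop_level_le:
  fixes A L \<beta> :: "nat \<Rightarrow> real"
  assumes A: "\<And>i. 0 \<le> A i" and L: "\<And>i. 0 \<le> L i" "\<And>j m. L (j + m) = L j * q ^ m"
    and q: "0 \<le> q" "q < 1" and k: "0 \<le> k" "\<And>j m. \<bar>\<beta> (j + m) - \<beta> j\<bar> \<le> k * real m"
  shows "(\<Sum>i\<le>N. L i * A i * (\<bar>B - \<beta> i\<bar> + 1))
    \<le> 2 * (\<Sum>m. q ^ m * (1 + k * real m)) * (\<Sum>j\<le>N. if stop_level A j = j then L j * A j * (\<bar>B - \<beta> j\<bar> + 1) else 0)"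
proof -
  let ?t = "\<lambda>j. if stop_level A j = j then L j * A j * (\<bar>B - \<beta> j\<bar> + 1) else 0"
  let ?c = "\<lambda>m. q ^ m * (1 + k * real m)"
  have t: "0 \<le> ?t j" for j using A L by auto
  have c: "0 \<le> ?c m" for m using q k by auto
  have one: "L i * A i * (\<bar>B - \<beta> i\<bar> + 1) \<le> (\<Sum>j\<le>N. if j = stop_level A i then 2 * ?t j * ?c (i - j) else 0)" if "i \<le> N" for i
  proof -
    define j where "j = stop_level A i"
    have j: "j \<le> i" "stop_level A j = j" unfolding j_def by (rule stop_level_le stop_level_idem)+
    define m where "m = i - j"
    have i: "i = j + m" using j m_def by simp
    have "A i \<le> 2 * A j" unfolding j_def by (rule stop_level_bound[OF A])
    \<comment> \<open>The summand 1 turns the additive drift \<open>k * real m\<close> into a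
      factor.\<close>
    moreover have "\<bar>B - \<beta> i\<bar> + 1 \<le> (\<bar>B - \<beta> j\<bar> + 1) * (1 + k * real m)"
    proof -
      have "\<bar>B - \<beta> i\<bar> \<le> \<bar>B - \<beta> j\<bar> + k * real m" using k(2)[of j m] i by auto
      moreover have "0 \<le> \<bar>B - \<beta> j\<bar> * (k * real m)" using k by auto
      ultimately show ?thesis by (simp add: algebra_simps)
    qed
    ultimately have "A i * (\<bar>B - \<beta> i\<bar> + 1) \<le> 2 * A j * ((\<bar>B - \<beta> j\<bar> + 1) * (1 + k * real m))"
      using A by (intro mult_mono) auto
    then have "L i * (A i * (\<bar>B - \<beta> i\<bar> + 1)) \<le> L i * (2 * A j * ((\<bar>B - \<beta> j\<bar> + 1) * (1 + k * real m)))"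
      by (rule mult_left_mono[OF _ L(1)])
    also have "\<dots> = 2 * ?t j * ?c (i - j)" using i L(2)[of j m] j by simp
    also have "\<dots> = (\<Sum>j\<le>N. if j = stop_level A i then 2 * ?t j * ?c (i - j) else 0)"
      using j that by (subst sum.delta) (auto simp: j_def[symmetric])
    finally show ?thesis by (simp add: mult.assoc)
  qed
  have "(\<Sum>i\<le>N. L i * A i * (\<bar>B - \<beta> i\<bar> + 1)) \<le> (\<Sum>i\<le>N. \<Sum>j\<le>N. if j = stop_level A i then 2 * ?t j * ?c (i - j) else 0)"
    by (rule sum_mono) (use one in auto)
  also have "\<dots> = (\<Sum>j\<le>N. \<Sum>i\<le>N. if j = stop_level A i then 2 * ?t j * ?c (i - j) else 0)"
    by (rule sum.swap)
  also have "\<dots> \<le> (\<Sum>j\<le>N. 2 * ?t j * (\<Sum>m. ?c m))"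
  proof (rule sum_mono)
    fix j assume "j \<in> {..N}"
    have "(\<Sum>i\<le>N. if j = stop_level A i then 2 * ?t j * ?c (i - j) else 0) \<le> (\<Sum>i\<in>{j..N}. 2 * ?t j * ?c (i - j))"
    proof -
      have "(\<Sum>i\<le>N. if j = stop_level A i then 2 * ?t j * ?c (i - j) else 0) = (\<Sum>i\<in>{i\<in>{..N}. j = stop_level A i}. 2 * ?t j * ?c (i - j))"
        by (rule sum.inter_filter[symmetric]) simp
      also have "\<dots> \<le> (\<Sum>i\<in>{j..N}. 2 * ?t j * ?c (i - j))"
      proof (rule sum_mono2)
        show "{i \<in> {..N}. j = stop_level A i} \<subseteq> {j..N}" using stop_level_le by auto
        show "0 \<le> 2 * ?t j * ?c (i - j)" for i using t[of j] q k by (intro mult_nonneg_nonneg add_nonneg_nonneg zero_le_power) auto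
      qed simp
      finally show ?thesis .
    qed
    also have "\<dots> = 2 * ?t j * (\<Sum>i\<in>{j..N}. ?c (i - j))" by (simp add: sum_distrib_left)
    also have "(\<Sum>i\<in>{j..N}. ?c (i - j)) = (\<Sum>m\<in>{..N - j}. ?c m)"
      by (rule sum.reindex_bij_witness[of _ "\<lambda>m. m + j" "\<lambda>i. i - j"]) (use \<open>j \<in> _\<close> in auto)
    also have "\<dots> \<le> (\<Sum>m. ?c m)"
      by (rule sum_le_suminf[OF summable_power_linear[OF q]]) (use c in auto)
    finally show "(\<Sum>i\<le>N. if j = stop_level A i then 2 * ?t j * ?c (i - j) else 0) \<le> 2 * ?t j * (\<Sum>m. ?c m)"
      using t[of j] by (simp add: mult_left_mono)
  qed
  also have "\<dots> = 2 * (\<Sum>m. ?c m) * (\<Sum>j\<le>N. ?t j)"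
    by (subst sum_distrib_left) (intro sum.cong refl, simp only: ac_simps)
  finally show ?thesis .
qed

section \<open>Dyadic maximal functions and the sparseness of the selected cells\<close>

context dyadic_grid
begin

text \<open>The points are sorted by the first level at which the inequality holds. These sets are
  disjoint and saturated, so the inequality on cells simply adds up and no covering argument is
  called for.\<close>

lemma maximal_weak_type:
  assumes [measurable_cong, simp]: "sets M = sets lebesgue" "sets H = sets lebesgue"
  shows "ennreal t * emeasure M {y. \<exists>k\<le>N. ennreal t * emeasure M (cell k y) < emeasure H (cell k y)} \<le> emeasure H UNIV"
proof -
  define V where "V k = {y. ennreal t * emeasure M (cell k y) < emeasure H (cell k y) \<and>
      (\<forall>j<k. \<not> ennreal t * emeasure M (cell j y) < emeasure H (cell j y))}" for k
  have sat: "saturated k (V k)" for k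
    unfolding saturated_def
  proof (intro ballI subsetI)
    fix y z assume y: "y \<in> V k" and z: "z \<in> cell k y"
    have "cell j z = cell j y" if "j \<le> k" for j using z cell_mono[OF that] cell_eq by blast
    then show "z \<in> V k" using y by (simp add: V_def)
  qed
  have V [measurable, simp]: "V k \<in> sets lebesgue" for k by (rule saturated_sets[OF sat])
  have dj: "disjoint_family_on V {..N}"
    unfolding disjoint_family_on_def
  proof (intro ballI impI equals0I)
    fix i j y assume "i \<noteq> j" "y \<in> V i \<inter> V j"
    then show False by (cases "i < j") (auto simp: V_def)
  qed
  have eq: "{y. \<exists>k\<le>N. ennreal t * emeasure M (cell k y) < emeasure H (cell k y)} = (\<Union>k\<in>{..N}. V k)"
  proof (intro equalityI subsetI)
    fix y assume "y \<in> {y. \<exists>k\<le>N. ennreal t * emeasure M (cell k y) < emeasure H (cell k y)}"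
    then obtain k where k: "k \<le> N" "ennreal t * emeasure M (cell k y) < emeasure H (cell k y)" by blast
    define l where "l = (LEAST k. ennreal t * emeasure M (cell k y) < emeasure H (cell k y))"
    have "ennreal t * emeasure M (cell l y) < emeasure H (cell l y)" unfolding l_def using k(2) by (rule LeastI)
    moreover have "\<not> ennreal t * emeasure M (cell j y) < emeasure H (cell j y)" if "j < l" for j
      using not_less_Least that unfolding l_def by blast
    moreover have "l \<le> k" unfolding l_def using k(2) by (rule Least_le)
    ultimately show "y \<in> (\<Union>k\<in>{..N}. V k)" using k(1) by (auto simp: V_def)
  qed (auto simp: V_def)
  have "ennreal t * emeasure M (\<Union>k\<in>{..N}. V k) = (\<Sum>k\<le>N. ennreal t * emeasure M (V k))"
    using dj by (subst sum_emeasure[symmetric]) (auto simp: sum_distrib_left)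
  also have "\<dots> \<le> (\<Sum>k\<le>N. emeasure H (V k))"
  proof (rule sum_mono)
    fix k
    have "emeasure (density M (\<lambda>_. ennreal t)) (V k) \<le> emeasure H (V k)"
      by (rule saturated_emeasure_le[OF _ _ sat])
         (auto simp: emeasure_density nn_integral_cmult_indicator V_def less_imp_le)
    then show "ennreal t * emeasure M (V k) \<le> emeasure H (V k)"
      by (simp add: emeasure_density nn_integral_cmult_indicator)
  qed
  also have "\<dots> = emeasure H (\<Union>k\<in>{..N}. V k)"
    using dj by (intro sum_emeasure) auto
  also have "\<dots> \<le> emeasure H UNIV" by (rule emeasure_mono) auto
  finally show ?thesis unfolding eq .
qed

end

text \<open>In the application \<open>G\<close> is \<open>f\<^sup>p \<nu>\<close> and \<open>E\<close> is part of a level set of the operator. Condition \<open>small\<close>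
  carries the \<open>A_infinity\<close> hypothesis, \<open>bw\<close> the John--Nirenberg inequality for \<open>w\<close>, and \<open>bump\<close> the hypothesis
  on the pair of weights. The stopping rule is run on \<open>AA\<close>, which for \<open>u = 1\<close> would be the average of \<open>w\<close> over
  \<open>E\<close>; the exponent \<open>u > 1\<close> makes room for the oscillation of \<open>b\<close> in Hoelder's inequality.\<close>

locale sparse_setting = dyadic_bmo cell len b \<kappa>
  for cell :: "nat \<Rightarrow> real ^ 'n \<Rightarrow> (real ^ 'n) set" and len b \<kappa> +
  fixes w :: "real ^ 'n \<Rightarrow> real" and \<beta> \<gamma> p u v C1 C2 :: real
    and f G :: "real ^ 'n \<Rightarrow> ennreal" and E :: "(real ^ 'n) set"
  assumes w_measurable [measurable]: "w \<in> borel_measurable lebesgue"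
    and \<beta>: "0 < \<beta>" "\<beta> < 1"
    and \<gamma>: "0 < \<gamma>" and p: "1 < p" and u: "1 < u" "u < v" and v: "v < p / (p - 1)"
    and C1: "0 < C1" and C2: "0 < C2"
    and wcell: "0 < emeasure (wmeasure w) (cell i x)" "emeasure (wmeasure w) (cell i x) < \<infinity>"
    and small: "\<And>j x S. S \<in> sets lebesgue \<Longrightarrow> S \<subseteq> cell j x \<Longrightarrow> 2 * emeasure lebesgue S \<le> emeasure lebesgue (cell j x)
      \<Longrightarrow> emeasure (wmeasure w) S \<le> ennreal \<beta> * emeasure (wmeasure w) (cell j x)"
    and bw: "(\<integral>\<^sup>+y\<in>cell i x. ennreal ((\<bar>b y - cell_mean b i x\<bar> + 1) powr (u / (u - 1))) \<partial>wmeasure w)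
      \<le> ennreal C1 * emeasure (wmeasure w) (cell i x)"
    and f [measurable]: "f \<in> borel_measurable lebesgue"
    and G [measurable]: "G \<in> borel_measurable lebesgue"
    and G_finite: "(\<integral>\<^sup>+x. G x \<partial>lebesgue) < \<infinity>"
    and bump: "ennreal (len i powr \<gamma>) * epow (emeasure (wmeasure w) (cell i x)) (1 / p) *
        (\<integral>\<^sup>+y\<in>cell i x. ennreal (\<bar>b y - cell_mean b i x\<bar> + 1) * f y \<partial>lebesgue)
      \<le> ennreal (C2 * len i ^ CARD('n)) * epow (\<integral>\<^sup>+y\<in>cell i x. G y \<partial>lebesgue) (1 / p)"
    and E [measurable]: "E \<in> sets lebesgue" and E_finite: "emeasure (wmeasure w) E < \<infinity>"
begin

abbreviation "W \<equiv> wmeasure w"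

definition "Wc i x = measure W (cell i x)"
definition "Ec i x = measure W (E \<inter> cell i x)"
definition "Gc i x = enn2real (\<integral>\<^sup>+y\<in>cell i x. G y \<partial>lebesgue)"
text \<open>Powers of averages relative to \<open>W\<close>, of the indicator of \<open>E\<close>
  and of the measure with density \<open>G\<close>; both averages are dominated by dyadic maximal
  functions relative to \<open>W\<close>. \<open>AA\<close> is \<open>XX\<close> times the Lebesgue
  average of \<open>w\<close>.\<close>

definition "XX i x = (Ec i x / Wc i x) powr (1 / u)"
definition "YY i x = (Gc i x / Wc i x) powr (1 / p)"
definition "AA i x = XX i x * Wc i x / len i ^ CARD('n)"
definition "st i x = stop_level (\<lambda>j. AA j x) i"

lemma W_cell: "emeasure W (cell i x) = ennreal (Wc i x)" and Wc_pos: "0 < Wc i x"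
proof -
  show 1: "emeasure W (cell i x) = ennreal (Wc i x)"
    unfolding Wc_def using wcell(2)[of i x] by (intro emeasure_eq_ennreal_measure) auto
  show "0 < Wc i x" using wcell(1)[of i x] unfolding 1 by simp
qed

lemma W_E_cell: "emeasure W (E \<inter> cell i x) = ennreal (Ec i x)" and Ec_nonneg: "0 \<le> Ec i x"
proof -
  have "emeasure W (E \<inter> cell i x) \<le> emeasure W E" by (rule emeasure_mono) auto
  then show "emeasure W (E \<inter> cell i x) = ennreal (Ec i x)"
    unfolding Ec_def using E_finite by (intro emeasure_eq_ennreal_measure) (auto simp: top_unique)
qed (simp add: Ec_def)

lemma G_cell: "(\<integral>\<^sup>+y\<in>cell i x. G y \<partial>lebesgue) = ennreal (Gc i x)" and Gc_nonneg: "0 \<le> Gc i x"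
proof -
  have "(\<integral>\<^sup>+y\<in>cell i x. G y \<partial>lebesgue) \<le> (\<integral>\<^sup>+y. G y \<partial>lebesgue)"
    by (rule nn_integral_mono) (auto simp: indicator_def)
  then show "(\<integral>\<^sup>+y\<in>cell i x. G y \<partial>lebesgue) = ennreal (Gc i x)"
    unfolding Gc_def using G_finite by (intro ennreal_enn2real[symmetric]) auto
qed (simp add: Gc_def)

lemma Ec_le_Wc: "Ec i x \<le> Wc i x"
proof -
  have "emeasure W (E \<inter> cell i x) \<le> emeasure W (cell i x)" by (rule emeasure_mono) auto
  then show ?thesis unfolding W_E_cell W_cell using Wc_pos[of i x] by (subst (asm) ennreal_le_iff) auto
qed

lemma cell_consts:
  assumes "y \<in> cell i x"
  shows "Wc i y = Wc i x" "Ec i y = Ec i x" "Gc i y = Gc i x" "XX i y = XX i x" "YY i y = YY i x" "AA i y = AA i x"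
  using cell_eq[OF assms] by (simp_all add: Wc_def Ec_def Gc_def XX_def YY_def AA_def)

lemma st_const: "y \<in> cell k x \<Longrightarrow> i \<le> k \<Longrightarrow> st i y = st i x"
  unfolding st_def by (rule stop_level_cong) (meson cell_mono cell_consts(6) in_mono order_trans)

lemma XX_nonneg: "0 \<le> XX i x" and YY_nonneg: "0 \<le> YY i x" and AA_nonneg: "0 \<le> AA i x"
  using Wc_pos[of i x] len_pos[of i] by (auto simp: XX_def YY_def AA_def intro!: divide_nonneg_nonneg mult_nonneg_nonneg)

lemma measurable_consts [measurable]:
  "Wc i \<in> borel_measurable lebesgue" "Ec i \<in> borel_measurable lebesgue" "Gc i \<in> borel_measurable lebesgue"
  "XX i \<in> borel_measurable lebesgue" "YY i \<in> borel_measurable lebesgue" "AA i \<in> borel_measurable lebesgue"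
  using cell_consts[of _ i] by (auto intro!: cell_const_measurable[of i])

lemma st_sets [measurable]: "{y. st i y = j} \<in> sets lebesgue"
  by (rule cell_const_sets[of i]) (use st_const[of _ i] in auto)

lemma stop_saturated: "saturated j {y. st j y = j}"
  unfolding saturated_def using st_const[of _ j] by auto

lemma AA_mult: "AA i x * len i ^ CARD('n) = XX i x * Wc i x"
  using len_pos[of i] by (simp add: AA_def)

text \<open>The quantity w(P)^(1-1/u) w(E \<inter> P)^(1/u) is not additive in P, but t^(1/u) is
  concave: its tangent at the value for \<open>cell j x\<close> bounds the quantity on every subcell
  by an additive one, c0 w(P) + c1 w(E \<inter> P), with equality on \<open>cell j x\<close> itself.
  Summed over the subcells on which \<open>AA\<close> first more than doubles, this says that twice
  their total measure is at most the measure of \<open>cell j x\<close>.\<close>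

lemma sparse_small:
  assumes j: "st j x = j" "j \<le> N"
  shows "2 * emeasure lebesgue {y \<in> cell j x. st N y \<noteq> j} \<le> emeasure lebesgue (cell j x)"
proof -
  define S where "S k = {y \<in> cell j x. j < k \<and> (\<forall>i. j \<le> i \<longrightarrow> i < k \<longrightarrow> st i y = j) \<and> 2 * AA j y < AA k y}" for k
  have sat: "saturated k (S k)" for k
    unfolding saturated_def
  proof (intro ballI subsetI)
    fix y z assume y: "y \<in> S k" and z: "z \<in> cell k y"
    have jk: "j < k" using y by (simp add: S_def)
    have "z \<in> cell j y" using z cell_mono[of j k y] jk by auto
    then have "z \<in> cell j x" "AA j z = AA j y" using y cell_eq[of y j x] cell_consts(6)[of z j y] by (auto simp: S_def)
    moreover have "AA k z = AA k y" by (rule cell_consts(6)[OF z])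
    moreover have "st i z = st i y" if "i \<le> k" for i by (rule st_const[OF z that])
    ultimately show "z \<in> S k" using y by (simp add: S_def)
  qed
  have [measurable, simp]: "S k \<in> sets lebesgue" for k by (rule saturated_sets[OF sat])
  have sub: "{y \<in> cell j x. st N y \<noteq> j} \<subseteq> (\<Union>k\<in>{j<..N}. S k)"
  proof safe
    fix y assume y: "y \<in> cell j x" "st N y \<noteq> j"
    have "st j y = j" using st_const[OF y(1), of j] j by simp
    then obtain k where "j < k" "k \<le> N" "\<forall>i. j \<le> i \<longrightarrow> i < k \<longrightarrow> st i y = j" "2 * AA j y < AA k y"
      using stop_level_first_change[OF j(2), of "\<lambda>i. AA i y"] y(2) unfolding st_def by auto
    then show "y \<in> (\<Union>k\<in>{j<..N}. S k)" using y by (auto simp: S_def)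
  qed
  have dj: "disjoint_family_on S {j<..N}"
    unfolding disjoint_family_on_def
  proof (intro ballI impI)
    fix i k assume "i \<in> {j<..N}" "k \<in> {j<..N}" "i \<noteq> k"
    then show "S i \<inter> S k = {}"
    proof (induction i k rule: linorder_wlog)
      case (le i k)
      show ?case
      proof (rule equals0I)
        fix y assume "y \<in> S i \<inter> S k"
        then have i: "j < i" "\<And>l. j \<le> l \<Longrightarrow> l < i \<Longrightarrow> st l y = j" "2 * AA j y < AA i y"
          and k: "\<And>l. j \<le> l \<Longrightarrow> l < k \<Longrightarrow> st l y = j" by (auto simp: S_def)
        obtain l where l: "i = Suc l" using i(1) by (cases i) auto
        have "st l y = j" using i l by auto
        then have "st i y = i" using i(3) unfolding l st_def by simp
        moreover have "st i y = j" using k[of i] le i(1) by auto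
        ultimately show False using i(1) by simp
      qed
    qed (simp add: Int_commute)
  qed
  define \<theta> where "\<theta> = XX j x"
  have \<theta>0: "0 \<le> \<theta>" by (simp add: \<theta>_def XX_nonneg)
  \<comment> \<open>Intercept and slope of the tangent of t^(1/u) at t =
    \<open>\<theta> powr u\<close>, the fraction of the weight of the cell that lies in
    \<open>E\<close>.\<close>
  define c0 where "c0 = (1 - 1/u) * \<theta>"
  define c1 where "c1 = (1/u) * \<theta> powr (1 - u)"
  have c0: "0 \<le> c0" and c1: "0 \<le> c1" using u \<theta>0 by (auto simp: c0_def c1_def)
  have cellwise: "(\<integral>\<^sup>+y\<in>cell k z. ennreal (2 * AA j x) \<partial>lebesgue) \<le> (\<integral>\<^sup>+y\<in>cell k z. ennreal c0 + ennreal c1 * indicator E y \<partial>W)"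
    if z: "z \<in> S k" for k z
  proof -
    have jk: "j < k" and zj: "z \<in> cell j x" and A: "2 * AA j z < AA k z" using z by (auto simp: S_def)
    have Az: "AA j z = AA j x" by (rule cell_consts(6)[OF zj])
    have "0 < AA k z" using A AA_nonneg[of j z] by simp
    then have Ekz: "0 < Ec k z" using Ec_nonneg[of k z] unfolding AA_def XX_def
      by (metis divide_eq_0_iff less_irrefl mult_zero_left order_le_less powr_eq_0_iff)
    have "Ec k z \<le> Ec j z"
    proof -
      have "emeasure W (E \<inter> cell k z) \<le> emeasure W (E \<inter> cell j z)"
        using cell_mono[of j k z] jk by (intro emeasure_mono) auto
      then show ?thesis unfolding W_E_cell using Ec_nonneg by (simp add: ennreal_le_iff)
    qed
    then have "0 < Ec j x" using Ekz cell_consts(2)[OF zj] by simp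
    then have \<theta>: "0 < \<theta>" unfolding \<theta>_def XX_def using Wc_pos[of j x] by simp
    define t where "t = XX k z"
    have t: "0 \<le> t" by (simp add: t_def XX_nonneg)
    have tu: "t powr u = Ec k z / Wc k z"
      unfolding t_def XX_def using u Ec_nonneg[of k z] Wc_pos[of k z] by (simp add: powr_powr)
    have "t * \<theta> powr (u - 1) \<le> t powr u / u + (\<theta> powr (u - 1)) powr (u / (u - 1)) / (u / (u - 1))"
      by (rule Youngs_inequality) (use u t in \<open>auto simp: field_simps\<close>)
    also have "(\<theta> powr (u - 1)) powr (u / (u - 1)) = \<theta> powr u" using u by (simp add: powr_powr)
    also have "t powr u / u + \<theta> powr u / (u / (u - 1)) = t powr u / u + \<theta> powr u * (1 - 1/u)"
      using u by (simp add: field_simps)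
    finally have "t * \<theta> powr (u - 1) * \<theta> powr (1 - u) \<le> (t powr u / u + \<theta> powr u * (1 - 1/u)) * \<theta> powr (1 - u)"
      by (rule mult_right_mono) auto
    moreover have "\<theta> powr (u - 1) * \<theta> powr (1 - u) = 1" "\<theta> powr u * \<theta> powr (1 - u) = \<theta>"
      using \<theta> by (simp_all add: powr_add[symmetric])
    ultimately have "t \<le> c1 * t powr u + c0"
      unfolding c0_def c1_def by (simp add: algebra_simps)
    then have "t * Wc k z \<le> (c1 * t powr u + c0) * Wc k z" using Wc_pos[of k z] by (intro mult_right_mono) auto
    also have "\<dots> = c0 * Wc k z + c1 * Ec k z"
      unfolding tu using Wc_pos[of k z] by (simp add: field_simps)
    finally have le: "2 * AA j x * len k ^ CARD('n) \<le> c0 * Wc k z + c1 * Ec k z"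
      using mult_right_mono[OF less_imp_le[OF A], of "len k ^ CARD('n)"] len_pos[of k]
      unfolding Az AA_mult t_def by (smt (verit) zero_less_power)
    have "(\<integral>\<^sup>+y\<in>cell k z. ennreal (2 * AA j x) \<partial>lebesgue) = ennreal (2 * AA j x * len k ^ CARD('n))"
      using AA_nonneg[of j x] len_pos[of k]
      by (subst nn_integral_cmult_indicator) (auto simp: emeasure_cell ennreal_mult)
    also have "\<dots> \<le> ennreal (c0 * Wc k z + c1 * Ec k z)" by (rule ennreal_leI[OF le])
    also have "\<dots> = ennreal c0 * emeasure W (cell k z) + ennreal c1 * emeasure W (E \<inter> cell k z)"
      using c0 c1 Wc_pos[of k z] Ec_nonneg[of k z] by (simp add: W_cell W_E_cell ennreal_plus ennreal_mult)
    also have "\<dots> = (\<integral>\<^sup>+y. ennreal c0 * indicator (cell k z) y + ennreal c1 * indicator (E \<inter> cell k z) y \<partial>W)"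
      by (subst nn_integral_add) (auto simp: nn_integral_cmult_indicator)
    also have "\<dots> = (\<integral>\<^sup>+y\<in>cell k z. ennreal c0 + ennreal c1 * indicator E y \<partial>W)"
      by (intro nn_integral_cong) (auto simp: indicator_def)
    finally show ?thesis .
  qed
  have "ennreal (2 * AA j x) * emeasure lebesgue {y \<in> cell j x. st N y \<noteq> j} \<le> ennreal (2 * AA j x) * emeasure lebesgue (\<Union>k\<in>{j<..N}. S k)"
    by (intro mult_left_mono emeasure_mono sub) auto
  also have "\<dots> = (\<integral>\<^sup>+y\<in>(\<Union>k\<in>{j<..N}. S k). ennreal (2 * AA j x) \<partial>lebesgue)"
    by (subst nn_integral_cmult_indicator) auto
  also have "\<dots> = (\<Sum>k\<in>{j<..N}. \<integral>\<^sup>+y\<in>S k. ennreal (2 * AA j x) \<partial>lebesgue)"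
    by (rule sum_nn_integral_disjoint[symmetric]) (use dj in auto)
  also have "\<dots> \<le> (\<Sum>k\<in>{j<..N}. \<integral>\<^sup>+y\<in>S k. ennreal c0 + ennreal c1 * indicator E y \<partial>W)"
    by (intro sum_mono saturated_nn_integral_le[OF _ _ sat] cellwise) auto
  also have "\<dots> = (\<integral>\<^sup>+y\<in>(\<Union>k\<in>{j<..N}. S k). ennreal c0 + ennreal c1 * indicator E y \<partial>W)"
    by (rule sum_nn_integral_disjoint) (use dj in auto)
  also have "\<dots> \<le> (\<integral>\<^sup>+y. ennreal c0 * indicator (cell j x) y + ennreal c1 * indicator (E \<inter> cell j x) y \<partial>W)"
    by (intro nn_integral_mono) (auto simp: indicator_def S_def)
  also have "\<dots> = ennreal c0 * emeasure W (cell j x) + ennreal c1 * emeasure W (E \<inter> cell j x)"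
    by (subst nn_integral_add) (auto simp: nn_integral_cmult_indicator)
  also have "\<dots> = ennreal (c0 * Wc j x + c1 * Ec j x)"
    using c0 c1 Wc_pos[of j x] Ec_nonneg[of j x] by (simp add: W_cell W_E_cell ennreal_plus ennreal_mult)
  finally have main: "ennreal (2 * AA j x) * emeasure lebesgue {y \<in> cell j x. st N y \<noteq> j} \<le> ennreal (c0 * Wc j x + c1 * Ec j x)" .
  show ?thesis
  \<comment> \<open>At 0 the tangent is vertical and \<open>AA j x\<close> cannot be cancelled. But
    then \<open>E\<close> is \<open>W\<close>-null in the cell, so \<open>AA\<close> vanishes on all
    smaller cells inside it and no later level is selected there.\<close>
  proof (cases "\<theta> = 0")
    case True
    have "S k = {}" for k
    proof (rule equals0I)
      fix z assume z: "z \<in> S k"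
      have jk: "j < k" and zj: "z \<in> cell j x" and A: "2 * AA j z < AA k z" using z by (auto simp: S_def)
      have "Ec j x = 0" using True Wc_pos[of j x] by (auto simp: \<theta>_def XX_def)
      then have "Ec j z = 0" using cell_consts(2)[OF zj] by simp
      moreover have "emeasure W (E \<inter> cell k z) \<le> emeasure W (E \<inter> cell j z)"
        using cell_mono[of j k z] jk by (intro emeasure_mono) auto
      ultimately have "Ec k z = 0" unfolding W_E_cell using Ec_nonneg[of k z] by simp
      then have "AA k z = 0" by (simp add: AA_def XX_def)
      then show False using A AA_nonneg[of j z] by simp
    qed
    then have "{y \<in> cell j x. st N y \<noteq> j} = {}" using sub by simp
    then show ?thesis by (simp only: emeasure_empty mult_zero_right zero_le)
  next
    case False
    then have \<theta>: "0 < \<theta>" using \<theta>0 by simp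
    have \<theta>u: "\<theta> powr u = Ec j x / Wc j x"
      unfolding \<theta>_def XX_def using u Ec_nonneg[of j x] Wc_pos[of j x] by (simp add: powr_powr)
    have "c1 * Ec j x = (1/u) * (\<theta> powr (1 - u) * \<theta> powr u) * Wc j x"
      unfolding c1_def \<theta>u using Wc_pos[of j x] by simp
    also have "\<theta> powr (1 - u) * \<theta> powr u = \<theta>" using \<theta> by (simp add: powr_add[symmetric])
    finally have "c0 * Wc j x + c1 * Ec j x = \<theta> * Wc j x" unfolding c0_def by (simp add: algebra_simps)
    also have "\<dots> = AA j x * len j ^ CARD('n)" by (simp add: AA_mult \<theta>_def)
    finally have eq: "c0 * Wc j x + c1 * Ec j x = AA j x * len j ^ CARD('n)" .
    have Ap: "0 < AA j x" unfolding AA_def using \<theta> Wc_pos[of j x] len_pos[of j] by (simp add: \<theta>_def)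
    have "ennreal (AA j x) * (2 * emeasure lebesgue {y \<in> cell j x. st N y \<noteq> j}) \<le> ennreal (AA j x) * emeasure lebesgue (cell j x)"
      using main Ap len_pos[of j] unfolding eq by (simp add: ennreal_mult emeasure_cell ac_simps)
    then show ?thesis using Ap by (subst (asm) ennreal_mult_le_mult_iff) auto
  qed
qed

end

section \<open>The grid operators and their dual form\<close>

definition grid_operator ::
  "(nat \<Rightarrow> real ^ 'n \<Rightarrow> (real ^ 'n) set) \<Rightarrow> (nat \<Rightarrow> real) \<Rightarrow> (real ^ 'n \<Rightarrow> real) \<Rightarrow> real \<Rightarrow> (real ^ 'n \<Rightarrow> ennreal)
    \<Rightarrow> nat \<Rightarrow> real ^ 'n \<Rightarrow> ennreal" where
  "grid_operator cell len b \<gamma> f N x = (\<Sum>i\<le>N. ennreal (len i powr \<gamma> / len i ^ CARD('n)) *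
      (\<integral>\<^sup>+y\<in>cell i x. ennreal \<bar>b x - b y\<bar> * f y \<partial>lebesgue))"

context dyadic_grid
begin

text \<open>Although \<open>cell i x\<close> moves with \<open>x\<close>, the set in the product is
  a countable union of squares \<open>Q \<times> Q\<close>.\<close>

lemma cell_pair_measurable [measurable]:
  "(\<lambda>(x, y). indicator (cell i x) y :: ennreal) \<in> borel_measurable (lebesgue \<Otimes>\<^sub>M lebesgue)"
proof -
  have eq: "{(x, y). y \<in> cell i x} = (\<Union>Q\<in>range (cell i). Q \<times> Q)"
  proof (intro equalityI subsetI)
    fix z assume "z \<in> {(x, y). y \<in> cell i x}"
    then obtain x y where z: "z = (x, y)" "y \<in> cell i x" by auto
    then have "z \<in> cell i x \<times> cell i x" using cell_self by simp
    then show "z \<in> (\<Union>Q\<in>range (cell i). Q \<times> Q)" by blast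
  next
    fix z assume "z \<in> (\<Union>Q\<in>range (cell i). Q \<times> Q)"
    then obtain c x y where "z = (x, y)" "x \<in> cell i c" "y \<in> cell i c" by auto
    then show "z \<in> {(x, y). y \<in> cell i x}" using cell_eq[of x i c] by simp
  qed
  have "(\<Union>Q\<in>range (cell i). Q \<times> Q) \<in> sets (lebesgue \<Otimes>\<^sub>M lebesgue)"
    by (rule sets.countable_UN'[OF countable_cells]) (auto intro!: pair_measureI)
  then have "indicator {(x, y). y \<in> cell i x} \<in> borel_measurable (lebesgue \<Otimes>\<^sub>M lebesgue)"
    unfolding eq by (rule borel_measurable_indicator)
  moreover have "(\<lambda>(x, y). indicator (cell i x) y :: ennreal) = indicator {(x, y). y \<in> cell i x}"
    by (auto simp: indicator_def fun_eq_iff)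
  ultimately show ?thesis by simp
qed

lemma cell_integral_measurable:
  assumes [measurable]: "b \<in> borel_measurable lebesgue" "f \<in> borel_measurable lebesgue"
  shows "(\<lambda>x. \<integral>\<^sup>+y\<in>cell i x. ennreal \<bar>b x - b y\<bar> * f y \<partial>lebesgue) \<in> borel_measurable lebesgue"
proof -
  have "(\<lambda>z. (ennreal \<bar>b (fst z) - b (snd z)\<bar> * f (snd z)) * (\<lambda>(x, y). indicator (cell i x) y) z)
      \<in> borel_measurable (lebesgue \<Otimes>\<^sub>M lebesgue)" by measurable
  then have "case_prod (\<lambda>x y. ennreal \<bar>b x - b y\<bar> * f y * indicator (cell i x) y) \<in> borel_measurable (lebesgue \<Otimes>\<^sub>M lebesgue)"
    by (simp add: case_prod_unfold)
  then show ?thesis by (rule lebesgue.borel_measurable_nn_integral)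
qed

lemma grid_operator_measurable:
  assumes "b \<in> borel_measurable lebesgue" "f \<in> borel_measurable lebesgue"
  shows "grid_operator cell len b \<gamma> f N \<in> borel_measurable lebesgue"
  unfolding grid_operator_def[abs_def]
  by (intro borel_measurable_sum borel_measurable_times_ennreal borel_measurable_const cell_integral_measurable[OF assms])

end

context sparse_setting
begin

abbreviation "TN \<equiv> grid_operator cell len b \<gamma> f"

text \<open>Hoelder's inequality with exponents \<open>u\<close> and \<open>u / (u - 1)\<close>:
  \<open>bw\<close> controls the oscillation, and the mass of \<open>E\<close> survives only with
  the power 1/u. This is the origin of the quantity on which the stopping rule is run.\<close>

lemma weighted_deviation_le:
  "(\<integral>\<^sup>+x. ennreal (\<bar>b x - cell_mean b i y\<bar> + 1) * indicator (E \<inter> cell i y) x \<partial>W)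
    \<le> ennreal (C1 powr (1 - 1/u) * XX i y * Wc i y)"
proof -
  let ?u' = "u / (u - 1)"
  let ?g = "\<lambda>x. ennreal (\<bar>b x - cell_mean b i y\<bar> + 1) * indicator (cell i y) x"
  have u': "0 < ?u'" "1/u + 1/?u' = 1" "1/?u' = 1 - 1/u" using u by (auto simp: field_simps)
  have "(\<integral>\<^sup>+x. ennreal (\<bar>b x - cell_mean b i y\<bar> + 1) * indicator (E \<inter> cell i y) x \<partial>W)
      = (\<integral>\<^sup>+x. indicator (E \<inter> cell i y) x * ?g x \<partial>W)"
    by (intro nn_integral_cong) (auto simp: indicator_def)
  also have "\<dots> \<le> epow (\<integral>\<^sup>+x. epow (indicator (E \<inter> cell i y) x) u \<partial>W) (1/u) * epow (\<integral>\<^sup>+x. epow (?g x) ?u' \<partial>W) (1/?u')"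
    by (rule Holder_nn_integral) (use u u' in auto)
  also have "(\<integral>\<^sup>+x. epow (indicator (E \<inter> cell i y) x) u \<partial>W) = (\<integral>\<^sup>+x. indicator (E \<inter> cell i y) x \<partial>W)"
    using u by (intro nn_integral_cong) (auto simp: indicator_def)
  also have "\<dots> = ennreal (Ec i y)" by (simp add: W_E_cell)
  also have "(\<integral>\<^sup>+x. epow (?g x) ?u' \<partial>W) = (\<integral>\<^sup>+x\<in>cell i y. ennreal ((\<bar>b x - cell_mean b i y\<bar> + 1) powr ?u') \<partial>W)"
    using u' by (intro nn_integral_cong) (auto simp: indicator_def epow_ennreal_pos simp del: ennreal_plus)
  also have "epow \<dots> (1/?u') \<le> epow (ennreal (C1 * Wc i y)) (1/?u')"
    using bw[of i y] u u' C1 Wc_pos[of i y] by (intro epow_mono) (auto simp: W_cell ennreal_mult)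
  also have "\<dots> = ennreal (C1 powr (1 - 1/u) * Wc i y powr (1 - 1/u))"
    using C1 Wc_pos[of i y] unfolding u'(3) by (subst epow_ennreal_pos) (auto simp: powr_mult)
  also have "epow (ennreal (Ec i y)) (1/u) = ennreal (Ec i y powr (1/u))"
    using u Ec_nonneg by (intro epow_ennreal) auto
  also have "ennreal (Ec i y powr (1/u)) * ennreal (C1 powr (1 - 1/u) * Wc i y powr (1 - 1/u))
      = ennreal (C1 powr (1 - 1/u) * (Ec i y powr (1/u) * Wc i y powr (1 - 1/u)))"
    by (simp add: ac_simps flip: ennreal_mult)
  also have "Ec i y powr (1/u) * Wc i y powr (1 - 1/u) = XX i y * Wc i y"
    using Wc_pos[of i y] Ec_nonneg[of i y] by (simp add: XX_def powr_divide powr_diff)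
  finally show ?thesis by (simp add: mult_left_mono mult.assoc)
qed

text \<open>Exchanging the integrals puts \<open>x\<close> into \<open>E \<inter> cell i y\<close>,
  because lying in a common cell is a symmetric relation, and \<open>weighted_deviation_le\<close>
  then applies to the inner integral.\<close>

lemma Fubini_cell:
  "(\<integral>\<^sup>+x\<in>E. (\<integral>\<^sup>+y\<in>cell i x. ennreal \<bar>b x - b y\<bar> * f y \<partial>lebesgue) \<partial>W)
    \<le> (\<integral>\<^sup>+y. f y * ennreal ((\<bar>b y - cell_mean b i y\<bar> + 1) * (C1 powr (1 - 1/u) * XX i y * Wc i y)) \<partial>lebesgue)"
proof -
  interpret P: pair_sigma_finite "lebesgue :: (real ^ 'n) measure" "lebesgue :: (real ^ 'n) measure" ..
  define h where "h x y = ennreal (w x) * (indicator E x * (indicator (cell i x) y * (ennreal \<bar>b x - b y\<bar> * f y)))" for x y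
  have [measurable]: "case_prod h \<in> borel_measurable (lebesgue \<Otimes>\<^sub>M lebesgue)"
  proof -
    have "(\<lambda>z. ennreal (w (fst z)) * (indicator E (fst z) * ((\<lambda>(x, y). indicator (cell i x) y) z * (ennreal \<bar>b (fst z) - b (snd z)\<bar> * f (snd z)))))
        \<in> borel_measurable (lebesgue \<Otimes>\<^sub>M lebesgue)"
      by measurable
    then show ?thesis by (simp add: h_def case_prod_unfold)
  qed
  note cell_integral_measurable[OF b_measurable f, measurable]
  have "(\<integral>\<^sup>+x\<in>E. (\<integral>\<^sup>+y\<in>cell i x. ennreal \<bar>b x - b y\<bar> * f y \<partial>lebesgue) \<partial>W)
      = (\<integral>\<^sup>+x. ennreal (w x) * ((\<integral>\<^sup>+y\<in>cell i x. ennreal \<bar>b x - b y\<bar> * f y \<partial>lebesgue) * indicator E x) \<partial>lebesgue)"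
    unfolding wmeasure_def by (subst nn_integral_density) auto
  also have "\<dots> = (\<integral>\<^sup>+x. (\<integral>\<^sup>+y. h x y \<partial>lebesgue) \<partial>lebesgue)"
  proof (rule nn_integral_cong)
    fix x
    have "(\<lambda>y. ennreal \<bar>b x - b y\<bar> * f y * indicator (cell i x) y) \<in> borel_measurable lebesgue" by measurable
    then have "(\<integral>\<^sup>+y. (ennreal (w x) * indicator E x) * (ennreal \<bar>b x - b y\<bar> * f y * indicator (cell i x) y) \<partial>lebesgue)
        = (ennreal (w x) * indicator E x) * (\<integral>\<^sup>+y\<in>cell i x. ennreal \<bar>b x - b y\<bar> * f y \<partial>lebesgue)"
      by (rule nn_integral_cmult)
    moreover have "(\<integral>\<^sup>+y. h x y \<partial>lebesgue) = (\<integral>\<^sup>+y. (ennreal (w x) * indicator E x) * (ennreal \<bar>b x - b y\<bar> * f y * indicator (cell i x) y) \<partial>lebesgue)"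
      by (intro nn_integral_cong) (simp add: h_def ac_simps)
    ultimately show "ennreal (w x) * ((\<integral>\<^sup>+y\<in>cell i x. ennreal \<bar>b x - b y\<bar> * f y \<partial>lebesgue) * indicator E x) = (\<integral>\<^sup>+y. h x y \<partial>lebesgue)"
      by (simp only: mult.assoc mult.commute[of "indicator E x"])
  qed
  also have "\<dots> = (\<integral>\<^sup>+y. (\<integral>\<^sup>+x. h x y \<partial>lebesgue) \<partial>lebesgue)"
    by (rule P.Fubini'[symmetric]) measurable
  also have "\<dots> \<le> (\<integral>\<^sup>+y. f y * ennreal ((\<bar>b y - cell_mean b i y\<bar> + 1) * (C1 powr (1 - 1/u) * XX i y * Wc i y)) \<partial>lebesgue)"
  proof (rule nn_integral_mono)
    fix y
    let ?d = "\<bar>b y - cell_mean b i y\<bar> + 1"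
    have "(\<integral>\<^sup>+x. h x y \<partial>lebesgue)
        \<le> (\<integral>\<^sup>+x. (f y * ennreal ?d) * (ennreal (w x) * (ennreal (\<bar>b x - cell_mean b i y\<bar> + 1) * indicator (E \<inter> cell i y) x)) \<partial>lebesgue)"
    proof (rule nn_integral_mono)
      fix x
      \<comment> \<open>The product form separates the variables at the price of the added
        1.\<close>
      have "\<bar>b x - b y\<bar> \<le> ?d * (\<bar>b x - cell_mean b i y\<bar> + 1)"
      proof -
        have "\<bar>b x - b y\<bar> \<le> \<bar>b y - cell_mean b i y\<bar> + \<bar>b x - cell_mean b i y\<bar>" by linarith
        moreover have "0 \<le> \<bar>b y - cell_mean b i y\<bar> * \<bar>b x - cell_mean b i y\<bar>" by simp
        ultimately show ?thesis unfolding distrib_left distrib_right by linarith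
      qed
      then have "ennreal \<bar>b x - b y\<bar> \<le> ennreal ?d * ennreal (\<bar>b x - cell_mean b i y\<bar> + 1)"
        by (subst ennreal_mult[symmetric]) (auto intro: ennreal_leI simp del: ennreal_plus)
      moreover have "indicator E x * indicator (cell i x) y = (indicator (E \<inter> cell i y) x :: ennreal)"
        using cell_sym[of y i x] by (auto simp: indicator_def)
      then have "h x y = ennreal (w x) * (indicator (E \<inter> cell i y) x * (ennreal \<bar>b x - b y\<bar> * f y))"
        by (simp add: h_def mult.assoc[symmetric])
      ultimately have "h x y \<le> ennreal (w x) * (indicator (E \<inter> cell i y) x * ((ennreal ?d * ennreal (\<bar>b x - cell_mean b i y\<bar> + 1)) * f y))"
        by (simp add: mult_left_mono mult_right_mono)
      then show "h x y \<le> (f y * ennreal ?d) * (ennreal (w x) * (ennreal (\<bar>b x - cell_mean b i y\<bar> + 1) * indicator (E \<inter> cell i y) x))"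
        by (simp add: ac_simps)
    qed
    also have "\<dots> = (f y * ennreal ?d) * (\<integral>\<^sup>+x. ennreal (w x) * (ennreal (\<bar>b x - cell_mean b i y\<bar> + 1) * indicator (E \<inter> cell i y) x) \<partial>lebesgue)"
      by (rule nn_integral_cmult) measurable
    also have "(\<integral>\<^sup>+x. ennreal (w x) * (ennreal (\<bar>b x - cell_mean b i y\<bar> + 1) * indicator (E \<inter> cell i y) x) \<partial>lebesgue)
        = (\<integral>\<^sup>+x. ennreal (\<bar>b x - cell_mean b i y\<bar> + 1) * indicator (E \<inter> cell i y) x \<partial>W)"
      unfolding wmeasure_def by (rule nn_integral_density[symmetric]) measurable
    also have "(f y * ennreal ?d) * \<dots> \<le> (f y * ennreal ?d) * ennreal (C1 powr (1 - 1/u) * XX i y * Wc i y)"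
      by (rule mult_left_mono[OF weighted_deviation_le]) auto
    also have "\<dots> = f y * ennreal (?d * (C1 powr (1 - 1/u) * XX i y * Wc i y))"
      by (simp add: mult.assoc ennreal_mult')
    finally show "(\<integral>\<^sup>+x. h x y \<partial>lebesgue) \<le> f y * ennreal (?d * (C1 powr (1 - 1/u) * XX i y * Wc i y))" .
  qed
  finally show ?thesis .
qed

text \<open>The constant of \<open>sum_stop_level_le\<close> for the ratio
  \<open>2 powr - \<gamma>\<close>, by which \<open>len i powr \<gamma>\<close> decays, and for the
  drift in \<open>cell_mean_diff\<close>. Its convergence rests on
  \<open>0 < \<gamma>\<close>.\<close>

definition "K0 = 2 * (\<Sum>m. (2 powr - \<gamma>) ^ m * (1 + 2 ^ CARD('n) * \<kappa> * real m))"

lemma K0_pos: "0 < K0"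
proof -
  have q: "0 \<le> 2 powr - \<gamma>" "2 powr - \<gamma> < 1" using \<gamma> by (auto simp: powr_less_one)
  have "(2 powr - \<gamma>) ^ 0 * (1 + 2 ^ CARD('n) * \<kappa> * real 0) \<le> (\<Sum>m. (2 powr - \<gamma>) ^ m * (1 + 2 ^ CARD('n) * \<kappa> * real m))"
    using sum_le_suminf[OF summable_power_linear[OF q], of "{0}" "2 ^ CARD('n) * \<kappa>"] \<kappa>_pos by simp
  then show ?thesis unfolding K0_def by simp
qed

lemma stopped_sum_le:
  "(\<Sum>i\<le>N. len i powr \<gamma> * AA i y * (\<bar>b y - cell_mean b i y\<bar> + 1))
    \<le> K0 * (\<Sum>j\<le>N. if st j y = j then len j powr \<gamma> * AA j y * (\<bar>b y - cell_mean b j y\<bar> + 1) else 0)"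
  unfolding K0_def st_def
proof (rule sum_stop_level_le)
  show "len (j + m) powr \<gamma> = len j powr \<gamma> * (2 powr - \<gamma>) ^ m" for j m
  proof -
    have "(2 powr - \<gamma>) ^ m = (2 ^ m) powr - \<gamma>"
      by (simp add: powr_powr powr_realpow[symmetric] mult.commute)
    then show ?thesis using len_pos[of j] by (simp add: len_eq powr_divide powr_minus_divide)
  qed
qed (use AA_nonneg \<gamma> \<kappa>_pos cell_mean_diff in \<open>auto simp: powr_less_one\<close>)

text \<open>Integrating the lower bound over \<open>E\<close> turns the level-set estimate into one
  for a bilinear form, in which the sum over all levels can be cut down to the selected ones for
  each \<open>y\<close> separately.\<close>

lemma duality_le:
  assumes "\<And>x. x \<in> E \<Longrightarrow> ennreal l \<le> TN N x"
  shows "ennreal l * emeasure W E \<le> ennreal (C1 powr (1 - 1/u) * K0) *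
     (\<Sum>j\<le>N. \<integral>\<^sup>+y\<in>{y. st j y = j}. f y * ennreal (len j powr \<gamma> * AA j y * (\<bar>b y - cell_mean b j y\<bar> + 1)) \<partial>lebesgue)"
proof -
  let ?C = "C1 powr (1 - 1/u)"
  let ?a = "\<lambda>j y. len j powr \<gamma> * AA j y * (\<bar>b y - cell_mean b j y\<bar> + 1)"
  have a: "0 \<le> ?a j y" for j y using AA_nonneg by simp
  note cell_integral_measurable[OF b_measurable f, measurable]
  have "ennreal l * emeasure W E = (\<integral>\<^sup>+x\<in>E. ennreal l \<partial>W)"
    by (subst nn_integral_cmult_indicator) auto
  also have "\<dots> \<le> (\<integral>\<^sup>+x\<in>E. TN N x \<partial>W)"
    by (rule nn_integral_mono) (use assms in \<open>auto simp: indicator_def\<close>)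
  also have "\<dots> = (\<Sum>i\<le>N. ennreal (len i powr \<gamma> / len i ^ CARD('n)) *
      (\<integral>\<^sup>+x\<in>E. (\<integral>\<^sup>+y\<in>cell i x. ennreal \<bar>b x - b y\<bar> * f y \<partial>lebesgue) \<partial>W))"
    unfolding grid_operator_def by (simp add: sum_distrib_right mult.assoc nn_integral_sum nn_integral_cmult)
  also have "\<dots> \<le> (\<Sum>i\<le>N. ennreal (len i powr \<gamma> / len i ^ CARD('n)) *
      (\<integral>\<^sup>+y. f y * ennreal ((\<bar>b y - cell_mean b i y\<bar> + 1) * (?C * XX i y * Wc i y)) \<partial>lebesgue))"
    by (intro sum_mono mult_left_mono Fubini_cell) auto
  also have "\<dots> = (\<Sum>i\<le>N. \<integral>\<^sup>+y. f y * ennreal (?C * ?a i y) \<partial>lebesgue)"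
  proof (intro sum.cong refl)
    fix i
    have "ennreal (len i powr \<gamma> / len i ^ CARD('n)) * (\<integral>\<^sup>+y. f y * ennreal ((\<bar>b y - cell_mean b i y\<bar> + 1) * (?C * XX i y * Wc i y)) \<partial>lebesgue)
        = (\<integral>\<^sup>+y. ennreal (len i powr \<gamma> / len i ^ CARD('n)) * (f y * ennreal ((\<bar>b y - cell_mean b i y\<bar> + 1) * (?C * XX i y * Wc i y))) \<partial>lebesgue)"
      by (rule nn_integral_cmult[symmetric]) measurable
    also have "\<dots> = (\<integral>\<^sup>+y. f y * ennreal (?C * ?a i y) \<partial>lebesgue)"
    proof (rule nn_integral_cong)
      fix y
      have "ennreal (len i powr \<gamma> / len i ^ CARD('n)) * ennreal ((\<bar>b y - cell_mean b i y\<bar> + 1) * (?C * XX i y * Wc i y))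
         = ennreal (len i powr \<gamma> / len i ^ CARD('n) * ((\<bar>b y - cell_mean b i y\<bar> + 1) * (?C * XX i y * Wc i y)))"
        using len_pos[of i] XX_nonneg[of i y] Wc_pos[of i y] by (intro ennreal_mult[symmetric]) auto
      also have "len i powr \<gamma> / len i ^ CARD('n) * ((\<bar>b y - cell_mean b i y\<bar> + 1) * (?C * XX i y * Wc i y)) = ?C * ?a i y"
        by (simp add: AA_def)
      finally show "ennreal (len i powr \<gamma> / len i ^ CARD('n)) * (f y * ennreal ((\<bar>b y - cell_mean b i y\<bar> + 1) * (?C * XX i y * Wc i y)))
          = f y * ennreal (?C * ?a i y)"
        by (simp add: mult.left_commute)
    qed
    finally show "ennreal (len i powr \<gamma> / len i ^ CARD('n)) * (\<integral>\<^sup>+y. f y * ennreal ((\<bar>b y - cell_mean b i y\<bar> + 1) * (?C * XX i y * Wc i y)) \<partial>lebesgue)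
      = (\<integral>\<^sup>+y. f y * ennreal (?C * ?a i y) \<partial>lebesgue)" .
  qed
  also have "\<dots> = (\<integral>\<^sup>+y. (\<Sum>i\<le>N. f y * ennreal (?C * ?a i y)) \<partial>lebesgue)"
    by (rule nn_integral_sum[symmetric]) measurable
  also have "\<dots> \<le> (\<integral>\<^sup>+y. ennreal (?C * K0) * (\<Sum>j\<le>N. f y * ennreal (?a j y) * indicator {y. st j y = j} y) \<partial>lebesgue)"
  proof (rule nn_integral_mono)
    fix y
    have "(\<Sum>i\<le>N. f y * ennreal (?C * ?a i y)) = f y * ennreal (?C * (\<Sum>i\<le>N. ?a i y))"
      using a by (simp add: sum_distrib_left[symmetric] sum_ennreal)
    also have "\<dots> \<le> f y * ennreal (?C * (K0 * (\<Sum>j\<le>N. if st j y = j then ?a j y else 0)))"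
      using stopped_sum_le[of y N] C1 by (intro mult_left_mono ennreal_leI) auto
    also have "\<dots> = ennreal (?C * K0) * (f y * ennreal (\<Sum>j\<le>N. if st j y = j then ?a j y else 0))"
      using K0_pos a by (subst mult.assoc[symmetric], subst ennreal_mult) (auto intro!: sum_nonneg simp: mult.left_commute)
    also have "ennreal (\<Sum>j\<le>N. if st j y = j then ?a j y else 0) = (\<Sum>j\<le>N. ennreal (?a j y) * indicator {y. st j y = j} y)"
    proof -
      have "(\<Sum>j\<le>N. ennreal (?a j y) * indicator {y. st j y = j} y) = (\<Sum>j\<le>N. ennreal (if st j y = j then ?a j y else 0))"
        by (intro sum.cong refl) (simp add: indicator_def)
      also have "\<dots> = ennreal (\<Sum>j\<le>N. if st j y = j then ?a j y else 0)"
        by (rule sum_ennreal) (simp add: a)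
      finally show ?thesis by (rule sym)
    qed
    finally show "(\<Sum>i\<le>N. f y * ennreal (?C * ?a i y)) \<le> ennreal (?C * K0) * (\<Sum>j\<le>N. f y * ennreal (?a j y) * indicator {y. st j y = j} y)"
      by (simp only: sum_distrib_left mult.assoc)
  qed
  also have "\<dots> = ennreal (?C * K0) * (\<integral>\<^sup>+y. (\<Sum>j\<le>N. f y * ennreal (?a j y) * indicator {y. st j y = j} y) \<partial>lebesgue)"
    by (rule nn_integral_cmult) measurable
  also have "(\<integral>\<^sup>+y. (\<Sum>j\<le>N. f y * ennreal (?a j y) * indicator {y. st j y = j} y) \<partial>lebesgue)
      = (\<Sum>j\<le>N. \<integral>\<^sup>+y\<in>{y. st j y = j}. f y * ennreal (?a j y) \<partial>lebesgue)"
    by (rule nn_integral_sum) measurable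
  finally show ?thesis .
qed

text \<open>On a selected cell the bump hypothesis bounds the integral of \<open>f\<close>, and
  \<open>AA_mult\<close> turns \<open>AA\<close> into \<open>XX * Wc\<close>. The factor
  \<open>Wc\<close> is then paid for by the points whose selected level is still \<open>j\<close> at
  level \<open>N\<close>: by \<open>sparse_small\<close> and \<open>small\<close> they carry at
  least the fraction \<open>1 - \<beta>\<close> of it.\<close>

lemma stop_piece_le:
  assumes "j \<le> N"
  shows "(\<integral>\<^sup>+y\<in>{y. st j y = j}. f y * ennreal (len j powr \<gamma> * AA j y * (\<bar>b y - cell_mean b j y\<bar> + 1)) \<partial>lebesgue)
    \<le> (\<integral>\<^sup>+y\<in>{y. st j y = j}. ennreal (C2 / (1 - \<beta>) * XX j y * YY j y) * indicator {y. st N y = j} y \<partial>W)"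
proof (rule saturated_nn_integral_le[OF _ _ stop_saturated])
  fix x assume "x \<in> {y. st j y = j}"
  then have x: "st j x = j" by simp
  let ?I = "\<integral>\<^sup>+y\<in>cell j x. ennreal (\<bar>b y - cell_mean b j x\<bar> + 1) * f y \<partial>lebesgue"
  have I: "ennreal (len j powr \<gamma>) * ?I \<le> ennreal (C2 * len j ^ CARD('n) * YY j x)"
  proof -
    have "ennreal (Wc j x powr (1/p)) * (ennreal (len j powr \<gamma>) * ?I) \<le> ennreal (C2 * len j ^ CARD('n)) * ennreal (Gc j x powr (1/p))"
      using bump[of j x] p Wc_pos[of j x] Gc_nonneg[of j x]
      by (simp add: W_cell G_cell epow_ennreal_pos epow_ennreal ac_simps)
    also have "\<dots> = ennreal (Wc j x powr (1/p)) * ennreal (C2 * len j ^ CARD('n) * YY j x)"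
      using C2 Wc_pos[of j x] Gc_nonneg[of j x] len_pos[of j]
      by (simp add: YY_def powr_divide flip: ennreal_mult)
    finally show ?thesis using Wc_pos[of j x] by (subst (asm) ennreal_mult_le_mult_iff) auto
  qed
  have "(\<integral>\<^sup>+y\<in>cell j x. f y * ennreal (len j powr \<gamma> * AA j y * (\<bar>b y - cell_mean b j y\<bar> + 1)) \<partial>lebesgue)
      = (\<integral>\<^sup>+y. ennreal (AA j x * len j powr \<gamma>) * (ennreal (\<bar>b y - cell_mean b j x\<bar> + 1) * f y * indicator (cell j x) y) \<partial>lebesgue)"
    using AA_nonneg[of j x]
    by (intro nn_integral_cong) (auto simp: indicator_def cell_consts(6) cell_mean_const ennreal_mult ac_simps)
  also have "\<dots> = ennreal (AA j x * len j powr \<gamma>) * ?I"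
    by (rule nn_integral_cmult) measurable
  also have "\<dots> = ennreal (AA j x) * (ennreal (len j powr \<gamma>) * ?I)"
    using AA_nonneg[of j x] by (simp add: ennreal_mult mult.assoc)
  also have "\<dots> \<le> ennreal (AA j x) * ennreal (C2 * len j ^ CARD('n) * YY j x)"
    by (rule mult_left_mono[OF I]) auto
  also have "\<dots> = ennreal (C2 * YY j x * (AA j x * len j ^ CARD('n)))"
    using AA_nonneg[of j x] C2 len_pos[of j] YY_nonneg[of j x] by (simp add: ac_simps flip: ennreal_mult)
  also have "\<dots> = ennreal (C2 / (1 - \<beta>) * XX j x * YY j x * ((1 - \<beta>) * Wc j x))"
  proof -
    have "C2 / (1 - \<beta>) * XX j x * YY j x * ((1 - \<beta>) * Wc j x) = (C2 / (1 - \<beta>) * (1 - \<beta>)) * (YY j x * (XX j x * Wc j x))"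
      by (simp only: ac_simps)
    also have "\<dots> = C2 * YY j x * (XX j x * Wc j x)" using \<beta> by simp
    finally show ?thesis unfolding AA_mult by simp
  qed
  also have "\<dots> = ennreal (C2 / (1 - \<beta>) * XX j x * YY j x) * ennreal ((1 - \<beta>) * Wc j x)"
    using C2 \<beta> XX_nonneg[of j x] YY_nonneg[of j x] Wc_pos[of j x] by (intro ennreal_mult) auto
  also have "ennreal ((1 - \<beta>) * Wc j x) \<le> emeasure W (cell j x \<inter> {y. st N y = j})"
  proof -
    let ?S = "{y \<in> cell j x. st N y \<noteq> j}"
    have S: "?S \<in> sets lebesgue"
    proof -
      have "?S = cell j x - {y. st N y = j}" by auto
      then show ?thesis by simp
    qed
    have "emeasure W ?S \<le> ennreal \<beta> * emeasure W (cell j x)"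
      by (rule small[OF S _ sparse_small[OF x assms]]) auto
    then have "emeasure W ?S \<le> ennreal (\<beta> * Wc j x)" using \<beta> Wc_pos[of j x] by (simp add: W_cell ennreal_mult)
    then have "emeasure W ?S + emeasure W (cell j x \<inter> {y. st N y = j}) \<le> ennreal (\<beta> * Wc j x) + emeasure W (cell j x \<inter> {y. st N y = j})"
      by (rule add_right_mono)
    moreover have "emeasure W ?S + emeasure W (cell j x \<inter> {y. st N y = j}) = emeasure W (cell j x)"
      using S by (subst plus_emeasure) (auto intro!: arg_cong[where f="emeasure W"])
    ultimately have *: "ennreal (Wc j x) \<le> ennreal (\<beta> * Wc j x) + emeasure W (cell j x \<inter> {y. st N y = j})"
      by (simp add: W_cell)
    have "ennreal ((1 - \<beta>) * Wc j x) = ennreal (Wc j x) - ennreal (\<beta> * Wc j x)"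
      using \<beta> Wc_pos[of j x] by (subst ennreal_minus) (auto simp: left_diff_distrib)
    also have "\<dots> \<le> emeasure W (cell j x \<inter> {y. st N y = j})"
      using * by (subst ennreal_minus_le_iff) auto
    finally show ?thesis .
  qed
  also have "ennreal (C2 / (1 - \<beta>) * XX j x * YY j x) * emeasure W (cell j x \<inter> {y. st N y = j})
      = (\<integral>\<^sup>+y. ennreal (C2 / (1 - \<beta>) * XX j x * YY j x) * indicator (cell j x \<inter> {y. st N y = j}) y \<partial>W)"
    by (subst nn_integral_cmult_indicator) auto
  also have "\<dots> = (\<integral>\<^sup>+y\<in>cell j x. ennreal (C2 / (1 - \<beta>) * XX j y * YY j y) * indicator {y. st N y = j} y \<partial>W)"
    by (intro nn_integral_cong) (auto simp: indicator_def cell_consts)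
  finally show "(\<integral>\<^sup>+y\<in>cell j x. f y * ennreal (len j powr \<gamma> * AA j y * (\<bar>b y - cell_mean b j y\<bar> + 1)) \<partial>lebesgue)
      \<le> (\<integral>\<^sup>+y\<in>cell j x. ennreal (C2 / (1 - \<beta>) * XX j y * YY j y) * indicator {y. st N y = j} y \<partial>W)"
    by (simp add: mult_left_mono)
qed (auto)

end

section \<open>From maximal functions to the weak-type inequality on a grid\<close>

lemma mult_le_two_powers:
  fixes x y v :: real
  assumes "0 \<le> x" "x \<le> 1" "0 \<le> y" and v: "1 < v"
  shows "x * y \<le> x powr v + min y 1 powr (v / (v - 1)) + (if 1 < y then y else 0)"
proof (cases "1 < y")
  \<comment> \<open>For large \<open>y\<close> only \<open>x \<le> 1\<close> is used; Young's
    inequality with the exponents \<open>v\<close> and \<open>v / (v - 1)\<close> handles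
    \<open>y \<le> 1\<close>.\<close>
  case True
  have "x * y \<le> 1 * y" using assms by (intro mult_right_mono) auto
  then show ?thesis using True by (smt (verit) powr_ge_zero)
next
  case False
  have "x * y \<le> x powr v / v + y powr (v / (v - 1)) / (v / (v - 1))"
    by (rule Youngs_inequality) (use assms in \<open>auto simp: field_simps\<close>)
  also have "\<dots> \<le> x powr v + y powr (v / (v - 1))"
  proof (rule add_mono)
    show "x powr v / v \<le> x powr v" using v divide_left_mono[of 1 v "x powr v"] by simp
    have "1 \<le> v / (v - 1)" using v by (simp add: field_simps)
    then show "y powr (v / (v - 1)) / (v / (v - 1)) \<le> y powr (v / (v - 1))"
      using v divide_left_mono[of 1 "v / (v - 1)" "y powr (v / (v - 1))"] by simp
  qed
  finally show ?thesis using False by (simp add: min_def)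
qed

lemma ennreal_le_divideI:
  fixes a c :: ennreal
  assumes "0 < t" "ennreal t * a \<le> c"
  shows "a \<le> c / ennreal t"
proof -
  have "a = a * ennreal t / ennreal t" using assms(1) by (subst ennreal_mult_divide_eq) auto
  also have "\<dots> \<le> c / ennreal t" using assms(2) by (intro divide_right_mono_ennreal) (simp add: mult.commute)
  finally show ?thesis .
qed

context dyadic_grid
begin

lemma sets_maximal_set:
  "{y. \<exists>k\<le>N. t * emeasure M (cell k y) < emeasure H (cell k y)} \<in> sets lebesgue"
proof -
  have *: "{y. t * emeasure M (cell k y) < emeasure H (cell k y)} \<in> sets lebesgue" for k
  proof (rule cell_const_sets[of k])
    fix x y assume "y \<in> cell k x"
    then show "(t * emeasure M (cell k y) < emeasure H (cell k y)) = (t * emeasure M (cell k x) < emeasure H (cell k x))"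
      by (simp only: cell_eq)
  qed
  have "{y. \<exists>k\<le>N. t * emeasure M (cell k y) < emeasure H (cell k y)}
      = (\<Union>k\<in>{..N}. {y. t * emeasure M (cell k y) < emeasure H (cell k y)})" by blast
  also have "\<dots> \<in> sets lebesgue" by (rule sets.finite_UN) (use * in auto)
  finally show ?thesis .
qed

end

context sparse_setting
begin

text \<open>Averages on the last cell selected up to level \<open>N\<close>. Each is at most a
  dyadic maximal function, whence the bounds \<open>weak_Z1\<close> and
  \<open>weak_Z2\<close>.\<close>

definition "Z1 N y = Ec (st N y) y / Wc (st N y) y"
definition "Z2 N y = Gc (st N y) y / Wc (st N y) y"

lemma st_le: "st N y \<le> N" by (simp add: st_def stop_level_le)

lemma st_idem: "st (st N y) y = st N y"
  by (simp add: st_def stop_level_idem)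

lemma Z_const:
  assumes "y \<in> cell N x"
  shows "Z1 N y = Z1 N x" "Z2 N y = Z2 N x"
proof -
  have 1: "st N y = st N x" by (rule st_const[OF assms order_refl])
  have 2: "y \<in> cell (st N x) x" using cell_mono[OF st_le] assms by blast
  show "Z1 N y = Z1 N x" "Z2 N y = Z2 N x"
    using cell_consts[OF 2] by (simp_all add: Z1_def Z2_def 1)
qed

lemma Z_measurable [measurable]: "Z1 N \<in> borel_measurable lebesgue" "Z2 N \<in> borel_measurable lebesgue"
  using Z_const[of _ N] by (auto intro!: cell_const_measurable[of N])

lemma Z_nonneg: "0 \<le> Z1 N y" "0 \<le> Z2 N y"
  using Ec_nonneg Gc_nonneg Wc_pos by (auto simp: Z1_def Z2_def intro!: divide_nonneg_pos)

lemma Z1_le_1: "Z1 N y \<le> 1"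
  using Ec_le_Wc Wc_pos by (simp add: Z1_def)

lemma weak_Z1: "0 < t \<Longrightarrow> emeasure W {y \<in> space W. t < Z1 N y} \<le> emeasure W E / ennreal t"
proof (rule ennreal_le_divideI)
  assume t: "0 < t"
  let ?H = "density W (indicator E)"
  have H: "emeasure ?H (cell k y) = ennreal (Ec k y)" for k y
    by (subst emeasure_density) (auto simp: W_E_cell[symmetric] indicator_inter_arith[symmetric] Int_commute)
  have "emeasure W {y \<in> space W. t < Z1 N y} \<le> emeasure W {y. \<exists>k\<le>N. ennreal t * emeasure W (cell k y) < emeasure ?H (cell k y)}"
  proof (rule emeasure_mono)
    show "{y \<in> space W. t < Z1 N y} \<subseteq> {y. \<exists>k\<le>N. ennreal t * emeasure W (cell k y) < emeasure ?H (cell k y)}"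
    proof safe
      fix y assume "t < Z1 N y"
      then have "t * Wc (st N y) y < Ec (st N y) y" using Wc_pos by (simp add: Z1_def pos_less_divide_eq)
      then have "ennreal t * ennreal (Wc (st N y) y) < ennreal (Ec (st N y) y)"
        using t Wc_pos[of "st N y" y] by (simp add: ennreal_less_iff flip: ennreal_mult)
      then show "\<exists>k\<le>N. ennreal t * emeasure W (cell k y) < emeasure ?H (cell k y)"
        using st_le[of N y] H W_cell by auto
    qed
    show "{y. \<exists>k\<le>N. ennreal t * emeasure W (cell k y) < emeasure ?H (cell k y)} \<in> sets W"
      unfolding sets_wmeasure by (rule sets_maximal_set)
  qed
  then have "ennreal t * emeasure W {y \<in> space W. t < Z1 N y} \<le> ennreal t * emeasure W {y. \<exists>k\<le>N. ennreal t * emeasure W (cell k y) < emeasure ?H (cell k y)}"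
    by (rule mult_left_mono) auto
  also have "\<dots> \<le> emeasure ?H UNIV" by (rule maximal_weak_type) auto
  also have "\<dots> = emeasure W E" by (subst emeasure_density) auto
  finally show "ennreal t * emeasure W {y \<in> space W. t < Z1 N y} \<le> emeasure W E" .
qed simp

lemma weak_Z2: "0 < t \<Longrightarrow> emeasure W {y \<in> space W. t < Z2 N y} \<le> (\<integral>\<^sup>+x. G x \<partial>lebesgue) / ennreal t"
proof (rule ennreal_le_divideI)
  assume t: "0 < t"
  let ?H = "density lebesgue G"
  have H: "emeasure ?H (cell k y) = ennreal (Gc k y)" for k y
    by (subst emeasure_density) (auto simp: G_cell)
  have "emeasure W {y \<in> space W. t < Z2 N y} \<le> emeasure W {y. \<exists>k\<le>N. ennreal t * emeasure W (cell k y) < emeasure ?H (cell k y)}"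
  proof (rule emeasure_mono)
    show "{y \<in> space W. t < Z2 N y} \<subseteq> {y. \<exists>k\<le>N. ennreal t * emeasure W (cell k y) < emeasure ?H (cell k y)}"
    proof safe
      fix y assume "t < Z2 N y"
      then have "t * Wc (st N y) y < Gc (st N y) y" using Wc_pos by (simp add: Z2_def pos_less_divide_eq)
      then have "ennreal t * ennreal (Wc (st N y) y) < ennreal (Gc (st N y) y)"
        using t Wc_pos[of "st N y" y] by (simp add: ennreal_less_iff flip: ennreal_mult)
      then show "\<exists>k\<le>N. ennreal t * emeasure W (cell k y) < emeasure ?H (cell k y)"
        using st_le[of N y] H W_cell by auto
    qed
    show "{y. \<exists>k\<le>N. ennreal t * emeasure W (cell k y) < emeasure ?H (cell k y)} \<in> sets W"
      unfolding sets_wmeasure by (rule sets_maximal_set)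
  qed
  then have "ennreal t * emeasure W {y \<in> space W. t < Z2 N y} \<le> ennreal t * emeasure W {y. \<exists>k\<le>N. ennreal t * emeasure W (cell k y) < emeasure ?H (cell k y)}"
    by (rule mult_left_mono) auto
  also have "\<dots> \<le> emeasure ?H UNIV" by (rule maximal_weak_type) auto
  also have "\<dots> = (\<integral>\<^sup>+x. G x \<partial>lebesgue)" by (subst emeasure_density) auto
  finally show "ennreal t * emeasure W {y \<in> space W. t < Z2 N y} \<le> (\<integral>\<^sup>+x. G x \<partial>lebesgue)" .
qed simp

text \<open>The sets \<open>{y. st N y = j}\<close> are disjoint in \<open>j\<close>, so at every
  point only the last selected level contributes and the sum collapses to a single integral.\<close>

lemma stopped_le_integral:
  "(\<Sum>j\<le>N. \<integral>\<^sup>+y\<in>{y. st j y = j}. f y * ennreal (len j powr \<gamma> * AA j y * (\<bar>b y - cell_mean b j y\<bar> + 1)) \<partial>lebesgue)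
   \<le> ennreal (C2 / (1 - \<beta>)) * (\<integral>\<^sup>+y. ennreal (Z1 N y powr (1/u) * Z2 N y powr (1/p)) \<partial>W)"
proof -
  have "(\<Sum>j\<le>N. \<integral>\<^sup>+y\<in>{y. st j y = j}. f y * ennreal (len j powr \<gamma> * AA j y * (\<bar>b y - cell_mean b j y\<bar> + 1)) \<partial>lebesgue)
      \<le> (\<Sum>j\<le>N. \<integral>\<^sup>+y\<in>{y. st j y = j}. ennreal (C2 / (1 - \<beta>) * XX j y * YY j y) * indicator {y. st N y = j} y \<partial>W)"
    by (intro sum_mono stop_piece_le) auto
  also have "\<dots> = (\<integral>\<^sup>+y. (\<Sum>j\<le>N. ennreal (C2 / (1 - \<beta>) * XX j y * YY j y) * indicator {y. st N y = j} y * indicator {y. st j y = j} y) \<partial>W)"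
    by (rule nn_integral_sum[symmetric]) measurable
  also have "\<dots> = (\<integral>\<^sup>+y. ennreal (C2 / (1 - \<beta>)) * ennreal (Z1 N y powr (1/u) * Z2 N y powr (1/p)) \<partial>W)"
  proof (rule nn_integral_cong)
    fix y
    have "(\<Sum>j\<le>N. ennreal (C2 / (1 - \<beta>) * XX j y * YY j y) * indicator {y. st N y = j} y * indicator {y. st j y = j} y)
        = (\<Sum>j\<le>N. if j = st N y then ennreal (C2 / (1 - \<beta>) * XX j y * YY j y) else 0)"
      by (intro sum.cong refl) (auto simp: indicator_def st_idem)
    also have "\<dots> = ennreal (C2 / (1 - \<beta>) * XX (st N y) y * YY (st N y) y)"
      by (subst sum.delta) (auto simp: st_le)
    also have "\<dots> = ennreal (C2 / (1 - \<beta>)) * ennreal (Z1 N y powr (1/u) * Z2 N y powr (1/p))"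
      using C2 \<beta> by (subst ennreal_mult[symmetric]) (auto simp: XX_def YY_def Z1_def Z2_def)
    finally show "(\<Sum>j\<le>N. ennreal (C2 / (1 - \<beta>) * XX j y * YY j y) * indicator {y. st N y = j} y * indicator {y. st j y = j} y)
       = ennreal (C2 / (1 - \<beta>)) * ennreal (Z1 N y powr (1/u) * Z2 N y powr (1/p))" .
  qed
  also have "\<dots> = ennreal (C2 / (1 - \<beta>)) * (\<integral>\<^sup>+y. ennreal (Z1 N y powr (1/u) * Z2 N y powr (1/p)) \<partial>W)"
    by (rule nn_integral_cmult) measurable
  finally show ?thesis .
qed

text \<open>\<open>c1\<close> and \<open>c2\<close> collect the constants of
  \<open>truncated_power_integral_le\<close> at the exponents v/u and v/((v-1) p) and of
  \<open>large_part_power_integral_le\<close> at 1/p.\<close>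

definition "c1 = 2 / (1 - 2 powr (1 - v / u))"
definition "c2 = 2 / (1 - 2 powr (1 - v / (v - 1) / p)) + 2 powr (1 / p) / (1 - 2 powr (1 / p - 1))"

lemma v1: "1 < v" using u by simp

lemma vu: "1 < v / u" using u by simp

text \<open>Conjugation reverses the order: v < p/(p-1) says that the conjugate exponent of v
  exceeds p.\<close>

lemma vp: "1 < v / (v - 1) / p"
proof -
  have "v * (p - 1) < p" using v p by (simp add: pos_less_divide_eq)
  then have "p * (v - 1) < v" by (simp add: algebra_simps)
  then show ?thesis using v1 p by (simp add: pos_less_divide_eq mult.commute)
qed

lemma c_pos: "0 < c1" "0 < c2"
proof -
  have "2 powr (1 - v / u) < 1" "2 powr (1 - v / (v - 1) / p) < 1" "2 powr (1 / p - 1) < 1"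
    using vu vp p by (auto simp: powr_less_one)
  then show "0 < c1" "0 < c2" unfolding c1_def c2_def by (auto intro!: add_pos_pos divide_pos_pos)
qed

text \<open>\<open>Z2\<close> is divided by \<open>d powr p\<close> before
  \<open>mult_le_two_powers\<close> is applied. All three resulting powers are integrable from the
  weak bounds: v/u and v/((v-1) p) exceed 1 and act on quantities cut off at 1, whereas the part
  above the cut carries the exponent 1/p < 1. The parameter \<open>d\<close> balances the two sides
  later.\<close>

lemma product_integral_le:
  assumes d: "0 < d"
  shows "(\<integral>\<^sup>+y. ennreal (Z1 N y powr (1/u) * Z2 N y powr (1/p)) \<partial>W)
    \<le> ennreal d * (ennreal c1 * emeasure W E + ennreal c2 * ((\<integral>\<^sup>+x. G x \<partial>lebesgue) / ennreal (d powr p)))"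
proof -
  define I where "I = (\<integral>\<^sup>+x. G x \<partial>lebesgue)"
  define Z3 where "Z3 y = Z2 N y / d powr p" for y
  have Z3m [measurable]: "Z3 \<in> borel_measurable lebesgue" unfolding Z3_def by measurable
  have Z3n: "0 \<le> Z3 y" for y unfolding Z3_def using Z_nonneg(2) by simp
  let ?r = "v / (v - 1) / p"
  have weak3: "emeasure W {y \<in> space W. t < Z3 y} \<le> I / ennreal (d powr p) / ennreal t" if t: "0 < t" for t
  proof -
    have "{y \<in> space W. t < Z3 y} = {y \<in> space W. t * d powr p < Z2 N y}"
      using d by (auto simp: Z3_def pos_less_divide_eq)
    then have "emeasure W {y \<in> space W. t < Z3 y} \<le> I / ennreal (t * d powr p)"
      using weak_Z2[of "t * d powr p" N] t d by (simp add: I_def)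
    also have "\<dots> = I / ennreal (d powr p) / ennreal t"
    proof -
      have "inverse (ennreal (t * d powr p)) = inverse (ennreal (d powr p)) * inverse (ennreal t)"
        using t d by (simp add: inverse_ennreal mult.commute flip: ennreal_mult)
      then show ?thesis unfolding divide_ennreal_def by (simp only: mult.assoc)
    qed
    finally show ?thesis .
  qed
  have 1: "(\<integral>\<^sup>+y. ennreal (min (Z1 N y) 1 powr (v/u)) \<partial>W) \<le> ennreal c1 * emeasure W E"
    unfolding c1_def by (rule truncated_power_integral_le) (use weak_Z1 vu Z_nonneg in auto)
  have 2: "(\<integral>\<^sup>+y. ennreal (min (Z3 y) 1 powr ?r) \<partial>W) \<le> ennreal (2 / (1 - 2 powr (1 - ?r))) * (I / ennreal (d powr p))"
    by (rule truncated_power_integral_le) (use weak3 vp Z3n in auto)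
  have 3: "(\<integral>\<^sup>+y. ennreal (Z3 y powr (1/p)) * indicator {y. 1 < Z3 y} y \<partial>W) \<le> ennreal (2 powr (1 / p) / (1 - 2 powr (1 / p - 1))) * (I / ennreal (d powr p))"
    by (rule large_part_power_integral_le) (use weak3 p in auto)
  have "(\<integral>\<^sup>+y. ennreal (Z1 N y powr (1/u) * Z2 N y powr (1/p)) \<partial>W)
      \<le> (\<integral>\<^sup>+y. ennreal d * (ennreal (min (Z1 N y) 1 powr (v/u)) + (ennreal (min (Z3 y) 1 powr ?r) + ennreal (Z3 y powr (1/p)) * indicator {y. 1 < Z3 y} y)) \<partial>W)"
  proof (rule nn_integral_mono)
    fix y
    let ?x = "Z1 N y powr (1/u)" and ?y = "Z3 y powr (1/p)"
    have y: "Z2 N y powr (1/p) = d * ?y"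
      using d p Z_nonneg(2)[of N y] by (simp add: Z3_def powr_divide powr_powr)
    have x: "0 \<le> ?x" "?x \<le> 1" using Z_nonneg(1)[of N y] Z1_le_1[of N y] u by (auto intro!: powr_le1)
    have gt: "1 < ?y \<longleftrightarrow> 1 < Z3 y"
    proof
      assume "1 < ?y" then show "1 < Z3 y" using Z3n[of y] p powr_le1[of "1/p" "Z3 y"] by force
    next
      assume "1 < Z3 y" then show "1 < ?y" using p powr_less_mono2[of "1/p" 1 "Z3 y"] by simp
    qed
    have "?x * ?y \<le> ?x powr v + min ?y 1 powr (v / (v - 1)) + (if 1 < ?y then ?y else 0)"
      by (rule mult_le_two_powers[OF x _ v1]) simp
    also have "?x powr v = min (Z1 N y) 1 powr (v/u)"
      using Z1_le_1[of N y] by (simp add: powr_powr)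
    also have "min ?y 1 powr (v / (v - 1)) = min (Z3 y) 1 powr ?r"
    proof (cases "1 < Z3 y")
      case True then show ?thesis using gt by simp
    next
      case False then show ?thesis using gt by (simp add: powr_powr mult.commute)
    qed
    finally have le: "?x * ?y \<le> min (Z1 N y) 1 powr (v/u) + min (Z3 y) 1 powr ?r + (if 1 < Z3 y then ?y else 0)"
      unfolding gt .
    have "ennreal (Z1 N y powr (1/u) * Z2 N y powr (1/p)) = ennreal d * ennreal (?x * ?y)"
      unfolding y using d by (subst ennreal_mult[symmetric]) (auto simp: ac_simps)
    also have "\<dots> \<le> ennreal d * ennreal (min (Z1 N y) 1 powr (v/u) + min (Z3 y) 1 powr ?r + (if 1 < Z3 y then ?y else 0))"
      by (intro mult_left_mono ennreal_leI le) auto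
    also have "\<dots> = ennreal d * (ennreal (min (Z1 N y) 1 powr (v/u)) + (ennreal (min (Z3 y) 1 powr ?r) + ennreal (Z3 y powr (1/p)) * indicator {y. 1 < Z3 y} y))"
      by (auto simp: indicator_def add.assoc)
    finally show "ennreal (Z1 N y powr (1/u) * Z2 N y powr (1/p))
      \<le> ennreal d * (ennreal (min (Z1 N y) 1 powr (v/u)) + (ennreal (min (Z3 y) 1 powr ?r) + ennreal (Z3 y powr (1/p)) * indicator {y. 1 < Z3 y} y))" .
  qed
  also have "\<dots> = ennreal d * ((\<integral>\<^sup>+y. ennreal (min (Z1 N y) 1 powr (v/u)) \<partial>W)
      + ((\<integral>\<^sup>+y. ennreal (min (Z3 y) 1 powr ?r) \<partial>W) + (\<integral>\<^sup>+y. ennreal (Z3 y powr (1/p)) * indicator {y. 1 < Z3 y} y \<partial>W)))"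
    by (simp add: nn_integral_cmult nn_integral_add)
  also have "\<dots> \<le> ennreal d * (ennreal c1 * emeasure W E + (ennreal (2 / (1 - 2 powr (1 - ?r))) * (I / ennreal (d powr p))
      + ennreal (2 powr (1 / p) / (1 - 2 powr (1 / p - 1))) * (I / ennreal (d powr p))))"
    by (intro mult_left_mono add_mono 1 2 3) auto
  also have "ennreal (2 / (1 - 2 powr (1 - ?r))) * (I / ennreal (d powr p)) + ennreal (2 powr (1 / p) / (1 - 2 powr (1 / p - 1))) * (I / ennreal (d powr p))
      = ennreal c2 * (I / ennreal (d powr p))"
  proof -
    have "2 powr (1 - ?r) < 1" "2 powr (1 / p - 1) < 1" using vp p by (auto simp: powr_less_one)
    then show ?thesis unfolding c2_def by (subst ennreal_plus) (auto simp: distrib_right)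
  qed
  finally show ?thesis unfolding I_def .
qed

definition "D0 = C1 powr (1 - 1/u) * K0 * (C2 / (1 - \<beta>))"

definition "weak_const = 2 * D0 * c2 * (2 * D0 * c1) powr (p - 1)"

lemma D0_pos: "0 < D0"
  unfolding D0_def using C1 C2 \<beta> K0_pos by (intro mult_pos_pos divide_pos_pos) auto

lemma weak_const_pos: "0 < weak_const"
  unfolding weak_const_def using D0_pos c_pos by (intro mult_pos_pos) auto

theorem grid_weak_type:
  assumes l: "0 < l" and lE: "\<And>x. x \<in> E \<Longrightarrow> ennreal l \<le> TN N x"
  shows "ennreal (l powr p) * emeasure W E \<le> ennreal weak_const * (\<integral>\<^sup>+x. G x \<partial>lebesgue)"
proof -
  obtain I where I: "(\<integral>\<^sup>+x. G x \<partial>lebesgue) = ennreal I" "0 \<le> I"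
    using G_finite by (cases "\<integral>\<^sup>+x. G x \<partial>lebesgue" rule: ennreal_cases) auto
  obtain e where e: "emeasure W E = ennreal e" "0 \<le> e"
    using E_finite by (cases "emeasure W E" rule: ennreal_cases) auto
  \<comment> \<open>With this \<open>d\<close> the term in \<open>emeasure W E\<close> is half of
    the left side and can be absorbed, since \<open>W\<close> is finite on \<open>E\<close>; the
    other term then scales like l^(1-p).\<close>
  define d where "d = l / (2 * D0 * c1)"
  have dp: "0 < d" unfolding d_def using l D0_pos c_pos by auto
  have "ennreal l * emeasure W E \<le> ennreal (C1 powr (1 - 1/u) * K0) *
     (\<Sum>j\<le>N. \<integral>\<^sup>+y\<in>{y. st j y = j}. f y * ennreal (len j powr \<gamma> * AA j y * (\<bar>b y - cell_mean b j y\<bar> + 1)) \<partial>lebesgue)"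
    by (rule duality_le[OF lE])
  also have "\<dots> \<le> ennreal (C1 powr (1 - 1/u) * K0) * (ennreal (C2 / (1 - \<beta>)) * (\<integral>\<^sup>+y. ennreal (Z1 N y powr (1/u) * Z2 N y powr (1/p)) \<partial>W))"
    by (intro mult_left_mono stopped_le_integral) auto
  also have "\<dots> \<le> ennreal (C1 powr (1 - 1/u) * K0) * (ennreal (C2 / (1 - \<beta>)) *
      (ennreal d * (ennreal c1 * emeasure W E + ennreal c2 * ((\<integral>\<^sup>+x. G x \<partial>lebesgue) / ennreal (d powr p)))))"
    by (intro mult_left_mono product_integral_le dp) auto
  also have "\<dots> = ennreal (D0 * (d * (c1 * e + c2 * (I / d powr p))))"
    unfolding D0_def e(1) I(1) using C1 C2 \<beta> K0_pos dp c_pos e(2) I(2)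
    by (simp add: divide_ennreal mult.assoc flip: ennreal_mult ennreal_plus)
  finally have "ennreal (l * e) \<le> ennreal (D0 * (d * (c1 * e + c2 * (I / d powr p))))"
    using l e by (simp add: ennreal_mult)
  then have "l * e \<le> D0 * (d * (c1 * e + c2 * (I / d powr p)))"
    using D0_pos dp c_pos e(2) I(2) by (subst (asm) ennreal_le_iff) auto
  also have "\<dots> = (D0 * d * c1) * e + D0 * c2 * I * (d / d powr p)" by (simp add: algebra_simps)
  also have "D0 * d * c1 = l / 2" unfolding d_def using D0_pos c_pos by simp
  finally have le: "l * e \<le> 2 * D0 * c2 * I * (d / d powr p)" by simp
  have dd: "d / d powr p = (2 * D0 * c1) powr (p - 1) * l powr (1 - p)"
  proof -
    have "d / d powr p = d powr (1 - p)" using dp by (simp add: powr_diff)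
    also have "\<dots> = l powr (1 - p) / (2 * D0 * c1) powr (1 - p)" unfolding d_def using l D0_pos c_pos by (simp add: powr_divide)
    also have "\<dots> = (2 * D0 * c1) powr (p - 1) * l powr (1 - p)"
      using powr_minus_divide[of "2 * D0 * c1" "1 - p"] by simp
    finally show ?thesis .
  qed
  have "l powr p * e = l powr (p - 1) * (l * e)" using l by (simp add: powr_diff)
  also have "\<dots> \<le> l powr (p - 1) * (2 * D0 * c2 * I * (d / d powr p))" by (rule mult_left_mono[OF le]) simp
  also have "\<dots> = weak_const * I * (l powr (p - 1) * l powr (1 - p))"
    unfolding dd weak_const_def by (simp add: ac_simps)
  also have "l powr (p - 1) * l powr (1 - p) = 1" using l by (simp add: powr_add[symmetric])
  finally have "l powr p * e \<le> weak_const * I" by simp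
  then show ?thesis unfolding e(1) I(1) using e(2) I(2) weak_const_pos
    by (simp add: ennreal_leI flip: ennreal_mult)
qed

end

section \<open>Shifted dyadic grids in Euclidean space\<close>

text \<open>Measured in side lengths, the offset is t/3 with alternating sign. Halving the side
  doubles it, and 2/3 differs from -1/3 by an integer, so the shifted grids stay nested.\<close>

definition grid_index :: "real \<Rightarrow> ('n \<Rightarrow> int) \<Rightarrow> nat \<Rightarrow> real ^ 'n \<Rightarrow> 'n \<Rightarrow> int" where
  "grid_index h t i x = (\<lambda>j. \<lfloor>x $ j / (h / 2 ^ i) - (-1) ^ i * of_int (t j) / 3\<rfloor>)"

definition grid_cell :: "real \<Rightarrow> ('n \<Rightarrow> int) \<Rightarrow> nat \<Rightarrow> real ^ 'n \<Rightarrow> (real ^ 'n) set" where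
  "grid_cell h t i x = {y. grid_index h t i y = grid_index h t i x}"

lemma floor_double_cong:
  fixes a c :: real
  assumes "\<lfloor>2 * a + of_int m\<rfloor> = \<lfloor>2 * c + of_int m\<rfloor>"
  shows "\<lfloor>a\<rfloor> = \<lfloor>c\<rfloor>"
proof -
  have "\<lfloor>2 * a\<rfloor> = \<lfloor>2 * c\<rfloor>" using assms by simp
  moreover have "2 * \<lfloor>a\<rfloor> \<le> \<lfloor>2 * a\<rfloor>" "\<lfloor>2 * a\<rfloor> < 2 * \<lfloor>a\<rfloor> + 2" "2 * \<lfloor>c\<rfloor> \<le> \<lfloor>2 * c\<rfloor>" "\<lfloor>2 * c\<rfloor> < 2 * \<lfloor>c\<rfloor> + 2"
    by linarith+
  ultimately show ?thesis by linarith
qed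

lemma grid_index_Suc:
  assumes "grid_index h t (Suc i) x = grid_index h t (Suc i) y" "0 < h"
  shows "grid_index h t i x = grid_index h t i y"
proof
  fix j
  define s :: int where "s = (-1) ^ i * t j"
  have eq: "z $ j / (h / 2 ^ Suc i) - (-1) ^ Suc i * of_int (t j) / 3
      = 2 * (z $ j / (h / 2 ^ i) - (-1) ^ i * of_int (t j) / 3) + of_int s" for z :: "real ^ 'a"
    using assms(2) by (simp add: s_def field_simps)
  show "grid_index h t i x j = grid_index h t i y j"
    using fun_cong[OF assms(1), of j] unfolding grid_index_def eq by (rule floor_double_cong)
qed

lemma grid_cell_eq_box:
  fixes x :: "real ^ 'n" and h :: real and i :: nat and t :: "'n \<Rightarrow> int"
  assumes "0 < h"
  defines "l \<equiv> h / 2 ^ i"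
  defines "a \<equiv> (\<chi> j. (of_int (grid_index h t i x j) + (-1) ^ i * of_int (t j) / 3) * l)"
  shows "grid_cell h t i x = {y. \<forall>j. a $ j \<le> y $ j \<and> y $ j < a $ j + l}"
proof -
  have l: "0 < l" using assms by simp
  have "grid_index h t i y j = grid_index h t i x j \<longleftrightarrow> a $ j \<le> y $ j \<and> y $ j < a $ j + l" for y j
  proof -
    let ?o = "(-1) ^ i * of_int (t j) / 3 :: real"
    have "grid_index h t i y j = grid_index h t i x j \<longleftrightarrow>
       of_int (grid_index h t i x j) \<le> y $ j / l - ?o \<and> y $ j / l - ?o < of_int (grid_index h t i x j) + 1"
      unfolding grid_index_def[of h t i y] l_def by (simp add: floor_eq_iff)
    also have "\<dots> \<longleftrightarrow> a $ j \<le> y $ j \<and> y $ j < a $ j + l"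
      using l by (simp add: a_def le_diff_eq diff_less_eq pos_le_divide_eq pos_divide_less_eq distrib_right)
         (simp add: algebra_simps)
    finally show ?thesis .
  qed
  then show ?thesis unfolding grid_cell_def by (auto simp: fun_eq_iff)
qed

lemma emeasure_box_cart:
  fixes a :: "real ^ 'n" and l :: real
  assumes "0 < l"
  shows "emeasure lebesgue (box a (a + (\<chi> j. l))) = ennreal (l ^ CARD('n))"
    and "emeasure lebesgue (cbox a (a + (\<chi> j. l))) = ennreal (l ^ CARD('n))"
proof -
  have b: "(\<chi> j. l) \<bullet> b = l" if "b \<in> Basis" for b :: "real ^ 'n"
    using that by (auto simp: Basis_vec_def inner_axis)
  have eq: "(\<Prod>b\<in>(Basis :: (real^'n) set). (\<chi> j. l) \<bullet> b) = l ^ CARD('n)"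
    using b by (simp add: prod.cong)
  show "emeasure lebesgue (box a (a + (\<chi> j. l))) = ennreal (l ^ CARD('n))"
    using assms b eq by (simp add: emeasure_lborel_box_eq inner_add_left)
  show "emeasure lebesgue (cbox a (a + (\<chi> j. l))) = ennreal (l ^ CARD('n))"
    using assms b eq by (simp add: emeasure_lborel_cbox_eq inner_add_left)
qed

theorem dyadic_grid_grid_cell:
  fixes t :: "'n::finite \<Rightarrow> int"
  assumes h: "0 < h"
  shows "dyadic_grid (grid_cell h t) (\<lambda>i. h / 2 ^ i)"
proof
  fix i and x :: "real ^ 'n"
  define l where "l = h / 2 ^ i"
  define a where "a = (\<chi> j. (of_int (grid_index h t i x j) + (-1) ^ i * of_int (t j) / 3) * l)"
  have l: "0 < l" using h by (simp add: l_def)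
  have cell: "grid_cell h t i x = {y. \<forall>j. a $ j \<le> y $ j \<and> y $ j < a $ j + l}"
    unfolding a_def l_def by (rule grid_cell_eq_box[OF h])
  have sub: "box a (a + (\<chi> j. l)) \<subseteq> grid_cell h t i x" "grid_cell h t i x \<subseteq> cbox a (a + (\<chi> j. l))"
    unfolding cell by (auto simp: mem_box_cart less_imp_le)
  show "0 < h / 2 ^ i" using h by simp
  show "h / 2 ^ Suc i = h / 2 ^ i / 2" by simp
  show "x \<in> grid_cell h t i x" by (simp add: grid_cell_def)
  show "grid_cell h t i y = grid_cell h t i x" if "y \<in> grid_cell h t i x" for y
    using that by (simp add: grid_cell_def)
  show "grid_cell h t (Suc i) x \<subseteq> grid_cell h t i x"
    unfolding grid_cell_def using grid_index_Suc[OF _ h] by blast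
  show "countable (range (grid_cell h t i))"
  proof -
    have "range (grid_cell h t i) \<subseteq> (\<lambda>k. {y. grid_index h t i y = k}) ` UNIV"
      by (auto simp: grid_cell_def)
    then show ?thesis by (rule countable_subset) auto
  qed
  have "grid_cell h t i x = (\<Inter>j. {y. a $ j \<le> y $ j} \<inter> {y. y $ j < a $ j + l})"
    unfolding cell by auto
  also have "\<dots> \<in> sets borel"
    by (intro sets.finite_INT sets.Int borel_closed borel_open closed_halfspace_component_ge_cart open_halfspace_component_lt_cart) auto
  finally show bor: "grid_cell h t i x \<in> sets borel" .
  \<comment> \<open>The half-open cell lies between an open and a closed box of the same
    volume.\<close>
  show "emeasure lebesgue (grid_cell h t i x) = ennreal ((h / 2 ^ i) ^ CARD('n))"
  proof (rule antisym)
    show "emeasure lebesgue (grid_cell h t i x) \<le> ennreal ((h / 2 ^ i) ^ CARD('n))"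
      using emeasure_mono[OF sub(2), of lebesgue] emeasure_box_cart(2)[OF l, of a] by (simp add: l_def)
    show "ennreal ((h / 2 ^ i) ^ CARD('n)) \<le> emeasure lebesgue (grid_cell h t i x)"
      using emeasure_mono[OF sub(1) borel_in_lebesgue[OF bor]] emeasure_box_cart(1)[OF l, of a] by (simp add: l_def)
  qed
  show "grid_cell h t i x \<subseteq> ball x (2 * real CARD('n) * (h / 2 ^ i))"
  proof
    fix y assume y: "y \<in> grid_cell h t i x"
    have x: "x \<in> grid_cell h t i x" by (simp add: grid_cell_def)
    have "norm (x - y) \<le> (\<Sum>j\<in>UNIV. \<bar>(x - y) $ j\<bar>)" by (rule norm_le_l1_cart)
    also have "\<dots> \<le> (\<Sum>j\<in>(UNIV::'n set). l)"
    proof (rule sum_mono)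
      fix j
      show "\<bar>(x - y) $ j\<bar> \<le> l"
        using x y unfolding cell by (simp add: abs_le_iff) (smt (verit))
    qed
    also have "\<dots> < 2 * real CARD('n) * l" using l by simp
    finally show "y \<in> ball x (2 * real CARD('n) * (h / 2 ^ i))" by (simp add: dist_norm l_def)
  qed
  show "\<exists>z. grid_cell h t i x \<subseteq> cube z (h / 2 ^ i)"
  proof -
    have "cube (a + (\<chi> j. l / 2)) l = cbox a (a + (\<chi> j. l))"
      unfolding cube_def by (intro arg_cong2[where f=cbox]) (auto simp: vec_eq_iff)
    then show ?thesis using sub(2) unfolding l_def by metis
  qed
qed

text \<open>If the window of radius \<open>r\<close> crosses an integer after scaling, its centre is
  within 1/12 of that integer, and so the whole window is within 1/6. Shifted by 1/3 in either
  direction it stays at least 1/6 away from all integers. Hence two shifts per coordinate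
  suffice.\<close>

lemma one_third_trick:
  fixes a r l s :: real
  assumes r: "12 * r \<le> l" "0 < l" and s: "s = 1 \<or> s = -1"
  shows "\<exists>t\<in>{0, 1::int}. \<forall>z. \<bar>z - a\<bar> \<le> r \<longrightarrow> \<lfloor>z / l - s * of_int t / 3\<rfloor> = \<lfloor>a / l - s * of_int t / 3\<rfloor>"
proof (cases "\<forall>z. \<bar>z - a\<bar> \<le> r \<longrightarrow> \<lfloor>z / l\<rfloor> = \<lfloor>a / l\<rfloor>")
  case True
  have e: "x / l - s * of_int (0::int) / 3 = x / l" for x by simp
  show ?thesis by (rule bexI[of _ 0], unfold e) (use True in blast, simp)
next
  case False
  have close: "\<bar>z / l - a / l\<bar> \<le> 1 / 12" if "\<bar>z - a\<bar> \<le> r" for z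
  proof -
    have "z / l - a / l = (z - a) / l" by (simp add: diff_divide_distrib)
    then have "\<bar>z / l - a / l\<bar> = \<bar>z - a\<bar> / l" using r by simp
    also have "\<dots> \<le> 1 / 12" using that r by (simp add: pos_divide_le_eq)
    finally show ?thesis .
  qed
  obtain z0 where z0: "\<bar>z0 - a\<bar> \<le> r" "\<lfloor>z0 / l\<rfloor> \<noteq> \<lfloor>a / l\<rfloor>" using False by blast
  have "\<exists>m::int. \<bar>a / l - of_int m\<bar> \<le> 1 / 12"
  proof (cases "\<lfloor>z0 / l\<rfloor> < \<lfloor>a / l\<rfloor>")
    case True
    then show ?thesis using close[OF z0(1)] by (intro exI[of _ "\<lfloor>a / l\<rfloor>"]) linarith
  next
    case False
    then have "\<lfloor>a / l\<rfloor> < \<lfloor>z0 / l\<rfloor>" using z0(2) by simp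
    then show ?thesis using close[OF z0(1)] by (intro exI[of _ "\<lfloor>z0 / l\<rfloor>"]) linarith
  qed
  then obtain m :: int where m: "\<bar>a / l - of_int m\<bar> \<le> 1 / 12" by blast
  have "\<lfloor>X - s * of_int 1 / 3\<rfloor> = (if s = 1 then m - 1 else m)" if "\<bar>X - a / l\<bar> \<le> 1 / 12" for X
  proof -
    have "X - of_int m \<le> 1 / 6" "- (1 / 6) \<le> X - of_int m" using that m by linarith+
    then show ?thesis using s unfolding floor_eq_iff by (elim disjE) simp_all
  qed
  moreover have "\<bar>a / l - a / l\<bar> \<le> 1 / 12" by simp
  ultimately have "\<forall>z. \<bar>z - a\<bar> \<le> r \<longrightarrow> \<lfloor>z / l - s * of_int 1 / 3\<rfloor> = \<lfloor>a / l - s * of_int 1 / 3\<rfloor>"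
    using close by metis
  then show ?thesis by (rule bexI[of _ 1]) simp
qed

definition shifts :: "('n \<Rightarrow> int) set" where
  "shifts = {t. \<forall>j. t j \<in> {0, 1}}"

lemma finite_shifts: "finite (shifts :: ('n::finite \<Rightarrow> int) set)"
proof -
  have "shifts = PiE (UNIV :: 'n set) (\<lambda>_. {0, 1::int})" by (auto simp: shifts_def PiE_def Pi_def)
  moreover have "finite (PiE (UNIV :: 'n set) (\<lambda>_. {0, 1::int}))" by (rule finite_PiE) auto
  ultimately show ?thesis by (simp only:)
qed

lemma ball_in_grid_cell:
  fixes a :: "real ^ 'n"
  assumes h: "0 < h" and r: "12 * r \<le> h / 2 ^ i"
  shows "\<exists>t\<in>shifts. \<forall>z. (\<forall>j. \<bar>z $ j - a $ j\<bar> \<le> r) \<longrightarrow> z \<in> grid_cell h t i a"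
proof -
  have "\<exists>t\<in>{0, 1::int}. \<forall>z. \<bar>z - a $ j\<bar> \<le> r \<longrightarrow>
      \<lfloor>z / (h / 2 ^ i) - (-1) ^ i * of_int t / 3\<rfloor> = \<lfloor>a $ j / (h / 2 ^ i) - (-1) ^ i * of_int t / 3\<rfloor>" for j
    by (rule one_third_trick) (use h r in \<open>auto simp: power_minus1_even minus_one_power_iff\<close>)
  then have "\<forall>j. \<exists>t. t \<in> {0, 1::int} \<and> (\<forall>z. \<bar>z - a $ j\<bar> \<le> r \<longrightarrow>
      \<lfloor>z / (h / 2 ^ i) - (-1) ^ i * of_int t / 3\<rfloor> = \<lfloor>a $ j / (h / 2 ^ i) - (-1) ^ i * of_int t / 3\<rfloor>)" by blast
  then obtain t where t: "\<And>j. t j \<in> {0, 1::int}" "\<And>j z. \<bar>z - a $ j\<bar> \<le> r \<Longrightarrow>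
      \<lfloor>z / (h / 2 ^ i) - (-1) ^ i * of_int (t j) / 3\<rfloor> = \<lfloor>a $ j / (h / 2 ^ i) - (-1) ^ i * of_int (t j) / 3\<rfloor>" by metis
  show ?thesis
    by (intro bexI[of _ t]) (use t in \<open>auto simp: shifts_def grid_cell_def grid_index_def\<close>)
qed

section \<open>The A-infinity condition\<close>

lemma locally_integrable_measurable: "locally_integrable w \<Longrightarrow> w \<in> borel_measurable lebesgue"
  for w :: "real ^ 'n \<Rightarrow> real"
proof -
  assume w: "locally_integrable w"
  have "(\<lambda>x. indicator (cball 0 (real k)) x * w x) \<in> borel_measurable lebesgue" for k :: nat
  proof -
    have "w absolutely_integrable_on cball 0 (real k)"
      using w by (auto simp: locally_integrable_def)
    then show ?thesis
      unfolding set_integrable_def real_scaleR_def by (rule borel_measurable_integrable)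
  qed
  moreover have "(\<lambda>k. indicator (cball 0 (real k)) x * w x) \<longlonglongrightarrow> w x" for x
  proof (rule tendsto_eventually)
    obtain K :: nat where "norm x \<le> real K" using real_arch_simple by blast
    then show "\<forall>\<^sub>F k in sequentially. indicator (cball 0 (real k)) x * w x = w x"
      unfolding eventually_sequentially by (intro exI[of _ K]) (auto simp: indicator_def)
  qed
  ultimately show "w \<in> borel_measurable lebesgue" by (rule borel_measurable_LIMSEQ_real[rotated])
qed

lemma weight_measurable: "weight w \<Longrightarrow> w \<in> borel_measurable lebesgue"
  for w :: "real ^ 'n \<Rightarrow> real"
  by (simp add: weight_def locally_integrable_measurable)

lemma emeasure_wmeasure:
  "w \<in> borel_measurable lebesgue \<Longrightarrow> S \<in> sets lebesgue \<Longrightarrow>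
    emeasure (wmeasure w) S = (\<integral>\<^sup>+x\<in>S. ennreal (w x) \<partial>lebesgue)"
  unfolding wmeasure_def by (subst emeasure_density) auto

lemma wmeasure_cball_finite:
  fixes w :: "real ^ 'n \<Rightarrow> real"
  assumes w: "weight w"
  shows "emeasure (wmeasure w) (cball y r) < \<infinity>"
proof -
  have w0: "0 \<le> w x" for x using w by (simp add: weight_def)
  have "w absolutely_integrable_on cball y r" using w by (auto simp: weight_def locally_integrable_def)
  then have i: "integrable lebesgue (\<lambda>x. indicator (cball y r) x * w x)" by (simp add: set_integrable_def)
  have "emeasure (wmeasure w) (cball y r) = (\<integral>\<^sup>+x. ennreal (indicator (cball y r) x * w x) \<partial>lebesgue)"
    unfolding emeasure_wmeasure[OF weight_measurable[OF w], of "cball y r", simplified]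
    by (intro nn_integral_cong) (auto simp: indicator_def)
  also have "\<dots> < \<infinity>"
    using nn_integral_eq_integral[OF i] w0 by (simp add: AE_I2)
  finally show ?thesis .
qed

lemma wmeasure_bounded_finite:
  assumes "weight w" "bounded S"
  shows "emeasure (wmeasure w) S < \<infinity>"
proof -
  obtain x0 r where "S \<subseteq> cball x0 r" using iffD1[OF bounded_subset_cball assms(2)] by blast
  then have "emeasure (wmeasure w) S \<le> emeasure (wmeasure w) (cball x0 r)" by (intro emeasure_mono) auto
  then show ?thesis using wmeasure_cball_finite[OF assms(1), of x0 r] by (rule le_less_trans)
qed

lemma ball_lebesgue: "emeasure lebesgue (ball y r) = ennreal (measure lebesgue (ball y r))"
  "0 < r \<Longrightarrow> 0 < measure lebesgue (ball y r)"
  for y :: "'a::euclidean_space"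
proof -
  show "emeasure lebesgue (ball y r) = ennreal (measure lebesgue (ball y r))"
    using lmeasurable_ball[of y r] by (intro emeasure_eq_measure2)
  show "0 < r \<Longrightarrow> 0 < measure lebesgue (ball y r)"
    by (simp add: content_ball measure_completion)
qed

lemma ennreal_divide_mult_self:
  assumes "0 < m"
  shows "x / ennreal m * ennreal m = x"
proof -
  have "ennreal m / ennreal m = 1" using assms by (intro ennreal_divide_self) auto
  then show ?thesis by (simp add: ennreal_divide_times)
qed

text \<open>The A_q condition tested on \<open>S\<close>: Hoelder's inequality for 1 = w^(1/q)
  w^(-1/q) on \<open>S\<close>, with the dual factor enlarged to the ball. Doubling, reverse
  doubling and the smallness constants are all derived from this one lower bound.\<close>

theorem A_infinity_lower_bound:
  fixes w :: "real ^ 'n \<Rightarrow> real"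
  assumes "w \<in> A_infinity"
  shows "\<exists>q\<ge>1. \<exists>C>0. \<forall>y r S. 0 < r \<longrightarrow> S \<in> sets lebesgue \<longrightarrow> S \<subseteq> ball y r \<longrightarrow>
     epow (emeasure lebesgue S) q * emeasure (wmeasure w) (ball y r)
     \<le> ennreal (C * measure lebesgue (ball y r) powr q) * emeasure (wmeasure w) S"
proof -
  obtain q C where q: "1 \<le> q" and w: "weight w" and *: "\<And>y r. 0 < r \<Longrightarrow>
     if q = 1 then
       AE x in lebesgue. x \<in> ball y r \<longrightarrow>
         eaverage (ball y r) (\<lambda>z. ennreal (w z)) \<le> ennreal C * ennreal (w x)
     else
       eaverage (ball y r) (\<lambda>x. ennreal (w x)) *
         epow (eaverage (ball y r) (\<lambda>x. epow (ennreal (w x)) (- 1 / (q - 1)))) (q - 1)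
       \<le> ennreal C"
    using assms unfolding A_infinity_def Muckenhoupt_def by blast
  have [measurable]: "w \<in> borel_measurable lebesgue" by (rule weight_measurable[OF w])
  \<comment> \<open>\<open>C\<close> may be zero or negative, in which case \<open>ennreal C\<close>
    is 0; a positive constant is asked for.\<close>
  define C' where "C' = max C 1"
  have C': "C \<le> C'" "0 < C'" by (auto simp: C'_def)
  have "epow (emeasure lebesgue S) q * emeasure (wmeasure w) (ball y r)
     \<le> ennreal (C' * measure lebesgue (ball y r) powr q) * emeasure (wmeasure w) S"
    if r: "0 < r" and S: "S \<in> sets lebesgue" "S \<subseteq> ball y r" for y r S
  proof -
    let ?B = "ball y r"
    have [measurable]: "?B \<in> sets lebesgue" by (rule borel_in_lebesgue) simp
    define m where "m = measure lebesgue ?B"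
    have m: "emeasure lebesgue ?B = ennreal m" "0 < m" using ball_lebesgue r by (auto simp: m_def)
    define WB where "WB = emeasure (wmeasure w) ?B"
    define WS where "WS = emeasure (wmeasure w) S"
    have WB: "WB = (\<integral>\<^sup>+x\<in>?B. ennreal (w x) \<partial>lebesgue)" unfolding WB_def by (rule emeasure_wmeasure) auto
    have WS: "WS = (\<integral>\<^sup>+x\<in>S. ennreal (w x) \<partial>lebesgue)" unfolding WS_def by (rule emeasure_wmeasure) (use S in auto)
    note S(1) [measurable]
    have "epow (emeasure lebesgue S) q * WB \<le> ennreal (C' * m powr q) * WS"
    proof (cases "q = 1")
      case True
      have ae: "AE x in lebesgue. x \<in> ?B \<longrightarrow> WB / ennreal m \<le> ennreal C * ennreal (w x)"
        using *[OF r, of y] True by (simp add: eaverage_def WB m)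
      have "WB / ennreal m * emeasure lebesgue S = (\<integral>\<^sup>+x\<in>S. WB / ennreal m \<partial>lebesgue)"
        by (subst nn_integral_cmult_indicator) auto
      also have "\<dots> \<le> (\<integral>\<^sup>+x. ennreal C * (ennreal (w x) * indicator S x) \<partial>lebesgue)"
        by (rule nn_integral_mono_AE) (use ae S in \<open>auto elim!: eventually_mono simp: indicator_def\<close>)
      also have "\<dots> = ennreal C * WS" unfolding WS by (rule nn_integral_cmult) measurable
      finally have le: "WB / ennreal m * emeasure lebesgue S \<le> ennreal C * WS" .
      have "emeasure lebesgue S * WB = ennreal m * (WB / ennreal m * emeasure lebesgue S)"
      proof -
        have "emeasure lebesgue S * WB = emeasure lebesgue S * (WB / ennreal m * ennreal m)"
          by (simp only: ennreal_divide_mult_self[OF m(2)])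
        then show ?thesis by (simp only: ac_simps)
      qed
      also have "\<dots> \<le> ennreal m * (ennreal C' * WS)"
        by (intro mult_left_mono order_trans[OF le] mult_right_mono ennreal_leI C'(1)) auto
      also have "\<dots> = ennreal (C' * m powr q) * WS" using True m C' by (simp add: ennreal_mult ac_simps)
      finally show ?thesis using True by simp
    next
      case False
      then have q1: "1 < q" using q by simp
      define V where "V = (\<integral>\<^sup>+x\<in>?B. epow (ennreal (w x)) (- 1 / (q - 1)) \<partial>lebesgue)"
      have A: "WB / ennreal m * epow (V / ennreal m) (q - 1) \<le> ennreal C"
        using *[OF r, of y] False by (simp add: eaverage_def WB V_def m)
      show ?thesis
      proof (cases "V = \<infinity>")
        case True
        \<comment> \<open>With an infinite dual integral the A_q product can be finite only if
          \<open>W\<close> vanishes on the ball.\<close>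
        have "V / ennreal m = \<infinity>" using True m by (simp add: ennreal_top_divide)
        then have "WB / ennreal m * \<infinity> \<le> ennreal C" using A q1 by simp
        then have "WB / ennreal m = 0" by (auto simp: ennreal_mult_top top_unique split: if_splits)
        then have "WB = 0" by (auto simp: ennreal_divide_eq_0_iff)
        then show ?thesis by simp
      next
        case fin: False
        \<comment> \<open>A finite dual integral forces \<open>w\<close> to be positive almost
          everywhere on the ball, since a negative power of 0 is \<infinity>; the factorisation of 1
          relies on this.\<close>
        have "AE x in lebesgue. epow (ennreal (w x)) (- 1 / (q - 1)) * indicator ?B x \<noteq> \<infinity>"
        proof (rule nn_integral_noteq_infinite)
          show "(\<lambda>x. epow (ennreal (w x)) (- 1 / (q - 1)) * indicator ?B x) \<in> borel_measurable lebesgue"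
            by measurable
          show "(\<integral>\<^sup>+x\<in>?B. epow (ennreal (w x)) (- 1 / (q - 1)) \<partial>lebesgue) \<noteq> \<infinity>"
            using fin unfolding V_def .
        qed
        then have pos: "AE x in lebesgue. x \<in> ?B \<longrightarrow> 0 < w x"
        proof eventually_elim
          case (elim x)
          have "epow (ennreal (w x)) (- 1 / (q - 1)) = \<infinity>" if "\<not> 0 < w x"
            using that q1 by (simp add: ennreal_neg epow_def)
          then show ?case using elim by (cases "0 < w x") (auto simp: indicator_def)
        qed
        let ?q' = "q / (q - 1)"
        have "emeasure lebesgue S = (\<integral>\<^sup>+x. indicator S x \<partial>lebesgue)" by simp
        also have "\<dots> \<le> (\<integral>\<^sup>+x. (epow (ennreal (w x)) (1/q) * indicator S x) * (epow (ennreal (w x)) (-1/q) * indicator S x) \<partial>lebesgue)"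
        proof (rule nn_integral_mono_AE, use pos in eventually_elim)
          case (elim x)
          have "epow (ennreal (w x)) (1/q) * epow (ennreal (w x)) (-1/q) = 1" if "x \<in> S"
          proof -
            have "0 < w x" using elim that S by auto
            then show ?thesis by (simp add: epow_ennreal_pos powr_add[symmetric] flip: ennreal_mult)
          qed
          then show ?case by (auto simp: indicator_def)
        qed
        also have "\<dots> \<le> epow (\<integral>\<^sup>+x. epow (epow (ennreal (w x)) (1/q) * indicator S x) q \<partial>lebesgue) (1/q)
            * epow (\<integral>\<^sup>+x. epow (epow (ennreal (w x)) (-1/q) * indicator S x) ?q' \<partial>lebesgue) (1/?q')"
          by (rule Holder_nn_integral) (use q1 in \<open>auto simp: field_simps\<close>)
        also have "(\<integral>\<^sup>+x. epow (epow (ennreal (w x)) (1/q) * indicator S x) q \<partial>lebesgue) = WS"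
          unfolding WS by (intro nn_integral_cong) (use q1 in \<open>auto simp: indicator_def epow_epow\<close>)
        also have "(\<integral>\<^sup>+x. epow (epow (ennreal (w x)) (-1/q) * indicator S x) ?q' \<partial>lebesgue) \<le> V"
          unfolding V_def by (intro nn_integral_mono) (use q1 S in \<open>auto simp: indicator_def epow_epow\<close>)
        finally have "emeasure lebesgue S \<le> epow WS (1/q) * epow V (1/?q')"
          using q1 by (simp add: mult_left_mono epow_mono)
        then have "epow (emeasure lebesgue S) q \<le> epow (epow WS (1/q) * epow V (1/?q')) q"
          using q1 by (intro epow_mono) auto
        also have "\<dots> = WS * epow V (q - 1)"
          using q1 by (simp add: epow_mult epow_epow)
        finally have le: "epow (emeasure lebesgue S) q \<le> WS * epow V (q - 1)" .
        have "epow (emeasure lebesgue S) q * WB \<le> WS * epow V (q - 1) * WB"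
          by (rule mult_right_mono[OF le]) simp
        also have "\<dots> = WS * (WB * epow V (q - 1))" by (simp only: ac_simps)
        also have "WB * epow V (q - 1) = (WB / ennreal m * epow (V / ennreal m) (q - 1)) * ennreal (m powr q)"
        proof -
          have "WB = WB / ennreal m * ennreal m" using m(2)
            by (simp only: ennreal_divide_mult_self)
          moreover have "V = V / ennreal m * ennreal m" using m(2)
            by (simp only: ennreal_divide_mult_self)
          then have "epow V (q - 1) = epow (V / ennreal m) (q - 1) * ennreal (m powr (q - 1))"
            using q1 m(2) by (metis epow_ennreal_pos epow_mult diff_ge_0_iff_ge less_imp_le)
          moreover have "ennreal m * ennreal (m powr (q - 1)) = ennreal (m powr q)"
            using m(2) by (simp add: powr_diff flip: ennreal_mult)
          ultimately show ?thesis by (metis (no_types, opaque_lifting) mult.assoc mult.commute)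
        qed
        also have "WS * (\<dots>) \<le> WS * (ennreal C' * ennreal (m powr q))"
          by (intro mult_left_mono mult_right_mono order_trans[OF A] ennreal_leI C'(1)) auto
        also have "\<dots> = ennreal (C' * m powr q) * WS" using C' by (simp add: ennreal_mult ac_simps)
        finally show ?thesis .
      qed
    qed
    then show ?thesis by (simp add: WB_def WS_def m_def)
  qed
  then show ?thesis using q C' by blast
qed

section \<open>The bump condition on cells\<close>

lemma measure_ball_cart:
  fixes y :: "real ^ 'n"
  assumes "0 \<le> r"
  shows "measure lebesgue (ball y r) = unit_ball_vol (real CARD('n)) * r ^ CARD('n)"
  using content_ball[OF assms, of y] by (simp add: measure_completion)

lemma one_plus_powr_le_exp:
  fixes t c s :: real
  assumes "0 \<le> t" "0 < c" "0 < s"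
  shows "(t + 1) powr s \<le> (1 + s / c) powr s * exp (c * t)"
proof -
  have "c * t / s \<le> exp (c * t / s)" using exp_ge_add_one_self[of "c * t / s"] by linarith
  then have "s / c * (c * t / s) \<le> s / c * exp (c * t / s)"
    using assms by (intro mult_left_mono) auto
  then have "t \<le> s / c * exp (c * t / s)" using assms by simp
  moreover have "1 \<le> exp (c * t / s)" using assms by simp
  ultimately have "t + 1 \<le> (1 + s / c) * exp (c * t / s)" unfolding distrib_right by linarith
  then have "(t + 1) powr s \<le> ((1 + s / c) * exp (c * t / s)) powr s"
    using assms by (intro powr_mono2) auto
  also have "\<dots> = (1 + s / c) powr s * exp (c * t)"
    using assms by (simp add: powr_mult exp_powr_real)
  finally show ?thesis .
qed

text \<open>The duality between L log L and exponential integrability. If \<open>s + 1\<close> is at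
  most K times \<open>1 + log_plus t\<close>, the logarithmic factor absorbs it. Otherwise
  \<open>t \<le> exp ((s + 1) / K)\<close>, and K = 2k/c makes \<open>t powr k\<close> at most exp(c
  (s+1)/2), which leaves another exp(c s/2) to pay for the power of \<open>s + 1\<close>.\<close>

lemma LlogL_exp_Young:
  fixes t c s k :: real
  assumes t: "0 \<le> t" and c: "0 < c" and s: "0 \<le> s" and k: "0 < k"
  shows "(s + 1) powr k * t powr k \<le> ((2 * k / c) powr k + (1 + 2 * k / c) powr k * exp c) *
     (t powr k * (1 + log_plus t) powr k + exp (c * s))"
proof -
  let ?K = "2 * k / c"
  have K: "0 < ?K" using c k by simp
  have lp: "0 \<le> log_plus t" by (simp add: log_plus_def)
  have nn: "0 \<le> t powr k * (1 + log_plus t) powr k" by simp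
  show ?thesis
  proof (cases "s + 1 \<le> ?K * (1 + log_plus t)")
    case True
    have "(s + 1) powr k \<le> (?K * (1 + log_plus t)) powr k"
      using True s k by (intro powr_mono2) auto
    then have "(s + 1) powr k * t powr k \<le> (?K * (1 + log_plus t)) powr k * t powr k"
      by (rule mult_right_mono) simp
    also have "\<dots> = ?K powr k * (t powr k * (1 + log_plus t) powr k)"
    proof -
      have "(?K * (1 + log_plus t)) powr k = ?K powr k * (1 + log_plus t) powr k"
        by (rule powr_mult)
      then show ?thesis by (simp only: ac_simps)
    qed
    also have "\<dots> \<le> (?K powr k + (1 + ?K) powr k * exp c) * (t powr k * (1 + log_plus t) powr k + exp (c * s))"
      using nn by (intro mult_mono) auto
    finally show ?thesis .
  next
    case False
    have "t \<le> exp ((s + 1) / ?K)"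
    proof (cases "t \<le> 0")
      case True
      then show ?thesis by (smt (verit) exp_gt_zero)
    next
      case tp: False
      have "(1 + log_plus t) * ?K < s + 1" using False by (simp only: not_le mult.commute[of "1 + log_plus t"])
      then have "1 + log_plus t < (s + 1) / ?K" by (simp only: pos_less_divide_eq[OF K])
      then have "ln t \<le> (s + 1) / ?K" by (simp add: log_plus_def)
      then show ?thesis using tp by (metis exp_le_cancel_iff exp_ln not_le)
    qed
    then have "t powr k \<le> exp ((s + 1) / ?K) powr k" using t k by (intro powr_mono2) auto
    also have "\<dots> = exp (c / 2 * s) * exp (c / 2)"
      using k c by (simp add: exp_powr_real mult_exp_exp field_simps)
    finally have tk: "t powr k \<le> exp (c / 2 * s) * exp (c / 2)" .
    have "(s + 1) powr k \<le> (1 + k / (c / 2)) powr k * exp (c / 2 * s)"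
      by (rule one_plus_powr_le_exp) (use s c k in auto)
    then have "(s + 1) powr k * t powr k \<le> ((1 + k / (c / 2)) powr k * exp (c / 2 * s)) * (exp (c / 2 * s) * exp (c / 2))"
      using tk by (intro mult_mono) auto
    also have "\<dots> = (1 + ?K) powr k * exp (c / 2) * exp (c * s)"
      by (simp add: mult_exp_exp mult.assoc mult.commute)
    also have "\<dots> \<le> (1 + ?K) powr k * exp c * exp (c * s)"
      using c by (intro mult_right_mono mult_left_mono) auto
    also have "\<dots> \<le> (?K powr k + (1 + ?K) powr k * exp c) * (t powr k * (1 + log_plus t) powr k + exp (c * s))"
      using nn by (intro mult_mono) auto
    finally show ?thesis .
  qed
qed

text \<open>The hypotheses with their constants extracted: \<open>M\<close> bounds the mean
  oscillation of \<open>b\<close>, and \<open>q\<close>, \<open>A\<close> come from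
  \<open>A_infinity_lower_bound\<close>. Positivity on balls excludes the weight that is almost
  everywhere 0, which is treated separately at the end.\<close>

locale two_weight =
  fixes b w \<nu> :: "real ^ 'n \<Rightarrow> real" and \<gamma> p r C0 q A M :: real
  assumes \<gamma>: "0 < \<gamma>" "\<gamma> < real CARD('n)" and p: "1 < p" and r: "1 < r"
    and b_loc: "locally_integrable b" and M: "0 < M"
    and b_osc: "\<And>y \<rho>. 0 < \<rho> \<Longrightarrow> (\<integral>\<^sup>+x\<in>ball y \<rho>. ennreal \<bar>b x - average (ball y \<rho>) b\<bar> \<partial>lebesgue)
       \<le> ennreal (M * measure lebesgue (ball y \<rho>))"
    and w: "weight w" and \<nu>: "weight \<nu>"
    and A: "0 < A" and q: "1 \<le> q"
    and A_inf: "\<And>y \<rho> S. 0 < \<rho> \<Longrightarrow> S \<in> sets lebesgue \<Longrightarrow> S \<subseteq> ball y \<rho> \<Longrightarrow>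
       epow (emeasure lebesgue S) q * emeasure (wmeasure w) (ball y \<rho>)
       \<le> ennreal (A * measure lebesgue (ball y \<rho>) powr q) * emeasure (wmeasure w) S"
    and w_ball_pos: "\<And>y \<rho>. 0 < \<rho> \<Longrightarrow> 0 < emeasure (wmeasure w) (ball y \<rho>)"
    and bump: "\<And>y l. 0 < l \<Longrightarrow>
          ennreal (measure lebesgue (cube y l) powr (\<gamma> / real CARD('n))) *
          epow (eaverage (cube y l) (\<lambda>x. ennreal (w x powr r))) (1 / (r * p)) *
          Luxemburg_average (Young_A p) (cube y l) (\<lambda>x. epow (ennreal (\<nu> x)) (- 1 / p))
          \<le> ennreal C0"
begin

abbreviation "W \<equiv> wmeasure w"

lemma measurable_weights [measurable]:
  "b \<in> borel_measurable lebesgue" "w \<in> borel_measurable lebesgue" "\<nu> \<in> borel_measurable lebesgue"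
  using locally_integrable_measurable[OF b_loc] weight_measurable[OF w] weight_measurable[OF \<nu>] by auto

lemma w_nonneg: "0 \<le> w x"
  using w by (simp add: weight_def)

lemma W_finite: "bounded S \<Longrightarrow> emeasure W S = ennreal (measure W S)"
  using wmeasure_bounded_finite[OF w, of S] by (intro emeasure_eq_ennreal_measure) auto

lemma A_inf_real:
  assumes "0 < \<rho>" "S \<in> sets lebesgue" "S \<subseteq> ball y \<rho>" "0 < measure lebesgue S"
  shows "measure W (ball y \<rho>) \<le> A * (measure lebesgue (ball y \<rho>) / measure lebesgue S) powr q * measure W S"
proof -
  have bd: "bounded (ball y \<rho>)" "bounded S" using bounded_subset[OF bounded_ball assms(3)] by auto
  have "emeasure lebesgue S \<le> emeasure lebesgue (ball y \<rho>)" by (rule emeasure_mono[OF assms(3)]) simp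
  then have S: "emeasure lebesgue S = ennreal (measure lebesgue S)"
    unfolding ball_lebesgue(1) by (intro emeasure_eq_ennreal_measure) (auto simp: top_unique)
  have "ennreal (measure lebesgue S powr q * measure W (ball y \<rho>)) \<le> ennreal (A * measure lebesgue (ball y \<rho>) powr q * measure W S)"
    using A_inf[OF assms(1-3)] A assms(4)
    by (simp add: S W_finite bd epow_ennreal_pos ennreal_mult)
  then have "measure lebesgue S powr q * measure W (ball y \<rho>) \<le> A * measure lebesgue (ball y \<rho>) powr q * measure W S"
    using A by (subst (asm) ennreal_le_iff) auto
  then have "measure W (ball y \<rho>) \<le> A * measure lebesgue (ball y \<rho>) powr q * measure W S / measure lebesgue S powr q"
    using assms(4) by (subst pos_le_divide_eq) (auto simp: mult.commute)
  then show ?thesis using assms(4) by (simp add: powr_divide)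
qed

lemma W_ball_pos: "0 < \<rho> \<Longrightarrow> 0 < measure W (ball y \<rho>)"
  using w_ball_pos[of \<rho> y] W_finite[of "ball y \<rho>"] by simp

definition "V = unit_ball_vol (real CARD('n)) * (2 * real CARD('n)) ^ CARD('n)"

lemma measure_cell_ball: "0 < l \<Longrightarrow> measure lebesgue (ball (x :: real ^ 'n) (2 * real CARD('n) * l)) = V * l ^ CARD('n)"
  by (subst measure_ball_cart) (auto simp: V_def power_mult_distrib)

text \<open>\<open>2 * V\<close> is the ratio of the ball enclosing a cell to half of the cell, and
  the maximum with 2 keeps \<open>\<beta>\<close> strictly between 0 and 1. The factor 2 in
  \<open>\<kappa>\<close> pays for replacing the mean over the ball by the mean over the
  cell.\<close>

definition "K\<beta> = max 2 (A * (2 * V) powr q)"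
definition "\<beta> = 1 - 1 / K\<beta>"
definition "\<kappa> = 2 * M * V"

lemma V_pos: "0 < V" unfolding V_def by simp

lemma K\<beta>: "2 \<le> K\<beta>" by (simp add: K\<beta>_def)

lemma \<beta>: "0 < \<beta>" "\<beta> < 1" using K\<beta> by (auto simp: \<beta>_def)

lemma b_set_integrable: "bounded S \<Longrightarrow> S \<in> sets lebesgue \<Longrightarrow> set_integrable lebesgue S b"
proof -
  assume S: "bounded S" "S \<in> sets lebesgue"
  obtain x0 e where "S \<subseteq> cball x0 e" using iffD1[OF bounded_subset_cball S(1)] by blast
  moreover have "b absolutely_integrable_on cball x0 e" using b_loc by (auto simp: locally_integrable_def)
  ultimately show "set_integrable lebesgue S b" using set_integrable_subset[of lebesgue "cball x0 e" b S] S(2) by blast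
qed

lemma oscillation_subset:
  assumes \<rho>: "0 < \<rho>" and S: "S \<in> sets lebesgue" "S \<subseteq> ball y \<rho>"
  shows "\<bar>average S b - average (ball y \<rho>) b\<bar> * measure lebesgue S \<le> M * measure lebesgue (ball y \<rho>)"
    and "(\<integral>\<^sup>+x\<in>S. ennreal \<bar>b x - average S b\<bar> \<partial>lebesgue) \<le> ennreal (2 * M * measure lebesgue (ball y \<rho>))"
proof -
  let ?B = "ball y \<rho>" and ?a = "average (ball y \<rho>) b"
  note S(1) [measurable]
  have bd: "bounded S" using bounded_subset[OF bounded_ball S(2)] .
  have Sl: "S \<in> lmeasurable" using bounded_set_imp_lmeasurable[OF bd S(1)] .
  have Sle: "(\<integral>\<^sup>+x\<in>S. ennreal \<bar>b x - ?a\<bar> \<partial>lebesgue) \<le> ennreal (M * measure lebesgue ?B)"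
    by (rule order_trans[OF nn_integral_mono b_osc[OF \<rho>, of y]]) (use S in \<open>auto simp: indicator_def\<close>)
  have "ennreal (\<bar>average S b - ?a\<bar> * measure lebesgue S) \<le> ennreal (M * measure lebesgue ?B)"
    using average_deviation_le[OF Sl b_set_integrable[OF bd S(1)], of ?a] Sle by (rule order_trans)
  then show 1: "\<bar>average S b - ?a\<bar> * measure lebesgue S \<le> M * measure lebesgue ?B"
    using M by (subst (asm) ennreal_le_iff) auto
  have "(\<integral>\<^sup>+x\<in>S. ennreal \<bar>b x - average S b\<bar> \<partial>lebesgue)
     \<le> (\<integral>\<^sup>+x. ennreal \<bar>b x - ?a\<bar> * indicator S x + ennreal \<bar>average S b - ?a\<bar> * indicator S x \<partial>lebesgue)"
    by (intro nn_integral_mono) (auto simp: indicator_def simp flip: ennreal_plus intro!: ennreal_leI)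
  also have "\<dots> = (\<integral>\<^sup>+x\<in>S. ennreal \<bar>b x - ?a\<bar> \<partial>lebesgue) + ennreal \<bar>average S b - ?a\<bar> * emeasure lebesgue S"
    by (subst nn_integral_add) (auto simp: nn_integral_cmult_indicator)
  also have "\<dots> \<le> ennreal (M * measure lebesgue ?B) + ennreal (M * measure lebesgue ?B)"
  proof (rule add_mono[OF Sle])
    have "emeasure lebesgue S = ennreal (measure lebesgue S)" using Sl by (rule emeasure_eq_measure2)
    then show "ennreal \<bar>average S b - ?a\<bar> * emeasure lebesgue S \<le> ennreal (M * measure lebesgue ?B)"
      using 1 by (simp add: ennreal_leI flip: ennreal_mult)
  qed
  also have "\<dots> = ennreal (2 * M * measure lebesgue ?B)" using M by (simp flip: ennreal_plus)
  finally show "(\<integral>\<^sup>+x\<in>S. ennreal \<bar>b x - average S b\<bar> \<partial>lebesgue) \<le> ennreal (2 * M * measure lebesgue ?B)" .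
qed

section \<open>Weighted estimates on the cells of an arbitrary grid\<close>

context
  fixes cell :: "nat \<Rightarrow> real ^ 'n \<Rightarrow> (real ^ 'n) set" and len
  assumes grid: "dyadic_grid cell len"
begin

interpretation dyadic_grid cell len by (rule grid)

lemma bounded_cell: "bounded (cell i x)"
  using bounded_subset[OF bounded_ball cell_subset_ball] .

lemma dyadic_bmo_cell: "dyadic_bmo cell len b \<kappa>"
proof
  fix i x
  have l: "0 < 2 * real CARD('n) * len i" using len_pos[of i] by simp
  show "b \<in> borel_measurable lebesgue" by simp
  show "set_integrable lebesgue (cell i x) b" by (rule b_set_integrable[OF bounded_cell cell_sets])
  show "0 < \<kappa>" using M V_pos by (simp add: \<kappa>_def)
  show "(\<integral>\<^sup>+y\<in>cell i x. ennreal \<bar>b y - cell_mean b i x\<bar> \<partial>lebesgue) \<le> ennreal (\<kappa> * len i ^ CARD('n))"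
    using oscillation_subset(2)[OF l cell_sets cell_subset_ball, of x]
    unfolding measure_cell_ball[OF len_pos] cell_mean_def \<kappa>_def by (simp only: mult.assoc)
qed

lemma W_cell_pos: "0 < measure W (cell i x)"
proof -
  have l: "0 < 2 * real CARD('n) * len i" using len_pos[of i] by simp
  have "0 < measure W (ball x (2 * real CARD('n) * len i))" by (rule W_ball_pos[OF l])
  also have "\<dots> \<le> A * (measure lebesgue (ball x (2 * real CARD('n) * len i)) / measure lebesgue (cell i x)) powr q * measure W (cell i x)"
    by (rule A_inf_real[OF l cell_sets cell_subset_ball]) (use len_pos[of i] in \<open>simp add: measure_cell\<close>)
  finally show ?thesis using measure_nonneg[of W "cell i x"] by (metis less_irrefl mult_zero_right order_le_less)
qed

text \<open>The A-infinity lower bound is applied to the complement \<open>cell j x - S\<close>,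
  which has at least half of the Lebesgue measure and hence at least the fraction
  \<open>1 / K\<beta>\<close> of the weight.\<close>

lemma W_cell_small:
  assumes S: "S \<in> sets lebesgue" "S \<subseteq> cell j x" "2 * emeasure lebesgue S \<le> emeasure lebesgue (cell j x)"
  shows "emeasure W S \<le> ennreal \<beta> * emeasure W (cell j x)"
proof -
  let ?P = "cell j x" and ?B = "ball x (2 * real CARD('n) * len j)"
  have l: "0 < 2 * real CARD('n) * len j" using len_pos[of j] by simp
  have lp: "0 < len j ^ CARD('n)" using len_pos by simp
  have bS: "bounded S" "bounded (?P - S)" using bounded_subset[OF bounded_cell] S(2) by auto
  have Sl: "S \<in> lmeasurable" using bounded_set_imp_lmeasurable[OF bS(1) S(1)] .
  have "2 * ennreal (measure lebesgue S) \<le> ennreal (measure lebesgue ?P)"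
    using S(3) Sl cell_lmeasurable by (simp add: emeasure_eq_measure2)
  then have "ennreal (2 * measure lebesgue S) \<le> ennreal (measure lebesgue ?P)"
    by (simp add: ennreal_mult)
  then have s: "2 * measure lebesgue S \<le> len j ^ CARD('n)" using lp by (simp add: ennreal_le_iff measure_cell)
  have "measure lebesgue (?P - S) = measure lebesgue ?P - measure lebesgue S"
    using S Sl cell_lmeasurable by (intro measurable_measure_Diff) auto
  then have d: "len j ^ CARD('n) / 2 \<le> measure lebesgue (?P - S)" using s by (simp add: measure_cell)
  have dp: "0 < measure lebesgue (?P - S)" using d lp by linarith
  have "measure W ?P \<le> measure W ?B"
  proof -
    have "emeasure W ?P \<le> emeasure W ?B" by (rule emeasure_mono[OF cell_subset_ball]) simp
    then show ?thesis by (simp add: W_finite bounded_cell ennreal_le_iff)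
  qed
  also have "\<dots> \<le> A * (measure lebesgue ?B / measure lebesgue (?P - S)) powr q * measure W (?P - S)"
    by (rule A_inf_real[OF l _ _ dp]) (use S cell_subset_ball in auto)
  also have "\<dots> \<le> A * (2 * V) powr q * measure W (?P - S)"
  proof (intro mult_right_mono mult_left_mono powr_mono2)
    have "measure lebesgue ?B = V * len j ^ CARD('n)" by (rule measure_cell_ball[OF len_pos])
    also have "\<dots> \<le> 2 * V * measure lebesgue (?P - S)" using mult_left_mono[OF d, of "2 * V"] V_pos by simp
    finally show "measure lebesgue ?B / measure lebesgue (?P - S) \<le> 2 * V" using dp by (simp add: pos_divide_le_eq)
  qed (use A q dp in auto)
  also have "\<dots> \<le> K\<beta> * measure W (?P - S)" by (intro mult_right_mono) (auto simp: K\<beta>_def)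
  finally have 1: "measure W ?P / K\<beta> \<le> measure W (?P - S)" using K\<beta> by (simp add: pos_divide_le_eq mult.commute)
  have "emeasure W S + emeasure W (?P - S) = emeasure W ?P"
    using S by (subst plus_emeasure) (auto intro!: arg_cong[where f="emeasure W"])
  then have "ennreal (measure W S + measure W (?P - S)) = ennreal (measure W ?P)"
    using bS bounded_cell by (simp add: W_finite)
  then have "measure W S + measure W (?P - S) = measure W ?P" by (subst (asm) ennreal_inj) auto
  then have "measure W S \<le> \<beta> * measure W ?P" using 1 by (simp add: \<beta>_def left_diff_distrib)
  then show ?thesis using bS bounded_cell \<beta> by (simp add: W_finite ennreal_leI flip: ennreal_mult)
qed

text \<open>Only \<open>TYPE('n)\<close> enters, neither \<open>cell\<close> nor \<open>len\<close>,
  so the constants are the same for all shifts and side lengths; the passage to the limit in the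
  truncation depends on this.\<close>

definition "cW = dyadic_bmo.jn_exponent TYPE('n) \<kappa> \<beta>"
definition "CW = exp (cW * \<kappa>) * dyadic_bmo.jn_const TYPE('n) \<kappa> \<beta>"
definition "cL = dyadic_bmo.jn_exponent TYPE('n) \<kappa> (1/2)"
definition "CL = exp (cL * \<kappa>) * dyadic_bmo.jn_const TYPE('n) \<kappa> (1/2)"

lemma exp_deviation_W: "(\<integral>\<^sup>+y\<in>cell i x. ennreal (exp (cW * \<bar>b y - average (cell i x) b\<bar>)) \<partial>W) \<le> ennreal CW * emeasure W (cell i x)"
  unfolding cW_def CW_def cell_mean_def[symmetric]
  by (rule dyadic_bmo.John_Nirenberg[OF dyadic_bmo_cell _ \<beta> W_cell_small]) auto

text \<open>Lebesgue measure is the case of the weight 1, for which the smallness condition with the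
  constant 1/2 coincides with its premise.\<close>

lemma exp_deviation_L: "(\<integral>\<^sup>+y\<in>cell i x. ennreal (exp (cL * \<bar>b y - average (cell i x) b\<bar>)) \<partial>lebesgue) \<le> ennreal CL * emeasure lebesgue (cell i x)"
proof -
  have eq: "wmeasure (\<lambda>x :: real ^ 'n. 1) = lebesgue" by (simp add: wmeasure_def density_1)
  have half: "a \<le> ennreal (1/2) * c" if "2 * a \<le> c" for a c :: ennreal
  proof -
    have "ennreal (1/2) * 2 = 1" using ennreal_mult[of "1/2" 2] by simp
    then have "a = ennreal (1/2) * (2 * a)" by (simp only: mult.assoc[symmetric] mult_1)
    also have "\<dots> \<le> ennreal (1/2) * c" by (rule mult_left_mono[OF that]) simp
    finally show ?thesis .
  qed
  have "(\<integral>\<^sup>+y\<in>cell i x. ennreal (exp (dyadic_bmo.jn_exponent TYPE('n) \<kappa> (1/2) * \<bar>b y - cell_mean b i x\<bar>)) \<partial>wmeasure (\<lambda>x. 1))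
     \<le> ennreal (exp (dyadic_bmo.jn_exponent TYPE('n) \<kappa> (1/2) * \<kappa>) * dyadic_bmo.jn_const TYPE('n) \<kappa> (1/2)) * emeasure (wmeasure (\<lambda>x. 1)) (cell i x)"
  proof (rule dyadic_bmo.John_Nirenberg[OF dyadic_bmo_cell])
    fix j and x :: "real ^ 'n" and S :: "(real ^ 'n) set" assume "2 * emeasure lebesgue S \<le> emeasure lebesgue (cell j x)"
    then show "emeasure (wmeasure (\<lambda>x. 1)) S \<le> ennreal (1/2) * emeasure (wmeasure (\<lambda>x. 1)) (cell j x)"
      unfolding eq by (rule half)
  qed auto
  then show ?thesis unfolding eq cell_mean_def cL_def CL_def .
qed

lemma exp_consts_pos: "0 < cW" "0 < cL" "0 < CW" "0 < CL"
proof -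
  show c: "0 < cW" "0 < cL"
    using dyadic_bmo.jn_exponent_pos[OF dyadic_bmo_cell] \<beta> by (auto simp: cW_def cL_def)
  show "0 < CW" "0 < CL"
    using \<beta> by (auto simp: CW_def CL_def dyadic_bmo.jn_const_def[OF dyadic_bmo_cell])
qed

end

end

lemma cube_facts:
  fixes z :: "real ^ 'n"
  assumes "0 < l"
  shows "emeasure lebesgue (cube z l) = ennreal (l ^ CARD('n))" "measure lebesgue (cube z l) = l ^ CARD('n)"
    "cube z l \<in> sets lebesgue"
proof -
  have "cube z l = cbox (\<chi> i. z $ i - l / 2) ((\<chi> i. z $ i - l / 2) + (\<chi> j. l))"
    unfolding cube_def by (intro arg_cong2[where f=cbox]) (auto simp: vec_eq_iff)
  then show e: "emeasure lebesgue (cube z l) = ennreal (l ^ CARD('n))" using emeasure_box_cart(2)[OF assms] by simp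
  show "measure lebesgue (cube z l) = l ^ CARD('n)" unfolding measure_def e using assms by simp
  show "cube z l \<in> sets lebesgue" by (rule borel_in_lebesgue) (simp add: cube_def)
qed

lemma ball_subset_cube: "ball y r \<subseteq> cube y (2 * r)"
proof
  fix x assume x: "x \<in> ball y r"
  have "\<bar>x $ i - y $ i\<bar> \<le> r" for i
    using x component_le_norm_cart[of "x - y" i] by (auto simp: dist_norm norm_minus_commute)
  then show "x \<in> cube y (2 * r)" by (auto simp: cube_def mem_box_cart abs_le_iff) (smt (verit))+
qed

lemma measurable_Young_A [measurable (raw)]:
  assumes [measurable]: "f \<in> borel_measurable M"
  shows "(\<lambda>x. Young_A p (f x)) \<in> borel_measurable M"
  unfolding Young_A_def log_plus_def by measurable

section \<open>The Luxemburg average against the oscillation of \<open>b\<close>\<close>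

context two_weight
begin

definition "pp = p / (p - 1)"

lemma pp: "1 < pp" "0 < pp" "1 / p + 1 / pp = 1" "1 / pp = 1 - 1 / p"
  using p by (auto simp: pp_def field_simps)

lemma consts_pos: "0 < cW" "0 < cL" "0 < CW" "0 < CL"
  \<comment> \<open>Any grid serves as a witness, since the constants do not depend on it.\<close>
  using exp_consts_pos[OF dyadic_grid_grid_cell[of 1 "\<lambda>_. 0"]] by auto

lemma deviation_power_W:
  assumes "dyadic_grid cell len" "0 < s"
  shows "(\<integral>\<^sup>+y\<in>cell i x. ennreal ((\<bar>b y - average (cell i x) b\<bar> + 1) powr s) \<partial>W)
    \<le> ennreal ((1 + s / cW) powr s * CW) * emeasure W (cell i x)"
proof -
  interpret dyadic_grid cell len by fact
  have "(\<integral>\<^sup>+y\<in>cell i x. ennreal ((\<bar>b y - average (cell i x) b\<bar> + 1) powr s) \<partial>W)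
    \<le> (\<integral>\<^sup>+y. ennreal ((1 + s / cW) powr s) * (ennreal (exp (cW * \<bar>b y - average (cell i x) b\<bar>)) * indicator (cell i x) y) \<partial>W)"
    using one_plus_powr_le_exp[OF abs_ge_zero consts_pos(1) assms(2)]
    by (intro nn_integral_mono) (auto simp: indicator_def ennreal_leI simp flip: ennreal_mult)
  also have "\<dots> = ennreal ((1 + s / cW) powr s) * (\<integral>\<^sup>+y\<in>cell i x. ennreal (exp (cW * \<bar>b y - average (cell i x) b\<bar>)) \<partial>W)"
    by (rule nn_integral_cmult) measurable
  also have "\<dots> \<le> ennreal ((1 + s / cW) powr s) * (ennreal CW * emeasure W (cell i x))"
    by (intro mult_left_mono exp_deviation_W[OF assms(1)]) simp
  also have "\<dots> = ennreal ((1 + s / cW) powr s * CW) * emeasure W (cell i x)"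
    using consts_pos by (simp add: ennreal_mult mult.assoc)
  finally show ?thesis .
qed

definition "K1 = (2 * pp / cL) powr pp + (1 + 2 * pp / cL) powr pp * exp cL"
definition "K2 = K1 * (1 + CL)"

lemma K_pos: "0 < K1" "0 < K2"
proof -
  have "0 < 2 * pp / cL" using pp consts_pos by simp
  then have "2 * pp / cL \<noteq> 0" "1 + 2 * pp / cL \<noteq> 0" by linarith+
  then show "0 < K1" unfolding K1_def by (intro add_pos_pos mult_pos_pos) (simp_all only: powr_gt_zero exp_gt_zero not_False_eq_True)
  then show "0 < K2" unfolding K2_def using consts_pos by (intro mult_pos_pos) auto
qed

abbreviation "g y \<equiv> epow (ennreal (\<nu> y)) (- 1 / p)"
abbreviation "Lux z l \<equiv> Luxemburg_average (Young_A p) (cube z l) g"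

lemma Young_pointwise:
  assumes "0 \<le> s"
  shows "ennreal ((s + 1) powr pp) * epow t pp \<le> ennreal K1 * (Young_A p t + ennreal (exp (cL * s)))"
proof (cases t rule: ennreal_cases)
  case top
  then show ?thesis using K_pos by (simp add: Young_A_def ennreal_mult_top)
next
  case (real T)
  have "(s + 1) powr pp * T powr pp \<le> K1 * (T powr pp * (1 + log_plus T) powr pp + exp (cL * s))"
    unfolding K1_def by (rule LlogL_exp_Young) (use real assms consts_pos pp in auto)
  then have "ennreal ((s + 1) powr pp * T powr pp) \<le> ennreal (K1 * (T powr pp * (1 + log_plus T) powr pp + exp (cL * s)))"
    by (rule ennreal_leI)
  also have "\<dots> = ennreal K1 * (Young_A p t + ennreal (exp (cL * s)))"
    using real K_pos by (simp add: Young_A_def conjugate_exponent_def pp_def[symmetric] ennreal_mult)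
  also have "ennreal ((s + 1) powr pp * T powr pp) = ennreal ((s + 1) powr pp) * epow t pp"
    using real pp by (simp add: epow_ennreal ennreal_mult)
  finally show ?thesis .
qed

text \<open>\<open>LlogL_exp_Young\<close> with t = g / l and s = |b - b_P|: admissibility of
  \<open>l\<close> bounds the first term by the volume of the cube, the John--Nirenberg inequality
  bounds the second. The infimum over \<open>l\<close> is taken only in
  \<open>Luxemburg_deviation_norm\<close>.\<close>

lemma Luxemburg_deviation:
  assumes gr: "dyadic_grid cell len" and sub: "cell i x \<subseteq> cube z (len i)"
    and l: "0 < l" and adm: "eaverage (cube z (len i)) (\<lambda>x. Young_A p (g x / ennreal l)) \<le> 1"
  shows "(\<integral>\<^sup>+y\<in>cell i x. ennreal ((\<bar>b y - average (cell i x) b\<bar> + 1) powr pp) * epow (g y) pp \<partial>lebesgue)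
    \<le> ennreal (K2 * len i ^ CARD('n)) * epow (ennreal l) pp"
proof -
  interpret dyadic_grid cell len by fact
  let ?s = "\<lambda>y. \<bar>b y - average (cell i x) b\<bar>"
  have lp: "0 < len i ^ CARD('n)" using len_pos by simp
  note cube_facts(3)[OF len_pos[of i], of z, measurable]
  have geq: "g y = g y / ennreal l * ennreal l" for y by (simp only: ennreal_divide_mult_self[OF l])
  have "(\<integral>\<^sup>+y\<in>cell i x. ennreal ((?s y + 1) powr pp) * epow (g y) pp \<partial>lebesgue)
     \<le> (\<integral>\<^sup>+y. (epow (ennreal l) pp * ennreal K1) * (Young_A p (g y / ennreal l) * indicator (cube z (len i)) y + ennreal (exp (cL * ?s y)) * indicator (cell i x) y) \<partial>lebesgue)"
  proof (rule nn_integral_mono)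
    fix y
    have "epow (g y) pp = epow (g y / ennreal l) pp * epow (ennreal l) pp"
      by (subst geq) (rule epow_mult, use pp in simp)
    then have "ennreal ((?s y + 1) powr pp) * epow (g y) pp = epow (ennreal l) pp * (ennreal ((?s y + 1) powr pp) * epow (g y / ennreal l) pp)"
      by (simp only: ac_simps)
    also have "\<dots> \<le> epow (ennreal l) pp * (ennreal K1 * (Young_A p (g y / ennreal l) + ennreal (exp (cL * ?s y))))"
      by (intro mult_left_mono Young_pointwise) auto
    finally show "ennreal ((?s y + 1) powr pp) * epow (g y) pp * indicator (cell i x) y \<le>
      (epow (ennreal l) pp * ennreal K1) * (Young_A p (g y / ennreal l) * indicator (cube z (len i)) y + ennreal (exp (cL * ?s y)) * indicator (cell i x) y)"
      using sub by (auto simp: indicator_def mult.assoc)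
  qed
  also have "\<dots> = (epow (ennreal l) pp * ennreal K1) * ((\<integral>\<^sup>+y\<in>cube z (len i). Young_A p (g y / ennreal l) \<partial>lebesgue) + (\<integral>\<^sup>+y\<in>cell i x. ennreal (exp (cL * ?s y)) \<partial>lebesgue))"
    by (subst nn_integral_cmult, measurable, subst nn_integral_add, measurable)
  also have "\<dots> \<le> (epow (ennreal l) pp * ennreal K1) * (1 * ennreal (len i ^ CARD('n)) + ennreal CL * ennreal (len i ^ CARD('n)))"
  proof (intro mult_left_mono add_mono)
    show "(\<integral>\<^sup>+y\<in>cube z (len i). Young_A p (g y / ennreal l) \<partial>lebesgue) \<le> 1 * ennreal (len i ^ CARD('n))"
      by (rule ennreal_divide_leD) (use adm lp len_pos[of i] in \<open>auto simp: eaverage_def cube_facts[OF len_pos]\<close>)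
    show "(\<integral>\<^sup>+y\<in>cell i x. ennreal (exp (cL * ?s y)) \<partial>lebesgue) \<le> ennreal CL * ennreal (len i ^ CARD('n))"
      using exp_deviation_L[OF gr, of i x] unfolding emeasure_cell .
  qed auto
  also have "\<dots> = ennreal (K2 * len i ^ CARD('n)) * epow (ennreal l) pp"
  proof -
    have "1 * ennreal (len i ^ CARD('n)) + ennreal CL * ennreal (len i ^ CARD('n)) = ennreal ((1 + CL) * len i ^ CARD('n))"
      using consts_pos lp by (simp add: distrib_right flip: ennreal_mult ennreal_plus)
    moreover have "ennreal K1 * ennreal ((1 + CL) * len i ^ CARD('n)) = ennreal (K2 * len i ^ CARD('n))"
      using K_pos consts_pos lp by (simp add: K2_def mult.assoc flip: ennreal_mult)
    ultimately show ?thesis by (metis mult.assoc mult.commute)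
  qed
  finally show ?thesis .
qed

lemma Luxemburg_deviation_norm:
  assumes gr: "dyadic_grid cell len" and sub: "cell i x \<subseteq> cube z (len i)"
  shows "epow (\<integral>\<^sup>+y\<in>cell i x. ennreal ((\<bar>b y - average (cell i x) b\<bar> + 1) powr pp) * epow (g y) pp \<partial>lebesgue) (1 / pp)
    \<le> ennreal ((K2 * len i ^ CARD('n)) powr (1 / pp)) * Lux z (len i)"
proof -
  interpret dyadic_grid cell len by fact
  let ?X = "epow (\<integral>\<^sup>+y\<in>cell i x. ennreal ((\<bar>b y - average (cell i x) b\<bar> + 1) powr pp) * epow (g y) pp \<partial>lebesgue) (1 / pp)"
  let ?c = "(K2 * len i ^ CARD('n)) powr (1 / pp)"
  have k: "0 < K2 * len i ^ CARD('n)" using K_pos len_pos[of i] by simp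
  then have c: "0 < ?c" by (subst powr_gt_zero) (metis less_irrefl)
  have "?X / ennreal ?c \<le> Lux z (len i)"
    unfolding Luxemburg_average_def
  proof (rule INF_greatest)
    fix l assume "l \<in> {l. 0 < l \<and> eaverage (cube z (len i)) (\<lambda>x. Young_A p (g x / ennreal l)) \<le> 1}"
    then have l: "0 < l" and adm: "eaverage (cube z (len i)) (\<lambda>x. Young_A p (g x / ennreal l)) \<le> 1" by auto
    have "?X \<le> epow (ennreal (K2 * len i ^ CARD('n)) * epow (ennreal l) pp) (1 / pp)"
      using pp p by (intro epow_mono Luxemburg_deviation[OF gr sub l adm]) auto
    also have "\<dots> = ennreal ?c * ennreal l"
      using pp(1,2) l k by (simp add: epow_mult powr_powr epow_ennreal_pos)
    finally have "?X / ennreal ?c \<le> (ennreal l * ennreal ?c) / ennreal ?c"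
      by (intro divide_right_mono_ennreal) (simp add: mult.commute)
    also have "\<dots> = ennreal l" using c by (intro ennreal_mult_divide_eq) auto
    finally show "?X / ennreal ?c \<le> ennreal l" .
  qed
  then have "?X / ennreal ?c * ennreal ?c \<le> Lux z (len i) * ennreal ?c" by (rule mult_right_mono) simp
  then show ?thesis unfolding ennreal_divide_mult_self[OF c] by (simp add: mult.commute)
qed

text \<open>By Hoelder's inequality the mean of \<open>w\<close> is at most its power mean of order
  \<open>r\<close>, the quantity in which the hypothesis on the pair of weights is phrased.\<close>

lemma W_le_power_mean:
  assumes l: "0 < l" and P: "P \<in> sets lebesgue" "P \<subseteq> cube z l"
  shows "epow (emeasure W P) (1 / p) \<le> ennreal ((l ^ CARD('n)) powr (1 / p)) *
     epow (eaverage (cube z l) (\<lambda>x. ennreal (w x powr r))) (1 / (r * p))"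
proof -
  let ?Q = "cube z l"
  note cube_facts(3)[OF l, of z, measurable]
  have lp: "0 < l ^ CARD('n)" using l by simp
  let ?r' = "r / (r - 1)"
  have r': "0 < ?r'" "1 / r + 1 / ?r' = 1" "1 / ?r' = 1 - 1 / r" using r by (auto simp: field_simps)
  define I where "I = (\<integral>\<^sup>+x\<in>?Q. ennreal (w x powr r) \<partial>lebesgue)"
  have "emeasure W P \<le> emeasure W ?Q" by (rule emeasure_mono[OF P(2)]) simp
  also have "\<dots> = (\<integral>\<^sup>+x. (ennreal (w x) * indicator ?Q x) * indicator ?Q x \<partial>lebesgue)"
    by (subst emeasure_wmeasure) (auto intro!: nn_integral_cong simp: indicator_def)
  also have "\<dots> \<le> epow (\<integral>\<^sup>+x. epow (ennreal (w x) * indicator ?Q x) r \<partial>lebesgue) (1 / r) * epow (\<integral>\<^sup>+x. epow (indicator ?Q x) ?r' \<partial>lebesgue) (1 / ?r')"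
    by (rule Holder_nn_integral) (use r r' in auto)
  also have "(\<integral>\<^sup>+x. epow (ennreal (w x) * indicator ?Q x) r \<partial>lebesgue) = I"
    unfolding I_def by (intro nn_integral_cong) (use r w_nonneg in \<open>auto simp: indicator_def epow_ennreal\<close>)
  also have "(\<integral>\<^sup>+x. epow (indicator ?Q x) ?r' \<partial>lebesgue) = (\<integral>\<^sup>+x. indicator ?Q x \<partial>lebesgue)"
    by (intro nn_integral_cong) (use r' in \<open>auto simp: indicator_def\<close>)
  also have "\<dots> = ennreal (l ^ CARD('n))" using cube_facts[OF l, of z] by simp
  also have "epow \<dots> (1 / ?r') = ennreal ((l ^ CARD('n)) powr (1 - 1 / r))"
    unfolding r'(3) by (rule epow_ennreal_pos[OF lp])
  also have "epow I (1 / r) = epow (I / ennreal (l ^ CARD('n)) * ennreal (l ^ CARD('n))) (1 / r)"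
    by (simp only: ennreal_divide_mult_self[OF lp])
  also have "\<dots> = epow (I / ennreal (l ^ CARD('n))) (1 / r) * ennreal ((l ^ CARD('n)) powr (1 / r))"
    using r lp by (simp add: epow_mult epow_ennreal_pos)
  also have "I / ennreal (l ^ CARD('n)) = eaverage ?Q (\<lambda>x. ennreal (w x powr r))"
    by (simp add: eaverage_def I_def cube_facts[OF l])
  finally have "emeasure W P \<le> epow (eaverage ?Q (\<lambda>x. ennreal (w x powr r))) (1 / r) * (ennreal ((l ^ CARD('n)) powr (1 / r)) * ennreal ((l ^ CARD('n)) powr (1 - 1 / r)))"
    by (simp only: mult.assoc)
  also have "ennreal ((l ^ CARD('n)) powr (1 / r)) * ennreal ((l ^ CARD('n)) powr (1 - 1 / r)) = ennreal (l ^ CARD('n))"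
  proof -
    have "(l ^ CARD('n)) powr (1 / r) * (l ^ CARD('n)) powr (1 - 1 / r) = l ^ CARD('n)"
      using lp by (simp add: powr_add[symmetric])
    then show ?thesis by (metis ennreal_mult powr_ge_zero)
  qed
  finally have "epow (emeasure W P) (1 / p) \<le> epow (epow (eaverage ?Q (\<lambda>x. ennreal (w x powr r))) (1 / r) * ennreal (l ^ CARD('n))) (1 / p)"
    using p by (intro epow_mono) auto
  also have "\<dots> = ennreal ((l ^ CARD('n)) powr (1 / p)) * epow (eaverage ?Q (\<lambda>x. ennreal (w x powr r))) (1 / (r * p))"
    using p r lp by (simp add: epow_mult epow_epow epow_ennreal_pos mult.commute)
  finally show ?thesis .
qed

text \<open>The other factors of the bump condition are nonzero because \<open>W\<close> is positive
  on the cube, so an infinite Luxemburg average would make the product infinite.\<close>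

lemma Luxemburg_finite: "0 < l \<Longrightarrow> Lux z l < \<infinity>"
proof (rule ccontr)
  assume l: "0 < l" and "\<not> Lux z l < \<infinity>"
  then have top: "Lux z l = \<infinity>" by (metis infinity_ennreal_def less_top)
  have lp: "0 < l ^ CARD('n)" using l by simp
  have "0 < emeasure W (cube z l)"
  proof -
    have "0 < emeasure W (ball z (l / 2))" using w_ball_pos[of "l / 2" z] l by simp
    also have "\<dots> \<le> emeasure W (cube z l)" using ball_subset_cube[of z "l / 2"] cube_facts(3)[OF l, of z] by (intro emeasure_mono) auto
    finally show ?thesis .
  qed
  then have "epow (emeasure W (cube z l)) (1 / p) \<noteq> 0" using p by (simp add: epow_eq_0_iff)
  then have "epow (eaverage (cube z l) (\<lambda>x. ennreal (w x powr r))) (1 / (r * p)) \<noteq> 0"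
    using W_le_power_mean[OF l cube_facts(3)[OF l] order_refl, of z] by auto
  moreover have "ennreal (measure lebesgue (cube z l) powr (\<gamma> / real CARD('n))) \<noteq> 0"
    using l by (simp add: cube_facts[OF l])
  ultimately have "ennreal (measure lebesgue (cube z l) powr (\<gamma> / real CARD('n))) *
          epow (eaverage (cube z l) (\<lambda>x. ennreal (w x powr r))) (1 / (r * p)) * Lux z l = \<infinity>"
    unfolding top by (simp add: ennreal_mult_top)
  then show False using bump[OF l, of z] by (simp add: top_unique)
qed

text \<open>A finite Luxemburg average makes \<open>g\<close>, a negative power of
  \<open>\<nu>\<close>, finite almost everywhere on the cube, and cubes of growing side exhaust the
  space.\<close>

lemma \<nu>_pos: "AE x in lebesgue. 0 < \<nu> x"
proof -
  have "AE x in lebesgue. x \<in> cube 0 (real k + 1) \<longrightarrow> 0 < \<nu> x" for k :: nat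
  proof -
    let ?Q = "cube (0 :: real ^ 'n) (real k + 1)"
    have kp: "0 < real k + 1" by simp
    note cube_facts(3)[OF kp, measurable]
    obtain l where l: "0 < l" "eaverage ?Q (\<lambda>x. Young_A p (g x / ennreal l)) \<le> 1"
      using Luxemburg_finite[OF kp, of 0] unfolding Luxemburg_average_def INF_less_iff by auto
    have "(\<integral>\<^sup>+y\<in>?Q. Young_A p (g y / ennreal l) \<partial>lebesgue) \<le> 1 * emeasure lebesgue ?Q"
    proof (rule ennreal_divide_leD)
      show "(\<integral>\<^sup>+y\<in>?Q. Young_A p (g y / ennreal l) \<partial>lebesgue) / emeasure lebesgue ?Q \<le> 1"
        using l(2) unfolding eaverage_def .
    qed (unfold cube_facts(1)[OF kp], use kp in auto)
    then have "(\<integral>\<^sup>+y\<in>?Q. Young_A p (g y / ennreal l) \<partial>lebesgue) \<noteq> \<infinity>"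
      unfolding cube_facts(1)[OF kp] by (auto simp: top_unique)
    moreover have "(\<lambda>y. Young_A p (g y / ennreal l) * indicator ?Q y) \<in> borel_measurable lebesgue" by measurable
    ultimately have "AE y in lebesgue. Young_A p (g y / ennreal l) * indicator ?Q y \<noteq> \<infinity>"
      by (intro nn_integral_noteq_infinite)
    then show ?thesis
    proof eventually_elim
      case (elim y)
      have "Young_A p (g y / ennreal l) = \<infinity>" if "\<not> 0 < \<nu> y"
      proof -
        have "g y = \<infinity>" using that p by (simp add: ennreal_neg epow_def)
        then show ?thesis by (simp add: Young_A_def ennreal_top_divide)
      qed
      then show ?case using elim by (cases "0 < \<nu> y") auto
    qed
  qed
  then have "AE x in lebesgue. \<forall>k::nat. x \<in> cube 0 (real k + 1) \<longrightarrow> 0 < \<nu> x"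
    unfolding AE_all_countable by blast
  then show ?thesis
  proof eventually_elim
    case (elim x)
    obtain k :: nat where k: "2 * norm x < real k" using reals_Archimedean2 by blast
    then have "x \<in> ball 0 ((real k + 1) / 2)" by simp
    then have "x \<in> cube 0 (2 * ((real k + 1) / 2))" using ball_subset_cube by blast
    moreover have "2 * ((real k + 1) / 2) = real k + 1" by simp
    ultimately have "x \<in> cube 0 (real k + 1)" by (simp only:)
    then show ?case using elim by blast
  qed
qed

definition "C2 = K2 powr (1 / pp) * max C0 1"

lemma C2_pos: "0 < C2" unfolding C2_def using K_pos by simp

text \<open>Hoelder's inequality for the factorisation of f into f \<nu>^(1/p) and \<nu>^(-1/p), the
  latter together with the oscillation of \<open>b\<close>. The volume powers 1/p from
  \<open>W_le_power_mean\<close> and 1/pp from \<open>Luxemburg_deviation_norm\<close> add up to one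
  factor \<open>len i ^ CARD('n)\<close>; what is left is the product in the bump condition.\<close>

lemma bump_cell:
  fixes f :: "real ^ 'n \<Rightarrow> ennreal"
  assumes gr: "dyadic_grid cell len" and [measurable]: "f \<in> borel_measurable lebesgue"
  shows "ennreal (len i powr \<gamma>) * epow (emeasure W (cell i x)) (1 / p) *
        (\<integral>\<^sup>+y\<in>cell i x. ennreal (\<bar>b y - average (cell i x) b\<bar> + 1) * f y \<partial>lebesgue)
      \<le> ennreal (C2 * len i ^ CARD('n)) * epow (\<integral>\<^sup>+y\<in>cell i x. epow (f y) p * ennreal (\<nu> y) \<partial>lebesgue) (1 / p)"
proof -
  interpret dyadic_grid cell len by fact
  let ?P = "cell i x" and ?d = "\<lambda>y. ennreal (\<bar>b y - average (cell i x) b\<bar> + 1)"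
  obtain z where z: "?P \<subseteq> cube z (len i)" using cell_subset_cube by blast
  have l: "0 < len i" by (rule len_pos)
  then have lp: "0 < len i ^ CARD('n)" by simp
  define a where "a = epow (eaverage (cube z (len i)) (\<lambda>x. ennreal (w x powr r))) (1 / (r * p))"
  define L where "L = Lux z (len i)"
  define Gp where "Gp = epow (\<integral>\<^sup>+y\<in>?P. epow (f y) p * ennreal (\<nu> y) \<partial>lebesgue) (1 / p)"
  have H: "(\<integral>\<^sup>+y\<in>?P. ?d y * f y \<partial>lebesgue) \<le> Gp * (ennreal ((K2 * len i ^ CARD('n)) powr (1 / pp)) * L)"
  proof -
    have "(\<integral>\<^sup>+y\<in>?P. ?d y * f y \<partial>lebesgue)
        \<le> (\<integral>\<^sup>+y. (f y * epow (ennreal (\<nu> y)) (1 / p) * indicator ?P y) * (?d y * g y * indicator ?P y) \<partial>lebesgue)"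
    proof (rule nn_integral_mono_AE, use \<nu>_pos in eventually_elim)
      case (elim y)
      have "epow (ennreal (\<nu> y)) (1 / p) * g y = 1"
        using elim by (simp add: epow_ennreal_pos powr_add[symmetric] flip: ennreal_mult)
      then have "?d y * f y = ?d y * f y * (epow (ennreal (\<nu> y)) (1 / p) * g y)" by (simp only: mult_1_right)
      also have "\<dots> = (f y * epow (ennreal (\<nu> y)) (1 / p)) * (?d y * g y)" by (simp only: ac_simps)
      finally show ?case by (cases "y \<in> ?P") simp_all
    qed
    also have "\<dots> \<le> epow (\<integral>\<^sup>+y. epow (f y * epow (ennreal (\<nu> y)) (1 / p) * indicator ?P y) p \<partial>lebesgue) (1 / p)
        * epow (\<integral>\<^sup>+y. epow (?d y * g y * indicator ?P y) pp \<partial>lebesgue) (1 / pp)"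
      by (rule Holder_nn_integral) (use p pp in auto)
    also have "(\<integral>\<^sup>+y. epow (f y * epow (ennreal (\<nu> y)) (1 / p) * indicator ?P y) p \<partial>lebesgue) = (\<integral>\<^sup>+y\<in>?P. epow (f y) p * ennreal (\<nu> y) \<partial>lebesgue)"
      using p by (intro nn_integral_cong) (auto simp: indicator_def epow_mult epow_epow)
    also have "(\<integral>\<^sup>+y. epow (?d y * g y * indicator ?P y) pp \<partial>lebesgue)
        = (\<integral>\<^sup>+y\<in>?P. ennreal ((\<bar>b y - average (cell i x) b\<bar> + 1) powr pp) * epow (g y) pp \<partial>lebesgue)"
      using pp by (intro nn_integral_cong) (auto simp: indicator_def epow_mult epow_ennreal_pos simp del: ennreal_plus)
    also have "epow \<dots> (1 / pp) \<le> ennreal ((K2 * len i ^ CARD('n)) powr (1 / pp)) * L"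
      unfolding L_def by (rule Luxemburg_deviation_norm[OF gr z])
    finally show ?thesis unfolding Gp_def by (simp add: mult_left_mono)
  qed
  have Wp: "epow (emeasure W ?P) (1 / p) \<le> ennreal ((len i ^ CARD('n)) powr (1 / p)) * a"
    unfolding a_def by (rule W_le_power_mean[OF l _ z]) simp
  have B: "ennreal (len i powr \<gamma>) * a * L \<le> ennreal (max C0 1)"
  proof -
    have "measure lebesgue (cube z (len i)) powr (\<gamma> / real CARD('n)) = len i powr \<gamma>"
      using l by (simp add: cube_facts[OF l] powr_powr flip: powr_realpow)
    then show ?thesis using bump[OF l, of z] unfolding a_def L_def by (simp add: order_trans ennreal_leI)
  qed
  have "ennreal (len i powr \<gamma>) * epow (emeasure W ?P) (1 / p) * (\<integral>\<^sup>+y\<in>?P. ?d y * f y \<partial>lebesgue)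
      \<le> ennreal (len i powr \<gamma>) * (ennreal ((len i ^ CARD('n)) powr (1 / p)) * a) * (Gp * (ennreal ((K2 * len i ^ CARD('n)) powr (1 / pp)) * L))"
    by (intro mult_mono Wp H mult_left_mono) auto
  also have "\<dots> = (ennreal (len i powr \<gamma>) * a * L) * (ennreal ((len i ^ CARD('n)) powr (1 / p)) * ennreal ((K2 * len i ^ CARD('n)) powr (1 / pp)) * Gp)"
    by (simp only: ac_simps)
  also have "\<dots> \<le> ennreal (max C0 1) * (ennreal ((len i ^ CARD('n)) powr (1 / p)) * ennreal ((K2 * len i ^ CARD('n)) powr (1 / pp)) * Gp)"
    by (rule mult_right_mono[OF B]) simp
  also have "ennreal ((len i ^ CARD('n)) powr (1 / p)) * ennreal ((K2 * len i ^ CARD('n)) powr (1 / pp)) = ennreal (K2 powr (1 / pp) * len i ^ CARD('n))"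
  proof -
    have "(len i ^ CARD('n)) powr (1 / p) * (K2 * len i ^ CARD('n)) powr (1 / pp) = K2 powr (1 / pp) * ((len i ^ CARD('n)) powr (1 / p) * (len i ^ CARD('n)) powr (1 / pp))"
      using K_pos lp by (simp add: powr_mult)
    also have "(len i ^ CARD('n)) powr (1 / p) * (len i ^ CARD('n)) powr (1 / pp) = len i ^ CARD('n)"
      using lp pp by (simp add: powr_add[symmetric])
    finally show ?thesis by (metis ennreal_mult powr_ge_zero)
  qed
  also have "ennreal (max C0 1) * (ennreal (K2 powr (1 / pp) * len i ^ CARD('n)) * Gp) = ennreal (C2 * len i ^ CARD('n)) * Gp"
    using lp unfolding C2_def by (simp add: ac_simps flip: ennreal_mult mult.assoc)
  finally show ?thesis unfolding Gp_def .
qed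

end

section \<open>The weak-type inequality for the positive operator\<close>

lemma measurable_lebesgue_pair_diff:
  "(\<lambda>z::('a::euclidean_space \<times> 'a). fst z - snd z) \<in> borel_measurable (lebesgue \<Otimes>\<^sub>M lebesgue)"
  by (intro borel_measurable_diff measurable_compose[OF measurable_fst lebesgue_id_borel]
      measurable_compose[OF measurable_snd lebesgue_id_borel])

definition kernel :: "(real ^ 'n \<Rightarrow> real) \<Rightarrow> real \<Rightarrow> real ^ 'n \<Rightarrow> real ^ 'n \<Rightarrow> real" where
  "kernel b \<gamma> x y = \<bar>b x - b y\<bar> / norm (x - y) powr (real CARD('n) - \<gamma>)"

definition annulus :: "nat \<Rightarrow> real ^ 'n \<Rightarrow> (real ^ 'n) set" where
  "annulus M x = {y. 1 / 2 ^ M < 12 * infnorm (x - y) \<and> 12 * infnorm (x - y) \<le> 2 ^ M}"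

definition full_operator :: "(real ^ 'n \<Rightarrow> real) \<Rightarrow> real \<Rightarrow> (real ^ 'n \<Rightarrow> ennreal) \<Rightarrow> real ^ 'n \<Rightarrow> ennreal" where
  "full_operator b \<gamma> f x = (\<integral>\<^sup>+y. ennreal (kernel b \<gamma> x y) * f y \<partial>lebesgue)"

definition truncated_operator :: "(real ^ 'n \<Rightarrow> real) \<Rightarrow> real \<Rightarrow> (real ^ 'n \<Rightarrow> ennreal) \<Rightarrow> nat \<Rightarrow> real ^ 'n \<Rightarrow> ennreal" where
  "truncated_operator b \<gamma> f M x = (\<integral>\<^sup>+y\<in>annulus M x. ennreal (kernel b \<gamma> x y) * f y \<partial>lebesgue)"

lemma kernel_pair_measurable:
  assumes [measurable]: "b \<in> borel_measurable lebesgue"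
  shows "(\<lambda>z. kernel b \<gamma> (fst z) (snd z)) \<in> borel_measurable (lebesgue \<Otimes>\<^sub>M lebesgue)"
proof -
  note measurable_lebesgue_pair_diff [measurable]
  show ?thesis unfolding kernel_def by measurable
qed

lemma kernel_measurable:
  assumes [measurable]: "b \<in> borel_measurable lebesgue"
  shows "kernel b \<gamma> x \<in> borel_measurable lebesgue"
proof -
  note lebesgue_id_borel [measurable]
  show ?thesis unfolding kernel_def[abs_def] by measurable
qed

lemma full_operator_measurable:
  assumes b [measurable]: "b \<in> borel_measurable lebesgue" and [measurable]: "f \<in> borel_measurable lebesgue"
  shows "full_operator b \<gamma> f \<in> borel_measurable lebesgue"
proof -
  note kernel_pair_measurable[OF b, measurable]
  have "(\<lambda>z. ennreal (kernel b \<gamma> (fst z) (snd z)) * f (snd z)) \<in> borel_measurable (lebesgue \<Otimes>\<^sub>M lebesgue)"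
    by measurable
  then have "case_prod (\<lambda>x y. ennreal (kernel b \<gamma> x y) * f y) \<in> borel_measurable (lebesgue \<Otimes>\<^sub>M lebesgue)"
    by (simp add: case_prod_unfold)
  then show ?thesis unfolding full_operator_def[abs_def] by (rule lebesgue.borel_measurable_nn_integral)
qed

lemma infnorm_borel [measurable]: "infnorm \<in> borel_measurable borel"
  by (intro borel_measurable_continuous_onI continuous_on_infnorm continuous_on_id)

lemma truncated_operator_measurable:
  assumes b [measurable]: "b \<in> borel_measurable lebesgue" and [measurable]: "f \<in> borel_measurable lebesgue"
  shows "truncated_operator b \<gamma> f M \<in> borel_measurable lebesgue"
proof -
  note kernel_pair_measurable[OF b, measurable] measurable_lebesgue_pair_diff [measurable]
  have [measurable]: "(\<lambda>z::(real^'n) \<times> (real^'n). infnorm (fst z - snd z)) \<in> borel_measurable (lebesgue \<Otimes>\<^sub>M lebesgue)"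
    by (rule measurable_compose[OF _ infnorm_borel]) measurable
  have "(\<lambda>z. ennreal (kernel b \<gamma> (fst z) (snd z)) * f (snd z) *
      indicator {z. 1 / 2 ^ M < 12 * infnorm (fst z - snd z) \<and> 12 * infnorm (fst z - snd z) \<le> 2 ^ M} z) \<in> borel_measurable (lebesgue \<Otimes>\<^sub>M lebesgue)"
    by measurable
  then have "case_prod (\<lambda>x y. ennreal (kernel b \<gamma> x y) * f y * indicator (annulus M x) y) \<in> borel_measurable (lebesgue \<Otimes>\<^sub>M lebesgue)"
    by (simp add: case_prod_unfold annulus_def indicator_def)
  then show ?thesis unfolding truncated_operator_def[abs_def] by (rule lebesgue.borel_measurable_nn_integral)
qed

lemma annulus_sets: "annulus M x \<in> sets lebesgue"
proof -
  note lebesgue_id_borel [measurable]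
  have [measurable]: "(\<lambda>y. infnorm (x - y)) \<in> borel_measurable lebesgue"
    by (rule measurable_compose[OF _ infnorm_borel]) measurable
  have "Measurable.pred lebesgue (\<lambda>y. 1 / 2 ^ M < 12 * infnorm (x - y) \<and> 12 * infnorm (x - y) \<le> 2 ^ M)" by measurable
  then show ?thesis by (simp add: annulus_def pred_def)
qed

lemma annulus_mono: "M \<le> N \<Longrightarrow> annulus M x \<subseteq> annulus N x"
proof
  fix y assume MN: "M \<le> N" and y: "y \<in> annulus M x"
  have "(2::real) ^ M \<le> 2 ^ N" using MN by (rule power_increasing) simp
  moreover have "1 / (2::real) ^ N \<le> 1 / 2 ^ M" using calculation by (intro divide_left_mono) auto
  ultimately show "y \<in> annulus N x" using y unfolding annulus_def mem_Collect_eq by linarith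
qed

lemma annulus_exhausts: "x \<noteq> y \<Longrightarrow> \<exists>M. y \<in> annulus M x"
proof -
  assume "x \<noteq> y"
  then have d: "0 < 12 * infnorm (x - y)" using infnorm_pos_lt[of "x - y"] by simp
  obtain M1 :: nat where M1: "12 * infnorm (x - y) < 2 ^ M1" using real_arch_pow[of 2] by auto
  obtain M2 :: nat where M2: "(1/2) ^ M2 < 12 * infnorm (x - y)" using real_arch_pow_inv[OF d, of "1/2"] by auto
  have "(2::real) ^ M1 \<le> 2 ^ (max M1 M2)" "(2::real) ^ M2 \<le> 2 ^ (max M1 M2)" by (auto intro: power_increasing)
  moreover have "1 / (2::real) ^ (max M1 M2) \<le> 1 / 2 ^ M2" using calculation(2) by (intro divide_left_mono) auto
  ultimately show ?thesis using M1 M2 unfolding annulus_def mem_Collect_eq power_one_over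
    by (intro exI[of _ "max M1 M2"]) linarith
qed

lemma truncated_operator_mono: "M \<le> N \<Longrightarrow> truncated_operator b \<gamma> f M x \<le> truncated_operator b \<gamma> f N x"
  unfolding truncated_operator_def using annulus_mono[of M N x]
  by (intro nn_integral_mono) (auto simp: indicator_def)

lemma truncated_operator_SUP:
  assumes b [measurable]: "b \<in> borel_measurable lebesgue" and [measurable]: "f \<in> borel_measurable lebesgue"
  shows "(SUP M. truncated_operator b \<gamma> f M x) = full_operator b \<gamma> f x"
proof -
  note kernel_measurable[OF b, measurable] annulus_sets[measurable]
  have "(SUP M. truncated_operator b \<gamma> f M x) = (\<integral>\<^sup>+y. (SUP M. ennreal (kernel b \<gamma> x y) * f y * indicator (annulus M x) y) \<partial>lebesgue)"
    unfolding truncated_operator_def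
  proof (rule nn_integral_monotone_convergence_SUP[symmetric])
    show "incseq (\<lambda>M y. ennreal (kernel b \<gamma> x y) * f y * indicator (annulus M x) y)"
      unfolding incseq_def le_fun_def using annulus_mono[of _ _ x] by (fastforce simp: indicator_def)
  qed measurable
  also have "\<dots> = full_operator b \<gamma> f x"
    unfolding full_operator_def
  proof (rule nn_integral_cong)
    fix y
    show "(SUP M. ennreal (kernel b \<gamma> x y) * f y * indicator (annulus M x) y) = ennreal (kernel b \<gamma> x y) * f y"
    proof (cases "x = y")
      case True
      then show ?thesis by (simp add: kernel_def)
    next
      case False
      then obtain M where M: "y \<in> annulus M x" using annulus_exhausts by blast
      show ?thesis
      proof (rule antisym)
        show "(SUP M. ennreal (kernel b \<gamma> x y) * f y * indicator (annulus M x) y) \<le> ennreal (kernel b \<gamma> x y) * f y"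
          by (rule SUP_least) (auto simp: indicator_def)
        show "ennreal (kernel b \<gamma> x y) * f y \<le> (SUP M. ennreal (kernel b \<gamma> x y) * f y * indicator (annulus M x) y)"
          using M by (intro SUP_upper2[of M]) auto
      qed
    qed
  qed
  finally show ?thesis .
qed

text \<open>The level \<open>i\<close> is the last one before the side drops below 12 times the
  distance. There \<open>ball_in_grid_cell\<close> finds a shift for which \<open>x\<close> and
  \<open>y\<close> share a cell, and as the side is less than 24 times the distance, the kernel
  exceeds its size at the scale of the cell by at most 24^(n-\<gamma>).\<close>

lemma kernel_in_grid:
  fixes x y :: "real ^ 'n"
  assumes y: "y \<in> annulus M x" and \<gamma>: "\<gamma> < real CARD('n)"
  shows "\<exists>i\<le>2 * M. \<exists>t\<in>shifts. y \<in> grid_cell (2 ^ M) t i x \<and>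
     kernel b \<gamma> x y \<le> 24 powr (real CARD('n) - \<gamma>) * ((2 ^ M / 2 ^ i) powr \<gamma> / (2 ^ M / 2 ^ i) ^ CARD('n)) * \<bar>b x - b y\<bar>"
proof -
  define d where "d = infnorm (x - y)"
  let ?L = "\<lambda>i. 2 ^ M / 2 ^ i :: real"
  have d: "1 / 2 ^ M < 12 * d" "12 * d \<le> 2 ^ M" using y by (auto simp: annulus_def d_def)
  have dp: "0 < d" using d(1) by (smt (verit) divide_pos_pos zero_less_power)
  define k where "k = (LEAST k. ?L k < 12 * d)"
  have "?L (2 * M) = 1 / 2 ^ M" by (simp add: mult_2 power_add)
  then have k0: "?L (2 * M) < 12 * d" using d by simp
  then have k1: "?L k < 12 * d" unfolding k_def by (rule LeastI)
  have k2: "k \<le> 2 * M" unfolding k_def using k0 by (rule Least_le)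
  have "k \<noteq> 0" using k1 d(2) by (intro notI) simp
  then obtain i where i: "k = Suc i" by (cases k) auto
  have "\<not> ?L i < 12 * d" using not_less_Least[of i "\<lambda>k. ?L k < 12 * d"] i by (simp add: k_def[symmetric])
  then have li: "12 * d \<le> ?L i" by simp
  have lk: "?L i < 24 * d" using k1 unfolding i by simp
  obtain t where t: "t \<in> shifts" "\<And>z. (\<forall>j. \<bar>z $ j - x $ j\<bar> \<le> d) \<Longrightarrow> z \<in> grid_cell (2 ^ M) t i x"
    using ball_in_grid_cell[of "2 ^ M" d i x] li by auto
  have yc: "y \<in> grid_cell (2 ^ M) t i x"
  proof (rule t(2), rule allI)
    fix j
    have "\<bar>(x - y) $ j\<bar> \<le> d" unfolding d_def by (rule component_le_infnorm_cart)
    then show "\<bar>y $ j - x $ j\<bar> \<le> d" by (simp add: abs_minus_commute)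
  qed
  have Lp: "0 < ?L i" by simp
  have n: "?L i / 24 \<le> norm (x - y)" using lk infnorm_le_norm[of "x - y"] by (simp add: d_def)
  have "(?L i / 24) powr (real CARD('n) - \<gamma>) \<le> norm (x - y) powr (real CARD('n) - \<gamma>)"
    using n \<gamma> Lp by (intro powr_mono2) auto
  then have "\<bar>b x - b y\<bar> / norm (x - y) powr (real CARD('n) - \<gamma>) \<le> \<bar>b x - b y\<bar> / (?L i / 24) powr (real CARD('n) - \<gamma>)"
    using Lp n by (intro divide_left_mono mult_pos_pos) auto
  also have "(?L i / 24) powr (real CARD('n) - \<gamma>) = ?L i ^ CARD('n) / ?L i powr \<gamma> / 24 powr (real CARD('n) - \<gamma>)"
    by (simp only: powr_divide[of "?L i" 24] powr_diff[of "?L i"] powr_realpow[OF Lp])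
  also have "\<bar>b x - b y\<bar> / (?L i ^ CARD('n) / ?L i powr \<gamma> / 24 powr (real CARD('n) - \<gamma>))
     = 24 powr (real CARD('n) - \<gamma>) * (?L i powr \<gamma> / ?L i ^ CARD('n)) * \<bar>b x - b y\<bar>"
    by (simp only: divide_divide_eq_left divide_divide_eq_right times_divide_eq_left times_divide_eq_right ac_simps)
  finally have "kernel b \<gamma> x y \<le> 24 powr (real CARD('n) - \<gamma>) * (?L i powr \<gamma> / ?L i ^ CARD('n)) * \<bar>b x - b y\<bar>"
    unfolding kernel_def .
  moreover have "i \<le> 2 * M" using k2 i by simp
  ultimately show ?thesis using t(1) yc by blast
qed

lemma truncated_operator_le_grid:
  fixes x :: "real ^ 'n"
  assumes [measurable]: "b \<in> borel_measurable lebesgue" "f \<in> borel_measurable lebesgue" and \<gamma>: "\<gamma> < real CARD('n)"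
  shows "truncated_operator b \<gamma> f M x \<le> (\<Sum>t\<in>shifts. ennreal (24 powr (real CARD('n) - \<gamma>)) *
     grid_operator (grid_cell (2 ^ M) t) (\<lambda>i. 2 ^ M / 2 ^ i) b \<gamma> f (2 * M) x)"
proof -
  let ?L = "\<lambda>i. 2 ^ M / 2 ^ i :: real" and ?c = "24 powr (real CARD('n) - \<gamma>)"
  let ?G = "\<lambda>t. grid_cell (2 ^ M) t :: nat \<Rightarrow> real ^ 'n \<Rightarrow> (real ^ 'n) set"
  have grid: "dyadic_grid (?G t) ?L" for t by (rule dyadic_grid_grid_cell) simp
  have [measurable]: "?G t i x \<in> sets lebesgue" for t i by (rule dyadic_grid.cell_sets[OF grid])
  let ?h = "\<lambda>t i y. ennreal ?c * (ennreal (?L i powr \<gamma> / ?L i ^ CARD('n)) * (ennreal \<bar>b x - b y\<bar> * f y * indicator (?G t i x) y))"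
  have "truncated_operator b \<gamma> f M x \<le> (\<integral>\<^sup>+y. (\<Sum>t\<in>shifts. \<Sum>i\<le>2 * M. ?h t i y) \<partial>lebesgue)"
    unfolding truncated_operator_def
  proof (rule nn_integral_mono)
    fix y
    show "ennreal (kernel b \<gamma> x y) * f y * indicator (annulus M x) y \<le> (\<Sum>t\<in>shifts. \<Sum>i\<le>2 * M. ?h t i y)"
    proof (cases "y \<in> annulus M x")
      case True
      obtain i t where it: "i \<le> 2 * M" "t \<in> shifts" "y \<in> ?G t i x"
        and k: "kernel b \<gamma> x y \<le> ?c * (?L i powr \<gamma> / ?L i ^ CARD('n)) * \<bar>b x - b y\<bar>"
        using kernel_in_grid[OF True \<gamma>, of b] by blast
      have "ennreal (kernel b \<gamma> x y) * f y \<le> ennreal (?c * (?L i powr \<gamma> / ?L i ^ CARD('n)) * \<bar>b x - b y\<bar>) * f y"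
        by (intro mult_right_mono ennreal_leI k) simp
      also have "\<dots> = ?h t i y"
      proof -
        have "ennreal (?c * (?L i powr \<gamma> / ?L i ^ CARD('n)) * \<bar>b x - b y\<bar>) = ennreal (?c * (?L i powr \<gamma> / ?L i ^ CARD('n))) * ennreal \<bar>b x - b y\<bar>"
          by (rule ennreal_mult) auto
        moreover have "ennreal (?c * (?L i powr \<gamma> / ?L i ^ CARD('n))) = ennreal ?c * ennreal (?L i powr \<gamma> / ?L i ^ CARD('n))"
          by (rule ennreal_mult) auto
        moreover have "indicator (?G t i x) y = (1 :: ennreal)" using it(3) by simp
        ultimately show ?thesis by (simp only: mult.assoc mult_1_right)
      qed
      also have "\<dots> \<le> (\<Sum>i\<le>2 * M. ?h t i y)" by (rule member_le_sum) (use it in auto)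
      also have "\<dots> \<le> (\<Sum>t\<in>shifts. \<Sum>i\<le>2 * M. ?h t i y)"
        by (rule member_le_sum[of t shifts "\<lambda>t. \<Sum>i\<le>2 * M. ?h t i y"]) (use it finite_shifts in auto)
      finally show ?thesis using True by simp
    qed simp
  qed
  also have "\<dots> = (\<Sum>t\<in>shifts. \<Sum>i\<le>2 * M. \<integral>\<^sup>+y. ?h t i y \<partial>lebesgue)"
    by (simp add: nn_integral_sum)
  also have "\<dots> = (\<Sum>t\<in>shifts. ennreal ?c * grid_operator (?G t) ?L b \<gamma> f (2 * M) x)"
    unfolding grid_operator_def by (simp add: nn_integral_cmult sum_distrib_left)
  finally show ?thesis .
qed

section \<open>Uniform weak-type bounds for the truncated operators\<close>

context two_weight
begin

text \<open>Midpoints, giving 1 < u0 < v0 < p/(p-1) as \<open>sparse_setting\<close>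
  demands.\<close>

definition "v0 = (1 + pp) / 2"
definition "u0 = (1 + v0) / 2"
definition "C1 = (1 + u0 / (u0 - 1) / cW) powr (u0 / (u0 - 1)) * CW"
definition "Cgrid = sparse_setting.weak_const TYPE('n) \<kappa> \<beta> \<gamma> p u0 v0 C1 C2"

lemma uv: "1 < u0" "u0 < v0" "v0 < p / (p - 1)"
  using pp(1) unfolding u0_def v0_def pp_def[symmetric] by auto

lemma C1_pos: "0 < C1"
proof -
  have "0 < u0 / (u0 - 1) / cW" using uv consts_pos by auto
  then have "1 + u0 / (u0 - 1) / cW \<noteq> 0" by linarith
  then show ?thesis unfolding C1_def using consts_pos by simp
qed

lemma sparse_setting_cell:
  assumes gr: "dyadic_grid cell len" and f: "f \<in> borel_measurable lebesgue"
    and fin: "(\<integral>\<^sup>+y. epow (f y) p * ennreal (\<nu> y) \<partial>lebesgue) < \<infinity>"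
    and E: "E \<in> sets lebesgue" "emeasure W E < \<infinity>"
  shows "sparse_setting cell len b \<kappa> w \<beta> \<gamma> p u0 v0 C1 C2 f (\<lambda>y. epow (f y) p * ennreal (\<nu> y)) E"
proof -
  interpret dyadic_bmo cell len b \<kappa> by (rule dyadic_bmo_cell[OF gr])
  show ?thesis
  proof
    fix i x
    show "0 < emeasure W (cell i x)" "emeasure W (cell i x) < \<infinity>"
      using W_cell_pos[OF gr, of i x] W_finite[OF bounded_cell[OF gr]] by simp_all
    show "(\<integral>\<^sup>+y\<in>cell i x. ennreal ((\<bar>b y - cell_mean b i x\<bar> + 1) powr (u0 / (u0 - 1))) \<partial>W) \<le> ennreal C1 * emeasure W (cell i x)"
      unfolding cell_mean_def C1_def by (rule deviation_power_W[OF gr]) (use uv in auto)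
    show "ennreal (len i powr \<gamma>) * epow (emeasure W (cell i x)) (1 / p) *
        (\<integral>\<^sup>+y\<in>cell i x. ennreal (\<bar>b y - cell_mean b i x\<bar> + 1) * f y \<partial>lebesgue)
      \<le> ennreal (C2 * len i ^ CARD('n)) * epow (\<integral>\<^sup>+y\<in>cell i x. epow (f y) p * ennreal (\<nu> y) \<partial>lebesgue) (1 / p)"
      unfolding cell_mean_def by (rule bump_cell[OF gr f])
  next
    note f [measurable]
    show "(\<lambda>y. epow (f y) p * ennreal (\<nu> y)) \<in> borel_measurable lebesgue" by measurable
  qed (use uv p \<gamma> \<beta> C1_pos C2_pos f fin E W_cell_small[OF gr] in auto)
qed

lemma Cgrid_pos: "0 < Cgrid"
proof -
  \<comment> \<open>The zero function and the empty set instantiate the locale merely to read off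
    the sign of the constant.\<close>
  have "sparse_setting (grid_cell 1 (\<lambda>_. 0)) (\<lambda>i. 1 / 2 ^ i) b \<kappa> w \<beta> \<gamma> p u0 v0 C1 C2 (\<lambda>_. 0) (\<lambda>y. epow 0 p * ennreal (\<nu> y)) {}"
    by (rule sparse_setting_cell) (use p in \<open>auto intro!: dyadic_grid_grid_cell\<close>)
  then show ?thesis unfolding Cgrid_def by (rule sparse_setting.weak_const_pos)
qed

lemma grid_operator_weak_type:
  assumes gr: "dyadic_grid cell len" and f: "f \<in> borel_measurable lebesgue"
    and fin: "(\<integral>\<^sup>+y. epow (f y) p * ennreal (\<nu> y) \<partial>lebesgue) < \<infinity>"
    and E: "E \<in> sets lebesgue" "emeasure W E < \<infinity>"
    and l: "0 < l" "\<And>x. x \<in> E \<Longrightarrow> ennreal l \<le> grid_operator cell len b \<gamma> f N x"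
  shows "ennreal (l powr p) * emeasure W E \<le> ennreal Cgrid * (\<integral>\<^sup>+y. epow (f y) p * ennreal (\<nu> y) \<partial>lebesgue)"
  unfolding Cgrid_def
  by (rule sparse_setting.grid_weak_type[OF sparse_setting_cell[OF gr f fin E] l])

text \<open>The constant of \<open>truncated_operator_le_grid\<close> times the number of shifts:
  where the truncated operator reaches \<open>l\<close>, at least one of the grid operators reaches
  \<open>l / c24\<close>.\<close>

definition "c24 = 24 powr (real CARD('n) - \<gamma>) * real (card (shifts :: ('n \<Rightarrow> int) set))"
definition "Cloc = real (card (shifts :: ('n \<Rightarrow> int) set)) * Cgrid * c24 powr p"

lemma shifts_pos: "0 < card (shifts :: ('n \<Rightarrow> int) set)"
proof -
  have "(\<lambda>_. 0) \<in> (shifts :: ('n \<Rightarrow> int) set)" by (simp add: shifts_def)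
  then show ?thesis using finite_shifts by (metis card_gt_0_iff empty_iff)
qed

lemma c24_pos: "0 < c24" using shifts_pos by (simp add: c24_def)

lemma Cloc_pos: "0 < Cloc" unfolding Cloc_def using shifts_pos Cgrid_pos c24_pos by simp

lemma truncated_weak_type:
  assumes f: "f \<in> borel_measurable lebesgue"
    and fin: "(\<integral>\<^sup>+y. epow (f y) p * ennreal (\<nu> y) \<partial>lebesgue) < \<infinity>"
    and E: "E \<in> sets lebesgue" "emeasure W E < \<infinity>"
    and l: "0 < l" "\<And>x. x \<in> E \<Longrightarrow> ennreal l \<le> truncated_operator b \<gamma> f m x"
  shows "ennreal (l powr p) * emeasure W E \<le> ennreal Cloc * (\<integral>\<^sup>+y. epow (f y) p * ennreal (\<nu> y) \<partial>lebesgue)"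
proof -
  let ?L = "\<lambda>i. 2 ^ m / 2 ^ i :: real"
  let ?G = "\<lambda>t. grid_cell (2 ^ m) t :: nat \<Rightarrow> real ^ 'n \<Rightarrow> (real ^ 'n) set"
  let ?m = "real (card (shifts :: ('n \<Rightarrow> int) set))"
  let ?c = "24 powr (real CARD('n) - \<gamma>)"
  define I where "I = (\<integral>\<^sup>+y. epow (f y) p * ennreal (\<nu> y) \<partial>lebesgue)"
  have grid: "dyadic_grid (?G t) ?L" for t by (rule dyadic_grid_grid_cell) simp
  have [measurable]: "grid_operator (?G t) ?L b \<gamma> f (2 * m) \<in> borel_measurable lebesgue" for t
    by (rule dyadic_grid.grid_operator_measurable[OF grid]) (use f in auto)
  define F where "F t = {x \<in> E. ennreal (l / c24) \<le> grid_operator (?G t) ?L b \<gamma> f (2 * m) x}" for t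
  note E(1) [measurable]
  have F [measurable]: "F t \<in> sets lebesgue" for t
  proof -
    have "{x \<in> space lebesgue. ennreal (l / c24) \<le> grid_operator (?G t) ?L b \<gamma> f (2 * m) x} \<in> sets lebesgue" by measurable
    moreover have "F t = E \<inter> {x \<in> space lebesgue. ennreal (l / c24) \<le> grid_operator (?G t) ?L b \<gamma> f (2 * m) x}" by (auto simp: F_def)
    ultimately show ?thesis using E(1) by (simp only: sets.Int)
  qed
  have lc: "0 < l / c24" using l c24_pos by simp
  have sub: "E \<subseteq> (\<Union>t\<in>shifts. F t)"
  proof (rule subsetI, rule ccontr)
    fix x assume x: "x \<in> E" "x \<notin> (\<Union>t\<in>shifts. F t)"
    have "truncated_operator b \<gamma> f m x \<le> (\<Sum>t\<in>shifts. ennreal ?c * grid_operator (?G t) ?L b \<gamma> f (2 * m) x)"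
      by (rule truncated_operator_le_grid) (use f \<gamma> in auto)
    also have "\<dots> < (\<Sum>t\<in>(shifts :: ('n \<Rightarrow> int) set). ennreal ?c * ennreal (l / c24))"
    proof -
      define a where "a t = enn2real (grid_operator (?G t) ?L b \<gamma> f (2 * m) x)" for t
      have lt: "grid_operator (?G t) ?L b \<gamma> f (2 * m) x < ennreal (l / c24)" if "t \<in> shifts" for t
        using x that by (auto simp: F_def not_le)
      have a: "grid_operator (?G t) ?L b \<gamma> f (2 * m) x = ennreal (a t)" "a t < l / c24" if "t \<in> shifts" for t
      proof -
        show 1: "grid_operator (?G t) ?L b \<gamma> f (2 * m) x = ennreal (a t)"
          using lt[OF that] unfolding a_def by (intro ennreal_enn2real[symmetric]) (auto intro: less_trans)
        show "a t < l / c24" using lt[OF that] unfolding 1 by (simp add: ennreal_less_iff a_def)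
      qed
      have a0: "0 \<le> a t" for t by (simp add: a_def)
      have "(\<Sum>t\<in>shifts. ennreal ?c * grid_operator (?G t) ?L b \<gamma> f (2 * m) x) = (\<Sum>t\<in>shifts. ennreal (?c * a t))"
        using a a0 by (intro sum.cong refl) (simp add: ennreal_mult)
      also have "\<dots> = ennreal (\<Sum>t\<in>shifts. ?c * a t)" by (rule sum_ennreal) (use a0 in auto)
      also have "\<dots> < ennreal (\<Sum>t\<in>(shifts :: ('n \<Rightarrow> int) set). ?c * (l / c24))"
      proof (rule ennreal_lessI)
        show "(\<Sum>t\<in>shifts. ?c * a t) < (\<Sum>t\<in>(shifts :: ('n \<Rightarrow> int) set). ?c * (l / c24))"
        proof (rule sum_strict_mono)
          show "(shifts :: ('n \<Rightarrow> int) set) \<noteq> {}" using shifts_pos by auto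
          show "?c * a t < ?c * (l / c24)" if "t \<in> shifts" for t
            using a(2)[OF that] by (intro mult_strict_left_mono) auto
        qed (rule finite_shifts)
        show "0 < (\<Sum>t\<in>(shifts :: ('n \<Rightarrow> int) set). ?c * (l / c24))" using l(1) c24_pos shifts_pos by simp
      qed
      also have "\<dots> = (\<Sum>t\<in>(shifts :: ('n \<Rightarrow> int) set). ennreal (?c * (l / c24)))"
        by (rule sum_ennreal[symmetric]) (use l(1) c24_pos in auto)
      also have "\<dots> = (\<Sum>t\<in>(shifts :: ('n \<Rightarrow> int) set). ennreal ?c * ennreal (l / c24))"
        using l(1) c24_pos by (intro sum.cong refl ennreal_mult) auto
      finally show ?thesis .
    qed
    also have "\<dots> = ennreal l"
    proof -
      have "ennreal ?c * ennreal (l / c24) = ennreal (?c * (l / c24))" using l(1) c24_pos by (intro ennreal_mult[symmetric]) auto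
      then have "(\<Sum>t\<in>(shifts :: ('n \<Rightarrow> int) set). ennreal ?c * ennreal (l / c24)) = ennreal ?m * ennreal (?c * (l / c24))"
        by (simp add: ennreal_of_nat_eq_real_of_nat)
      also have "\<dots> = ennreal (?m * (?c * (l / c24)))" using l(1) c24_pos by (intro ennreal_mult[symmetric]) auto
      also have "?m * (?c * (l / c24)) = l" using c24_pos shifts_pos by (simp add: c24_def)
      finally show ?thesis .
    qed
    finally show False using l(2)[OF x(1)] by simp
  qed
  have Fle: "ennreal ((l / c24) powr p) * emeasure W (F t) \<le> ennreal Cgrid * I" for t
    unfolding I_def
  proof (rule grid_operator_weak_type[OF grid f fin F _ lc])
    have "emeasure W (F t) \<le> emeasure W E" by (rule emeasure_mono) (auto simp: F_def)
    then show "emeasure W (F t) < \<infinity>" using E(2) by (rule le_less_trans)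
  qed (auto simp: F_def)
  have "ennreal ((l / c24) powr p) * emeasure W E \<le> ennreal ((l / c24) powr p) * (\<Sum>t\<in>shifts. emeasure W (F t))"
  proof (rule mult_left_mono)
    have "emeasure W E \<le> emeasure W (\<Union>t\<in>shifts. F t)" by (rule emeasure_mono[OF sub]) (auto intro: sets.finite_UN finite_shifts)
    also have "\<dots> \<le> (\<Sum>t\<in>shifts. emeasure W (F t))" by (rule emeasure_subadditive_finite) (auto intro: finite_shifts)
    finally show "emeasure W E \<le> (\<Sum>t\<in>shifts. emeasure W (F t))" .
  qed simp
  also have "\<dots> \<le> (\<Sum>t\<in>(shifts :: ('n \<Rightarrow> int) set). ennreal Cgrid * I)"
    unfolding sum_distrib_left by (intro sum_mono Fle)
  also have "\<dots> = ennreal ?m * (ennreal Cgrid * I)" by (simp add: ennreal_of_nat_eq_real_of_nat)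
  finally have le: "ennreal ((l / c24) powr p) * emeasure W E \<le> ennreal ?m * (ennreal Cgrid * I)" .
  have "l powr p = c24 powr p * (l / c24) powr p" using l c24_pos by (simp add: powr_divide)
  then have "ennreal (l powr p) * emeasure W E = ennreal (c24 powr p) * (ennreal ((l / c24) powr p) * emeasure W E)"
    by (simp add: ennreal_mult mult.assoc)
  also have "\<dots> \<le> ennreal (c24 powr p) * (ennreal ?m * (ennreal Cgrid * I))"
    by (rule mult_left_mono[OF le]) simp
  also have "\<dots> = ennreal Cloc * I"
    unfolding Cloc_def using Cgrid_pos by (simp add: ennreal_mult ac_simps)
  finally show ?thesis unfolding I_def .
qed

text \<open>Monotone convergence in the truncation. Boundedness of \<open>B\<close> guarantees that
  the level sets have finite weight, as the absorption in \<open>grid_weak_type\<close> requires;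
  the constant does not depend on \<open>B\<close>.\<close>

theorem full_operator_weak_type:
  assumes f: "f \<in> borel_measurable lebesgue" and B: "bounded B" "B \<in> sets lebesgue" and l: "0 < l"
  shows "ennreal (l powr p) * emeasure W {x \<in> B. ennreal l < full_operator b \<gamma> f x}
     \<le> ennreal Cloc * (\<integral>\<^sup>+y. epow (f y) p * ennreal (\<nu> y) \<partial>lebesgue)"
proof (cases "(\<integral>\<^sup>+y. epow (f y) p * ennreal (\<nu> y) \<partial>lebesgue) = \<infinity>")
  case True
  then show ?thesis using Cloc_pos by (simp add: ennreal_mult_top)
next
  case False
  then have fin: "(\<integral>\<^sup>+y. epow (f y) p * ennreal (\<nu> y) \<partial>lebesgue) < \<infinity>" by (simp add: less_top)
  define E where "E m = {x \<in> B. ennreal l < truncated_operator b \<gamma> f m x}" for m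
  have tm [measurable]: "truncated_operator b \<gamma> f m \<in> borel_measurable lebesgue" for m
    by (rule truncated_operator_measurable) (use f in auto)
  have E: "E m \<in> sets lebesgue" for m
  proof -
    have "{x \<in> space lebesgue. ennreal l < truncated_operator b \<gamma> f m x} \<in> sets lebesgue" by measurable
    moreover have "E m = B \<inter> {x \<in> space lebesgue. ennreal l < truncated_operator b \<gamma> f m x}" by (auto simp: E_def)
    ultimately show ?thesis using B(2) by (simp only: sets.Int)
  qed
  have "{x \<in> B. ennreal l < full_operator b \<gamma> f x} = (\<Union>m. E m)"
    unfolding truncated_operator_SUP[OF measurable_weights(1) f, symmetric] by (auto simp: E_def less_SUP_iff)
  moreover have "emeasure W (\<Union>m. E m) = (SUP m. emeasure W (E m))"
  proof (rule SUP_emeasure_incseq[symmetric])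
    show "range E \<subseteq> sets W" using E by auto
    show "incseq E" unfolding incseq_def E_def using truncated_operator_mono by (fastforce intro: less_le_trans)
  qed
  moreover have "ennreal (l powr p) * (SUP m. emeasure W (E m)) \<le> ennreal Cloc * (\<integral>\<^sup>+y. epow (f y) p * ennreal (\<nu> y) \<partial>lebesgue)"
    unfolding SUP_mult_left_ennreal[symmetric]
  proof (subst SUP_mult_left_ennreal, rule SUP_least)
    fix m
    have "emeasure W (E m) \<le> emeasure W B" by (rule emeasure_mono) (use B in \<open>auto simp: E_def\<close>)
    then have "emeasure W (E m) < \<infinity>" using wmeasure_bounded_finite[OF w B(1)] by (rule le_less_trans)
    then show "ennreal (l powr p) * emeasure W (E m) \<le> ennreal Cloc * (\<integral>\<^sup>+y. epow (f y) p * ennreal (\<nu> y) \<partial>lebesgue)"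
      by (intro truncated_weak_type[OF f fin E _ l, of m m]) (auto simp: E_def less_imp_le)
  qed
  ultimately show ?thesis by simp
qed

end

section \<open>Local and far parts on a ball\<close>

lemma epow_neg_cancel:
  assumes "x \<noteq> 0" "x \<noteq> \<infinity>"
  shows "epow x a * epow x (- a) = 1"
  using epow_add[OF assms, of a "- a"] by simp

context two_weight
begin

lemma ball_ratio:
  fixes y :: "real ^ 'n"
  assumes "0 < s" "0 < k"
  shows "measure lebesgue (ball y (k * s)) = k ^ CARD('n) * measure lebesgue (ball y s)"
proof -
  have "0 \<le> k * s" "0 \<le> s" using assms by auto
  then show ?thesis by (simp only: measure_ball_cart power_mult_distrib ac_simps)
qed

text \<open>The cell of side 12 s and the ball of radius s both lie in the ball of radius 24 n s.
  The two summands are the costs of comparing their means with the mean over that ball.\<close>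

definition "\<kappa>2 = M * (V + (24 * real CARD('n)) ^ CARD('n))"
definition "\<kappa>3 = M * 2 ^ CARD('n)"

lemma \<kappa>s_pos: "0 < \<kappa>2" "0 < \<kappa>3"
  using M V_pos by (auto simp: \<kappa>2_def \<kappa>3_def intro!: mult_pos_pos add_pos_pos)

lemma W_ball_nontriv: "0 < \<rho> \<Longrightarrow> emeasure W (ball y \<rho>) \<noteq> 0" "emeasure W (ball y \<rho>) \<noteq> \<infinity>"
  using w_ball_pos[of \<rho> y] W_finite[of "ball y \<rho>"] by auto

lemma doubling:
  assumes \<rho>: "0 < \<rho>" and k: "1 \<le> k"
  shows "emeasure W (ball y (k * \<rho>)) \<le> ennreal (A * (k ^ CARD('n)) powr q) * emeasure W (ball y \<rho>)"
proof -
  have kp: "0 < k" "0 < k * \<rho>" using assms by auto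
  have "measure W (ball y (k * \<rho>)) \<le> A * (measure lebesgue (ball y (k * \<rho>)) / measure lebesgue (ball y \<rho>)) powr q * measure W (ball y \<rho>)"
  proof (rule A_inf_real[OF kp(2)])
    show "ball y \<rho> \<subseteq> ball y (k * \<rho>)"
      using mult_right_mono[OF k, of \<rho>] \<rho> by (intro subset_ball) simp
    show "0 < measure lebesgue (ball y \<rho>)" by (rule ball_lebesgue(2)[OF \<rho>])
  qed simp
  also have "measure lebesgue (ball y (k * \<rho>)) / measure lebesgue (ball y \<rho>) = k ^ CARD('n)"
    using ball_lebesgue(2)[OF \<rho>, of y] by (simp add: ball_ratio[OF \<rho> kp(1)])
  finally show ?thesis
    using A by (simp add: W_finite ennreal_leI flip: ennreal_mult)
qed

definition "K\<theta> = max 2 (A * 2 powr q)"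
definition "\<theta>0 = 1 - 1 / K\<theta>"

lemma \<theta>0: "0 < \<theta>0" "\<theta>0 < 1"
proof -
  have "2 \<le> K\<theta>" by (simp add: K\<theta>_def)
  then show "0 < \<theta>0" "\<theta>0 < 1" by (auto simp: \<theta>0_def)
qed

text \<open>The shell between the two balls has at least half of the Lebesgue measure of the larger
  one, as 2^n \<ge> 2, so the A-infinity lower bound gives it the fraction
  \<open>1 / K\<theta>\<close> of the weight.\<close>

lemma reverse_doubling:
  assumes \<rho>: "0 < \<rho>"
  shows "measure W (ball y \<rho>) \<le> \<theta>0 * measure W (ball y (2 * \<rho>))"
proof -
  let ?B = "ball y \<rho>" and ?B2 = "ball y (2 * \<rho>)"
  have sub: "?B \<subseteq> ?B2" using \<rho> by (intro subset_ball) simp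
  have lp: "0 < measure lebesgue ?B" by (rule ball_lebesgue(2)[OF \<rho>])
  have r: "measure lebesgue ?B2 = 2 ^ CARD('n) * measure lebesgue ?B" by (rule ball_ratio[OF \<rho>]) simp
  have "(2::real) ^ 1 \<le> 2 ^ CARD('n)" by (intro power_increasing) auto
  then have two: "2 * measure lebesgue ?B \<le> measure lebesgue ?B2" unfolding r using lp by (intro mult_right_mono) auto
  have "measure lebesgue (?B2 - ?B) = measure lebesgue ?B2 - measure lebesgue ?B"
    by (rule measurable_measure_Diff[OF lmeasurable_ball _ sub]) simp
  then have d: "measure lebesgue ?B2 / 2 \<le> measure lebesgue (?B2 - ?B)" using two by simp
  then have dp: "0 < measure lebesgue (?B2 - ?B)" using two lp by linarith
  have "measure W ?B2 \<le> A * (measure lebesgue ?B2 / measure lebesgue (?B2 - ?B)) powr q * measure W (?B2 - ?B)"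
    by (rule A_inf_real[OF _ _ _ dp]) (use \<rho> in auto)
  also have "\<dots> \<le> A * 2 powr q * measure W (?B2 - ?B)"
  proof (intro mult_right_mono mult_left_mono powr_mono2)
    show "measure lebesgue ?B2 / measure lebesgue (?B2 - ?B) \<le> 2" using d dp by (simp add: pos_divide_le_eq)
  qed (use A q dp in auto)
  also have "\<dots> \<le> K\<theta> * measure W (?B2 - ?B)" by (intro mult_right_mono) (auto simp: K\<theta>_def)
  finally have 1: "measure W ?B2 / K\<theta> \<le> measure W (?B2 - ?B)" by (simp add: pos_divide_le_eq mult.commute K\<theta>_def)
  have "emeasure W ?B + emeasure W (?B2 - ?B) = emeasure W ?B2"
    using sub by (subst plus_emeasure) (auto intro!: arg_cong[where f="emeasure W"])
  then have "ennreal (measure W ?B + measure W (?B2 - ?B)) = ennreal (measure W ?B2)"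
    using bounded_subset[OF bounded_ball, of "?B2 - ?B" y "2 * \<rho>"] by (simp add: W_finite)
  then have "measure W ?B + measure W (?B2 - ?B) = measure W ?B2" by (subst (asm) ennreal_inj) auto
  then show ?thesis using 1 by (simp add: \<theta>0_def left_diff_distrib)
qed

lemma reverse_doubling_power:
  assumes \<rho>: "0 < \<rho>"
  shows "measure W (ball y \<rho>) \<le> \<theta>0 ^ j * measure W (ball y (2 ^ j * \<rho>))"
proof (induction j)
  case (Suc j)
  have "\<theta>0 ^ j * measure W (ball y (2 ^ j * \<rho>)) \<le> \<theta>0 ^ j * (\<theta>0 * measure W (ball y (2 * (2 ^ j * \<rho>))))"
    by (intro mult_left_mono reverse_doubling) (use \<rho> \<theta>0 in auto)
  then show ?case using Suc by (simp add: ac_simps)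
qed simp

lemma ball_mean_doubling:
  assumes \<rho>: "0 < \<rho>"
  shows "\<bar>average (ball y (2 ^ j * \<rho>)) b - average (ball y \<rho>) b\<bar> \<le> \<kappa>3 * real j"
proof (induction j)
  case (Suc j)
  have s: "0 < 2 ^ j * \<rho>" "0 < 2 * (2 ^ j * \<rho>)" using \<rho> by auto
  have "\<bar>average (ball y (2 ^ j * \<rho>)) b - average (ball y (2 * (2 ^ j * \<rho>))) b\<bar> * measure lebesgue (ball y (2 ^ j * \<rho>))
     \<le> M * measure lebesgue (ball y (2 * (2 ^ j * \<rho>)))"
  proof (rule oscillation_subset(1)[OF s(2)])
    show "ball y (2 ^ j * \<rho>) \<subseteq> ball y (2 * (2 ^ j * \<rho>))" using \<rho> by (intro subset_ball) simp
  qed simp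
  also have "\<dots> = \<kappa>3 * measure lebesgue (ball y (2 ^ j * \<rho>))"
    by (subst ball_ratio[OF s(1)]) (auto simp: \<kappa>3_def)
  finally have "\<bar>average (ball y (2 ^ j * \<rho>)) b - average (ball y (2 * (2 ^ j * \<rho>))) b\<bar> \<le> \<kappa>3"
    using ball_lebesgue(2)[OF s(1), of y] by (subst (asm) mult_le_cancel_right_pos) auto
  then show ?case using Suc by (simp add: mult.assoc distrib_left)
qed simp

text \<open>The bridge from cells to balls: a shifted grid whose coarsest cell at \<open>y\<close>
  contains the ball, so that estimates proved on cells become available on balls. The side 12 s is
  what the one-third trick asks for.\<close>

lemma cell_around_ball:
  fixes y :: "real ^ 'n"
  assumes s: "0 < s"
  obtains cell len where "dyadic_grid cell len" "len 0 = 12 * s" "ball y s \<subseteq> cell 0 y"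
    "cell 0 y \<subseteq> ball y (24 * real CARD('n) * s)"
    "\<bar>average (cell 0 y) b - average (ball y s) b\<bar> \<le> \<kappa>2"
proof -
  obtain t where t: "\<And>z. (\<forall>j. \<bar>z $ j - y $ j\<bar> \<le> s) \<Longrightarrow> z \<in> grid_cell (12 * s) t 0 y"
    using ball_in_grid_cell[of "12 * s" s 0 y] s by auto
  have gr: "dyadic_grid (grid_cell (12 * s) t) (\<lambda>i. 12 * s / 2 ^ i)"
    by (rule dyadic_grid_grid_cell) (use s in simp)
  interpret dyadic_grid "grid_cell (12 * s) t" "\<lambda>i. 12 * s / 2 ^ i" by (rule gr)
  let ?P = "grid_cell (12 * s) t 0 y" and ?B = "ball y (24 * real CARD('n) * s)"
  have sub1: "ball y s \<subseteq> ?P"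
  proof
    fix z assume z: "z \<in> ball y s"
    have "\<bar>z $ j - y $ j\<bar> \<le> s" for j
      using z component_le_norm_cart[of "z - y" j] by (auto simp: dist_norm norm_minus_commute)
    then show "z \<in> ?P" using t by blast
  qed
  have sub2: "?P \<subseteq> ?B" using cell_subset_ball[of 0 y] by (simp add: ac_simps)
  have \<rho>: "0 < 24 * real CARD('n) * s" using s by simp
  have B1: "measure lebesgue ?B = V * (12 * s) ^ CARD('n)"
    using measure_cell_ball[of "12 * s" y] s by (simp add: ac_simps)
  have B2: "measure lebesgue ?B = (24 * real CARD('n)) ^ CARD('n) * measure lebesgue (ball y s)"
    by (rule ball_ratio[OF s]) simp
  have "\<bar>average ?P b - average ?B b\<bar> * measure lebesgue ?P \<le> M * measure lebesgue ?B"
    by (rule oscillation_subset(1)[OF \<rho> cell_sets sub2])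
  then have "\<bar>average ?P b - average ?B b\<bar> * (12 * s) ^ CARD('n) \<le> (M * V) * (12 * s) ^ CARD('n)"
    unfolding B1 measure_cell by (simp add: mult.assoc)
  then have 1: "\<bar>average ?P b - average ?B b\<bar> \<le> M * V"
    by (subst (asm) mult_le_cancel_right_pos) (use s in auto)
  have "\<bar>average (ball y s) b - average ?B b\<bar> * measure lebesgue (ball y s) \<le> M * measure lebesgue ?B"
    by (rule oscillation_subset(1)[OF \<rho>]) (use sub1 sub2 in auto)
  then have "\<bar>average (ball y s) b - average ?B b\<bar> * measure lebesgue (ball y s) \<le> (M * (24 * real CARD('n)) ^ CARD('n)) * measure lebesgue (ball y s)"
    unfolding B2 by (simp add: mult.assoc)
  then have 2: "\<bar>average (ball y s) b - average ?B b\<bar> \<le> M * (24 * real CARD('n)) ^ CARD('n)"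
    using ball_lebesgue(2)[OF s, of y] by (subst (asm) mult_le_cancel_right_pos) auto
  have "\<bar>average ?P b - average (ball y s) b\<bar> \<le> \<kappa>2"
    using 1 2 unfolding \<kappa>2_def distrib_left by linarith
  then show ?thesis using that[OF gr _ sub1 sub2] by simp
qed

lemma change_mean: "\<bar>a - c\<bar> \<le> \<kappa>2 \<Longrightarrow> \<bar>t - c\<bar> + 1 \<le> (1 + \<kappa>2) * (\<bar>t - a\<bar> + 1)"
proof -
  assume "\<bar>a - c\<bar> \<le> \<kappa>2"
  then have "\<bar>t - c\<bar> \<le> \<bar>t - a\<bar> + \<kappa>2" by linarith
  moreover have "0 \<le> \<kappa>2 * \<bar>t - a\<bar>" using \<kappa>s_pos by simp
  moreover have "(1 + \<kappa>2) * (\<bar>t - a\<bar> + 1) = \<bar>t - a\<bar> + \<kappa>2 * \<bar>t - a\<bar> + 1 + \<kappa>2" by (simp add: algebra_simps)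
  ultimately show ?thesis by linarith
qed

definition "ball_norm f y s = epow (\<integral>\<^sup>+z\<in>ball y s. epow (f z) p * ennreal (\<nu> z) \<partial>lebesgue) (1 / p)"

definition "Ce = (1 + \<kappa>2) * C2 * 12 powr (real CARD('n) - \<gamma>)"

lemma Ce_pos: "0 < Ce" unfolding Ce_def using \<kappa>s_pos C2_pos by simp

text \<open>\<open>bump_cell\<close> for \<open>f\<close> restricted to the ball, in a cell around
  the ball, solved for the integral. The scale factor s^(n-\<gamma>) cancels against the size of the
  kernel at distances comparable to s.\<close>

lemma ball_integral_le:
  fixes f :: "real ^ 'n \<Rightarrow> ennreal"
  assumes f [measurable]: "f \<in> borel_measurable lebesgue" and s: "0 < s"
  shows "(\<integral>\<^sup>+z\<in>ball y s. ennreal (\<bar>b z - average (ball y s) b\<bar> + 1) * f z \<partial>lebesgue)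
    \<le> ennreal (Ce * s powr (real CARD('n) - \<gamma>)) * (ball_norm f y s * epow (emeasure W (ball y s)) (- 1 / p))"
proof -
  obtain cell len where gr: "dyadic_grid cell len" and l0: "len 0 = 12 * s" and sub: "ball y s \<subseteq> cell 0 y"
    and mean: "\<bar>average (cell 0 y) b - average (ball y s) b\<bar> \<le> \<kappa>2"
    using cell_around_ball[OF s] by metis
  interpret dyadic_grid cell len by (rule gr)
  let ?B = "ball y s" and ?P = "cell 0 y"
  have [measurable]: "?B \<in> sets lebesgue" by simp
  define I where "I = (\<integral>\<^sup>+z\<in>?B. ennreal (\<bar>b z - average ?B b\<bar> + 1) * f z \<partial>lebesgue)"
  define J where "J = (\<integral>\<^sup>+z\<in>?P. ennreal (\<bar>b z - average ?P b\<bar> + 1) * (f z * indicator ?B z) \<partial>lebesgue)"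
  define N where "N = ball_norm f y s"
  define wB where "wB = emeasure W ?B"
  have wB: "wB \<noteq> 0" "wB \<noteq> \<infinity>" unfolding wB_def using W_ball_nontriv s by auto
  have lp: "0 < len 0 powr \<gamma>" "0 < len 0 ^ CARD('n)" using l0 s by auto
  have "I \<le> (\<integral>\<^sup>+z. ennreal (1 + \<kappa>2) * (ennreal (\<bar>b z - average ?P b\<bar> + 1) * (f z * indicator ?B z) * indicator ?P z) \<partial>lebesgue)"
    unfolding I_def
  proof (rule nn_integral_mono)
    fix z
    have "ennreal (\<bar>b z - average ?B b\<bar> + 1) \<le> ennreal (1 + \<kappa>2) * ennreal (\<bar>b z - average ?P b\<bar> + 1)"
      using change_mean[OF mean, of "b z"] \<kappa>s_pos by (subst ennreal_mult[symmetric]) (auto intro: ennreal_leI simp del: ennreal_plus)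
    then have "ennreal (\<bar>b z - average ?B b\<bar> + 1) * f z \<le> ennreal (1 + \<kappa>2) * ennreal (\<bar>b z - average ?P b\<bar> + 1) * f z"
      by (rule mult_right_mono) simp
    then show "ennreal (\<bar>b z - average ?B b\<bar> + 1) * f z * indicator ?B z
      \<le> ennreal (1 + \<kappa>2) * (ennreal (\<bar>b z - average ?P b\<bar> + 1) * (f z * indicator ?B z) * indicator ?P z)"
      using sub by (cases "z \<in> ?B") (simp_all add: subset_eq mult.assoc del: ennreal_plus)
  qed
  also have "\<dots> = ennreal (1 + \<kappa>2) * J" unfolding J_def by (rule nn_integral_cmult) measurable
  finally have IJ: "I \<le> ennreal (1 + \<kappa>2) * J" .
  have "ennreal (len 0 powr \<gamma>) * epow wB (1 / p) * J \<le> ennreal (len 0 powr \<gamma>) * epow (emeasure W ?P) (1 / p) * J"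
    unfolding wB_def using p by (intro mult_right_mono mult_left_mono epow_mono emeasure_mono sub) auto
  also have "\<dots> \<le> ennreal (C2 * len 0 ^ CARD('n)) * epow (\<integral>\<^sup>+z\<in>?P. epow (f z * indicator ?B z) p * ennreal (\<nu> z) \<partial>lebesgue) (1 / p)"
    unfolding J_def by (rule bump_cell[OF gr]) measurable
  also have "(\<integral>\<^sup>+z\<in>?P. epow (f z * indicator ?B z) p * ennreal (\<nu> z) \<partial>lebesgue) = (\<integral>\<^sup>+z\<in>?B. epow (f z) p * ennreal (\<nu> z) \<partial>lebesgue)"
    using sub p by (intro nn_integral_cong) (auto simp: indicator_def)
  finally have J: "ennreal (len 0 powr \<gamma>) * epow wB (1 / p) * J \<le> ennreal (C2 * len 0 ^ CARD('n)) * N"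
    unfolding N_def ball_norm_def .
  \<comment> \<open>Cancelling w(B)^(1/p) is possible because the weight of the ball is neither 0
    nor \<infinity>.\<close>
  have "J = ennreal (len 0 powr - \<gamma>) * epow wB (- (1 / p)) * (ennreal (len 0 powr \<gamma>) * epow wB (1 / p) * J)"
  proof -
    have "ennreal (len 0 powr - \<gamma>) * ennreal (len 0 powr \<gamma>) = 1"
      using l0 s by (simp add: powr_add[symmetric] flip: ennreal_mult)
    then have "ennreal (len 0 powr - \<gamma>) * epow wB (- (1 / p)) * (ennreal (len 0 powr \<gamma>) * epow wB (1 / p) * J)
      = 1 * (epow wB (1 / p) * epow wB (- (1 / p))) * J"
      by (metis (no_types, opaque_lifting) mult.assoc mult.commute)
    then show ?thesis using epow_neg_cancel[OF wB, of "1 / p"] by simp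
  qed
  also have "\<dots> \<le> ennreal (len 0 powr - \<gamma>) * epow wB (- (1 / p)) * (ennreal (C2 * len 0 ^ CARD('n)) * N)"
    by (rule mult_left_mono[OF J]) simp
  finally have "I \<le> ennreal (1 + \<kappa>2) * (ennreal (len 0 powr - \<gamma>) * epow wB (- (1 / p)) * (ennreal (C2 * len 0 ^ CARD('n)) * N))"
    using IJ by (meson mult_left_mono order_trans zero_le)
  also have "\<dots> = (ennreal (1 + \<kappa>2) * ennreal (len 0 powr - \<gamma>) * ennreal (C2 * len 0 ^ CARD('n))) * (N * epow wB (- (1 / p)))"
    by (simp only: ac_simps)
  also have "ennreal (1 + \<kappa>2) * ennreal (len 0 powr - \<gamma>) * ennreal (C2 * len 0 ^ CARD('n)) = ennreal ((1 + \<kappa>2) * len 0 powr - \<gamma> * (C2 * len 0 ^ CARD('n)))"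
    using \<kappa>s_pos C2_pos lp by (simp add: ennreal_mult del: ennreal_plus)
  also have "(1 + \<kappa>2) * len 0 powr - \<gamma> * (C2 * len 0 ^ CARD('n)) = Ce * s powr (real CARD('n) - \<gamma>)"
  proof -
    have l: "0 < len 0" using l0 s by simp
    have "len 0 powr - \<gamma> * len 0 ^ CARD('n) = len 0 powr (real CARD('n) - \<gamma>)"
      using l by (simp add: powr_diff powr_minus_divide powr_realpow)
    also have "\<dots> = 12 powr (real CARD('n) - \<gamma>) * s powr (real CARD('n) - \<gamma>)"
      unfolding l0 using s by (simp add: powr_mult)
    finally have "len 0 powr - \<gamma> * len 0 ^ CARD('n) = 12 powr (real CARD('n) - \<gamma>) * s powr (real CARD('n) - \<gamma>)" .
    then show ?thesis unfolding Ce_def by (simp add: mult.assoc mult.left_commute)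
  qed
  finally show ?thesis by (simp add: I_def N_def wB_def)
qed

definition "Cb = (1 + \<kappa>2) powr p * ((1 + p / cW) powr p * CW) * (A * ((24 * real CARD('n)) ^ CARD('n)) powr q)"

lemma Cb_pos: "0 < Cb"
proof -
  have "0 < p / cW" using p consts_pos by simp
  then have "1 + p / cW \<noteq> 0" by linarith
  then show ?thesis unfolding Cb_def using \<kappa>s_pos consts_pos A by auto
qed

text \<open>The John--Nirenberg bound on the cell around the ball; doubling brings the weight of the
  cell back to that of the ball.\<close>

lemma ball_deviation_power_le:
  assumes s: "0 < s"
  shows "(\<integral>\<^sup>+z\<in>ball y s. ennreal ((\<bar>b z - average (ball y s) b\<bar> + 1) powr p) \<partial>W) \<le> ennreal Cb * emeasure W (ball y s)"
proof -
  obtain cell len where gr: "dyadic_grid cell len" and sub: "ball y s \<subseteq> cell 0 y"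
    and sub2: "cell 0 y \<subseteq> ball y (24 * real CARD('n) * s)"
    and mean: "\<bar>average (cell 0 y) b - average (ball y s) b\<bar> \<le> \<kappa>2"
    using cell_around_ball[OF s] by metis
  interpret dyadic_grid cell len by (rule gr)
  let ?B = "ball y s" and ?P = "cell 0 y"
  have "(\<integral>\<^sup>+z\<in>?B. ennreal ((\<bar>b z - average ?B b\<bar> + 1) powr p) \<partial>W)
    \<le> (\<integral>\<^sup>+z. ennreal ((1 + \<kappa>2) powr p) * (ennreal ((\<bar>b z - average ?P b\<bar> + 1) powr p) * indicator ?P z) \<partial>W)"
  proof (rule nn_integral_mono)
    fix z
    have "(\<bar>b z - average ?B b\<bar> + 1) powr p \<le> ((1 + \<kappa>2) * (\<bar>b z - average ?P b\<bar> + 1)) powr p"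
      using change_mean[OF mean, of "b z"] p by (intro powr_mono2) auto
    also have "\<dots> = (1 + \<kappa>2) powr p * (\<bar>b z - average ?P b\<bar> + 1) powr p"
      by (rule powr_mult)
    finally have "ennreal ((\<bar>b z - average ?B b\<bar> + 1) powr p) \<le> ennreal ((1 + \<kappa>2) powr p) * ennreal ((\<bar>b z - average ?P b\<bar> + 1) powr p)"
      by (simp add: ennreal_leI flip: ennreal_mult)
    then show "ennreal ((\<bar>b z - average ?B b\<bar> + 1) powr p) * indicator ?B z
      \<le> ennreal ((1 + \<kappa>2) powr p) * (ennreal ((\<bar>b z - average ?P b\<bar> + 1) powr p) * indicator ?P z)"
      using sub by (auto simp: indicator_def)
  qed
  also have "\<dots> = ennreal ((1 + \<kappa>2) powr p) * (\<integral>\<^sup>+z\<in>?P. ennreal ((\<bar>b z - average ?P b\<bar> + 1) powr p) \<partial>W)"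
    by (rule nn_integral_cmult) measurable
  also have "\<dots> \<le> ennreal ((1 + \<kappa>2) powr p) * (ennreal ((1 + p / cW) powr p * CW) * emeasure W ?P)"
    by (intro mult_left_mono deviation_power_W[OF gr]) (use p in auto)
  also have "\<dots> \<le> ennreal ((1 + \<kappa>2) powr p) * (ennreal ((1 + p / cW) powr p * CW) * (ennreal (A * ((24 * real CARD('n)) ^ CARD('n)) powr q) * emeasure W ?B))"
  proof (intro mult_left_mono)
    have "emeasure W ?P \<le> emeasure W (ball y ((24 * real CARD('n)) * s))" by (rule emeasure_mono[OF sub2]) simp
    also have "\<dots> \<le> ennreal (A * ((24 * real CARD('n)) ^ CARD('n)) powr q) * emeasure W ?B"
      by (rule doubling[OF s]) (use zero_less_card_finite[where 'a='n] in linarith)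
    finally show "emeasure W ?P \<le> ennreal (A * ((24 * real CARD('n)) ^ CARD('n)) powr q) * emeasure W ?B" .
  qed auto
  also have "\<dots> = ennreal Cb * emeasure W ?B"
    unfolding Cb_def using consts_pos A by (simp add: ennreal_mult mult.assoc)
  finally show ?thesis .
qed

end

section \<open>The commutator itself: domination, integrability, measurability\<close>

lemma commutator_le_full_operator:
  "ennreal \<bar>commutator b \<gamma> f x\<bar> \<le> ennreal \<bar>1 / riesz_constant TYPE('n) \<gamma>\<bar> * full_operator b \<gamma> (\<lambda>y. ennreal \<bar>f y\<bar>) x"
  for b f :: "real ^ 'n \<Rightarrow> real"
proof -
  have "ennreal \<bar>LINT y|lebesgue. commutator_integrand b \<gamma> f x y\<bar> \<le> full_operator b \<gamma> (\<lambda>y. ennreal \<bar>f y\<bar>) x"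
  proof (cases "integrable lebesgue (commutator_integrand b \<gamma> f x)")
    case True
    have "ennreal \<bar>LINT y|lebesgue. commutator_integrand b \<gamma> f x y\<bar> \<le> (\<integral>\<^sup>+y. ennreal (norm (commutator_integrand b \<gamma> f x y)) \<partial>lebesgue)"
      using integral_norm_bound_ennreal[OF True] by simp
    also have "\<dots> = full_operator b \<gamma> (\<lambda>y. ennreal \<bar>f y\<bar>) x"
      unfolding full_operator_def
      by (intro nn_integral_cong) (simp add: commutator_integrand_def kernel_def abs_mult flip: ennreal_mult)
    finally show ?thesis .
  \<comment> \<open>Without integrability the Bochner integral is 0 and the bound is
    trivial.\<close>
  qed (simp add: not_integrable_integral_eq)
  then have "ennreal \<bar>1 / riesz_constant TYPE('n) \<gamma>\<bar> * ennreal \<bar>LINT y|lebesgue. commutator_integrand b \<gamma> f x y\<bar>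
     \<le> ennreal \<bar>1 / riesz_constant TYPE('n) \<gamma>\<bar> * full_operator b \<gamma> (\<lambda>y. ennreal \<bar>f y\<bar>) x"
    by (rule mult_left_mono) simp
  then show ?thesis unfolding commutator_def abs_mult[of "1 / riesz_constant TYPE('n) \<gamma>"]
    by (subst ennreal_mult[OF abs_ge_zero abs_ge_zero])
qed

lemma commutator_integrable:
  fixes b f :: "real ^ 'n \<Rightarrow> real"
  assumes b [measurable]: "b \<in> borel_measurable lebesgue" and [measurable]: "f \<in> borel_measurable lebesgue"
    and fin: "full_operator b \<gamma> (\<lambda>y. ennreal \<bar>f y\<bar>) x < \<infinity>"
  shows "integrable lebesgue (commutator_integrand b \<gamma> f x)"
proof (rule integrableI_bounded)
  note lebesgue_id_borel [measurable]
  show "commutator_integrand b \<gamma> f x \<in> borel_measurable lebesgue"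
    unfolding commutator_integrand_def[abs_def] by measurable
  have "(\<integral>\<^sup>+y. ennreal (norm (commutator_integrand b \<gamma> f x y)) \<partial>lebesgue) = full_operator b \<gamma> (\<lambda>y. ennreal \<bar>f y\<bar>) x"
    unfolding full_operator_def
    by (intro nn_integral_cong) (simp add: commutator_integrand_def kernel_def abs_mult flip: ennreal_mult)
  then show "(\<integral>\<^sup>+y. ennreal (norm (commutator_integrand b \<gamma> f x y)) \<partial>lebesgue) < \<infinity>" using fin by simp
qed

lemma commutator_measurable:
  fixes b f :: "real ^ 'n \<Rightarrow> real"
  assumes b [measurable]: "b \<in> borel_measurable lebesgue" and [measurable]: "f \<in> borel_measurable lebesgue"
  shows "commutator b \<gamma> f \<in> borel_measurable lebesgue"
proof -
  note measurable_lebesgue_pair_diff [measurable]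
  have "(\<lambda>z. (b (fst z) - b (snd z)) * f (snd z) / norm (fst z - snd z) powr (real CARD('n) - \<gamma>)) \<in> borel_measurable (lebesgue \<Otimes>\<^sub>M lebesgue)"
    by measurable
  then have "case_prod (commutator_integrand b \<gamma> f) \<in> borel_measurable (lebesgue \<Otimes>\<^sub>M lebesgue)"
    by (simp add: commutator_integrand_def case_prod_unfold)
  then have [measurable]: "(\<lambda>x. LINT y|lebesgue. commutator_integrand b \<gamma> f x y) \<in> borel_measurable lebesgue"
    by (rule lebesgue.borel_measurable_lebesgue_integral)
  show ?thesis unfolding commutator_def[abs_def] by measurable
qed

section \<open>The far part and the weak estimate on a single ball\<close>

context two_weight
begin

text \<open>The term \<open>j\<close> accounts for one annulus, enlarged to a full ball, and
  \<open>1 + \<kappa>3 * real j\<close> for the growth of the means of \<open>b\<close>. Up to a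
  constant, the sum times w(B)^(1/p) bounds the weak norm of the whole operator on the ball.\<close>

definition "far_sum f y \<rho> = (\<Sum>j. ennreal (1 + \<kappa>3 * real j) * (ball_norm f y (2 ^ j * \<rho>) * epow (emeasure W (ball y (2 ^ j * \<rho>))) (- 1 / p)))"

definition "Cf = Ce * 4 powr (real CARD('n) - \<gamma>)"

lemma Cf_pos: "0 < Cf" unfolding Cf_def using Ce_pos by simp

text \<open>Take \<open>j\<close> least such that \<open>z\<close> lies in the ball of radius 2^j
  \<rho>, and let D be the distance from \<open>y\<close> to \<open>z\<close>. Then D \<ge> 2 \<rho>
  and |x - z| \<ge> D - \<rho> \<ge> D/2 \<ge> 2^j \<rho>/4. The numerator is split at the means
  over the smallest and the largest ball, which differ by at most
  \<open>\<kappa>3 * real j\<close>.\<close>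

lemma kernel_far_le:
  assumes \<rho>: "0 < \<rho>" and x: "x \<in> ball y \<rho>" and z: "z \<notin> ball y (2 * \<rho>)"
  shows "\<exists>j. z \<in> ball y (2 ^ j * \<rho>) \<and> kernel b \<gamma> x z \<le>
     (\<bar>b x - average (ball y \<rho>) b\<bar> + 1) * (1 + \<kappa>3 * real j) * (\<bar>b z - average (ball y (2 ^ j * \<rho>)) b\<bar> + 1) /
     (2 ^ j * \<rho> / 4) powr (real CARD('n) - \<gamma>)"
proof -
  define D where "D = dist y z"
  have D: "2 * \<rho> \<le> D" using z by (simp add: D_def)
  obtain k :: nat where "D / \<rho> < 2 ^ k" using real_arch_pow[of 2 "D / \<rho>"] by auto
  then have k: "D < 2 ^ k * \<rho>" using \<rho> by (simp add: pos_divide_less_eq)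
  define j where "j = (LEAST j. D < 2 ^ j * \<rho>)"
  have j: "D < 2 ^ j * \<rho>" unfolding j_def using k by (rule LeastI)
  have "j \<noteq> 0" using j D \<rho> by (intro notI) simp
  then obtain i where i: "j = Suc i" by (cases j) auto
  have "\<not> D < 2 ^ i * \<rho>" using not_less_Least[of i "\<lambda>j. D < 2 ^ j * \<rho>"] i by (simp add: j_def[symmetric])
  then have Di: "2 ^ j * \<rho> / 2 \<le> D" unfolding i by simp
  have "D \<le> dist y x + dist x z" unfolding D_def by (rule dist_triangle)
  moreover have "dist y x < \<rho>" using x by simp
  ultimately have nx: "2 ^ j * \<rho> / 4 \<le> norm (x - z)" using Di D unfolding dist_norm by linarith
  let ?s = "2 ^ j * \<rho> / 4"
  have s: "0 < ?s" using \<rho> by simp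
  let ?b0 = "average (ball y \<rho>) b" and ?bj = "average (ball y (2 ^ j * \<rho>)) b"
  have bb: "\<bar>b x - b z\<bar> \<le> (\<bar>b x - ?b0\<bar> + 1) * (1 + \<kappa>3 * real j) * (\<bar>b z - ?bj\<bar> + 1)"
  proof -
    \<comment> \<open>Again a product, so that the factor in \<open>x\<close>, the growth in
      \<open>j\<close> and the factor in \<open>z\<close> can be treated separately.\<close>
    have ineq: "u + v + t \<le> (u + 1) * (1 + v) * (t + 1)" if "0 \<le> u" "0 \<le> v" "0 \<le> t" for u v t :: real
    proof -
      have "0 \<le> u * v" "0 \<le> u * t" "0 \<le> v * t" "0 \<le> u * v * t" using that by auto
      moreover have "(u + 1) * (1 + v) * (t + 1) = u * v * t + u * v + u * t + v * t + u + v + t + 1" by (simp add: algebra_simps)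
      ultimately show ?thesis by linarith
    qed
    have "\<bar>b x - b z\<bar> \<le> \<bar>b x - ?b0\<bar> + \<kappa>3 * real j + \<bar>b z - ?bj\<bar>"
      using ball_mean_doubling[OF \<rho>, of y j] by linarith
    also have "\<dots> \<le> (\<bar>b x - ?b0\<bar> + 1) * (1 + \<kappa>3 * real j) * (\<bar>b z - ?bj\<bar> + 1)"
      using \<kappa>s_pos by (intro ineq) auto
    finally show ?thesis .
  qed
  have "?s powr (real CARD('n) - \<gamma>) \<le> norm (x - z) powr (real CARD('n) - \<gamma>)"
    using nx s \<gamma> by (intro powr_mono2) auto
  then have "kernel b \<gamma> x z \<le> \<bar>b x - b z\<bar> / ?s powr (real CARD('n) - \<gamma>)"
    unfolding kernel_def using nx s by (intro divide_left_mono mult_pos_pos) auto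
  also have "\<dots> \<le> (\<bar>b x - ?b0\<bar> + 1) * (1 + \<kappa>3 * real j) * (\<bar>b z - ?bj\<bar> + 1) / ?s powr (real CARD('n) - \<gamma>)"
    by (rule divide_right_mono[OF bb]) simp
  finally show ?thesis using j by (intro exI[of _ j]) (simp add: D_def)
qed

lemma far_operator_le:
  fixes f :: "real ^ 'n \<Rightarrow> ennreal"
  assumes f [measurable]: "f \<in> borel_measurable lebesgue" and \<rho>: "0 < \<rho>" and x: "x \<in> ball y \<rho>"
  shows "full_operator b \<gamma> (\<lambda>z. f z * indicator (- ball y (2 * \<rho>)) z) x
    \<le> ennreal ((\<bar>b x - average (ball y \<rho>) b\<bar> + 1) * Cf) * far_sum f y \<rho>"
proof -
  let ?n = "real CARD('n) - \<gamma>"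
  let ?s = "\<lambda>j::nat. 2 ^ j * \<rho>"
  let ?K = "\<bar>b x - average (ball y \<rho>) b\<bar> + 1"
  have s: "0 < ?s j" for j using \<rho> by simp
  have [measurable]: "ball y (?s j) \<in> sets lebesgue" for j by simp
  define c where "c j = ?K * (1 + \<kappa>3 * real j) / (?s j / 4) powr ?n" for j
  have c: "0 \<le> c j" for j unfolding c_def using \<kappa>s_pos by auto
  define h where "h j z = ennreal (\<bar>b z - average (ball y (?s j)) b\<bar> + 1) * f z * indicator (ball y (?s j)) z" for j z
  have [measurable]: "h j \<in> borel_measurable lebesgue" for j unfolding h_def by measurable
  have "full_operator b \<gamma> (\<lambda>z. f z * indicator (- ball y (2 * \<rho>)) z) x \<le> (\<integral>\<^sup>+z. (\<Sum>j. ennreal (c j) * h j z) \<partial>lebesgue)"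
    unfolding full_operator_def
  proof (rule nn_integral_mono)
    fix z
    show "ennreal (kernel b \<gamma> x z) * (f z * indicator (- ball y (2 * \<rho>)) z) \<le> (\<Sum>j. ennreal (c j) * h j z)"
    proof (cases "z \<in> ball y (2 * \<rho>)")
      case False
      obtain j where j: "z \<in> ball y (?s j)" and k: "kernel b \<gamma> x z \<le> ?K * (1 + \<kappa>3 * real j) * (\<bar>b z - average (ball y (?s j)) b\<bar> + 1) / (?s j / 4) powr ?n"
        using kernel_far_le[OF \<rho> x False] by blast
      have "ennreal (kernel b \<gamma> x z) \<le> ennreal (c j * (\<bar>b z - average (ball y (?s j)) b\<bar> + 1))"
        using k by (intro ennreal_leI) (simp add: c_def)
      also have "\<dots> = ennreal (c j) * ennreal (\<bar>b z - average (ball y (?s j)) b\<bar> + 1)"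
        by (rule ennreal_mult) (use c in auto)
      finally have "ennreal (kernel b \<gamma> x z) * f z \<le> ennreal (c j) * ennreal (\<bar>b z - average (ball y (?s j)) b\<bar> + 1) * f z"
        by (rule mult_right_mono) simp
      also have "\<dots> = ennreal (c j) * h j z" unfolding h_def using j by (simp add: mult.assoc)
      also have "\<dots> \<le> (\<Sum>j. ennreal (c j) * h j z)" by (rule term_le_suminf_ennreal)
      finally show ?thesis using False by simp
    qed simp
  qed
  also have "\<dots> = (\<Sum>j. ennreal (c j) * (\<integral>\<^sup>+z. h j z \<partial>lebesgue))"
    by (simp add: nn_integral_suminf nn_integral_cmult)
  also have "\<dots> \<le> (\<Sum>j. ennreal (?K * Cf) * (ennreal (1 + \<kappa>3 * real j) * (ball_norm f y (?s j) * epow (emeasure W (ball y (?s j))) (- 1 / p))))"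
  proof (intro suminf_le allI)
    fix j
    let ?X = "ball_norm f y (?s j) * epow (emeasure W (ball y (?s j))) (- 1 / p)"
    have "(\<integral>\<^sup>+z. h j z \<partial>lebesgue) \<le> ennreal (Ce * ?s j powr ?n) * ?X"
      unfolding h_def by (rule ball_integral_le[OF f s])
    then have "ennreal (c j) * (\<integral>\<^sup>+z. h j z \<partial>lebesgue) \<le> ennreal (c j) * (ennreal (Ce * ?s j powr ?n) * ?X)"
      by (rule mult_left_mono) simp
    also have "\<dots> = ennreal (c j * (Ce * ?s j powr ?n)) * ?X"
      using c[of j] Ce_pos by (simp add: ennreal_mult mult.assoc)
    also have "c j * (Ce * ?s j powr ?n) = ?K * Cf * (1 + \<kappa>3 * real j)"
    proof -
      have e: "(?s j / 4) powr ?n = ?s j powr ?n / 4 powr ?n" by (rule powr_divide)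
      have p0: "?s j powr ?n \<noteq> 0" using \<rho> by simp
      show ?thesis unfolding c_def Cf_def e using p0 by (simp add: field_simps)
    qed
    also have "ennreal (?K * Cf * (1 + \<kappa>3 * real j)) * ?X = ennreal (?K * Cf) * (ennreal (1 + \<kappa>3 * real j) * ?X)"
    proof -
      have "ennreal (?K * Cf * (1 + \<kappa>3 * real j)) = ennreal (?K * Cf) * ennreal (1 + \<kappa>3 * real j)"
        by (rule ennreal_mult) (use Cf_pos \<kappa>s_pos in auto)
      then show ?thesis by (simp only: mult.assoc)
    qed
    finally show "ennreal (c j) * (\<integral>\<^sup>+z. h j z \<partial>lebesgue) \<le> ennreal (?K * Cf) * (ennreal (1 + \<kappa>3 * real j) * ?X)" .
  qed auto
  also have "\<dots> = ennreal (?K * Cf) * far_sum f y \<rho>"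
    unfolding far_sum_def by (rule ennreal_suminf_cmult)
  finally show ?thesis .
qed

definition "Ck = 2 powr p * (Cloc * (A * (2 ^ CARD('n)) powr q) + Cf powr p * Cb)"

lemma Ck_pos: "0 < Ck"
  unfolding Ck_def using Cloc_pos A Cb_pos Cf_pos by (intro mult_pos_pos add_pos_pos) auto

text \<open>The term j = 1 alone. It lets \<open>far_sum\<close> bound the local part as
  well.\<close>

lemma ball_norm_le_far_sum:
  assumes \<rho>: "0 < \<rho>"
  shows "ball_norm f y (2 * \<rho>) \<le> far_sum f y \<rho> * epow (emeasure W (ball y (2 * \<rho>))) (1 / p)"
proof -
  let ?x = "emeasure W (ball y (2 * \<rho>))"
  have nt: "?x \<noteq> 0" "?x \<noteq> \<infinity>" using W_ball_nontriv(1)[of "2 * \<rho>" y] W_ball_nontriv(2)[of y "2 * \<rho>"] \<rho> by auto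
  have one: "epow ?x (- 1 / p) * epow ?x (1 / p) = 1" using epow_neg_cancel[OF nt, of "1 / p"] by (simp add: mult.commute)
  have "1 * (ball_norm f y (2 * \<rho>) * epow ?x (- 1 / p)) \<le> ennreal (1 + \<kappa>3) * (ball_norm f y (2 * \<rho>) * epow ?x (- 1 / p))"
    using \<kappa>s_pos by (intro mult_right_mono) auto
  also have "\<dots> \<le> far_sum f y \<rho>"
    unfolding far_sum_def
    using term_le_suminf_ennreal[of "\<lambda>j. ennreal (1 + \<kappa>3 * real j) * (ball_norm f y (2 ^ j * \<rho>) * epow (emeasure W (ball y (2 ^ j * \<rho>))) (- 1 / p))" 1]
    by simp
  finally have "ball_norm f y (2 * \<rho>) * epow ?x (- 1 / p) * epow ?x (1 / p) \<le> far_sum f y \<rho> * epow ?x (1 / p)"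
    by (intro mult_right_mono) auto
  then show ?thesis using one by (simp add: mult.assoc)
qed

text \<open>The level is halved between the local part, where \<open>full_operator_weak_type\<close>
  applies, and the far part. There the pointwise bound is \<open>far_sum\<close> times the
  oscillation of \<open>b\<close> at \<open>x\<close>, whose p-th power is integrable under
  \<open>W\<close> by \<open>ball_deviation_power_le\<close>, so Chebyshev's inequality
  suffices.\<close>

theorem full_operator_weak_on_ball:
  fixes f :: "real ^ 'n \<Rightarrow> ennreal"
  assumes f [measurable]: "f \<in> borel_measurable lebesgue" and \<rho>: "0 < \<rho>" and l: "0 < l"
  shows "ennreal (l powr p) * emeasure W {x \<in> ball y \<rho>. ennreal l < full_operator b \<gamma> f x}
    \<le> ennreal Ck * (epow (far_sum f y \<rho>) p * emeasure W (ball y \<rho>))"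
proof -
  let ?B = "ball y \<rho>" and ?B2 = "ball y (2 * \<rho>)"
  have [measurable]: "?B \<in> sets lebesgue" "?B2 \<in> sets lebesgue" by simp_all
  define f1 where "f1 z = f z * indicator ?B2 z" for z
  define f2 where "f2 z = f z * indicator (- ?B2) z" for z
  have [measurable]: "f1 \<in> borel_measurable lebesgue" "f2 \<in> borel_measurable lebesgue"
    unfolding f1_def f2_def by measurable
  have fm: "full_operator b \<gamma> f \<in> borel_measurable lebesgue" "full_operator b \<gamma> f1 \<in> borel_measurable lebesgue" "full_operator b \<gamma> f2 \<in> borel_measurable lebesgue"
    by (rule full_operator_measurable; measurable)+
  note fm [measurable] kernel_measurable[OF measurable_weights(1), measurable]
  define S where "S = epow (far_sum f y \<rho>) p"
  have split: "full_operator b \<gamma> f x = full_operator b \<gamma> f1 x + full_operator b \<gamma> f2 x" for x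
  proof -
    have "full_operator b \<gamma> f x = (\<integral>\<^sup>+z. ennreal (kernel b \<gamma> x z) * f1 z + ennreal (kernel b \<gamma> x z) * f2 z \<partial>lebesgue)"
      unfolding full_operator_def by (intro nn_integral_cong) (auto simp: f1_def f2_def indicator_def)
    then show ?thesis unfolding full_operator_def by (subst (asm) nn_integral_add) auto
  qed
  define E1 where "E1 = {x \<in> ?B. ennreal (l / 2) < full_operator b \<gamma> f1 x}"
  define E2 where "E2 = {x \<in> ?B. ennreal (l / 2) < full_operator b \<gamma> f2 x}"
  have Em: "{x \<in> ?B. ennreal t < full_operator b \<gamma> h x} \<in> sets lebesgue" if "full_operator b \<gamma> h \<in> borel_measurable lebesgue" for t h
  proof -
    have "{x \<in> space lebesgue. ennreal t < full_operator b \<gamma> h x} \<in> sets lebesgue" using that by measurable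
    moreover have "{x \<in> ?B. ennreal t < full_operator b \<gamma> h x} = ?B \<inter> {x \<in> space lebesgue. ennreal t < full_operator b \<gamma> h x}" by auto
    ultimately show ?thesis by (simp only: sets.Int \<open>?B \<in> sets lebesgue\<close>)
  qed
  have E [measurable]: "E1 \<in> sets lebesgue" "E2 \<in> sets lebesgue" unfolding E1_def E2_def by (rule Em[OF fm(2)] Em[OF fm(3)])+
  have sub: "{x \<in> ?B. ennreal l < full_operator b \<gamma> f x} \<subseteq> E1 \<union> E2"
  proof
    fix x assume x: "x \<in> {x \<in> ?B. ennreal l < full_operator b \<gamma> f x}"
    show "x \<in> E1 \<union> E2"
    proof (rule ccontr)
      assume "x \<notin> E1 \<union> E2"
      then have "full_operator b \<gamma> f1 x + full_operator b \<gamma> f2 x \<le> ennreal (l / 2) + ennreal (l / 2)"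
        using x by (intro add_mono) (auto simp: E1_def E2_def not_less)
      also have "\<dots> = ennreal l" using l by (simp flip: ennreal_plus)
      finally have "\<not> ennreal l < full_operator b \<gamma> f x" unfolding split by (rule leD)
      then show False using x by simp
    qed
  qed
  have l2: "0 < l / 2" using l by simp
  have 1: "ennreal ((l / 2) powr p) * emeasure W E1 \<le> ennreal (Cloc * (A * (2 ^ CARD('n)) powr q)) * (S * emeasure W ?B)"
  proof -
    have "ennreal ((l / 2) powr p) * emeasure W E1 \<le> ennreal Cloc * (\<integral>\<^sup>+z. epow (f1 z) p * ennreal (\<nu> z) \<partial>lebesgue)"
      unfolding E1_def by (rule full_operator_weak_type[OF _ bounded_ball _ l2]) auto
    also have "(\<integral>\<^sup>+z. epow (f1 z) p * ennreal (\<nu> z) \<partial>lebesgue) = epow (ball_norm f y (2 * \<rho>)) p"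
    proof -
      have "(\<integral>\<^sup>+z. epow (f1 z) p * ennreal (\<nu> z) \<partial>lebesgue) = (\<integral>\<^sup>+z\<in>?B2. epow (f z) p * ennreal (\<nu> z) \<partial>lebesgue)"
        using p by (intro nn_integral_cong) (auto simp: f1_def indicator_def)
      then show ?thesis unfolding ball_norm_def using p by (simp add: epow_epow)
    qed
    also have "\<dots> \<le> epow (far_sum f y \<rho> * epow (emeasure W ?B2) (1 / p)) p"
      using p by (intro epow_mono ball_norm_le_far_sum \<rho>) auto
    also have "\<dots> = S * emeasure W ?B2" unfolding S_def using p by (simp add: epow_mult epow_epow)
    also have "emeasure W ?B2 \<le> ennreal (A * (2 ^ CARD('n)) powr q) * emeasure W ?B" by (rule doubling[OF \<rho>]) simp
    finally have "ennreal ((l / 2) powr p) * emeasure W E1 \<le> ennreal Cloc * (S * (ennreal (A * (2 ^ CARD('n)) powr q) * emeasure W ?B))"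
      by (simp add: mult_left_mono)
    also have "\<dots> = ennreal Cloc * ennreal (A * (2 ^ CARD('n)) powr q) * (S * emeasure W ?B)" by (simp only: ac_simps)
    also have "ennreal Cloc * ennreal (A * (2 ^ CARD('n)) powr q) = ennreal (Cloc * (A * (2 ^ CARD('n)) powr q))"
      by (rule ennreal_mult[symmetric]) (use Cloc_pos A in auto)
    finally show ?thesis .
  qed
  have 2: "ennreal ((l / 2) powr p) * emeasure W E2 \<le> ennreal (Cf powr p * Cb) * (S * emeasure W ?B)"
  proof -
    let ?K = "\<lambda>x. \<bar>b x - average ?B b\<bar> + 1"
    have "ennreal ((l / 2) powr p) * emeasure W E2 = (\<integral>\<^sup>+x\<in>E2. ennreal ((l / 2) powr p) \<partial>W)"
      by (subst nn_integral_cmult_indicator) auto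
    also have "\<dots> \<le> (\<integral>\<^sup>+x. (ennreal (Cf powr p) * S) * (ennreal (?K x powr p) * indicator ?B x) \<partial>W)"
    proof (rule nn_integral_mono)
      fix x
      show "ennreal ((l / 2) powr p) * indicator E2 x \<le> (ennreal (Cf powr p) * S) * (ennreal (?K x powr p) * indicator ?B x)"
      proof (cases "x \<in> E2")
        case True
        then have xB: "x \<in> ?B" and lt: "ennreal (l / 2) < full_operator b \<gamma> f2 x" by (auto simp: E2_def)
        have "ennreal ((l / 2) powr p) = epow (ennreal (l / 2)) p" using l by (simp add: epow_ennreal_pos)
        also have "\<dots> \<le> epow (ennreal (?K x * Cf) * far_sum f y \<rho>) p"
          using less_imp_le[OF lt] far_operator_le[OF f \<rho> xB] p unfolding f2_def
          by (intro epow_mono) (auto intro: order_trans)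
        also have "\<dots> = ennreal ((?K x * Cf) powr p) * S"
          unfolding S_def using p Cf_pos by (subst epow_mult) (auto simp: epow_ennreal_pos add_nonneg_pos)
        also have "(?K x * Cf) powr p = Cf powr p * ?K x powr p" by (subst powr_mult) (simp add: mult.commute)
        also have "ennreal (Cf powr p * ?K x powr p) = ennreal (Cf powr p) * ennreal (?K x powr p)" by (rule ennreal_mult) auto
        finally show ?thesis using True xB by (simp add: ac_simps)
      qed simp
    qed
    also have "\<dots> = (ennreal (Cf powr p) * S) * (\<integral>\<^sup>+x\<in>?B. ennreal (?K x powr p) \<partial>W)"
      by (rule nn_integral_cmult) measurable
    also have "\<dots> \<le> (ennreal (Cf powr p) * S) * (ennreal Cb * emeasure W ?B)"
      by (intro mult_left_mono ball_deviation_power_le \<rho>) simp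
    also have "\<dots> = (ennreal (Cf powr p) * ennreal Cb) * (S * emeasure W ?B)" by (simp only: ac_simps)
    also have "ennreal (Cf powr p) * ennreal Cb = ennreal (Cf powr p * Cb)"
      by (rule ennreal_mult[symmetric]) (use Cb_pos in auto)
    finally show ?thesis .
  qed
  have "emeasure W {x \<in> ?B. ennreal l < full_operator b \<gamma> f x} \<le> emeasure W E1 + emeasure W E2"
  proof -
    have "emeasure W {x \<in> ?B. ennreal l < full_operator b \<gamma> f x} \<le> emeasure W (E1 \<union> E2)"
      by (rule emeasure_mono[OF sub]) auto
    also have "\<dots> \<le> emeasure W E1 + emeasure W E2" by (rule emeasure_subadditive) auto
    finally show ?thesis .
  qed
  then have "ennreal ((l / 2) powr p) * emeasure W {x \<in> ?B. ennreal l < full_operator b \<gamma> f x}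
     \<le> ennreal ((l / 2) powr p) * (emeasure W E1 + emeasure W E2)" by (rule mult_left_mono) simp
  also have "\<dots> \<le> ennreal (Cloc * (A * (2 ^ CARD('n)) powr q)) * (S * emeasure W ?B) + ennreal (Cf powr p * Cb) * (S * emeasure W ?B)"
    unfolding distrib_left by (rule add_mono[OF 1 2])
  also have "\<dots> = ennreal (Cloc * (A * (2 ^ CARD('n)) powr q) + Cf powr p * Cb) * (S * emeasure W ?B)"
    using Cloc_pos A Cb_pos by (subst ennreal_plus) (auto simp: distrib_right)
  finally have le: "ennreal ((l / 2) powr p) * emeasure W {x \<in> ?B. ennreal l < full_operator b \<gamma> f x}
     \<le> ennreal (Cloc * (A * (2 ^ CARD('n)) powr q) + Cf powr p * Cb) * (S * emeasure W ?B)" .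
  have "l powr p = 2 powr p * (l / 2) powr p" using l by (simp add: powr_divide)
  then have "ennreal (l powr p) * emeasure W {x \<in> ?B. ennreal l < full_operator b \<gamma> f x}
    = ennreal (2 powr p) * (ennreal ((l / 2) powr p) * emeasure W {x \<in> ?B. ennreal l < full_operator b \<gamma> f x})"
    by (simp add: ennreal_mult mult.assoc)
  also have "\<dots> \<le> ennreal (2 powr p) * (ennreal (Cloc * (A * (2 ^ CARD('n)) powr q) + Cf powr p * Cb) * (S * emeasure W ?B))"
    by (rule mult_left_mono[OF le]) simp
  also have "\<dots> = ennreal Ck * (S * emeasure W ?B)"
    unfolding Ck_def using Cloc_pos A Cb_pos by (subst ennreal_mult) (auto simp: mult.assoc)
  finally show ?thesis unfolding S_def .
qed

end

section \<open>Amalgam norms\<close>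

lemma outer_Ls_norm_mono:
  assumes "G \<in> borel_measurable lebesgue" "\<And>y. G y \<le> H y" "0 < s"
  shows "outer_Ls_norm s \<mu> G \<le> outer_Ls_norm s \<mu> H"
proof (cases "s = \<infinity>")
  case True
  have "G \<in> borel_measurable (wmeasure \<mu>)" using assms(1) by (simp cong: measurable_cong_sets)
  then show ?thesis unfolding outer_Ls_norm_def using True assms(2) by (auto intro: esssup_mono)
next
  case False
  then show ?thesis unfolding outer_Ls_norm_def using assms(2)
    by (auto intro!: epow_mono nn_integral_mono)
qed

lemma outer_Ls_norm_finite_AE:
  assumes G: "G \<in> borel_measurable lebesgue" and fin: "outer_Ls_norm s \<mu> G < \<infinity>" and s: "0 < s"
  shows "AE y in wmeasure \<mu>. G y < \<infinity>"
proof (cases "s = \<infinity>")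
  case True
  have "AE y in wmeasure \<mu>. G y \<le> esssup (wmeasure \<mu>) G" by (rule esssup_AE)
  then show ?thesis using fin True unfolding outer_Ls_norm_def by (auto elim!: eventually_mono)
next
  case False
  then have S: "0 < enn2real s" using s by (simp add: enn2real_positive_iff less_top)
  have [measurable]: "G \<in> borel_measurable (wmeasure \<mu>)" using G by (simp cong: measurable_cong_sets)
  have "(\<integral>\<^sup>+y. epow (G y) (enn2real s) \<partial>wmeasure \<mu>) \<noteq> \<infinity>"
    using fin False S unfolding outer_Ls_norm_def by (auto simp: epow_def split: if_splits)
  then have "AE y in wmeasure \<mu>. epow (G y) (enn2real s) \<noteq> \<infinity>"
    by (intro nn_integral_noteq_infinite) auto
  then show ?thesis using S by (auto elim!: eventually_mono simp: epow_finite_iff less_top[symmetric])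
qed

text \<open>Splitting \<open>\<eta>\<^sup>2\<close> as \<open>\<eta> \<eta>\<close> and bounding one factor by the supremum over \<open>j\<close> replaces Minkowski's inequality
  for series.\<close>

lemma outer_Ls_norm_series_le:
  fixes H :: "nat \<Rightarrow> real ^ 'n \<Rightarrow> ennreal" and a :: "nat \<Rightarrow> real" and s :: ennreal
  assumes H: "\<And>j. H j \<in> borel_measurable lebesgue" and s: "0 < s"
    and a: "\<And>j. 0 \<le> a j" "summable a" and \<eta>: "0 < \<eta>" "\<eta> < 1"
    and bd: "\<And>j. outer_Ls_norm s \<mu> (H j) \<le> N"
  shows "outer_Ls_norm s \<mu> (\<lambda>y. \<Sum>j. ennreal (a j * \<eta> ^ j) * H j y)
    \<le> ennreal (suminf a * (if s = \<infinity> then 1 else (1 / (1 - \<eta> powr enn2real s)) powr (1 / enn2real s))) * N"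
proof -
  let ?G = "\<lambda>y. \<Sum>j. ennreal (a j * \<eta> ^ j) * H j y"
  note H [measurable]
  have D: "(\<Sum>j. ennreal (a j)) = ennreal (suminf a)" using a by (rule suminf_ennreal2)
  have D0: "0 \<le> suminf a" using a by (simp add: suminf_nonneg)
  have Gle: "?G y \<le> ennreal (suminf a) * B" if "\<And>j. ennreal (\<eta> ^ j) * H j y \<le> B" for y B
  proof -
    have "?G y \<le> (\<Sum>j. ennreal (a j) * B)"
    proof (intro suminf_le allI)
      fix j
      have "ennreal (a j * \<eta> ^ j) * H j y = ennreal (a j) * (ennreal (\<eta> ^ j) * H j y)"
        using a \<eta> by (simp add: ennreal_mult mult.assoc)
      also have "\<dots> \<le> ennreal (a j) * B" by (rule mult_left_mono[OF that]) simp
      finally show "ennreal (a j * \<eta> ^ j) * H j y \<le> ennreal (a j) * B" .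
    qed auto
    also have "\<dots> = ennreal (suminf a) * B" unfolding D[symmetric] by (rule ennreal_suminf_multc)
    finally show ?thesis .
  qed
  show ?thesis
  proof (cases "s = \<infinity>")
    case True
    have Hm: "H j \<in> borel_measurable (wmeasure \<mu>)" for j using H by (simp cong: measurable_cong_sets)
    have "AE y in wmeasure \<mu>. \<forall>j. H j y \<le> N"
      unfolding AE_all_countable
    proof
      fix j
      have "AE y in wmeasure \<mu>. H j y \<le> esssup (wmeasure \<mu>) (H j)" by (rule esssup_AE)
      moreover have "esssup (wmeasure \<mu>) (H j) \<le> N" using bd[of j] True by (simp add: outer_Ls_norm_def)
      ultimately show "AE y in wmeasure \<mu>. H j y \<le> N" by (auto elim!: eventually_mono)
    qed
    then have "AE y in wmeasure \<mu>. ?G y \<le> ennreal (suminf a) * N"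
    proof eventually_elim
      case (elim y)
      show ?case
      proof (rule Gle)
        fix j
        have "ennreal (\<eta> ^ j) * H j y \<le> 1 * N"
          using elim \<eta> by (intro mult_mono) (auto simp: power_le_one)
        then show "ennreal (\<eta> ^ j) * H j y \<le> N" by simp
      qed
    qed
    moreover have "?G \<in> borel_measurable (wmeasure \<mu>)" using Hm by measurable
    ultimately show ?thesis using True by (simp add: outer_Ls_norm_def esssup_I)
  next
    case False
    define S where "S = enn2real s"
    have S: "0 < S" using False s by (simp add: S_def enn2real_positive_iff less_top)
    define t where "t = \<eta> powr S"
    have t: "0 < t" "t < 1" using \<eta> S powr_less_mono2[of S \<eta> 1] by (auto simp: t_def)
    have tj: "t ^ j = (\<eta> ^ j) powr S" for j
      using \<eta> by (simp add: t_def powr_powr mult.commute flip: powr_realpow)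
    have int: "(\<integral>\<^sup>+y. epow (H j y) S \<partial>wmeasure \<mu>) \<le> epow N S" for j
    proof -
      have "epow (\<integral>\<^sup>+y. epow (H j y) S \<partial>wmeasure \<mu>) (1 / S) \<le> N"
        using bd[of j] False by (simp add: outer_Ls_norm_def S_def)
      then have "epow (epow (\<integral>\<^sup>+y. epow (H j y) S \<partial>wmeasure \<mu>) (1 / S)) S \<le> epow N S" using S by (intro epow_mono) auto
      then show ?thesis using S by (simp add: epow_epow)
    qed
    have pw: "epow (?G y) S \<le> ennreal (suminf a powr S) * (\<Sum>j. ennreal (t ^ j) * epow (H j y) S)" for y
    proof -
      let ?T = "\<Sum>j. ennreal (t ^ j) * epow (H j y) S"
      \<comment> \<open>The supremum over \<open>j\<close> is bounded by the sum of the
        \<open>S\<close>-th powers, which can be integrated term by term.\<close>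
      have "?G y \<le> ennreal (suminf a) * epow ?T (1 / S)"
      proof (rule Gle)
        fix j
        have "epow (ennreal (\<eta> ^ j) * H j y) S = ennreal (t ^ j) * epow (H j y) S"
          using S \<eta> by (simp add: epow_mult epow_ennreal_pos tj)
        also have "\<dots> \<le> ?T" by (rule term_le_suminf_ennreal)
        finally have "epow (epow (ennreal (\<eta> ^ j) * H j y) S) (1 / S) \<le> epow ?T (1 / S)"
          using S by (intro epow_mono) auto
        then show "ennreal (\<eta> ^ j) * H j y \<le> epow ?T (1 / S)" using S by (simp add: epow_epow)
      qed
      then have "epow (?G y) S \<le> epow (ennreal (suminf a) * epow ?T (1 / S)) S" using S by (intro epow_mono) auto
      also have "\<dots> = ennreal (suminf a powr S) * ?T" using S D0 by (simp add: epow_mult epow_epow epow_ennreal)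
      finally show ?thesis .
    qed
    have Hm [measurable]: "H j \<in> borel_measurable (wmeasure \<mu>)" for j using H by (simp cong: measurable_cong_sets)
    have "(\<integral>\<^sup>+y. epow (?G y) S \<partial>wmeasure \<mu>) \<le> (\<integral>\<^sup>+y. ennreal (suminf a powr S) * (\<Sum>j. ennreal (t ^ j) * epow (H j y) S) \<partial>wmeasure \<mu>)"
      by (intro nn_integral_mono pw)
    also have "\<dots> = ennreal (suminf a powr S) * (\<Sum>j. ennreal (t ^ j) * (\<integral>\<^sup>+y. epow (H j y) S \<partial>wmeasure \<mu>))"
      by (simp add: nn_integral_cmult nn_integral_suminf)
    also have "\<dots> \<le> ennreal (suminf a powr S) * (\<Sum>j. ennreal (t ^ j) * epow N S)"
      by (intro mult_left_mono suminf_le allI int) auto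
    also have "(\<Sum>j. ennreal (t ^ j) * epow N S) = (\<Sum>j. ennreal (t ^ j)) * epow N S" by (rule ennreal_suminf_multc)
    also have "(\<Sum>j. ennreal (t ^ j)) = ennreal (1 / (1 - t))"
      using t by (subst suminf_ennreal2) (auto simp: suminf_geometric intro!: summable_geometric)
    finally have "epow (\<integral>\<^sup>+y. epow (?G y) S \<partial>wmeasure \<mu>) (1 / S) \<le> epow (ennreal (suminf a powr S) * (ennreal (1 / (1 - t)) * epow N S)) (1 / S)"
      using S by (intro epow_mono) auto
    also have "\<dots> = ennreal (suminf a) * (ennreal ((1 / (1 - t)) powr (1 / S)) * N)"
    proof -
      have "epow (ennreal (suminf a powr S)) (1 / S) = ennreal (suminf a)"
        using S D0 by (simp add: epow_ennreal powr_powr)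
      moreover have "epow (ennreal (1 / (1 - t))) (1 / S) = ennreal ((1 / (1 - t)) powr (1 / S))"
        using t by (intro epow_ennreal_pos) simp
      moreover have "epow (epow N S) (1 / S) = N" using S by (simp add: epow_epow)
      ultimately show ?thesis using S by (simp add: epow_mult)
    qed
    also have "\<dots> = ennreal (suminf a * (1 / (1 - t)) powr (1 / S)) * N"
      using D0 by (simp add: ennreal_mult mult.assoc)
    finally show ?thesis using False by (simp add: outer_Ls_norm_def S_def t_def)
  qed
qed

section \<open>Measurable dependence on the centre of the ball\<close>

lemma ball_integral_measurable:
  fixes g :: "real ^ 'n \<Rightarrow> ennreal"
  assumes [measurable]: "g \<in> borel_measurable lebesgue"
  shows "(\<lambda>y. \<integral>\<^sup>+z\<in>ball y t. g z \<partial>lebesgue) \<in> borel_measurable lebesgue"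
proof -
  note measurable_lebesgue_pair_diff [measurable]
  have "(\<lambda>z. g (snd z) * indicator {z. norm (fst z - snd z) < t} z) \<in> borel_measurable (lebesgue \<Otimes>\<^sub>M lebesgue)"
    by measurable
  then have "case_prod (\<lambda>y z. g z * indicator (ball y t) z) \<in> borel_measurable (lebesgue \<Otimes>\<^sub>M lebesgue)"
    by (simp add: case_prod_unfold indicator_def dist_norm)
  then show ?thesis by (rule lebesgue.borel_measurable_nn_integral)
qed

lemma wmeasure_ball_measurable:
  assumes w [measurable]: "w \<in> borel_measurable lebesgue" and Z [measurable]: "Z \<in> sets lebesgue"
  shows "(\<lambda>y. emeasure (wmeasure w) (ball y t \<inter> Z)) \<in> borel_measurable lebesgue"
proof -
  have "emeasure (wmeasure w) (ball y t \<inter> Z) = (\<integral>\<^sup>+z\<in>ball y t. ennreal (w z) * indicator Z z \<partial>lebesgue)" for y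
    by (subst emeasure_wmeasure) (auto intro!: nn_integral_cong simp: indicator_def)
  then show ?thesis by (simp add: ball_integral_measurable)
qed

lemma ennreal_eq_SUP_rat:
  assumes "0 < l"
  shows "ennreal l = (SUP q\<in>{q. 0 < q \<and> real_of_rat q < l}. ennreal (real_of_rat q))"
proof (rule antisym)
  show "ennreal l \<le> (SUP q\<in>{q. 0 < q \<and> real_of_rat q < l}. ennreal (real_of_rat q))"
  proof (rule dense_le)
    fix z assume z: "z < ennreal l"
    obtain t where t: "z = ennreal t" "0 \<le> t" using z by (cases z rule: ennreal_cases) (auto simp: top_unique)
    have "t < l" using z t by (simp add: ennreal_less_iff)
    then obtain q where q: "t < real_of_rat q" "real_of_rat q < l" using of_rat_dense by blast
    have "0 < q" using q t by (smt (verit) zero_less_of_rat_iff)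
    have "z \<le> ennreal (real_of_rat q)" using q t by (simp add: ennreal_leI)
    also have "\<dots> \<le> (SUP q\<in>{q. 0 < q \<and> real_of_rat q < l}. ennreal (real_of_rat q))"
      by (rule SUP_upper) (use q \<open>0 < q\<close> in auto)
    finally show "z \<le> (SUP q\<in>{q. 0 < q \<and> real_of_rat q < l}. ennreal (real_of_rat q))" .
  qed
  show "(SUP q\<in>{q. 0 < q \<and> real_of_rat q < l}. ennreal (real_of_rat q)) \<le> ennreal l"
    by (rule SUP_least) (auto intro: ennreal_leI)
qed

text \<open>The weight of the level set decreases in \<open>l\<close>, so the supremum over real
  \<open>l\<close> is already reached over the positive rationals and is a countable one.
  Monotonicity of the outer norm, an essential supremum for \<open>s = \<infinity>\<close>, calls
  for this measurability.\<close>

lemma weak_Lp_norm_ball_measurable: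
  fixes h w :: "real ^ 'n \<Rightarrow> real"
  assumes w [measurable]: "w \<in> borel_measurable lebesgue" and h [measurable]: "h \<in> borel_measurable lebesgue" and p: "0 < p"
  shows "(\<lambda>y. weak_Lp_norm p w (\<lambda>x. h x * indicator (ball y t) x)) \<in> borel_measurable lebesgue"
proof -
  define Z where "Z l = {x. l < \<bar>h x\<bar>}" for l
  have Z: "Z l \<in> sets lebesgue" for l
  proof -
    have "{x \<in> space lebesgue. l < \<bar>h x\<bar>} \<in> sets lebesgue" by measurable
    then show ?thesis by (simp add: Z_def)
  qed
  let ?\<phi> = "\<lambda>y l. epow (emeasure (wmeasure w) (ball y t \<inter> Z l)) (1 / p)"
  have eq: "weak_Lp_norm p w (\<lambda>x. h x * indicator (ball y t) x) = (SUP q\<in>{q. 0 < q}. ennreal (real_of_rat q) * ?\<phi> y (real_of_rat q))" for y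
  proof -
    have set_eq: "{x. l < \<bar>h x * indicator (ball y t) x\<bar>} = ball y t \<inter> Z l" if "0 < l" for l
      using that by (auto simp: Z_def indicator_def split: if_splits)
    have "weak_Lp_norm p w (\<lambda>x. h x * indicator (ball y t) x) = (SUP l\<in>{0<..}. ennreal l * ?\<phi> y l)"
      unfolding weak_Lp_norm_def by (intro SUP_cong refl) (simp add: set_eq)
    also have "\<dots> = (SUP q\<in>{q. 0 < q}. ennreal (real_of_rat q) * ?\<phi> y (real_of_rat q))"
    proof (rule antisym)
      show "(SUP l\<in>{0<..}. ennreal l * ?\<phi> y l) \<le> (SUP q\<in>{q. 0 < q}. ennreal (real_of_rat q) * ?\<phi> y (real_of_rat q))"
      proof (rule SUP_least)
        fix l :: real assume "l \<in> {0<..}"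
        then have l: "0 < l" by simp
        have "ennreal l * ?\<phi> y l = (SUP q\<in>{q. 0 < q \<and> real_of_rat q < l}. ennreal (real_of_rat q) * ?\<phi> y l)"
          by (subst ennreal_eq_SUP_rat[OF l]) (rule SUP_mult_right_ennreal)
        also have "\<dots> \<le> (SUP q\<in>{q. 0 < q}. ennreal (real_of_rat q) * ?\<phi> y (real_of_rat q))"
        proof (rule SUP_mono)
          fix q assume q: "q \<in> {q. 0 < q \<and> real_of_rat q < l}"
          have "?\<phi> y l \<le> ?\<phi> y (real_of_rat q)"
            using q p Z by (intro epow_mono emeasure_mono) (auto simp: Z_def)
          then show "\<exists>q'\<in>{q. 0 < q}. ennreal (real_of_rat q) * ?\<phi> y l \<le> ennreal (real_of_rat q') * ?\<phi> y (real_of_rat q')"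
            using q by (intro bexI[of _ q] mult_left_mono) auto
        qed
        finally show "ennreal l * ?\<phi> y l \<le> (SUP q\<in>{q. 0 < q}. ennreal (real_of_rat q) * ?\<phi> y (real_of_rat q))" .
      qed
      show "(SUP q\<in>{q. 0 < q}. ennreal (real_of_rat q) * ?\<phi> y (real_of_rat q)) \<le> (SUP l\<in>{0<..}. ennreal l * ?\<phi> y l)"
        by (rule SUP_mono) auto
    qed
    finally show ?thesis .
  qed
  have [measurable]: "(\<lambda>y. emeasure (wmeasure w) (ball y t \<inter> Z l)) \<in> borel_measurable lebesgue" for l
    by (rule wmeasure_ball_measurable[OF w Z])
  show ?thesis unfolding eq by (intro borel_measurable_SUP) auto
qed

section \<open>Summation over the annuli in the amalgam norm\<close>

locale amalgam_setting = two_weight b w \<nu> \<gamma> p r C0 q A M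
  for b w \<nu> :: "real ^ 'n \<Rightarrow> real" and \<gamma> p r C0 q A M +
  fixes \<mu> :: "real ^ 'n \<Rightarrow> real" and \<alpha> :: real and s :: ennreal
  assumes \<alpha>: "p \<le> \<alpha>" and s: "ennreal \<alpha> < s"
begin

text \<open>\<open>e\<close> is the exponent of the weight of the ball in both amalgam norms, and
  \<open>a = e + 1 / p\<close> is what it becomes together with the factor w(B)^(1/p) of the weak
  estimate. \<open>\<theta>\<close> is the gain from reverse doubling for each doubling of the
  radius.\<close>

definition "e = 1 / \<alpha> - 1 / p - enn2real (1 / s)"
definition "a = 1 / \<alpha> - enn2real (1 / s)"
definition "\<theta> = \<theta>0 powr a"

lemma \<alpha>_pos: "0 < \<alpha>" using p \<alpha> by simp

lemma s_pos: "0 < s" using s by (metis zero_le le_less_trans)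

text \<open>Here the strict inequality between \<open>\<alpha>\<close> and \<open>s\<close> enters;
  without it the annuli would bring no decay.\<close>

lemma a_pos: "0 < a"
proof -
  have "enn2real (1 / s) < 1 / \<alpha>"
  proof (cases s rule: ennreal_cases)
    case top
    then show ?thesis using \<alpha>_pos by simp
  next
    case (real S)
    have S: "\<alpha> < S" using s real \<alpha>_pos by (simp add: ennreal_less_iff)
    then have "1 / s = ennreal (1 / S)"
      using \<alpha>_pos real divide_ennreal[of 1 S] by simp
    then have "enn2real (1 / s) = 1 / S" using S \<alpha>_pos by simp
    then show ?thesis using S \<alpha>_pos by (simp add: frac_less2)
  qed
  then show ?thesis by (simp add: a_def)
qed

lemma e_a: "e + 1 / p = a" "a + - 1 / p = e" by (simp_all add: e_def a_def)

lemma \<theta>: "0 < \<theta>" "\<theta> < 1" using \<theta>0 a_pos powr_less_mono2[of a \<theta>0 1] by (auto simp: \<theta>_def)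

definition "amalgam_term f y t = epow (emeasure W (ball y t)) e * ball_norm f y t"

lemma amalgam_term_measurable:
  assumes [measurable]: "f \<in> borel_measurable lebesgue"
  shows "(\<lambda>y. amalgam_term f y t) \<in> borel_measurable lebesgue"
proof -
  have [measurable]: "(\<lambda>y. \<integral>\<^sup>+z\<in>ball y t. epow (f z) p * ennreal (\<nu> z) \<partial>lebesgue) \<in> borel_measurable lebesgue"
    by (rule ball_integral_measurable) measurable
  have "(\<lambda>y. emeasure W (ball y t \<inter> UNIV)) \<in> borel_measurable lebesgue"
    by (rule wmeasure_ball_measurable) auto
  then have [measurable]: "(\<lambda>y. emeasure W (ball y t)) \<in> borel_measurable lebesgue" by simp
  show ?thesis unfolding amalgam_term_def ball_norm_def by measurable
qed

lemma Lp_norm_ball: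
  fixes f :: "real ^ 'n \<Rightarrow> real"
  assumes [measurable]: "f \<in> borel_measurable lebesgue"
  shows "Lp_norm p \<nu> (\<lambda>x. f x * indicator (ball y t) x) = ball_norm (\<lambda>x. ennreal \<bar>f x\<bar>) y t"
proof -
  have [measurable]: "ball y t \<in> sets lebesgue" by simp
  have "(\<integral>\<^sup>+x. ennreal (\<bar>f x * indicator (ball y t) x\<bar> powr p) \<partial>wmeasure \<nu>)
     = (\<integral>\<^sup>+x. ennreal (\<nu> x) * ennreal (\<bar>f x * indicator (ball y t) x\<bar> powr p) \<partial>lebesgue)"
    unfolding wmeasure_def by (rule nn_integral_density) measurable
  also have "\<dots> = (\<integral>\<^sup>+z\<in>ball y t. epow (ennreal \<bar>f z\<bar>) p * ennreal (\<nu> z) \<partial>lebesgue)"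
    using p by (intro nn_integral_cong) (auto simp: indicator_def epow_ennreal mult.commute)
  finally show ?thesis by (simp add: Lp_norm_def ball_norm_def)
qed

definition "series f y \<rho> = (\<Sum>j. ennreal ((1 + \<kappa>3 * real j) * \<theta> ^ j) * amalgam_term f y (2 ^ j * \<rho>))"

text \<open>Reverse doubling bounds w(B)^a by \<open>\<theta> ^ j\<close> times w(2^j B)^a, and the
  product of w(2^j B)^a with w(2^j B)^(-1/p) is the normalisation w(2^j B)^e of the amalgam norm at
  the radius 2^j \<rho>.\<close>

lemma far_sum_le_series:
  assumes \<rho>: "0 < \<rho>"
  shows "epow (emeasure W (ball y \<rho>)) a * far_sum f y \<rho> \<le> series f y \<rho>"
proof -
  let ?W = "\<lambda>j. emeasure W (ball y (2 ^ j * \<rho>))"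
  have "epow (emeasure W (ball y \<rho>)) a * far_sum f y \<rho>
     = (\<Sum>j. epow (emeasure W (ball y \<rho>)) a * (ennreal (1 + \<kappa>3 * real j) * (ball_norm f y (2 ^ j * \<rho>) * epow (?W j) (- 1 / p))))"
    unfolding far_sum_def by (rule ennreal_suminf_cmult[symmetric])
  also have "\<dots> \<le> series f y \<rho>"
    unfolding series_def
  proof (intro suminf_le allI)
    fix j
    have nt: "?W j \<noteq> 0" "?W j \<noteq> \<infinity>" using W_ball_nontriv(1)[of "2 ^ j * \<rho>" y] W_ball_nontriv(2)[of y "2 ^ j * \<rho>"] \<rho> by auto
    have "emeasure W (ball y \<rho>) \<le> ennreal (\<theta>0 ^ j) * ?W j"
      using reverse_doubling_power[OF \<rho>, of y j] \<theta>0 by (simp add: W_finite ennreal_leI flip: ennreal_mult)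
    then have "epow (emeasure W (ball y \<rho>)) a \<le> epow (ennreal (\<theta>0 ^ j) * ?W j) a"
      using a_pos by (intro epow_mono) auto
    also have "\<dots> = ennreal (\<theta> ^ j) * epow (?W j) a"
    proof -
      have "(\<theta>0 ^ j) powr a = \<theta> ^ j" using \<theta>0 by (simp add: \<theta>_def powr_powr mult.commute flip: powr_realpow)
      then show ?thesis using a_pos \<theta>0 by (simp add: epow_mult epow_ennreal_pos)
    qed
    finally have le: "epow (emeasure W (ball y \<rho>)) a \<le> ennreal (\<theta> ^ j) * epow (?W j) a" .
    have "epow (?W j) a * epow (?W j) (- 1 / p) = epow (?W j) e"
      using epow_add[OF nt, of a "- 1 / p"] e_a by simp
    moreover have "ennreal (1 + \<kappa>3 * real j) * ennreal (\<theta> ^ j) = ennreal ((1 + \<kappa>3 * real j) * \<theta> ^ j)"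
      by (rule ennreal_mult[symmetric]) (use \<kappa>s_pos \<theta> in auto)
    moreover have "epow (emeasure W (ball y \<rho>)) a * (ennreal (1 + \<kappa>3 * real j) * (ball_norm f y (2 ^ j * \<rho>) * epow (?W j) (- 1 / p)))
      \<le> (ennreal (\<theta> ^ j) * epow (?W j) a) * (ennreal (1 + \<kappa>3 * real j) * (ball_norm f y (2 ^ j * \<rho>) * epow (?W j) (- 1 / p)))"
      by (rule mult_right_mono[OF le]) simp
    moreover have "(ennreal (\<theta> ^ j) * epow (?W j) a) * (ennreal (1 + \<kappa>3 * real j) * (ball_norm f y (2 ^ j * \<rho>) * epow (?W j) (- 1 / p)))
      = (ennreal (1 + \<kappa>3 * real j) * ennreal (\<theta> ^ j)) * ((epow (?W j) a * epow (?W j) (- 1 / p)) * ball_norm f y (2 ^ j * \<rho>))"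
      by (simp only: ac_simps)
    ultimately show "epow (emeasure W (ball y \<rho>)) a * (ennreal (1 + \<kappa>3 * real j) * (ball_norm f y (2 ^ j * \<rho>) * epow (?W j) (- 1 / p)))
      \<le> ennreal ((1 + \<kappa>3 * real j) * \<theta> ^ j) * amalgam_term f y (2 ^ j * \<rho>)"
      by (simp only: amalgam_term_def)
  qed auto
  finally show ?thesis .
qed

text \<open>The summand 1 makes the factor positive without any evaluation of the Gamma
  function.\<close>

definition "kz = \<bar>1 / riesz_constant TYPE('n) \<gamma>\<bar> + 1"
definition "Cw = kz * Ck powr (1 / p)"

lemma kz_pos: "0 < kz" unfolding kz_def by (rule add_nonneg_pos) auto

text \<open>For each \<open>l\<close> the set where the commutator exceeds \<open>l\<close> lies in
  a level set of the positive operator. The p-th root of \<open>full_operator_weak_on_ball\<close>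
  and the identity e + 1/p = a then lead to \<open>far_sum_le_series\<close>.\<close>

lemma weak_term_le_series:
  fixes f :: "real ^ 'n \<Rightarrow> real"
  assumes [measurable]: "f \<in> borel_measurable lebesgue" and \<rho>: "0 < \<rho>"
  shows "epow (emeasure W (ball y \<rho>)) e * weak_Lp_norm p w (\<lambda>x. commutator b \<gamma> f x * indicator (ball y \<rho>) x)
    \<le> ennreal Cw * series (\<lambda>x. ennreal \<bar>f x\<bar>) y \<rho>"
proof -
  let ?F = "\<lambda>x. ennreal \<bar>f x\<bar>" and ?B = "ball y \<rho>"
  have nt: "emeasure W ?B \<noteq> 0" "emeasure W ?B \<noteq> \<infinity>" using W_ball_nontriv(1)[OF \<rho>, of y] W_ball_nontriv(2)[of y \<rho>] by auto
  have fm [measurable]: "full_operator b \<gamma> ?F \<in> borel_measurable lebesgue"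
    by (rule full_operator_measurable) measurable
  have "weak_Lp_norm p w (\<lambda>x. commutator b \<gamma> f x * indicator ?B x) \<le> ennreal Cw * (far_sum ?F y \<rho> * epow (emeasure W ?B) (1 / p))"
    unfolding weak_Lp_norm_def
  proof (rule SUP_least)
    fix l :: real assume "l \<in> {0<..}"
    then have l: "0 < l" by simp
    define E where "E = {x \<in> ?B. ennreal (l / kz) < full_operator b \<gamma> ?F x}"
    have lk: "0 < l / kz" using l kz_pos by simp
    have Es: "E \<in> sets lebesgue"
    proof -
      have "{x \<in> space lebesgue. ennreal (l / kz) < full_operator b \<gamma> ?F x} \<in> sets lebesgue" by measurable
      moreover have "E = ?B \<inter> {x \<in> space lebesgue. ennreal (l / kz) < full_operator b \<gamma> ?F x}" by (auto simp: E_def)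
      ultimately show ?thesis by (simp add: sets.Int)
    qed
    have sub: "{x. l < \<bar>commutator b \<gamma> f x * indicator ?B x\<bar>} \<subseteq> E"
    proof
      fix x assume x: "x \<in> {x. l < \<bar>commutator b \<gamma> f x * indicator ?B x\<bar>}"
      then have xB: "x \<in> ?B" by (cases "x \<in> ?B") (use l in auto)
      then have "ennreal l < ennreal \<bar>commutator b \<gamma> f x\<bar>" using x l by (simp add: ennreal_less_iff)
      also have "\<dots> \<le> ennreal \<bar>1 / riesz_constant TYPE('n) \<gamma>\<bar> * full_operator b \<gamma> ?F x" by (rule commutator_le_full_operator)
      also have "\<dots> \<le> ennreal kz * full_operator b \<gamma> ?F x" by (intro mult_right_mono ennreal_leI) (auto simp: kz_def)
      finally have lt: "ennreal l < ennreal kz * full_operator b \<gamma> ?F x" .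
      have "ennreal (l / kz) < full_operator b \<gamma> ?F x"
      proof (rule ccontr)
        assume "\<not> ?thesis"
        then have "ennreal kz * full_operator b \<gamma> ?F x \<le> ennreal kz * ennreal (l / kz)" by (intro mult_left_mono) (auto simp: not_less)
        also have "\<dots> = ennreal l" using kz_pos l by (simp flip: ennreal_mult)
        finally show False using lt by simp
      qed
      then show "x \<in> E" using xB by (simp add: E_def)
    qed
    have "ennreal ((l / kz) powr p) * emeasure W E \<le> ennreal Ck * (epow (far_sum ?F y \<rho>) p * emeasure W ?B)"
      unfolding E_def by (rule full_operator_weak_on_ball[OF _ \<rho> lk]) measurable
    then have "epow (ennreal ((l / kz) powr p) * emeasure W E) (1 / p) \<le> epow (ennreal Ck * (epow (far_sum ?F y \<rho>) p * emeasure W ?B)) (1 / p)"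
      using p by (intro epow_mono) auto
    then have le: "ennreal (l / kz) * epow (emeasure W E) (1 / p) \<le> ennreal (Ck powr (1 / p)) * (far_sum ?F y \<rho> * epow (emeasure W ?B) (1 / p))"
    proof -
      have "epow (ennreal ((l / kz) powr p)) (1 / p) = ennreal (((l / kz) powr p) powr (1 / p))"
        by (rule epow_ennreal) (use p in auto)
      also have "\<dots> = ennreal (l / kz)" using p l kz_pos by (simp add: powr_powr)
      finally have "epow (ennreal ((l / kz) powr p)) (1 / p) = ennreal (l / kz)" .
      moreover have "epow (ennreal Ck) (1 / p) = ennreal (Ck powr (1 / p))" by (rule epow_ennreal_pos[OF Ck_pos])
      moreover have "epow (epow (far_sum ?F y \<rho>) p) (1 / p) = far_sum ?F y \<rho>" using p by (simp add: epow_epow)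
      ultimately show ?thesis
        using \<open>epow (ennreal ((l / kz) powr p) * emeasure W E) (1 / p) \<le> _\<close> p by (simp add: epow_mult)
    qed
    have "ennreal l * epow (emeasure W {x. l < \<bar>commutator b \<gamma> f x * indicator ?B x\<bar>}) (1 / p) \<le> ennreal l * epow (emeasure W E) (1 / p)"
      using p Es by (intro mult_left_mono epow_mono emeasure_mono sub) auto
    also have "ennreal l * epow (emeasure W E) (1 / p) = ennreal kz * (ennreal (l / kz) * epow (emeasure W E) (1 / p))"
      using kz_pos l by (simp add: mult.assoc[symmetric] flip: ennreal_mult)
    also have "\<dots> \<le> ennreal kz * (ennreal (Ck powr (1 / p)) * (far_sum ?F y \<rho> * epow (emeasure W ?B) (1 / p)))"
      by (rule mult_left_mono[OF le]) simp
    also have "\<dots> = ennreal Cw * (far_sum ?F y \<rho> * epow (emeasure W ?B) (1 / p))"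
      using kz_pos by (simp add: Cw_def ennreal_mult mult.assoc)
    finally show "ennreal l * epow (emeasure W {x. l < \<bar>commutator b \<gamma> f x * indicator ?B x\<bar>}) (1 / p)
      \<le> ennreal Cw * (far_sum ?F y \<rho> * epow (emeasure W ?B) (1 / p))" .
  qed
  then have "epow (emeasure W ?B) e * weak_Lp_norm p w (\<lambda>x. commutator b \<gamma> f x * indicator ?B x)
     \<le> epow (emeasure W ?B) e * (ennreal Cw * (far_sum ?F y \<rho> * epow (emeasure W ?B) (1 / p)))"
    by (rule mult_left_mono) simp
  also have "\<dots> = ennreal Cw * ((epow (emeasure W ?B) e * epow (emeasure W ?B) (1 / p)) * far_sum ?F y \<rho>)"
    by (simp only: ac_simps)
  also have "epow (emeasure W ?B) e * epow (emeasure W ?B) (1 / p) = epow (emeasure W ?B) a"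
    using epow_add[OF nt, of e "1 / p"] e_a by simp
  also have "ennreal Cw * (epow (emeasure W ?B) a * far_sum ?F y \<rho>) \<le> ennreal Cw * series ?F y \<rho>"
    by (intro mult_left_mono far_sum_le_series \<rho>) simp
  finally show ?thesis .
qed

text \<open>One factor \<open>\<eta> ^ j\<close> of \<open>\<theta> ^ j\<close> makes the linearly
  growing coefficients summable, the other is the one demanded by
  \<open>outer_Ls_norm_series_le\<close>.\<close>

definition "\<eta> = sqrt \<theta>"

lemma \<eta>: "0 < \<eta>" "\<eta> < 1" "\<eta> ^ j * \<eta> ^ j = \<theta> ^ j"
  using \<theta> by (auto simp: \<eta>_def simp flip: power_mult_distrib)

lemma series_eq:
  assumes "0 \<le> c"
  shows "ennreal c * series f y \<rho> = (\<Sum>j. ennreal (c * (\<eta> ^ j * (1 + \<kappa>3 * real j)) * \<eta> ^ j) * amalgam_term f y (2 ^ j * \<rho>))"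
proof -
  have "ennreal (c * (\<eta> ^ j * (1 + \<kappa>3 * real j)) * \<eta> ^ j) = ennreal c * ennreal ((1 + \<kappa>3 * real j) * \<theta> ^ j)" for j
  proof -
    have "c * (\<eta> ^ j * (1 + \<kappa>3 * real j)) * \<eta> ^ j = c * ((1 + \<kappa>3 * real j) * (\<eta> ^ j * \<eta> ^ j))" by (simp only: ac_simps)
    moreover have "ennreal (c * ((1 + \<kappa>3 * real j) * \<theta> ^ j)) = ennreal c * ennreal ((1 + \<kappa>3 * real j) * \<theta> ^ j)"
      by (rule ennreal_mult) (use assms \<kappa>s_pos \<theta> in auto)
    ultimately show ?thesis unfolding \<eta>(3) by (simp only:)
  qed
  then show ?thesis unfolding series_def by (simp add: mult.assoc)
qed

definition "Cser c = (\<Sum>j. c * (\<eta> ^ j * (1 + \<kappa>3 * real j))) *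
  (if s = \<infinity> then 1 else (1 / (1 - \<eta> powr enn2real s)) powr (1 / enn2real s))"

lemma amalgam_term_norm_le:
  fixes f :: "real ^ 'n \<Rightarrow> real"
  assumes "f \<in> borel_measurable lebesgue" "0 < t"
  shows "outer_Ls_norm s \<mu> (\<lambda>y. amalgam_term (\<lambda>x. ennreal \<bar>f x\<bar>) y t) \<le> amalgam_norm p s \<alpha> \<nu> w \<mu> f"
  unfolding amalgam_norm_def Lp_norm_ball[OF assms(1)] amalgam_term_def e_def
  by (rule SUP_upper2[of t]) (use assms in auto)

lemma series_measurable:
  assumes "f \<in> borel_measurable lebesgue"
  shows "(\<lambda>y. series f y \<rho>) \<in> borel_measurable lebesgue"
proof -
  note amalgam_term_measurable[OF assms, measurable]
  show ?thesis unfolding series_def by measurable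
qed

lemma series_norm_le:
  fixes f :: "real ^ 'n \<Rightarrow> real"
  assumes f [measurable]: "f \<in> borel_measurable lebesgue" and \<rho>: "0 < \<rho>" and c: "0 \<le> c"
  shows "outer_Ls_norm s \<mu> (\<lambda>y. ennreal c * series (\<lambda>x. ennreal \<bar>f x\<bar>) y \<rho>) \<le> ennreal (Cser c) * amalgam_norm p s \<alpha> \<nu> w \<mu> f"
  unfolding series_eq[OF c] Cser_def
proof (rule outer_Ls_norm_series_le)
  fix j
  show "(\<lambda>y. amalgam_term (\<lambda>x. ennreal \<bar>f x\<bar>) y (2 ^ j * \<rho>)) \<in> borel_measurable lebesgue"
    by (rule amalgam_term_measurable) measurable
  show "outer_Ls_norm s \<mu> (\<lambda>y. amalgam_term (\<lambda>x. ennreal \<bar>f x\<bar>) y (2 ^ j * \<rho>)) \<le> amalgam_norm p s \<alpha> \<nu> w \<mu> f"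
    by (rule amalgam_term_norm_le[OF f]) (use \<rho> in simp)
  show "0 \<le> c * (\<eta> ^ j * (1 + \<kappa>3 * real j))" using c \<eta>(1) \<kappa>s_pos by auto
next
  show "summable (\<lambda>j. c * (\<eta> ^ j * (1 + \<kappa>3 * real j)))"
    by (intro summable_mult summable_power_linear) (use \<eta> in auto)
qed (use s_pos \<eta> in auto)

definition "Cfin = max (Cser Cw) 1"

theorem commutator_weak_norm_le:
  fixes f :: "real ^ 'n \<Rightarrow> real"
  assumes f [measurable]: "f \<in> borel_measurable lebesgue"
  shows "weak_amalgam_norm p s \<alpha> w \<mu> (commutator b \<gamma> f) \<le> ennreal Cfin * amalgam_norm p s \<alpha> \<nu> w \<mu> f"
  unfolding weak_amalgam_norm_def e_def[symmetric]
proof (rule SUP_least)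
  fix \<rho> :: real assume "\<rho> \<in> {0<..}"
  then have \<rho>: "0 < \<rho>" by simp
  let ?G = "\<lambda>y. epow (emeasure W (ball y \<rho>)) e * weak_Lp_norm p w (\<lambda>x. commutator b \<gamma> f x * indicator (ball y \<rho>) x)"
  have "(\<lambda>y. emeasure W (ball y \<rho> \<inter> UNIV)) \<in> borel_measurable lebesgue"
    by (rule wmeasure_ball_measurable) auto
  then have [measurable]: "(\<lambda>y. emeasure W (ball y \<rho>)) \<in> borel_measurable lebesgue" by simp
  have [measurable]: "(\<lambda>y. weak_Lp_norm p w (\<lambda>x. commutator b \<gamma> f x * indicator (ball y \<rho>) x)) \<in> borel_measurable lebesgue"
    by (rule weak_Lp_norm_ball_measurable[OF measurable_weights(2) commutator_measurable[OF measurable_weights(1) f]]) (use p in simp)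
  have "outer_Ls_norm s \<mu> ?G \<le> outer_Ls_norm s \<mu> (\<lambda>y. ennreal Cw * series (\<lambda>x. ennreal \<bar>f x\<bar>) y \<rho>)"
    by (rule outer_Ls_norm_mono[OF _ weak_term_le_series[OF f \<rho>] s_pos]) measurable
  also have "\<dots> \<le> ennreal (Cser Cw) * amalgam_norm p s \<alpha> \<nu> w \<mu> f"
    by (rule series_norm_le[OF f \<rho>]) (use kz_pos in \<open>simp add: Cw_def\<close>)
  also have "\<dots> \<le> ennreal Cfin * amalgam_norm p s \<alpha> \<nu> w \<mu> f"
    by (intro mult_right_mono ennreal_leI) (auto simp: Cfin_def)
  finally show "outer_Ls_norm s \<mu> ?G \<le> ennreal Cfin * amalgam_norm p s \<alpha> \<nu> w \<mu> f" .
qed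

text \<open>The A-infinity lower bound makes Lebesgue measure absolutely continuous with respect to
  \<open>W\<close>, so that what holds \<open>W\<close>-almost everywhere holds almost
  everywhere.\<close>

lemma wmeasure_zero_imp:
  assumes Z: "Z \<in> sets lebesgue" "Z \<subseteq> ball y \<rho>" "0 < \<rho>" "emeasure W Z = 0"
  shows "emeasure lebesgue Z = 0"
proof -
  have "epow (emeasure lebesgue Z) q * emeasure W (ball y \<rho>) \<le> 0"
    using A_inf[OF Z(3) Z(1,2)] Z(4) by simp
  then have "epow (emeasure lebesgue Z) q = 0" using w_ball_pos[OF Z(3), of y] by auto
  then show ?thesis using q by (simp add: epow_eq_0_iff)
qed

text \<open>The finite norm yields a centre \<open>y\<close> at which the series is finite for all
  radii k + 1. On these balls the weak estimate, used at every level, shows that the set where the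
  positive operator is \<infinity> is \<open>W\<close>-null and hence Lebesgue null.\<close>

theorem commutator_integrand_integrable_AE:
  fixes f :: "real ^ 'n \<Rightarrow> real"
  assumes f [measurable]: "f \<in> borel_measurable lebesgue" and fin: "amalgam_norm p s \<alpha> \<nu> w \<mu> f < \<infinity>"
    and \<mu>: "weight \<mu>" "\<not> (AE x in lebesgue. \<mu> x = 0)"
  shows "AE x in lebesgue. integrable lebesgue (commutator_integrand b \<gamma> f x)"
proof -
  let ?F = "\<lambda>x. ennreal \<bar>f x\<bar>"
  have Fm [measurable]: "?F \<in> borel_measurable lebesgue" by measurable
  have [measurable]: "\<mu> \<in> borel_measurable lebesgue" by (rule weight_measurable[OF \<mu>(1)])
  have "AE y in wmeasure \<mu>. series ?F y (real k + 1) < \<infinity>" for k :: nat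
  proof (rule outer_Ls_norm_finite_AE[OF series_measurable[OF Fm] _ s_pos])
    have "outer_Ls_norm s \<mu> (\<lambda>y. ennreal 1 * series ?F y (real k + 1)) \<le> ennreal (Cser 1) * amalgam_norm p s \<alpha> \<nu> w \<mu> f"
      by (rule series_norm_le[OF f]) auto
    also have "\<dots> < \<infinity>" using fin by (simp add: ennreal_mult_less_top)
    finally show "outer_Ls_norm s \<mu> (\<lambda>y. series ?F y (real k + 1)) < \<infinity>" by simp
  qed
  then have "AE y in wmeasure \<mu>. \<forall>k::nat. series ?F y (real k + 1) < \<infinity>" unfolding AE_all_countable by blast
  then have ae: "AE y in lebesgue. 0 < ennreal (\<mu> y) \<longrightarrow> (\<forall>k::nat. series ?F y (real k + 1) < \<infinity>)"
    unfolding wmeasure_def by (subst (asm) AE_density) auto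
  \<comment> \<open>Such a centre exists because \<open>\<mu>\<close> is not almost everywhere 0;
    since only countably many radii are considered, one centre serves them all.\<close>
  obtain y where y: "\<And>k::nat. series ?F y (real k + 1) < \<infinity>"
  proof (rule ccontr)
    assume "\<not> thesis"
    then have "\<not> (\<forall>k::nat. series ?F y (real k + 1) < \<infinity>)" for y using that by blast
    then have "AE y in lebesgue. \<mu> y = 0" using ae
      by (auto elim!: eventually_mono simp: ennreal_eq_0_iff) (use \<mu>(1) in \<open>simp add: weight_def antisym\<close>)
    then show False using \<mu>(2) by simp
  qed
  have fm [measurable]: "full_operator b \<gamma> ?F \<in> borel_measurable lebesgue"
    by (rule full_operator_measurable) measurable
  have "AE x in lebesgue. x \<in> ball y (real k + 1) \<longrightarrow> full_operator b \<gamma> ?F x < \<infinity>" for k :: nat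
  proof -
    let ?\<rho> = "real k + 1"
    have \<rho>: "0 < ?\<rho>" by simp
    let ?B = "ball y ?\<rho>"
    have nt: "emeasure W ?B \<noteq> 0" "emeasure W ?B \<noteq> \<infinity>" using W_ball_nontriv(1)[OF \<rho>, of y] W_ball_nontriv(2)[of y ?\<rho>] by auto
    have "epow (emeasure W ?B) a * far_sum ?F y ?\<rho> < \<infinity>"
      using far_sum_le_series[OF \<rho>] y by (rule le_less_trans)
    moreover have "epow (emeasure W ?B) a \<noteq> 0" using nt a_pos by (simp add: epow_eq_0_iff)
    ultimately have "far_sum ?F y ?\<rho> \<noteq> \<infinity>" by (auto simp: ennreal_mult_less_top)
    then have "epow (far_sum ?F y ?\<rho>) p \<noteq> \<infinity>" using p epow_finite_iff[of p "far_sum ?F y ?\<rho>"] by simp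
    then have "ennreal Ck * (epow (far_sum ?F y ?\<rho>) p * emeasure W ?B) < \<infinity>"
      using nt by (simp add: less_top[symmetric] ennreal_mult_eq_top_iff)
    then obtain Q where Q: "ennreal Ck * (epow (far_sum ?F y ?\<rho>) p * emeasure W ?B) = ennreal Q" "0 \<le> Q"
      by (cases "ennreal Ck * (epow (far_sum ?F y ?\<rho>) p * emeasure W ?B)" rule: ennreal_cases) auto
    define Z where "Z = {x \<in> ?B. full_operator b \<gamma> ?F x = \<infinity>}"
    have Zm: "Z \<in> sets lebesgue"
    proof -
      have "{x \<in> space lebesgue. full_operator b \<gamma> ?F x = \<infinity>} \<in> sets lebesgue" by measurable
      moreover have "Z = ?B \<inter> {x \<in> space lebesgue. full_operator b \<gamma> ?F x = \<infinity>}" by (auto simp: Z_def)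
      ultimately show ?thesis by (simp add: sets.Int)
    qed
    have ZB: "Z \<subseteq> ?B" by (auto simp: Z_def)
    have le: "l powr p * measure W Z \<le> Q" if l: "0 < l" for l
    proof -
      have "emeasure W Z \<le> emeasure W {x \<in> ?B. ennreal l < full_operator b \<gamma> ?F x}"
      proof (rule emeasure_mono)
        have "{x \<in> space lebesgue. ennreal l < full_operator b \<gamma> ?F x} \<in> sets lebesgue" by measurable
        moreover have "{x \<in> ?B. ennreal l < full_operator b \<gamma> ?F x} = ?B \<inter> {x \<in> space lebesgue. ennreal l < full_operator b \<gamma> ?F x}" by auto
        ultimately show "{x \<in> ?B. ennreal l < full_operator b \<gamma> ?F x} \<in> sets W" by (simp add: sets.Int)
      qed (auto simp: Z_def)
      then have "ennreal (l powr p) * emeasure W Z \<le> ennreal (l powr p) * emeasure W {x \<in> ?B. ennreal l < full_operator b \<gamma> ?F x}"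
        by (rule mult_left_mono) simp
      also have "\<dots> \<le> ennreal Q" unfolding Q(1)[symmetric] by (rule full_operator_weak_on_ball[OF Fm \<rho> l])
      finally have "ennreal (l powr p * measure W Z) \<le> ennreal Q"
        using W_finite[OF bounded_subset[OF bounded_ball ZB]] by (simp add: ennreal_mult)
      then show ?thesis using Q(2) by (simp add: ennreal_le_iff)
    qed
    have "measure W Z = 0"
    proof (rule ccontr)
      assume "measure W Z \<noteq> 0"
      then have z: "0 < measure W Z" by (simp add: zero_less_measure_iff)
      \<comment> \<open>At this level the weak estimate would read Q + 1 \<le> Q.\<close>
      define l where "l = ((Q + 1) / measure W Z) powr (1 / p)"
      have pos: "0 < (Q + 1) / measure W Z" using Q(2) z by (intro divide_pos_pos) auto
      then have "0 < l" unfolding l_def by (subst powr_gt_zero) (metis less_irrefl)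
      moreover have "l powr p = (Q + 1) / measure W Z" unfolding l_def using p pos Q(2) by (simp add: powr_powr)
      ultimately show False using le[of l] z by simp
    qed
    then have "emeasure W Z = 0" using W_finite[OF bounded_subset[OF bounded_ball ZB]] by simp
    then have "emeasure lebesgue Z = 0" by (rule wmeasure_zero_imp[OF Zm ZB \<rho>])
    then have "Z \<in> null_sets lebesgue" using Zm by blast
    then have "AE x in lebesgue. x \<notin> Z" by (rule AE_not_in)
    then show ?thesis by eventually_elim (auto simp: Z_def less_top)
  qed
  then have "AE x in lebesgue. \<forall>k::nat. x \<in> ball y (real k + 1) \<longrightarrow> full_operator b \<gamma> ?F x < \<infinity>"
    unfolding AE_all_countable by blast
  then show ?thesis
  proof eventually_elim
    case (elim x)
    obtain k :: nat where "dist y x < real k" using reals_Archimedean2 by blast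
    then have "x \<in> ball y (real k + 1)" by simp
    then show ?case using elim by (intro commutator_integrable[OF measurable_weights(1) f]) blast
  qed
qed

end

section \<open>Degenerate weights and the conclusion\<close>

lemma wmeasure_UNIV_eq_0_iff:
  assumes "weight w"
  shows "emeasure (wmeasure w) UNIV = 0 \<longleftrightarrow> (AE x in lebesgue. w x = 0)"
proof -
  have [measurable]: "w \<in> borel_measurable lebesgue" by (rule weight_measurable[OF assms])
  have w0: "0 \<le> w x" for x using assms by (simp add: weight_def)
  have "emeasure (wmeasure w) UNIV = (\<integral>\<^sup>+x. ennreal (w x) \<partial>lebesgue)"
    by (subst emeasure_wmeasure) auto
  then show ?thesis using w0 by (simp add: nn_integral_0_iff_AE ennreal_eq_0_iff antisym_conv)
qed

text \<open>If one ball were null, the lower bound with this ball as \<open>S\<close> would make all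
  larger concentric balls null, and \<open>w\<close> would vanish almost everywhere.\<close>

lemma A_infinity_ball_pos:
  fixes w :: "real ^ 'n \<Rightarrow> real"
  assumes w: "weight w" "\<not> (AE x in lebesgue. w x = 0)" and q: "1 \<le> q"
    and A_inf: "\<And>y \<rho> S. 0 < \<rho> \<Longrightarrow> S \<in> sets lebesgue \<Longrightarrow> S \<subseteq> ball y \<rho> \<Longrightarrow>
       epow (emeasure lebesgue S) q * emeasure (wmeasure w) (ball y \<rho>)
       \<le> ennreal (A * measure lebesgue (ball y \<rho>) powr q) * emeasure (wmeasure w) S"
    and \<rho>: "0 < \<rho>"
  shows "0 < emeasure (wmeasure w) (ball y \<rho>)"
proof (rule ccontr)
  assume "\<not> ?thesis"
  then have 0: "emeasure (wmeasure w) (ball y \<rho>) = 0" by simp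
  have "emeasure (wmeasure w) (ball y (\<rho> + real k)) = 0" for k :: nat
  proof -
    have "epow (emeasure lebesgue (ball y \<rho>)) q * emeasure (wmeasure w) (ball y (\<rho> + real k)) \<le> 0"
      using A_inf[of "\<rho> + real k" "ball y \<rho>" y] \<rho> 0 by (simp add: subset_ball)
    moreover have "epow (emeasure lebesgue (ball y \<rho>)) q \<noteq> 0"
      using ball_lebesgue(2)[OF \<rho>, of y] q by (subst ball_lebesgue(1)) (simp add: epow_eq_0_iff)
    ultimately show ?thesis by auto
  qed
  then have "(\<Union>k::nat. ball y (\<rho> + real k)) \<in> null_sets (wmeasure w)"
    by (intro null_sets_UN) (auto simp: null_sets_def)
  moreover have "(\<Union>k::nat. ball y (\<rho> + real k)) = UNIV"
  proof -
    have "\<exists>k::nat. x \<in> ball y (\<rho> + real k)" for x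
    proof -
      obtain k :: nat where "dist y x < real k" using reals_Archimedean2 by blast
      then show ?thesis using \<rho> by (intro exI[of _ k]) simp
    qed
    then show ?thesis by blast
  qed
  ultimately have "emeasure (wmeasure w) UNIV = 0" by (simp add: null_sets_def)
  then show False using w wmeasure_UNIV_eq_0_iff by blast
qed

lemma BMO_oscillation_le:
  fixes b :: "real ^ 'n \<Rightarrow> real"
  assumes "b \<in> BMO"
  shows "\<exists>M>0. \<forall>y \<rho>. 0 < \<rho> \<longrightarrow> (\<integral>\<^sup>+x\<in>ball y \<rho>. ennreal \<bar>b x - average (ball y \<rho>) b\<bar> \<partial>lebesgue)
       \<le> ennreal (M * measure lebesgue (ball y \<rho>))"
proof -
  obtain K where K: "BMO_norm b = ennreal K" "0 \<le> K"
    using assms by (cases "BMO_norm b" rule: ennreal_cases) (auto simp: BMO_def)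
  have "(\<integral>\<^sup>+x\<in>ball y \<rho>. ennreal \<bar>b x - average (ball y \<rho>) b\<bar> \<partial>lebesgue) \<le> ennreal ((K + 1) * measure lebesgue (ball y \<rho>))"
    if \<rho>: "0 < \<rho>" for y \<rho>
  proof -
    have "eaverage (ball y \<rho>) (\<lambda>x. ennreal \<bar>b x - average (ball y \<rho>) b\<bar>) \<le> ennreal K"
      unfolding K(1)[symmetric] BMO_norm_def by (rule SUP_upper2[of "(y, \<rho>)"]) (use \<rho> in auto)
    then have "(\<integral>\<^sup>+x\<in>ball y \<rho>. ennreal \<bar>b x - average (ball y \<rho>) b\<bar> \<partial>lebesgue) \<le> ennreal K * ennreal (measure lebesgue (ball y \<rho>))"
      using ball_lebesgue(2)[OF \<rho>, of y] unfolding eaverage_def ball_lebesgue(1) by (intro ennreal_divide_leD) auto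
    also have "\<dots> \<le> ennreal ((K + 1) * measure lebesgue (ball y \<rho>))"
      using K by (simp add: ennreal_leI mult_right_mono flip: ennreal_mult)
    finally show ?thesis .
  qed
  \<comment> \<open>\<open>K + 1\<close> in place of \<open>K\<close>, because the norm of a
    constant function is 0 and \<open>M\<close> has to be positive.\<close>
  then show ?thesis using K(2) by (intro exI[of _ "K + 1"]) auto
qed

text \<open>The power of the weight of the ball may be \<infinity>, namely for a negative exponent,
  but it multiplies a weak norm equal to 0, and \<open>0 * \<infinity> = 0\<close>.\<close>

lemma weak_amalgam_norm_null:
  fixes w \<mu> :: "real ^ 'n \<Rightarrow> real"
  assumes w: "weight w" "AE x in lebesgue. w x = 0" and p: "0 < p" and s: "0 < s"
  shows "weak_amalgam_norm p s \<alpha> w \<mu> h = 0"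
proof -
  have "emeasure (wmeasure w) S = 0" for S
  proof -
    have "emeasure (wmeasure w) S \<le> emeasure (wmeasure w) UNIV"
      using emeasure_space[of "wmeasure w" S] by simp
    also have "\<dots> = 0" using wmeasure_UNIV_eq_0_iff[OF w(1)] w(2) by simp
    finally show ?thesis by simp
  qed
  then have "weak_Lp_norm p w g = 0" for g
    unfolding weak_Lp_norm_def using p by simp
  moreover have "outer_Ls_norm s \<mu> (\<lambda>_. 0) = 0"
  proof (cases "s = \<infinity>")
    case True
    have "esssup (wmeasure \<mu>) (\<lambda>_. 0 :: ennreal) \<le> 0" by (rule esssup_I) auto
    then show ?thesis using True by (simp add: outer_Ls_norm_def)
  next
    case False
    then have "0 < enn2real s" using s by (simp add: enn2real_positive_iff less_top)
    then show ?thesis using False by (simp add: outer_Ls_norm_def)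
  qed
  ultimately show ?thesis unfolding weak_amalgam_norm_def by simp
qed

text \<open>The integrability clause gives the commutator its meaning as an integral almost
  everywhere. It is confined to non-degenerate weights: if \<open>\<mu>\<close> is almost everywhere
  0, the norm of every \<open>f\<close> vanishes, and if \<open>w\<close> is, the bump condition
  says nothing about \<open>\<nu>\<close>.\<close>

theorem theorem6p4:
  fixes b w \<nu> \<mu> :: "real ^ 'n \<Rightarrow> real"
    and \<gamma> p \<alpha> r C0 :: real and s :: ennreal
  assumes "0 < \<gamma>" "\<gamma> < real CARD('n)"
    and "1 < p" "p \<le> \<alpha>" "ennreal \<alpha> < s"
    and "\<mu> \<in> Delta2" "b \<in> BMO"
    and "weight w" "weight \<nu>"
    and "1 < r"
    and "\<And>y l. 0 < l \<Longrightarrow>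
          ennreal (measure lebesgue (cube y l) powr (\<gamma> / real CARD('n))) *
          epow (eaverage (cube y l) (\<lambda>x. ennreal (w x powr r))) (1 / (r * p)) *
          Luxemburg_average (Young_A p) (cube y l) (\<lambda>x. epow (ennreal (\<nu> x)) (- 1 / p))
          \<le> ennreal C0"
    and "w \<in> A_infinity"
  shows "\<exists>C>0. \<forall>f \<in> amalgam_space p s \<alpha> \<nu> w \<mu>.
           (\<not> (AE x in lebesgue. w x = 0) \<and> \<not> (AE x in lebesgue. \<mu> x = 0) \<longrightarrow>
              (AE x in lebesgue. integrable lebesgue (commutator_integrand b \<gamma> f x))) \<and>
           commutator b \<gamma> f \<in> weak_amalgam_space p s \<alpha> w \<mu> \<and>
           weak_amalgam_norm p s \<alpha> w \<mu> (commutator b \<gamma> f)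
             \<le> ennreal C * amalgam_norm p s \<alpha> \<nu> w \<mu> f"
proof -
  have b: "locally_integrable b" using assms(7) by (simp add: BMO_def)
  note bm = locally_integrable_measurable[OF b]
  have fm: "f \<in> borel_measurable lebesgue" "amalgam_norm p s \<alpha> \<nu> w \<mu> f < \<infinity>" if "f \<in> amalgam_space p s \<alpha> \<nu> w \<mu>" for f
    using that locally_integrable_measurable by (auto simp: amalgam_space_def)
  show ?thesis
  proof (cases "AE x in lebesgue. w x = 0")
    case True
    have "0 < s" using assms(5) by (metis zero_le le_less_trans)
    then have null: "weak_amalgam_norm p s \<alpha> w \<mu> h = 0" for h
      using assms(3,8) True by (intro weak_amalgam_norm_null) auto
    show ?thesis
      by (rule exI[of _ 1]) (use True null commutator_measurable[OF bm fm(1)] in \<open>auto simp: weak_amalgam_space_def\<close>)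
  next
    case False
    obtain q A where q: "1 \<le> q" "0 < A" and A: "\<And>y \<rho> S. 0 < \<rho> \<Longrightarrow> S \<in> sets lebesgue \<Longrightarrow> S \<subseteq> ball y \<rho> \<Longrightarrow>
       epow (emeasure lebesgue S) q * emeasure (wmeasure w) (ball y \<rho>)
       \<le> ennreal (A * measure lebesgue (ball y \<rho>) powr q) * emeasure (wmeasure w) S"
      using A_infinity_lower_bound[OF assms(12)] by (elim exE conjE) (rule that, blast+)
    obtain M where M: "0 < M" "\<And>y \<rho>. 0 < \<rho> \<Longrightarrow> (\<integral>\<^sup>+x\<in>ball y \<rho>. ennreal \<bar>b x - average (ball y \<rho>) b\<bar> \<partial>lebesgue)
       \<le> ennreal (M * measure lebesgue (ball y \<rho>))"
      using BMO_oscillation_le[OF assms(7)] by blast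
    interpret amalgam_setting b w \<nu> \<gamma> p r C0 q A M \<mu> \<alpha> s
    proof
      show "0 < emeasure (wmeasure w) (ball y \<rho>)" if "0 < \<rho>" for y \<rho>
        by (rule A_infinity_ball_pos[OF assms(8) False q(1) A that])
    qed (use assms b M q A in auto)
    have \<mu>: "weight \<mu>" using assms(6) by (simp add: Delta2_def)
    show ?thesis
    proof (intro exI[of _ Cfin] conjI ballI impI)
      show "0 < Cfin" by (simp add: Cfin_def)
      fix f assume f: "f \<in> amalgam_space p s \<alpha> \<nu> w \<mu>"
      show le: "weak_amalgam_norm p s \<alpha> w \<mu> (commutator b \<gamma> f) \<le> ennreal Cfin * amalgam_norm p s \<alpha> \<nu> w \<mu> f"
        by (rule commutator_weak_norm_le[OF fm(1)[OF f]])
      also have "\<dots> < \<infinity>" using fm(2)[OF f] by (simp add: ennreal_mult_less_top)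
      finally show "commutator b \<gamma> f \<in> weak_amalgam_space p s \<alpha> w \<mu>"
        using commutator_measurable[OF bm fm(1)[OF f]] by (simp add: weak_amalgam_space_def)
      show "AE x in lebesgue. integrable lebesgue (commutator_integrand b \<gamma> f x)"
        if "\<not> (AE x in lebesgue. w x = 0) \<and> \<not> (AE x in lebesgue. \<mu> x = 0)"
        using that by (intro commutator_integrand_integrable_AE[OF fm[OF f] \<mu>]) simp
    qed
  qed
qed

end
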